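(* Let $X=Gr(\mathbf P^k,\mathbf P^n)=SL(n+1)/P(\alpha_{k+1})$. Let $E_\lambda=S^\alpha U\otimes S^\beta Q^*(t)$ and $E_{\lambda''}=S^{\alpha''}U\otimes S^{\beta''}Q^*(t)$, where $\alpha''$ is obtained from $\alpha$ by adding two boxes to rows $p_1,p_2$ and $\beta''$ is obtained from $\beta$ by adding two boxes to rows $q_1,q_2$. If $p_1=p_2$ and $q_1=q_2$ then $\mathrm{Ext}^2(E_\lambda,E_{\lambda''})^G=0$; by symmetry assume $p_1\le p_2$, $q_1<q_2$. Then the explicit relations of $\mathcal Q_X$ between $\lambda$ and $\lambda''$ are the following. (i) If $p_1<p_2$, we have the subcases: (i1) $\tilde p\neq1$, $\tilde q\neq1$; in this case we have the two equations $$g_{\lambda_{p_1,q_1},p_2,q_2}\,g_{\lambda,p_1,q_1}\Big(\frac1{\tilde q}-\frac1{\tilde p}\Big)-g_{\lambda_{p_1,q_2},p_2,q_1}\,g_{\lambda,p_1,q_2}+g_{\lambda_{p_2,q_1},p_1,q_2}\,g_{\lambda,p_2,q_1}=0,$$ $$g_{\lambda_{p_1,q_1},p_2,q_2}\,g_{\lambda,p_1,q_1}\Big(\frac1{\tilde p\tilde q}-1\Big)-g_{\lambda_{p_1,q_2},p_2,q_1}\,g_{\lambda,p_1,q_2}\Big(\frac1{\tilde p}\Big)-g_{\lambda_{p_2,q_1},p_1,q_2}\,g_{\lambda,p_2,q_1}\Big(\frac1{\tilde q}\Big)+g_{\lambda_{p_2,q_2},p_1,q_1}\,g_{\lambda,p_2,q_2}=0.$$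 (i2) $\tilde p=1$ and $\tilde q\neq1$; in this case $\lambda_{p_2,q_1},\lambda_{p_2,q_2}$ do not exist (as vertices) and we have the single equation $$g_{\lambda_{p_1,q_1},p_2,q_2}\,g_{\lambda,p_1,q_1}\Big(\frac1{\tilde q}-1\Big)-g_{\lambda_{p_1,q_2},p_2,q_1}\,g_{\lambda,p_1,q_2}=0.$$ (i3) $\tilde p\neq1$ and $\tilde q=1$; in this case $\lambda_{p_1,q_2},\lambda_{p_2,q_2}$ do not exist and we have the single equation $$g_{\lambda_{p_1,q_1},p_2,q_2}\,g_{\lambda,p_1,q_1}\Big(1-\frac1{\tilde p}\Big)+g_{\lambda_{p_2,q_1},p_1,q_2}\,g_{\lambda,p_2,q_1}=0.$$ (i4) $\tilde p=\tilde q=1$; in this case only $\lambda_{p_1,q_1}$ survives and there are no equations at all. (Hille's counterexample, the path $\mathcal O(1)\to\Omega^1(1)\to\mathcal O(-1)$ on $Gr(\mathbf P^1,\mathbf P^3)$, fits this case.) (ii) If $p_1=p_2$ we have the subcases: (ii1) $\tilde q\neq1$; in this case we have the equation $$g_{\lambda_{p_1,q_1},p_1,q_2}\,g_{\lambda,p_1,q_1}\Big(\frac{1+\tilde q}{\tilde q}\Big)-g_{\lambda_{p_1,q_2},p_1,q_1}\,g_{\lambda,p_1,q_2}=0.$$ (ii2) $\tilde q=1$; in this case we have the equation $$g_{\lambda_{p_1,q_1},p_1,q_2}\,g_{\lambda,p_1,q_1}=0.$$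
   Context: Let $G=SL(n+1)$, with simple roots $\alpha_1,\dots,\alpha_n$ and fundamental weights $\lambda_1,\dots,\lambda_n$. $P=P(\alpha_{k+1})$ is the parabolic subgroup whose Lie algebra is spanned by the Cartan subalgebra, the negative root spaces, and the root spaces of the positive roots $\sum n_i\alpha_i$ with $n_{k+1}=0$. Let $R$ be the reductive part of $P$ and $\mathcal N$ the nilpotent radical of $\mathrm{Lie}\,P$ (it is abelian). $D_1$ is the set of integral weights $\sum c_i\lambda_i$ with $c_i\ge0$ for $i\ne k+1$; for $\lambda\in D_1$, $E_\lambda$ denotes the irreducible $R$-module of highest weight $\lambda$ and the corresponding irreducible homogeneous bundle on $X$. $U$ (rank $k+1$) and $Q$ (rank $n-k$) are the universal and quotient bundles; $\Omega^1_X=U\otimes Q^*$ is the bundle corresponding to $\mathcal N$. Every irreducible homogeneous bundle has the form $E_\lambda=S^\alpha U\otimes S^\beta Q^*(t)$, with $\alpha=(\alpha_p)$ and $\beta=(\beta_q)$ partitions (the parts $\alpha_p$ are not to be confused with simple roots), $S^\alpha,S^\beta$ the Schur functors, and $t\in\mathbf Z$. Write $\lambda=\sum_{i=1}^n c_i\lambda_i$. For $1\le p\le k+1$ and $1\le q\le n-k$ put $n_{p,q}=-\sum_{i=-(p-1)}^{q-1}\alpha_{k+1+i}$ (a sum of simple roots; these are the weights of $\mathcal N$) and $\lambda_{p,q}=\lambda+n_{p,q}$. Then $E_{\lambda_{p,q}}=S^{\alpha'}U\otimes S^{\beta'}Q^*(t)$, where $\alpha'$ is $\alpha$ with a box added to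 row $p$ and $\beta'$ is $\beta$ with a box added to row $q$. Put $$\tilde p=\sum_{i=p_1}^{p_2-1}c_{k+1-i}+p_2-p_1=\alpha_{p_1}-\alpha_{p_2}+p_2-p_1,\qquad \tilde q=\sum_{i=q_1}^{q_2-1}c_{k+1+i}+q_2-q_1=\beta_{q_1}-\beta_{q_2}+q_2-q_1,$$ with $\alpha_{p_1},\alpha_{p_2},\beta_{q_1},\beta_{q_2}$ parts of the partitions. The quiver $\mathcal Q_X$ has vertex set $D_1$ and an arrow $\lambda\to\mu$ iff $\mathrm{Ext}^1(E_\lambda,E_\mu)^G\ne0$; this space is isomorphic to $\mathrm{Hom}(E_\lambda\otimes\Omega^1_X,E_\mu)^G$, is then one-dimensional, and $\mu=\lambda_{p,q}$ for some $p,q$. Normalization: for every $\lambda\in D_1$ fix a maximal (highest weight) vector $v_\lambda\in E_\lambda$, and for every weight of $\mathcal N$ fix an eigenvector in $\mathcal N$ of that weight, the one of weight $n_{p,q}$ being again denoted $n_{p,q}$. For each arrow $\lambda\to\lambda_{p,q}$, $m_{\lambda,p,q}\colon E_\lambda\otimes\Omega^1_X\to E_{\lambda_{p,q}}$ is the generator of $\mathrm{Hom}(E_\lambda\otimes\Omega^1_X,E_{\lambda_{p,q}})^G$ sending $v_\lambda\otimes n_{p,q}$ to $v_{\lambda_{p,q}}$. In a representation of $\mathcal Q_X$ with vector spaces $V_\lambda$, $g_{\lambda,p,q}\colon V_\lambda\to V_{\lambda_{p,q}}$ denotes the linear map attached to the arrow $\lambda\to\lambda_{p,q}$. The relations of $\mathcal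 Q_X$ between $\lambda$ and $\lambda''$ are, by definition, the system of quadratic equations in the maps $g$ given by $$\sum (g_{\lambda_{p,q},p',q'}\,g_{\lambda,p,q})\,(m_{\lambda_{p,q},p',q'}\wedge m_{\lambda,p,q})=0,$$ the sum being over all paths $\lambda\to\lambda_{p,q}\to\lambda''=(\lambda_{p,q})_{p',q'}$. Here $m'\wedge m\in\mathrm{Ext}^2(E_\lambda,E_{\lambda''})^G\cong\mathrm{Hom}(E_\lambda\otimes\Omega^2_X,E_{\lambda''})^G$ is the Yoneda product, computed by $(m'\wedge m)((x\wedge y)\otimes v)=m'(x\otimes m(y\otimes v))-m'(y\otimes m(x\otimes v))$ for $x,y\in\mathcal N$, $v\in E_\lambda$.
   Formalization: The fixed eigenvectors n_{p,q} are required to be of product form u_p⊗w_q in U⊗Q^* (e.g. matrix units); with independently scaled eigenvectors the printed coefficients in case (i) are false. *)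

theory Defs
  imports "Jordan_Normal_Form.VS_Connect" "Jordan_Normal_Form.Determinant"
begin

text \<open>
  Conventions. The base field is the complex numbers, $G = SL(n+1)$, with the standard
  diagonal torus and simple roots $\alpha_i = \varepsilon_i - \varepsilon_{i+1}$, so that the
  root space of $\varepsilon_i - \varepsilon_j$ is spanned by the matrix unit in position
  $(i,j)$ and $P(\alpha_{k+1})$ is the group of block lower triangular matrices with diagonal
  blocks of size $k+1$ and $n-k$. Matrix indices start at 0; the indices of roots,
  weights, rows of partitions and the indices $p$, $q$ start at 1.
  Homogeneous bundles on $X = G/P$ are given by their fibres, which are $P$-modules; all
  modules below are modules over the reductive part \<open>levi k n\<close> of $P$, the unipotent
  radical of $P$ acting trivially on them.
\<close>

section \<open>Weights\<close>

text \<open>A weight $\sum_{i=1}^n c_i\lambda_i$ is the function $i \mapsto c_i$, zero outside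
  \<open>{1..n}\<close>.\<close>

type_synonym weight = "nat \<Rightarrow> int"

definition fund_weight :: "nat \<Rightarrow> nat \<Rightarrow> weight" where
  "fund_weight n i = (\<lambda>j. if j = i \<and> i \<in> {1..n} then 1 else 0)"

definition simple_root :: "nat \<Rightarrow> nat \<Rightarrow> weight" where
  "simple_root n i = (\<lambda>j. if j \<notin> {1..n} then 0 else if j = i then 2
      else if j = i + 1 \<or> i = j + 1 then - 1 else 0)"

definition D1 :: "nat \<Rightarrow> nat \<Rightarrow> weight set" where
  "D1 k n = {c. (\<forall>i. i \<notin> {1..n} \<longrightarrow> c i = 0) \<and> (\<forall>i\<in>{1..n} - {k + 1}. 0 \<le> c i)}"

text \<open>The weight $n_{p,q}$ of $\mathcal N$; the summation index is shifted by $k+1$.\<close>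

definition nil_weight :: "nat \<Rightarrow> nat \<Rightarrow> nat \<Rightarrow> nat \<Rightarrow> weight" where
  "nil_weight k n p q = (\<lambda>j. - (\<Sum>i = k + 2 - p..k + q. simple_root n i j))"

text \<open>$\lambda_{p,q} = \lambda + n_{p,q}$\<close>

definition shift :: "nat \<Rightarrow> nat \<Rightarrow> weight \<Rightarrow> nat \<Rightarrow> nat \<Rightarrow> weight" where
  "shift k n lam p q = (\<lambda>j. lam j + nil_weight k n p q j)"

text \<open>The weight $\varepsilon_i$ of the $i$-th standard basis vector.\<close>

definition eps :: "nat \<Rightarrow> nat \<Rightarrow> weight" where
  "eps n i = (\<lambda>j. fund_weight n i j - fund_weight n (i - 1) j)"

definition is_partition :: "nat \<Rightarrow> (nat \<Rightarrow> nat) \<Rightarrow> bool" where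
  "is_partition r \<alpha> \<longleftrightarrow> (\<forall>i\<in>{1..r}. \<forall>j\<in>{1..r}. i \<le> j \<longrightarrow> \<alpha> j \<le> \<alpha> i)"

definition add_box :: "nat \<Rightarrow> (nat \<Rightarrow> nat) \<Rightarrow> (nat \<Rightarrow> nat)" where
  "add_box r \<alpha> = \<alpha>(r := \<alpha> r + 1)"

text \<open>The weight $\lambda$ with $E_\lambda = S^\alpha U \otimes S^\beta Q^*(t)$: the weights of
  $U$ are $-\varepsilon_{k+1}, -\varepsilon_k, \dots, -\varepsilon_1$ and those of $Q^*$ are
  $\varepsilon_{k+2}, \dots, \varepsilon_{n+1}$, both in decreasing order, and
  $\mathcal O(1) = E_{\lambda_{k+1}}$.\<close>

definition bundle_weight ::
    "nat \<Rightarrow> nat \<Rightarrow> (nat \<Rightarrow> nat) \<Rightarrow> (nat \<Rightarrow> nat) \<Rightarrow> int \<Rightarrow> weight" where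
  "bundle_weight k n \<alpha> \<beta> t = (\<lambda>j.
      (\<Sum>p = 1..k + 1. int (\<alpha> p) * (- eps n (k + 2 - p) j))
    + (\<Sum>q = 1..n - k. int (\<beta> q) * eps n (k + 1 + q) j)
    + t * fund_weight n (k + 1) j)"

definition ptilde :: "nat \<Rightarrow> weight \<Rightarrow> nat \<Rightarrow> nat \<Rightarrow> int" where
  "ptilde k lam p1 p2 = (\<Sum>i = p1..<p2. lam (k + 1 - i)) + int p2 - int p1"

definition qtilde :: "nat \<Rightarrow> weight \<Rightarrow> nat \<Rightarrow> nat \<Rightarrow> int" where
  "qtilde k lam q1 q2 = (\<Sum>i = q1..<q2. lam (k + 1 + i)) + int q2 - int q1"


section \<open>The reductive part of the parabolic and its modules\<close>

definition levi :: "nat \<Rightarrow> nat \<Rightarrow> complex mat set" where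
  "levi k n = {A \<in> carrier_mat (n + 1) (n + 1). det A = 1 \<and>
      (\<forall>i<n + 1. \<forall>j<n + 1. (i < k + 1) \<noteq> (j < k + 1) \<longrightarrow> A $$ (i, j) = 0)}"

definition nilrad :: "nat \<Rightarrow> nat \<Rightarrow> complex mat set" where
  "nilrad k n = {A \<in> carrier_mat (n + 1) (n + 1).
      (\<forall>i<n + 1. \<forall>j<n + 1. \<not> (k + 1 \<le> i \<and> j < k + 1) \<longrightarrow> A $$ (i, j) = 0)}"

text \<open>The adjoint action $g x g^{-1}$: for $\det g = 1$ the adjugate is the inverse.\<close>

definition Ad :: "complex mat \<Rightarrow> complex mat \<Rightarrow> complex mat" where
  "Ad g x = g * x * adj_mat g"

text \<open>Polynomial functions in the entries of an $N\times N$ matrix. Since \<open>levi k n\<close> is closed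
  in the space of matrices, its regular functions are the restrictions of these.\<close>

inductive_set poly_fun :: "nat \<Rightarrow> (complex mat \<Rightarrow> complex) set" for N :: nat where
  const: "(\<lambda>A. c) \<in> poly_fun N"
| entry: "i < N \<Longrightarrow> j < N \<Longrightarrow> (\<lambda>A. A $$ (i, j)) \<in> poly_fun N"
| add: "f \<in> poly_fun N \<Longrightarrow> h \<in> poly_fun N \<Longrightarrow> (\<lambda>A. f A + h A) \<in> poly_fun N"
| mult: "f \<in> poly_fun N \<Longrightarrow> h \<in> poly_fun N \<Longrightarrow> (\<lambda>A. f A * h A) \<in> poly_fun N"

text \<open>A finite dimensional module on the space of column vectors of length \<open>rdim\<close>.\<close>

record rmod =
  rdim :: nat
  act :: "complex mat \<Rightarrow> complex mat"

definition is_module :: "nat \<Rightarrow> nat \<Rightarrow> rmod \<Rightarrow> bool" where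
  "is_module k n E \<longleftrightarrow>
     (\<forall>A\<in>levi k n. act E A \<in> carrier_mat (rdim E) (rdim E)) \<and>
     act E (1\<^sub>m (n + 1)) = 1\<^sub>m (rdim E) \<and>
     (\<forall>A\<in>levi k n. \<forall>B\<in>levi k n. act E (A * B) = act E A * act E B) \<and>
     (\<forall>i<rdim E. \<forall>j<rdim E. \<exists>f\<in>poly_fun (n + 1). \<forall>A\<in>levi k n. act E A $$ (i, j) = f A)"

definition is_irreducible :: "nat \<Rightarrow> nat \<Rightarrow> rmod \<Rightarrow> bool" where
  "is_irreducible k n E \<longleftrightarrow> is_module k n E \<and> rdim E > 0 \<and>
     (\<forall>W. subspace class_ring W (module_vec TYPE(complex) (rdim E)) \<and>
          (\<forall>A\<in>levi k n. \<forall>w\<in>W. act E A *\<^sub>v w \<in> W)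
        \<longrightarrow> W = {0\<^sub>v (rdim E)} \<or> W = carrier_vec (rdim E))"

definition torus :: "nat \<Rightarrow> complex mat set" where
  "torus n = {A \<in> carrier_mat (n + 1) (n + 1). det A = 1 \<and> diagonal_mat A}"

text \<open>The character of the torus given by a weight; $\lambda_i$ is
  $\varepsilon_1 + \dots + \varepsilon_i$.\<close>

definition weight_char :: "nat \<Rightarrow> weight \<Rightarrow> complex mat \<Rightarrow> complex" where
  "weight_char n c A = (\<Prod>i = 1..n. (\<Prod>j<i. A $$ (j, j)) powi c i)"

definition unipotent :: "nat \<Rightarrow> nat \<Rightarrow> complex mat set" where
  "unipotent k n = {A \<in> levi k n. upper_triangular A \<and> (\<forall>i<n + 1. A $$ (i, i) = 1)}"

definition is_maximal_vector :: "nat \<Rightarrow> nat \<Rightarrow> rmod \<Rightarrow> weight \<Rightarrow> complex vec \<Rightarrow> bool" where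
  "is_maximal_vector k n E lam w \<longleftrightarrow>
     w \<in> carrier_vec (rdim E) \<and> w \<noteq> 0\<^sub>v (rdim E) \<and>
     (\<forall>A\<in>torus n. act E A *\<^sub>v w = weight_char n lam A \<cdot>\<^sub>v w) \<and>
     (\<forall>A\<in>unipotent k n. act E A *\<^sub>v w = w)"

text \<open>The families of modules $E_\lambda$ with fixed maximal vectors $v_\lambda$, for $\lambda\in D_1$.\<close>

definition is_irreducible_family ::
    "nat \<Rightarrow> nat \<Rightarrow> (weight \<Rightarrow> rmod) \<Rightarrow> (weight \<Rightarrow> complex vec) \<Rightarrow> bool" where
  "is_irreducible_family k n E v \<longleftrightarrow>
     (\<forall>lam\<in>D1 k n. is_irreducible k n (E lam) \<and> is_maximal_vector k n (E lam) lam (v lam))"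

text \<open>
  Fixed eigenvectors of weight $n_{p,q}$ in $\mathcal N$; the weight space is spanned by the matrix
  unit in row $k+q$ and column $k+1-p$. The last condition says that
  $n_{p,q} = u_p\otimes w_q$ for eigenvectors $u_p$, $w_q$ in the fibres of $U$ and $Q^*$, with respect to
  $\Omega^1_X = U\otimes Q^*$. It cannot be dropped: multiplying a single $n_{p,q}$ by a scalar
  divides the maps \<open>m\<close> labelled by $(p,q)$ by this scalar, and so changes the ratios of
  the coefficients of the relations.
\<close>

definition is_eigenbasis ::
    "nat \<Rightarrow> nat \<Rightarrow> (nat \<Rightarrow> nat \<Rightarrow> complex mat) \<Rightarrow> bool" where
  "is_eigenbasis k n nv \<longleftrightarrow>
     (\<forall>p\<in>{1..k + 1}. \<forall>q\<in>{1..n - k}. nv p q \<in> nilrad k n \<and> nv p q \<noteq> 0\<^sub>m (n + 1) (n + 1) \<and>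
        (\<forall>A\<in>torus n. Ad A (nv p q) = weight_char n (nil_weight k n p q) A \<cdot>\<^sub>m nv p q)) \<and>
     (\<exists>x y. \<forall>p\<in>{1..k + 1}. \<forall>q\<in>{1..n - k}. nv p q $$ (k + q, k + 1 - p) = x p * y q)"


section \<open>Extensions\<close>

text \<open>$\mathrm{Ext}^1(A,B)^G$ as the space $\mathrm{Hom}(A\otimes\Omega^1_X,B)^G$: an invariant
  homomorphism is given on fibres by an equivariant bilinear map, here written as a map which is
  linear on $\mathcal N$ with values in matrices.\<close>

definition Ext1_G :: "nat \<Rightarrow> nat \<Rightarrow> rmod \<Rightarrow> rmod \<Rightarrow> (complex mat \<Rightarrow> complex mat) set" where
  "Ext1_G k n A B = {f.
     (\<forall>x\<in>nilrad k n. f x \<in> carrier_mat (rdim B) (rdim A)) \<and>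
     (\<forall>x\<in>nilrad k n. \<forall>y\<in>nilrad k n. f (x + y) = f x + f y) \<and>
     (\<forall>c. \<forall>x\<in>nilrad k n. f (c \<cdot>\<^sub>m x) = c \<cdot>\<^sub>m f x) \<and>
     (\<forall>g\<in>levi k n. \<forall>x\<in>nilrad k n. f (Ad g x) * act A g = act B g * f x)}"

text \<open>Likewise $\mathrm{Ext}^2(A,B)^G$ as $\mathrm{Hom}(A\otimes\Omega^2_X,B)^G$, using alternating
  bilinear maps on $\mathcal N$.\<close>

definition Ext2_G ::
    "nat \<Rightarrow> nat \<Rightarrow> rmod \<Rightarrow> rmod \<Rightarrow> (complex mat \<Rightarrow> complex mat \<Rightarrow> complex mat) set" where
  "Ext2_G k n A B = {f.
     (\<forall>x\<in>nilrad k n. \<forall>y\<in>nilrad k n. f x y \<in> carrier_mat (rdim B) (rdim A)) \<and>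
     (\<forall>x\<in>nilrad k n. \<forall>x'\<in>nilrad k n. \<forall>y\<in>nilrad k n. f (x + x') y = f x y + f x' y) \<and>
     (\<forall>x\<in>nilrad k n. \<forall>y\<in>nilrad k n. \<forall>y'\<in>nilrad k n. f x (y + y') = f x y + f x y') \<and>
     (\<forall>c. \<forall>x\<in>nilrad k n. \<forall>y\<in>nilrad k n. f (c \<cdot>\<^sub>m x) y = c \<cdot>\<^sub>m f x y \<and> f x (c \<cdot>\<^sub>m y) = c \<cdot>\<^sub>m f x y) \<and>
     (\<forall>x\<in>nilrad k n. f x x = 0\<^sub>m (rdim B) (rdim A)) \<and>
     (\<forall>g\<in>levi k n. \<forall>x\<in>nilrad k n. \<forall>y\<in>nilrad k n. f (Ad g x) (Ad g y) * act A g = act B g * f x y)}"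

definition Ext2_G_zero :: "nat \<Rightarrow> nat \<Rightarrow> rmod \<Rightarrow> rmod \<Rightarrow> bool" where
  "Ext2_G_zero k n A B \<longleftrightarrow>
     (\<forall>f\<in>Ext2_G k n A B. \<forall>x\<in>nilrad k n. \<forall>y\<in>nilrad k n. f x y = 0\<^sub>m (rdim B) (rdim A))"

text \<open>The Yoneda product.\<close>

definition wedge ::
    "(complex mat \<Rightarrow> complex mat) \<Rightarrow> (complex mat \<Rightarrow> complex mat) \<Rightarrow>
     complex mat \<Rightarrow> complex mat \<Rightarrow> complex mat" where
  "wedge m' m x y = m' x * m y - m' y * m x"


section \<open>The quiver and its relations\<close>

definition arrow :: "nat \<Rightarrow> nat \<Rightarrow> (weight \<Rightarrow> rmod) \<Rightarrow> weight \<Rightarrow> weight \<Rightarrow> bool" where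
  "arrow k n E lam mu \<longleftrightarrow> lam \<in> D1 k n \<and> mu \<in> D1 k n \<and>
     (\<exists>f\<in>Ext1_G k n (E lam) (E mu). \<exists>x\<in>nilrad k n. f x \<noteq> 0\<^sub>m (rdim (E mu)) (rdim (E lam)))"

definition is_normalized ::
    "nat \<Rightarrow> nat \<Rightarrow> (weight \<Rightarrow> rmod) \<Rightarrow> (weight \<Rightarrow> complex vec) \<Rightarrow> (nat \<Rightarrow> nat \<Rightarrow> complex mat) \<Rightarrow>
     (weight \<Rightarrow> nat \<Rightarrow> nat \<Rightarrow> complex mat \<Rightarrow> complex mat) \<Rightarrow> bool" where
  "is_normalized k n E v nv m \<longleftrightarrow>
     (\<forall>lam. \<forall>p\<in>{1..k + 1}. \<forall>q\<in>{1..n - k}. arrow k n E lam (shift k n lam p q) \<longrightarrow>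
        m lam p q \<in> Ext1_G k n (E lam) (E (shift k n lam p q)) \<and>
        m lam p q (nv p q) *\<^sub>v v lam = v (shift k n lam p q))"

text \<open>A representation of the quiver: $V_\lambda$ has dimension \<open>dV lam\<close>, and \<open>g lam p q\<close> is the
  matrix of $g_{\lambda,p,q}$.\<close>

definition is_quiver_rep ::
    "nat \<Rightarrow> nat \<Rightarrow> (weight \<Rightarrow> rmod) \<Rightarrow> (weight \<Rightarrow> nat) \<Rightarrow>
     (weight \<Rightarrow> nat \<Rightarrow> nat \<Rightarrow> complex mat) \<Rightarrow> bool" where
  "is_quiver_rep k n E dV g \<longleftrightarrow>
     (\<forall>lam. \<forall>p\<in>{1..k + 1}. \<forall>q\<in>{1..n - k}. arrow k n E lam (shift k n lam p q) \<longrightarrow>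
        g lam p q \<in> carrier_mat (dV (shift k n lam p q)) (dV lam))"

definition paths ::
    "nat \<Rightarrow> nat \<Rightarrow> (weight \<Rightarrow> rmod) \<Rightarrow> weight \<Rightarrow> weight \<Rightarrow> (nat \<times> nat \<times> nat \<times> nat) set" where
  "paths k n E lam lam'' = {(p, q, p', q').
     p \<in> {1..k + 1} \<and> q \<in> {1..n - k} \<and> p' \<in> {1..k + 1} \<and> q' \<in> {1..n - k} \<and>
     arrow k n E lam (shift k n lam p q) \<and> arrow k n E (shift k n lam p q) lam'' \<and>
     lam'' = shift k n (shift k n lam p q) p' q'}"

text \<open>$g_{\lambda_{p,q},p',q'}\, g_{\lambda,p,q}$\<close>

definition path_map ::
    "nat \<Rightarrow> nat \<Rightarrow> (weight \<Rightarrow> nat \<Rightarrow> nat \<Rightarrow> complex mat) \<Rightarrow> weight \<Rightarrow>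
     nat \<Rightarrow> nat \<Rightarrow> nat \<Rightarrow> nat \<Rightarrow> complex mat" where
  "path_map k n g lam p q p' q' = g (shift k n lam p q) p' q' * g lam p q"

text \<open>The relation is an equation in
  $\mathrm{Hom}(V_\lambda,V_{\lambda''})\otimes\mathrm{Ext}^2(E_\lambda,E_{\lambda''})^G$; it is
  expressed by the vanishing of all coordinates, $(i,j)$ and $(a,b)$ being the positions of the entries of
  the two tensor factors.\<close>

definition relations_hold ::
    "nat \<Rightarrow> nat \<Rightarrow> (weight \<Rightarrow> rmod) \<Rightarrow>
     (weight \<Rightarrow> nat \<Rightarrow> nat \<Rightarrow> complex mat \<Rightarrow> complex mat) \<Rightarrow> (weight \<Rightarrow> nat) \<Rightarrow>
     (weight \<Rightarrow> nat \<Rightarrow> nat \<Rightarrow> complex mat) \<Rightarrow> weight \<Rightarrow> weight \<Rightarrow> bool" where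
  "relations_hold k n E m dV g lam lam'' \<longleftrightarrow>
     (\<forall>x\<in>nilrad k n. \<forall>y\<in>nilrad k n.
      \<forall>i<dV lam''. \<forall>j<dV lam. \<forall>a<rdim (E lam''). \<forall>b<rdim (E lam).
        (\<Sum>(p, q, p', q')\<in>paths k n E lam lam''.
           path_map k n g lam p q p' q' $$ (i, j) *
           wedge (m (shift k n lam p q) p' q') (m lam p q) x y $$ (a, b)) = 0)"


section \<open>Consistency of the two descriptions of weights\<close>

lemma simple_root_eps:
  assumes "1 \<le> i" "i \<le> n"
  shows "simple_root n i j = eps n i j - eps n (i + 1) j"
  using assms by (auto simp: simple_root_def eps_def fund_weight_def)

lemma nil_weight_eps:
  assumes "p \<in> {1..k + 1}" "q \<in> {1..n - k}" "k < n"
  shows "nil_weight k n p q j = eps n (k + 1 + q) j - eps n (k + 2 - p) j"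
proof -
  have "(\<Sum>i = k + 2 - p..k + q. simple_root n i j)
      = (\<Sum>i = k + 2 - p..k + q. eps n i j - eps n (Suc i) j)"
    using assms by (intro sum.cong) (auto simp: simple_root_eps)
  also have "\<dots> = - (\<Sum>i = k + 2 - p..k + q. eps n (Suc i) j - eps n i j)"
    by (simp add: sum_negf[symmetric])
  also have "\<dots> = eps n (k + 2 - p) j - eps n (k + 1 + q) j"
    using assms by (subst sum_Suc_diff) auto
  finally show ?thesis by (simp add: nil_weight_def)
qed

lemma shift_bundle_weight:
  assumes "p \<in> {1..k + 1}" "q \<in> {1..n - k}" "k < n"
  shows "shift k n (bundle_weight k n \<alpha> \<beta> t) p q
       = bundle_weight k n (add_box p \<alpha>) (add_box q \<beta>) t"
proof
  fix j
  have box: "(\<Sum>i\<in>S. int (add_box r c i) * f i) = (\<Sum>i\<in>S. int (c i) * f i) + f r"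
    if "r \<in> S" "finite S" for r :: nat and S c and f :: "nat \<Rightarrow> int"
    using that by (simp add: add_box_def sum.remove algebra_simps)
  show "shift k n (bundle_weight k n \<alpha> \<beta> t) p q j
       = bundle_weight k n (add_box p \<alpha>) (add_box q \<beta>) t j"
    unfolding shift_def bundle_weight_def nil_weight_eps[OF assms]
    by (subst (1 2) box) (use assms in auto)
qed

lemma bundle_weight_coeff:
  assumes "k < n"
  shows "i \<in> {1..k} \<Longrightarrow> bundle_weight k n \<alpha> \<beta> t (k + 1 - i) = int (\<alpha> i) - int (\<alpha> (i + 1))"
    and "i \<in> {1..<n - k} \<Longrightarrow> bundle_weight k n \<alpha> \<beta> t (k + 1 + i) = int (\<beta> i) - int (\<beta> (i + 1))"
    and "bundle_weight k n \<alpha> \<beta> t (k + 1) = t - int (\<alpha> 1) - int (\<beta> 1)"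
proof -
  have U: "(\<Sum>p = 1..k + 1. int (\<alpha> p) * (- eps n (k + 2 - p) j))
      = (\<Sum>p = 1..k + 1. if p = k + 1 - j then int (\<alpha> p) else 0)
      - (\<Sum>p = 1..k + 1. if p = k + 2 - j then int (\<alpha> p) else 0)" if "j \<in> {1..n}" for j
    unfolding sum_subtractf[symmetric]
  proof (intro sum.cong refl)
    fix p assume "p \<in> {1..k + 1}"
    then have "j = k + 2 - p \<longleftrightarrow> p = k + 2 - j" "j = k + 2 - p - 1 \<longleftrightarrow> p = k + 1 - j"
      using that by auto
    then show "int (\<alpha> p) * (- eps n (k + 2 - p) j)
        = (if p = k + 1 - j then int (\<alpha> p) else 0) - (if p = k + 2 - j then int (\<alpha> p) else 0)"
      using that by (auto simp: eps_def fund_weight_def)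
  qed
  have Q: "(\<Sum>q = 1..n - k. int (\<beta> q) * eps n (k + 1 + q) j)
      = (\<Sum>q = 1..n - k. if q = j - (k + 1) then int (\<beta> q) else 0)
      - (\<Sum>q = 1..n - k. if q = j - k then int (\<beta> q) else 0)" if "j \<in> {1..n}" for j
    unfolding sum_subtractf[symmetric]
  proof (intro sum.cong refl)
    fix q assume "q \<in> {1..n - k}"
    then have "j = k + 1 + q \<longleftrightarrow> q = j - (k + 1)" "j = k + 1 + q - 1 \<longleftrightarrow> q = j - k"
      by auto
    then show "int (\<beta> q) * eps n (k + 1 + q) j
        = (if q = j - (k + 1) then int (\<beta> q) else 0) - (if q = j - k then int (\<beta> q) else 0)"
      using that by (auto simp: eps_def fund_weight_def)
  qed
  have c: "bundle_weight k n \<alpha> \<beta> t j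
      = (if k + 1 - j \<in> {1..k + 1} then int (\<alpha> (k + 1 - j)) else 0)
      - (if k + 2 - j \<in> {1..k + 1} then int (\<alpha> (k + 2 - j)) else 0)
      + ((if j - (k + 1) \<in> {1..n - k} then int (\<beta> (j - (k + 1))) else 0)
      - (if j - k \<in> {1..n - k} then int (\<beta> (j - k)) else 0))
      + t * fund_weight n (k + 1) j" if "j \<in> {1..n}" for j
    unfolding bundle_weight_def U[OF that] Q[OF that] by (simp only: sum.delta finite_atLeastAtMost)
  show "bundle_weight k n \<alpha> \<beta> t (k + 1 - i) = int (\<alpha> i) - int (\<alpha> (i + 1))" if "i \<in> {1..k}"
  proof -
    have "k + 1 - (k + 1 - i) = i" "k + 2 - (k + 1 - i) = i + 1" using that by auto
    then show ?thesis using that assms by (subst c) (auto simp: fund_weight_def)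
  qed
  show "bundle_weight k n \<alpha> \<beta> t (k + 1 + i) = int (\<beta> i) - int (\<beta> (i + 1))" if "i \<in> {1..<n - k}"
    using that assms by (subst c) (auto simp: fund_weight_def)
  show "bundle_weight k n \<alpha> \<beta> t (k + 1) = t - int (\<alpha> 1) - int (\<beta> 1)"
    using assms by (subst c) (auto simp: fund_weight_def)
qed

lemma ptilde_bundle_weight:
  assumes "k < n" "1 \<le> p1" "p1 \<le> p2" "p2 \<le> k + 1"
  shows "ptilde k (bundle_weight k n \<alpha> \<beta> t) p1 p2 = int (\<alpha> p1) - int (\<alpha> p2) + int p2 - int p1"
proof -
  have "(\<Sum>i = p1..<p2. bundle_weight k n \<alpha> \<beta> t (k + 1 - i))
      = (\<Sum>i = p1..<p2. - (int (\<alpha> (Suc i)) - int (\<alpha> i)))"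
    using assms by (intro sum.cong refl, subst bundle_weight_coeff(1)) auto
  also have "\<dots> = int (\<alpha> p1) - int (\<alpha> p2)"
    unfolding sum_negf using assms(3) by (subst sum_Suc_diff') auto
  finally show ?thesis by (simp add: ptilde_def)
qed

lemma qtilde_bundle_weight:
  assumes "k < n" "1 \<le> q1" "q1 \<le> q2" "q2 \<le> n - k"
  shows "qtilde k (bundle_weight k n \<alpha> \<beta> t) q1 q2 = int (\<beta> q1) - int (\<beta> q2) + int q2 - int q1"
proof -
  have "(\<Sum>i = q1..<q2. bundle_weight k n \<alpha> \<beta> t (k + 1 + i))
      = (\<Sum>i = q1..<q2. - (int (\<beta> (Suc i)) - int (\<beta> i)))"
    using assms by (intro sum.cong refl, subst bundle_weight_coeff(2)) auto
  also have "\<dots> = int (\<beta> q1) - int (\<beta> q2)"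
    unfolding sum_negf using assms(3) by (subst sum_Suc_diff') auto
  finally show ?thesis by (simp add: qtilde_def)
qed

end

theory Submission
  imports Defs "HOL-Library.Function_Algebras" "HOL-Complex_Analysis.Cauchy_Integral_Formula"
begin

text \<open>
  Differentiation along one-parameter subgroups turns an equivariant map into one that commutes with
  the Lie algebra of the reductive part up to the derivation on $\mathcal N = U\otimes Q^*$, and
  a uniqueness theorem for linear differential systems reverses this step. The two factors
  $\mathfrak{gl}$ act independently, so for an index \<open>s\<close> (true for $U$, false for $Q^*$) a Casimir
  computation on $E_\lambda\otimes\mathcal N$ compares the contents of the rows: exchanging the
  two boxes that a path adds multiplies the highest weight coefficient of $m'\circ m$ by the reciprocal
  of minus the difference of contents $\tilde p$ or $\tilde q$, or by 0 if the lower row is filled first, as in Young's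
  seminormal form. The relations are the vanishing of these coefficients, because an equivariant
  bilinear map is determined by its highest weight coefficients.
\<close>

hide_const (open) Finite_Cartesian_Product.mat Finite_Cartesian_Product.row Finite_Cartesian_Product.vec
  Determinants.det Inner_Product.real_inner_class.inner
hide_type (open) Finite_Cartesian_Product.vec

text \<open>A relation sums over paths, and a path consists of arrows, that is, of nonzero
  equivariant maps. Computing with given maps is therefore not enough: whenever \<lambda>+n_{p,q}
  lies in D_1, a nonzero map has to be produced out of two abstract irreducible modules. A product
  of shifted Casimir operators isolates the right component of the tensor product, and a submodule
  of a direct sum compares it with the abstract target. The delicate point is that this component is
  nonzero; it comes down to a left eigenvector of a triangular matrix built from the contents.

  Modules are given only as matrices of polynomial functions on the group. Hence the differential
  rests on a chain rule for polynomials, and the way back to the group on Gaussian elimination,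
  which generates the Levi subgroup by one-parameter subgroups.

  Each n_{p,q} is x_p y_q times a matrix unit. Along all paths with the same ends these scalars
  multiply to the same number, so they drop out of the relations; a general choice of scalars would
  not.\<close>

class cspace = ab_group_add +
  fixes scaleC :: "complex \<Rightarrow> 'a \<Rightarrow> 'a" (infixr "*\<^sub>C" 75)
  assumes scaleC_add_right: "a *\<^sub>C (x + y) = a *\<^sub>C x + a *\<^sub>C y"
    and scaleC_add_left: "(a + b) *\<^sub>C x = a *\<^sub>C x + b *\<^sub>C x"
    and scaleC_scaleC: "a *\<^sub>C (b *\<^sub>C x) = (a * b) *\<^sub>C x"
    and scaleC_one: "1 *\<^sub>C x = x"
instantiation complex :: cspace begin
definition scaleC_complex :: "complex \<Rightarrow> complex \<Rightarrow> complex" where "scaleC_complex = (*)"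
instance by standard (auto simp: scaleC_complex_def algebra_simps)
end
instantiation "fun" :: (type, cspace) cspace begin
definition scaleC_fun :: "complex \<Rightarrow> ('a \<Rightarrow> 'b) \<Rightarrow> 'a \<Rightarrow> 'b" where "scaleC_fun c f = (\<lambda>i. c *\<^sub>C f i)"
instance by standard (auto simp: scaleC_fun_def plus_fun_def scaleC_add_left scaleC_add_right scaleC_one scaleC_scaleC)
end
instantiation prod :: (cspace, cspace) cspace begin
definition "scaleC_prod c p = (c *\<^sub>C fst p, c *\<^sub>C snd p)"
instance by standard (auto simp: scaleC_prod_def scaleC_add_left scaleC_add_right scaleC_one scaleC_scaleC plus_prod_def)
end
text \<open>A type class in place of carrier sets: coordinate functions, functions on
  \<open>J r\<close> with values in a module, and pairs are complex vector spaces by instantiation,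
  and submodules are plain sets. Bases and spans come from this interpretation.\<close>

interpretation cs: vector_space "scaleC :: complex \<Rightarrow> 'a \<Rightarrow> 'a::cspace"
  by standard (auto simp: scaleC_add_left scaleC_add_right scaleC_one scaleC_scaleC)
interpretation csp: vector_space_pair "scaleC :: complex \<Rightarrow> 'a \<Rightarrow> 'a::cspace" "scaleC :: complex \<Rightarrow> 'b \<Rightarrow> 'b::cspace"
  by standard 

definition clin :: "('a::cspace \<Rightarrow> 'b::cspace) \<Rightarrow> bool" where
  "clin f \<longleftrightarrow> (\<forall>x y. f (x + y) = f x + f y) \<and> (\<forall>c x. f (c *\<^sub>C x) = c *\<^sub>C f x)"

lemma clinI:
  assumes "\<And>x y. f (x + y) = f x + f y" "\<And>c x. f (c *\<^sub>C x) = c *\<^sub>C f x"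
  shows "clin f"
  using assms by (auto simp: clin_def)

lemma clin_add: "clin f \<Longrightarrow> f (x + y) = f x + f y"
  and clin_scale: "clin f \<Longrightarrow> f (c *\<^sub>C x) = c *\<^sub>C f x"
  by (auto simp: clin_def)

lemma clin_zero: "clin f \<Longrightarrow> f 0 = 0"
  using clin_scale[of f 0 0] by simp

lemma clin_minus: "clin f \<Longrightarrow> f (- x) = - f x"
  using clin_add[of f x "- x"] clin_zero[of f] by (simp add: add_eq_0_iff2)

lemma clin_diff: "clin f \<Longrightarrow> f (x - y) = f x - f y"
  using clin_add[of f x "- y"] clin_minus[of f y] by simp

lemma clin_sum: "clin f \<Longrightarrow> f (sum g A) = (\<Sum>i\<in>A. f (g i))"
  by (induction A rule: infinite_finite_induct) (auto simp: clin_zero clin_add)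

lemmas clin_rules = clin_add clin_scale clin_zero clin_minus clin_diff clin_sum

lemma clin_comp: "clin f \<Longrightarrow> clin g \<Longrightarrow> clin (\<lambda>x. f (g x))"
  by (auto simp: clin_def)

lemma clin_sub: "clin f \<Longrightarrow> clin g \<Longrightarrow> clin (\<lambda>x. f x - g x)"
  by (auto simp: clin_def cs.scale_right_diff_distrib)

lemma clin_plus: "clin f \<Longrightarrow> clin g \<Longrightarrow> clin (\<lambda>x. f x + g x)"
  by (auto simp: clin_def scaleC_add_right)

lemma clin_id: "clin (\<lambda>x. x)"
  by (auto simp: clin_def)

lemma clin_zero_fun: "clin (\<lambda>x. 0)"
  by (auto simp: clin_def)

lemma clin_smul: "clin f \<Longrightarrow> clin (\<lambda>x. c *\<^sub>C f x)"
  by (auto simp: clin_def scaleC_add_right scaleC_scaleC mult.commute)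

lemma clin_sum_fun: "(\<And>i. i \<in> A \<Longrightarrow> clin (f i)) \<Longrightarrow> clin (\<lambda>x. \<Sum>i\<in>A. f i x)"
  by (induction A rule: infinite_finite_induct) (auto intro: clin_zero_fun clin_plus)

lemma clin_apply: "clin (\<lambda>f. f i)"
  by (auto simp: clin_def scaleC_fun_def)

lemma sum_fun_apply: "(sum f A) i = (\<Sum>a\<in>A. f a i)"
  by (induction A rule: infinite_finite_induct) auto

lemma scaleC_complex [simp]: "c *\<^sub>C (x::complex) = c * x"
  by (simp add: scaleC_complex_def)

lemma scaleC_fun_apply [simp]: "(c *\<^sub>C f) i = c *\<^sub>C f i"
  by (simp add: scaleC_fun_def)

lemma scaleC_pair [simp]: "c *\<^sub>C (x, y) = (c *\<^sub>C x, c *\<^sub>C y)"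
  by (simp add: scaleC_prod_def)

lemma clin_iff_linear: "clin f \<longleftrightarrow> Vector_Spaces.linear scaleC scaleC f"
  by (simp add: clin_def Vector_Spaces.linear_iff cs.vector_space_axioms)

text \<open>A basis of \<open>S\<close> stays independent when \<open>v\<close> is joined, so a
  linear map can be prescribed on it. Such functionals cut out subspaces and reduce vector
  identities to complex functions, to which complex analysis applies.\<close>

lemma exists_functional:
  fixes v :: "'a::cspace"
  assumes "cs.subspace S" "v \<notin> S"
  shows "\<exists>\<psi>::'a \<Rightarrow> complex. clin \<psi> \<and> \<psi> v = 1 \<and> (\<forall>w\<in>S. \<psi> w = 0)"
proof -
  obtain B where B: "B \<subseteq> S" "cs.independent B" "S \<subseteq> cs.span B"
    using cs.maximal_independent_subset by blast
  have S: "cs.span B = S" using B assms(1) by (simp add: cs.span_minimal subset_antisym)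
  have "cs.independent (insert v B)"
    using B(2) S assms(2) by (simp add: cs.independent_insertI)
  from csp.linear_independent_extend[OF this, of "\<lambda>x. if x = v then (1::complex) else 0"]
  obtain g where g: "clin g" and gB: "\<forall>x\<in>insert v B. g x = (if x = v then 1 else (0::complex))"
    unfolding clin_iff_linear by blast
  have "g x = 0" if "x \<in> B" for x using gB that B(1) assms(2) by auto
  then have "g w = 0" if "w \<in> cs.span B" for w
  proof -
    have "cs.subspace {w. g w = 0}" by (auto simp: cs.subspace_def clin_rules[OF g])
    then show ?thesis using cs.span_induct[OF that, of "\<lambda>w. g w = 0"] \<open>\<And>x. x \<in> B \<Longrightarrow> g x = 0\<close> by auto
  qed
  then show ?thesis using g gB S by auto
qed

section \<open>Products of shifts of an operator\<close>

text \<open>The polynomial in \<open>T\<close> with the listed roots, applied to \<open>w\<close>.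
  Up to scalars, projections onto eigenspaces have this form.\<close>

definition shifts :: "('a \<Rightarrow> 'a) \<Rightarrow> complex list \<Rightarrow> 'a \<Rightarrow> 'a::cspace" where
  "shifts T cs w = foldr (\<lambda>c w. T w - c *\<^sub>C w) cs w"

lemma shifts_Nil [simp]: "shifts T [] w = w"
  and shifts_Cons: "shifts T (c # cs) w = T (shifts T cs w) - c *\<^sub>C shifts T cs w"
  and shifts_append: "shifts T (xs @ ys) w = shifts T xs (shifts T ys w)"
  by (auto simp: shifts_def)

lemma clin_shifts: "clin T \<Longrightarrow> clin (shifts T cs)"
proof (induction cs)
  case Nil
  have "shifts T [] = (\<lambda>w. w)" by auto
  then show ?case by (simp add: clin_id)
next
  case (Cons c cs)
  have "shifts T (c # cs) = (\<lambda>w. T (shifts T cs w) - c *\<^sub>C shifts T cs w)" by (auto simp: shifts_Cons)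
  then show ?case using Cons by (simp add: clin_sub clin_comp[of T] clin_smul)
qed

lemma shifts_commute:
  assumes S: "clin S" "clin T" and c: "\<And>w. S (T w) = T (S w)"
  shows "S (shifts T cs w) = shifts T cs (S w)"
  by (induction cs) (auto simp: shifts_Cons clin_rules[OF S(1)] c)

lemma shifts_Cons': "clin T \<Longrightarrow> shifts T (c # cs) w = shifts T cs (T w - c *\<^sub>C w)"
  by (simp add: shifts_Cons clin_rules[OF clin_shifts] shifts_commute)

lemma shifts_remove1:
  assumes "clin T" "c \<in> set cs"
  shows "shifts T cs w = shifts T (remove1 c cs) (T w - c *\<^sub>C w)"
  using assms(2)
proof (induction cs)
  case (Cons d cs)
  show ?case
  proof (cases "c = d")
    case True
    then show ?thesis by (simp add: shifts_Cons'[OF assms(1)])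
  next
    case False
    then have "shifts T cs w = shifts T (remove1 c cs) (T w - c *\<^sub>C w)" using Cons by simp
    then show ?thesis using False by (simp add: shifts_Cons)
  qed
qed simp

text \<open>The factors commute, so any chosen root can be moved to the front.\<close>

lemma shifts_mset:
  assumes "clin T" "mset xs = mset ys"
  shows "shifts T xs w = shifts T ys w"
  using assms(2)
proof (induction xs arbitrary: ys w)
  case (Cons x xs)
  have "x \<in> set ys" using mset_eq_setD[OF Cons.prems] by auto
  moreover have "mset xs = mset (remove1 x ys)" 
    by (simp add: Cons.prems[symmetric])
  ultimately show ?case
    by (simp add: shifts_Cons'[OF assms(1)] Cons.IH shifts_remove1[OF assms(1), of x ys])
qed simp

lemma shifts_zero_mono:
  assumes "clin T" "shifts T xs w = 0" "mset xs \<subseteq># mset ys"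
  shows "shifts T ys w = 0"
proof -
  obtain A where A: "mset ys = mset xs + A" using assms(3) by (auto simp: mset_subset_eq_exists_conv)
  obtain zs where "mset zs = A" using ex_mset by blast
  then have "mset ys = mset (zs @ xs)" using A by (simp add: union_commute)
  then show ?thesis using shifts_mset[OF assms(1), of ys "zs @ xs"] assms
    by (simp add: shifts_append clin_zero clin_shifts)
qed

lemma shifts_eigen:
  assumes "clin T" "T w = a *\<^sub>C w"
  shows "shifts T cs w = (\<Prod>c\<leftarrow>cs. a - c) *\<^sub>C w"
proof (induction cs)
  case (Cons c cs)
  have "p *\<^sub>C (a *\<^sub>C w) - c *\<^sub>C (p *\<^sub>C w) = ((a - c) * p) *\<^sub>C w" for p
    unfolding scaleC_scaleC cs.scale_left_diff_distrib[symmetric] by (simp add: algebra_simps)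
  then show ?case
    by (simp add: shifts_Cons Cons.IH clin_scale[OF assms(1)] assms(2) del: cs.scale_scale)
qed (simp add: scaleC_one)

text \<open>\<open>f\<close> lowers eigenvalues of \<open>T\<close> by \<open>d\<close>, so it
  carries a polynomial relation to the one with all roots lowered by \<open>d\<close>.\<close>

lemma shifts_translate:
  assumes "clin T" "clin f" "\<And>w. T (f w) = f (T w) - d *\<^sub>C f w"
  shows "shifts T (map (\<lambda>c. c - d) cs) (f w) = f (shifts T cs w)"
proof (induction cs)
  case (Cons c cs)
  then show ?case
    by (simp add: shifts_Cons assms(3) clin_diff[OF assms(2)] clin_scale[OF assms(2)] cs.scale_left_diff_distrib)
qed simp

section \<open>Linear differential systems of entire functions\<close>

text \<open>All iterated derivatives of a member are finite sums of members, hence vanish at 0, and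
  an entire function with zero Taylor series is zero. The family may be infinite, so no bases of
  modules have to be chosen.\<close>

lemma entire_system_zero:
  fixes R :: "'s \<Rightarrow> complex \<Rightarrow> complex"
  assumes z: "\<And>s. P s \<Longrightarrow> R s 0 = 0"
    and d: "\<And>s. P s \<Longrightarrow> \<exists>ss. (\<forall>s'\<in>set ss. P s') \<and> (\<forall>z. (R s has_field_derivative (\<Sum>s'\<leftarrow>ss. R s' z)) (at z))"
    and s: "P s"
  shows "R s z = 0"
proof -
  \<comment> \<open>The closure of the family under finite sums, which differentiation maps to
    itself.\<close>
  define Q where "Q = (\<lambda>ss z. \<Sum>s\<leftarrow>ss. R s z) ` {ss. \<forall>s'\<in>set ss. P s'}"
  have Q0: "q 0 = 0" if q: "q \<in> Q" for q
  proof -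
    obtain ss where ss: "q = (\<lambda>z. \<Sum>s\<leftarrow>ss. R s z)" "\<forall>s'\<in>set ss. P s'" using q unfolding Q_def by blast
    then show ?thesis 
      by (simp add: z cong: map_cong)
  qed
  have Qd: "\<exists>q'\<in>Q. \<forall>z. (q has_field_derivative q' z) (at z)" if q: "q \<in> Q" for q
  proof -
    obtain ss where ss: "q = (\<lambda>z. \<Sum>s\<leftarrow>ss. R s z)" "\<forall>s'\<in>set ss. P s'" using q unfolding Q_def by blast
    have "\<exists>ts. (\<forall>s'\<in>set ts. P s') \<and> (\<forall>z. ((\<lambda>z. \<Sum>s\<leftarrow>ss. R s z) has_field_derivative (\<Sum>s'\<leftarrow>ts. R s' z)) (at z))"
      using ss(2)
    proof (induction ss)
      case Nil
      then show ?case by (intro exI[of _ "[]"]) auto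
    next
      case (Cons s ss)
      then obtain ts where ts: "\<forall>s'\<in>set ts. P s'"
        "\<forall>z. ((\<lambda>z. \<Sum>s\<leftarrow>ss. R s z) has_field_derivative (\<Sum>s'\<leftarrow>ts. R s' z)) (at z)" by auto
      obtain us where us: "\<forall>s'\<in>set us. P s'" "\<forall>z. (R s has_field_derivative (\<Sum>s'\<leftarrow>us. R s' z)) (at z)"
        using d[of s] Cons.prems by auto
      show ?case using ts us by (intro exI[of _ "us @ ts"]) (auto intro!: derivative_eq_intros)
    qed
    then obtain ts where "\<forall>s'\<in>set ts. P s'"
        "\<forall>z. (q has_field_derivative (\<Sum>s'\<leftarrow>ts. R s' z)) (at z)" unfolding ss(1) by blast
    then show ?thesis unfolding Q_def by (intro bexI[of _ "\<lambda>z. \<Sum>s\<leftarrow>ts. R s z"]) auto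
  qed
  have dq: "(deriv ^^ n) q \<in> Q" if "q \<in> Q" for q n
    using that
  proof (induction n arbitrary: q)
    case (Suc n)
    obtain q' where "q' \<in> Q" "\<forall>z. (q has_field_derivative q' z) (at z)" using Qd[OF Suc.prems] by auto
    then have "deriv q = q'" by (auto intro!: DERIV_imp_deriv)
    then show ?case using Suc.IH[OF \<open>q' \<in> Q\<close>] by (simp add: funpow_swap1)
  qed simp
  have sQ: "R s \<in> Q" unfolding Q_def using s by (intro image_eqI[of _ _ "[s]"]) auto
  have "R s holomorphic_on UNIV"
    using Qd[OF sQ] by (auto simp: holomorphic_on_open field_differentiable_def)
  then show ?thesis
    by (rule holomorphic_fun_eq_0_on_connected[of _ UNIV 0]) (use Q0[OF dq[OF sQ]] in auto)
qed

declare One_nat_def [simp del]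

section \<open>Generators of the Levi subgroup\<close>

lemma levi_carrier: "A \<in> levi k n \<Longrightarrow> A \<in> carrier_mat (n + 1) (n + 1)"
  by (simp add: levi_def)

lemma levi_block: "A \<in> levi k n \<Longrightarrow> i < n + 1 \<Longrightarrow> j < n + 1 \<Longrightarrow> (i < k + 1) \<noteq> (j < k + 1) \<Longrightarrow> A $$ (i, j) = 0"
  by (auto simp: levi_def)

lemma levi_mult:
  assumes "A \<in> levi k n" "B \<in> levi k n"
  shows "A * B \<in> levi k n"
proof -
  have c: "A \<in> carrier_mat (n + 1) (n + 1)" "B \<in> carrier_mat (n + 1) (n + 1)"
    using assms levi_carrier by auto
  have "(A * B) $$ (i, j) = 0" if ij: "i < n + 1" "j < n + 1" "(i < k + 1) \<noteq> (j < k + 1)" for i j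
  proof -
    have "A $$ (i, l) * B $$ (l, j) = 0" if "l < n + 1" for l
      using levi_block[OF assms(1), of i l] levi_block[OF assms(2), of l j] ij that by (cases "l < k + 1") auto
    then show ?thesis using c ij by (simp add: scalar_prod_def sum.neutral del: mult_eq_0_iff)
  qed
  moreover have "det (A * B) = 1" using assms by (auto simp: levi_def det_mult)
  ultimately show ?thesis using c by (simp add: levi_def)
qed

lemma levi_one: "1\<^sub>m (n + 1) \<in> levi k n"
  by (auto simp: levi_def)

lemma levi_transpose: "A \<in> levi k n \<Longrightarrow> transpose_mat A \<in> levi k n"
  using Determinant.det_transpose[OF levi_carrier] by (auto simp: levi_def)

lemma addrow_levi:
  assumes "i \<noteq> j" "i < n + 1" "j < n + 1" "(i < k + 1) = (j < k + 1)"
  shows "addrow_mat (n + 1) z i j \<in> levi k n"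
  using assms det_addrow_mat[of i j "n + 1" z] by (auto simp: levi_def)

text \<open>The entry in position \<open>n\<close> restores determinant 1; this position is the
  reference point of all torus computations.\<close>

definition tor :: "nat \<Rightarrow> nat \<Rightarrow> complex \<Rightarrow> complex mat" where
  "tor n i z = mat (n + 1) (n + 1) (\<lambda>(a, b). if a \<noteq> b then 0
     else if a = i then exp z else if a = n then exp (- z) else 1)"

lemma tor_levi: "i < n \<Longrightarrow> tor n i z \<in> levi k n"
proof -
  assume i: "i < n"
  have "det (tor n i z) = prod_list (diag_mat (tor n i z))"
    by (rule det_upper_triangular[of _ "n + 1"]) (auto simp: tor_def upper_triangular_def)
  also have "\<dots> = (\<Prod>a<n + 1. (if a = i then exp z else if a = n then exp (- z) else 1))"
    unfolding prod_list_diag_prod by (intro prod.cong) (auto simp: tor_def)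
  also have "\<dots> = (\<Prod>a\<in>{i, n}. (if a = i then exp z else if a = n then exp (- z) else 1))"
    using i by (intro prod.mono_neutral_right) auto
  also have "\<dots> = 1" using i by (simp add: exp_add[symmetric])
  finally show ?thesis by (auto simp: levi_def tor_def)
qed

text \<open>The group generated by one-parameter subgroups of the Levi subgroup. That it is
  everything (\<open>levi_Gen\<close>) is what leads back from the Lie algebra to the group.\<close>

inductive_set Gen :: "nat \<Rightarrow> nat \<Rightarrow> complex mat set" for k n where
  one: "1\<^sub>m (n + 1) \<in> Gen k n"
| addrow: "i \<noteq> j \<Longrightarrow> i < n + 1 \<Longrightarrow> j < n + 1 \<Longrightarrow> (i < k + 1) = (j < k + 1) \<Longrightarrow>
    addrow_mat (n + 1) z i j \<in> Gen k n"
| tor: "i < n \<Longrightarrow> tor n i z \<in> Gen k n"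
| mult: "A \<in> Gen k n \<Longrightarrow> B \<in> Gen k n \<Longrightarrow> A * B \<in> Gen k n"

lemma Gen_levi: "A \<in> Gen k n \<Longrightarrow> A \<in> levi k n"
  by (induction rule: Gen.induct) (auto simp: levi_one addrow_levi tor_levi intro: levi_mult)

text \<open>Elimination is carried out on columns only; rows are reached through the
  transpose.\<close>

lemma Gen_transpose: "A \<in> Gen k n \<Longrightarrow> transpose_mat A \<in> Gen k n"
proof (induction rule: Gen.induct)
  case one
  then show ?case by (simp add: Gen.one)
next
  case (addrow i j z)
  have "transpose_mat (addrow_mat (n + 1) z i j) = addrow_mat (n + 1) z j i"
    by (rule eq_matI) (auto simp: addrow_mat_def)
  then show ?case using addrow by (simp add: Gen.addrow)
next
  case (tor i z)
  have "transpose_mat (tor n i z) = tor n i z"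
    by (rule eq_matI) (auto simp: tor_def)
  then show ?case using tor by (simp add: Gen.tor)
next
  case (mult A B)
  then have "transpose_mat (A * B) = transpose_mat B * transpose_mat A"
    using transpose_mult[OF levi_carrier[OF Gen_levi] levi_carrier[OF Gen_levi]] by blast
  then show ?case using mult by (simp add: Gen.mult)
qed

lemma addrow_mat_add:
  assumes "i \<noteq> j" "i < N" "j < N"
  shows "addrow_mat N z i j * addrow_mat N w i j = addrow_mat N (z + w :: complex) i j"
  using assms
  by (subst addrow_mat[symmetric, of _ N N]) (auto simp: addrow_mat_def intro!: eq_matI)

lemma addrow_mat_zero: "addrow_mat N (0::complex) i j = 1\<^sub>m N"
  by (rule eq_matI) (auto simp: addrow_mat_def)

lemma tor_add: "i < n \<Longrightarrow> tor n i z * tor n i w = tor n i (z + w)"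
proof (rule eq_matI, goal_cases)
  case (1 a b)
  then have "(tor n i z * tor n i w) $$ (a, b) = (\<Sum>l<n + 1. tor n i z $$ (a, l) * tor n i w $$ (l, b))"
    by (simp add: scalar_prod_def tor_def atLeast0LessThan)
  also have "\<dots> = tor n i z $$ (a, a) * tor n i w $$ (a, b)"
    using 1 by (subst sum.remove[of _ a]) (auto simp: tor_def intro!: sum.neutral)
  finally show ?case using 1 by (auto simp: tor_def exp_add[symmetric])
qed (auto simp: tor_def)

lemma tor_zero: "tor n i 0 = 1\<^sub>m (n + 1)"
  by (rule eq_matI) (auto simp: tor_def)

lemma Gen_addrow_cancel:
  assumes "i \<noteq> j" "i < n + 1" "j < n + 1" "(i < k + 1) = (j < k + 1)"
    and A: "A \<in> levi k n" and G: "addrow z i j A \<in> Gen k n"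
  shows "A \<in> Gen k n"
proof -
  have "addrow_mat (n + 1) (- z) i j * addrow z i j A
    = addrow_mat (n + 1) (- z) i j * (addrow_mat (n + 1) z i j * A)"
    using levi_carrier[OF A] assms(3) by (subst addrow_mat) auto
  also have "\<dots> = (addrow_mat (n + 1) (- z) i j * addrow_mat (n + 1) z i j) * A"
    using levi_carrier[OF A] by (intro assoc_mult_mat[symmetric]) auto
  also have "\<dots> = A"
    using levi_carrier[OF A] assms by (simp add: addrow_mat_add addrow_mat_zero)
  finally show ?thesis using Gen.mult[OF Gen.addrow[of i j n k "- z"] G] assms by simp
qed

lemma addrow_in_levi:
  assumes "i \<noteq> j" "i < n + 1" "j < n + 1" "(i < k + 1) = (j < k + 1)" "A \<in> levi k n"
  shows "addrow z i j A \<in> levi k n"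
  using levi_mult[OF addrow_levi[OF assms(1-4)] assms(5)] levi_carrier[OF assms(5)] assms(3)
  by (subst addrow_mat) auto

text \<open>The diagonal entries are normalized to 1 one at a time at the expense of the last one,
  which determinant 1 finally forces to be 1 as well.\<close>

lemma Gen_diagonal:
  assumes "A \<in> levi k n" "\<And>i j. i < n + 1 \<Longrightarrow> j < n + 1 \<Longrightarrow> i \<noteq> j \<Longrightarrow> A $$ (i, j) = 0"
  shows "A \<in> Gen k n"
proof -
  have "A \<in> Gen k n" if "r \<le> n" "A \<in> levi k n"
    "\<And>i j. i < n + 1 \<Longrightarrow> j < n + 1 \<Longrightarrow> i \<noteq> j \<Longrightarrow> A $$ (i, j) = 0"
    "\<And>i. i < r \<Longrightarrow> A $$ (i, i) = 1" for r A
    using that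
  proof (induction r arbitrary: A rule: inc_induct)
    case base
    have A: "A \<in> carrier_mat (n + 1) (n + 1)" using levi_carrier base by auto
    have "det A = prod_list (diag_mat A)"
      using A base by (intro det_upper_triangular) (auto simp: upper_triangular_def)
    also have "\<dots> = (\<Prod>a<n + 1. A $$ (a, a))"
      using A by (simp add: prod_list_diag_prod atLeast0LessThan)
    also have "\<dots> = A $$ (n, n)" using base by (subst prod.remove[of _ n]) (auto intro!: prod.neutral)
    finally have "A $$ (n, n) = 1" using base by (simp add: levi_def)
    then have d: "A $$ (i, i) = 1" if "i < n + 1" for i
      using that base(3) by (cases "i = n") auto
    have "A = 1\<^sub>m (n + 1)"
      using A base(2) d by (intro eq_matI) auto
    then show ?case by (simp add: Gen.one)
  next
    case (step r)
    have A: "A \<in> carrier_mat (n + 1) (n + 1)" using levi_carrier step.prems step.hyps by auto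
    have "det A = prod_list (diag_mat A)"
      using A step.prems step.hyps by (intro det_upper_triangular) (auto simp: upper_triangular_def)
    also have "\<dots> = (\<Prod>a<n + 1. A $$ (a, a))"
      using A by (simp add: prod_list_diag_prod atLeast0LessThan)
    finally have "(\<Prod>a<n + 1. A $$ (a, a)) \<noteq> 0" using step.prems(1) by (simp add: levi_def)
    then have nz: "A $$ (r, r) \<noteq> 0" using step.hyps by auto
    \<comment> \<open>Every nonzero number is an exponential, so the entry is a value of the
      one-parameter subgroup.\<close>
    define z where "z = Ln (A $$ (r, r))"
    have ez: "exp z = A $$ (r, r)" using nz by (simp add: z_def)
    define B where "B = tor n r (- z) * A"
    have Bl: "B \<in> levi k n" unfolding B_def using step.prems step.hyps by (intro levi_mult tor_levi) auto
    have Bi: "B $$ (i, j) = (if i = r then exp (- z) else if i = n then exp z else 1) * A $$ (i, j)"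
      if "i < n + 1" "j < n + 1" for i j
    proof -
      have "B $$ (i, j) = (\<Sum>l<n + 1. tor n r (- z) $$ (i, l) * A $$ (l, j))"
        using that A by (auto simp: B_def scalar_prod_def tor_def atLeast0LessThan)
      also have "\<dots> = tor n r (- z) $$ (i, i) * A $$ (i, j)"
        using that by (subst sum.remove[of _ i]) (auto simp: tor_def intro!: sum.neutral)
      finally show ?thesis using that by (auto simp: tor_def)
    qed
    have "B \<in> Gen k n"
    proof (rule step.IH[OF Bl])
      show "B $$ (i, i) = 1" if "i < Suc r" for i
        using that step.prems(3) step.hyps Bi[of i i] ez nz by (cases "i = r") (auto simp: exp_minus)
      show "B $$ (i, j) = 0" if "i < n + 1" "j < n + 1" "i \<noteq> j" for i j
        using Bi[of i j] step.prems(2)[OF that] that by simp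
    qed
    moreover have "A = tor n r z * B"
    proof -
      have "tor n r z * B = (tor n r z * tor n r (- z)) * A"
        unfolding B_def using A by (intro assoc_mult_mat[symmetric]) (auto simp: tor_def)
      then show ?thesis using A step.prems step.hyps by (simp add: tor_add tor_zero)
    qed
    ultimately show ?case using Gen.mult[OF Gen.tor[of r n z k]] step.hyps by simp
  qed
  from this[of 0 A] show ?thesis using assms by auto
qed

section \<open>Gaussian elimination inside the diagonal blocks\<close>

definition cleared :: "nat \<Rightarrow> nat \<Rightarrow> complex mat \<Rightarrow> bool" where
  "cleared n r A \<longleftrightarrow> (\<forall>i<n + 1. \<forall>j<n + 1. i \<noteq> j \<longrightarrow> i < r \<or> j < r \<longrightarrow> A $$ (i, j) = 0)"

lemma cleared_transpose: "A \<in> carrier_mat (n + 1) (n + 1) \<Longrightarrow> cleared n r A \<Longrightarrow> cleared n r (transpose_mat A)"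
  by (auto simp: cleared_def)

lemma cleared_addrow:
  assumes "A \<in> carrier_mat (n + 1) (n + 1)" "cleared n r A" "r \<le> i" "r \<le> j" "i < n + 1" "j < n + 1"
  shows "cleared n r (addrow z i j A)"
  using assms by (auto simp: cleared_def)

text \<open>The invariant \<open>Q\<close> lets one elimination serve twice: with a trivial
  invariant for the column, and for the transposed matrix with the row that is already clear as
  invariant. The induction is on the number of nonzero entries below the pivot.\<close>

lemma Gen_clear_column:
  assumes r: "r < n + 1"
    and base: "\<And>A. A \<in> levi k n \<Longrightarrow> cleared n r A \<Longrightarrow> A $$ (r, r) \<noteq> 0 \<Longrightarrow> Q A \<Longrightarrow>
      (\<And>i. r < i \<Longrightarrow> i < n + 1 \<Longrightarrow> A $$ (i, r) = 0) \<Longrightarrow> A \<in> Gen k n"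
    and Q: "\<And>A i z. A \<in> levi k n \<Longrightarrow> r < i \<Longrightarrow> i < n + 1 \<Longrightarrow> Q A \<Longrightarrow> Q (addrow z i r A)"
    and A: "A \<in> levi k n" "cleared n r A" "A $$ (r, r) \<noteq> 0" "Q A"
  shows "A \<in> Gen k n"
  using A
proof (induction "card {i. r < i \<and> i < n + 1 \<and> A $$ (i, r) \<noteq> 0}" arbitrary: A rule: less_induct)
  case less
  let ?S = "\<lambda>A::complex mat. {i. r < i \<and> i < n + 1 \<and> A $$ (i, r) \<noteq> 0}"
  have A: "A \<in> carrier_mat (n + 1) (n + 1)" using levi_carrier less.prems by auto
  show ?case
  proof (cases "?S A = {}")
    case True
    then show ?thesis using base[OF less.prems] by blast
  next
    case False
    then obtain i where i: "r < i" "i < n + 1" "A $$ (i, r) \<noteq> 0" by auto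
    \<comment> \<open>Nonzero entries occur only inside the diagonal blocks, so the row operation
      that removes one stays in the Levi subgroup.\<close>
    then have blk: "(i < k + 1) = (r < k + 1)" using levi_block[OF less.prems(1), of i r] r by auto
    define B where "B = addrow (- A $$ (i, r) / A $$ (r, r)) i r A"
    have Br: "B $$ (a, r) = (if a = i then 0 else A $$ (a, r))" if "a < n + 1" for a
      using that i(2) A r less.prems(3) by (cases "a = i") (simp_all add: B_def)
    have "i \<in> ?S A" "i \<notin> ?S B" "?S B \<subseteq> ?S A"
      using Br i by (auto split: if_splits)
    then have "?S B \<subset> ?S A" by blast
    then have "card (?S B) < card (?S A)" by (intro psubset_card_mono) auto
    then have "B \<in> Gen k n"
    proof (rule less.hyps)
      show "B \<in> levi k n" unfolding B_def using i(1,2) r blk less.prems(1) by (intro addrow_in_levi) auto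
      show "cleared n r B" unfolding B_def using i(1,2) r A less.prems(2) by (intro cleared_addrow) auto
      show "B $$ (r, r) \<noteq> 0" using Br[OF r] i(1) less.prems(3) by simp
      show "Q B" unfolding B_def by (rule Q[OF less.prems(1) i(1,2) less.prems(4)])
    qed
    then show ?thesis unfolding B_def using i(1,2) r blk less.prems(1) Gen_addrow_cancel[of i r n k A] by blast
  qed
qed

lemma levi_Gen:
  assumes "A \<in> levi k n"
  shows "A \<in> Gen k n"
proof -
  have "A \<in> Gen k n" if "r \<le> n + 1" "A \<in> levi k n" "cleared n r A" for r A
    using that
  proof (induction r arbitrary: A rule: inc_induct)
    case base
    then show ?case by (intro Gen_diagonal) (auto simp: cleared_def)
  next
    case (step r)
    note r = step.hyps(2)
    define row where "row = (\<lambda>A::complex mat. \<forall>j. r < j \<and> j < n + 1 \<longrightarrow> A $$ (r, j) = 0)"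
    have 1: "A \<in> Gen k n" if "A \<in> levi k n" "cleared n r A" "A $$ (r, r) \<noteq> 0" "row A" for A
    proof (rule Gen_clear_column[of r n k row])
      fix B assume B: "B \<in> levi k n" "cleared n r B" "row B"
        "\<And>i. r < i \<Longrightarrow> i < n + 1 \<Longrightarrow> B $$ (i, r) = 0"
      have "cleared n (Suc r) B"
        unfolding cleared_def
      proof (intro allI impI)
        fix i j assume "i < n + 1" "j < n + 1" "i \<noteq> j" "i < Suc r \<or> j < Suc r"
        then show "B $$ (i, j) = 0"
          using B by (cases "i < r \<or> j < r") (auto simp: cleared_def row_def less_Suc_eq)
      qed
      then show "B \<in> Gen k n" using step.IH B by auto
    next
      fix B :: "complex mat" and i z assume "B \<in> levi k n" "r < i" "i < n + 1" "row B"
      then show "row (addrow z i r B)" using levi_carrier[of B k n] r by (auto simp: row_def)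
    qed (use that r in auto)
    have 2: "A \<in> Gen k n" if "A \<in> levi k n" "cleared n r A" "A $$ (r, r) \<noteq> 0" for A
    proof (rule Gen_clear_column[of r n k "\<lambda>_. True"])
      fix B assume B: "B \<in> levi k n" "cleared n r B" "B $$ (r, r) \<noteq> 0"
        "\<And>i. r < i \<Longrightarrow> i < n + 1 \<Longrightarrow> B $$ (i, r) = 0"
      have "B \<in> carrier_mat (n + 1) (n + 1)" using levi_carrier B by auto
      then have "transpose_mat B \<in> Gen k n"
        using B r by (intro 1 levi_transpose cleared_transpose) (auto simp: row_def)
      then show "B \<in> Gen k n" using Gen_transpose by fastforce
    qed (use that r in auto)
    have A: "A \<in> carrier_mat (n + 1) (n + 1)" using levi_carrier step.prems step.hyps by auto
    show ?case
    proof (cases "A $$ (r, r) = 0")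
      case False
      then show ?thesis using 2 step.prems step.hyps by auto
    next
      case True
      \<comment> \<open>The column cannot vanish since \<open>A\<close> is invertible; adding a row
        with a nonzero entry then creates a pivot.\<close>
      have "\<exists>i<n + 1. A $$ (i, r) \<noteq> 0"
      proof (rule ccontr)
        assume "\<not> (\<exists>i<n + 1. A $$ (i, r) \<noteq> 0)"
        then have "A *\<^sub>v unit_vec (n + 1) r = 0\<^sub>v (n + 1)"
          using A r by (intro eq_vecI) auto
        then have "det A = 0" using A r
          by (subst det_0_iff_vec_prod_zero[OF A]) (auto intro!: exI[of _ "unit_vec (n + 1) r"])
        then show False using step.prems step.hyps by (simp add: levi_def)
      qed
      then obtain i where i: "i < n + 1" "A $$ (i, r) \<noteq> 0" by auto
      then have blk: "(r < k + 1) = (i < k + 1)" using levi_block[OF step.prems(1), of i r] r by auto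
      have "\<not> i < r" using i(2) step.prems(2) r i(1) by (auto simp: cleared_def)
      then have ri: "r < i" using i(2) True by (cases "i = r") auto
      have "addrow 1 r i A \<in> Gen k n"
        using ri i r blk A step.prems step.hyps True by (intro 2 addrow_in_levi cleared_addrow) auto
      then show ?thesis using Gen_addrow_cancel[of r i n k A] ri i(1) r blk step.prems(1) by blast
    qed
  qed
  from this[of 0 A] show ?thesis using assms by (auto simp: cleared_def)
qed

section \<open>Differentiating modules\<close>

lemma poly_fun_cong:
  "f \<in> poly_fun N \<Longrightarrow> (\<And>i j. i < N \<Longrightarrow> j < N \<Longrightarrow> A $$ (i, j) = B $$ (i, j)) \<Longrightarrow> f A = f B"
  by (induction rule: poly_fun.induct) auto

text \<open>The differential of \<open>f\<close> at \<open>P\<close>, obtained without a topology on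
  matrices: by induction on \<open>f\<close>, coefficients that are fixed before the curve is chosen
  work for every curve through \<open>P\<close>.\<close>

lemma poly_fun_chain:
  assumes "f \<in> poly_fun N"
  shows "\<exists>c. \<forall>\<gamma> Y. (\<forall>i<N. \<forall>j<N. \<gamma> 0 $$ (i, j) = P $$ (i, j)) \<longrightarrow>
    (\<forall>i<N. \<forall>j<N. ((\<lambda>z. \<gamma> z $$ (i, j)) has_field_derivative Y i j) (at (0::complex))) \<longrightarrow>
    ((\<lambda>z. f (\<gamma> z)) has_field_derivative (\<Sum>i<N. \<Sum>j<N. c i j * Y i j)) (at 0)"
  using assms
proof (induction rule: poly_fun.induct)
  case (const c)
  show ?case by (intro exI[of _ "\<lambda>_ _. 0"]) auto
next
  case (entry a b)
  have "(\<Sum>i<N. \<Sum>j<N. (if i = a \<and> j = b then 1 else 0) * Y i j) = Y a b" for Y :: "nat \<Rightarrow> nat \<Rightarrow> complex"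
  proof -
    have "(\<Sum>j<N. (if i = a \<and> j = b then 1 else 0) * Y i j) = (if i = a then Y i b else 0)" for i
      using entry by (subst sum.remove[of _ b]) (auto intro!: sum.neutral)
    then show ?thesis using entry by simp
  qed
  then show ?case using entry by (intro exI[of _ "\<lambda>i j. if i = a \<and> j = b then 1 else 0"]) auto
next
  case (add f h)
  then obtain c d where
    "\<forall>\<gamma> Y. (\<forall>i<N. \<forall>j<N. \<gamma> 0 $$ (i, j) = P $$ (i, j)) \<longrightarrow>
      (\<forall>i<N. \<forall>j<N. ((\<lambda>z. \<gamma> z $$ (i, j)) has_field_derivative Y i j) (at 0)) \<longrightarrow>
      ((\<lambda>z. f (\<gamma> z)) has_field_derivative (\<Sum>i<N. \<Sum>j<N. c i j * Y i j)) (at 0)"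
    "\<forall>\<gamma> Y. (\<forall>i<N. \<forall>j<N. \<gamma> 0 $$ (i, j) = P $$ (i, j)) \<longrightarrow>
      (\<forall>i<N. \<forall>j<N. ((\<lambda>z. \<gamma> z $$ (i, j)) has_field_derivative Y i j) (at 0)) \<longrightarrow>
      ((\<lambda>z. h (\<gamma> z)) has_field_derivative (\<Sum>i<N. \<Sum>j<N. d i j * Y i j)) (at 0)" by blast
  then show ?case
    by (intro exI[of _ "\<lambda>i j. c i j + d i j"])
      (auto simp: distrib_right sum.distrib intro!: DERIV_add)
next
  case (mult f h)
  then obtain c d where cd:
    "\<And>\<gamma> Y. (\<forall>i<N. \<forall>j<N. \<gamma> 0 $$ (i, j) = P $$ (i, j)) \<Longrightarrow>
      (\<forall>i<N. \<forall>j<N. ((\<lambda>z. \<gamma> z $$ (i, j)) has_field_derivative Y i j) (at 0)) \<Longrightarrow>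
      ((\<lambda>z. f (\<gamma> z)) has_field_derivative (\<Sum>i<N. \<Sum>j<N. c i j * Y i j)) (at 0)"
    "\<And>\<gamma> Y. (\<forall>i<N. \<forall>j<N. \<gamma> 0 $$ (i, j) = P $$ (i, j)) \<Longrightarrow>
      (\<forall>i<N. \<forall>j<N. ((\<lambda>z. \<gamma> z $$ (i, j)) has_field_derivative Y i j) (at 0)) \<Longrightarrow>
      ((\<lambda>z. h (\<gamma> z)) has_field_derivative (\<Sum>i<N. \<Sum>j<N. d i j * Y i j)) (at 0)" by blast
  show ?case
  proof (intro exI[of _ "\<lambda>i j. c i j * h P + f P * d i j"] allI impI)
    fix \<gamma> Y
    assume a: "\<forall>i<N. \<forall>j<N. \<gamma> 0 $$ (i, j) = P $$ (i, j)"
      "\<forall>i<N. \<forall>j<N. ((\<lambda>z. \<gamma> z $$ (i, j)) has_field_derivative Y i j) (at (0::complex))"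
    have P: "f (\<gamma> 0) = f P" "h (\<gamma> 0) = h P"
      using poly_fun_cong[OF mult.hyps(1)] poly_fun_cong[OF mult.hyps(2)] a(1) by blast+
    have "(\<Sum>i<N. \<Sum>j<N. (c i j * h P + f P * d i j) * Y i j)
      = (\<Sum>i<N. \<Sum>j<N. c i j * Y i j) * h (\<gamma> 0) + (\<Sum>i<N. \<Sum>j<N. d i j * Y i j) * f (\<gamma> 0)"
      unfolding P sum_distrib_right sum.distrib[symmetric]
      by (intro sum.cong refl) (simp add: algebra_simps)
    then show "((\<lambda>z. f (\<gamma> z) * h (\<gamma> z)) has_field_derivative
        (\<Sum>i<N. \<Sum>j<N. (c i j * h P + f P * d i j) * Y i j)) (at 0)"
      using DERIV_mult[OF cd(1)[OF a] cd(2)[OF a]] by simp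
  qed
qed

section \<open>One-parameter subgroups and the differential of a representation\<close>

definition one_param :: "nat \<Rightarrow> nat \<Rightarrow> (complex \<Rightarrow> complex mat) \<Rightarrow> (nat \<Rightarrow> nat \<Rightarrow> complex) \<Rightarrow> bool" where
  "one_param k n \<gamma> Y \<longleftrightarrow> (\<forall>z. \<gamma> z \<in> levi k n) \<and> \<gamma> 0 = 1\<^sub>m (n + 1) \<and> (\<forall>z w. \<gamma> (z + w) = \<gamma> z * \<gamma> w) \<and>
    (\<forall>i<n + 1. \<forall>j<n + 1. ((\<lambda>z. \<gamma> z $$ (i, j)) has_field_derivative Y i j) (at 0))"

lemma one_param_inverse:
  assumes "one_param k n \<gamma> Y"
  shows "\<gamma> z * \<gamma> (- z) = 1\<^sub>m (n + 1)" "\<gamma> (- z) * \<gamma> z = 1\<^sub>m (n + 1)"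
  using assms unfolding one_param_def by (metis add.right_inverse, metis add.left_inverse)

lemma one_param_addrow:
  assumes "i \<noteq> j" "i < n + 1" "j < n + 1" "(i < k + 1) = (j < k + 1)"
  shows "one_param k n (\<lambda>z. addrow_mat (n + 1) z i j) (\<lambda>a b. if a = i \<and> b = j then 1 else 0)"
proof -
  have "((\<lambda>z. addrow_mat (n + 1) z i j $$ (a, b)) has_field_derivative (if a = i \<and> b = j then 1 else 0)) (at (0::complex))"
    if "a < n + 1" "b < n + 1" for a b
  proof -
    have e: "addrow_mat (n + 1) z i j $$ (a, b)
        = (if a = i \<and> b = j then 1 else 0) * z + (if a = b then 1 else 0)" for z :: complex
      using that assms(1) by auto
    show ?thesis unfolding e by (auto intro!: derivative_eq_intros)
  qed
  then show ?thesis
    unfolding one_param_def using assms by (simp add: addrow_levi addrow_mat_zero addrow_mat_add)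
qed

lemma one_param_tor:
  assumes "i < n"
  shows "one_param k n (tor n i) (\<lambda>a b. if a = b \<and> a = i then 1 else if a = b \<and> a = n then - 1 else 0)"
proof -
  have "((\<lambda>z. tor n i z $$ (a, b)) has_field_derivative
      (if a = b \<and> a = i then 1 else if a = b \<and> a = n then - 1 else 0)) (at 0)"
    if "a < n + 1" "b < n + 1" for a b
  proof -
    have e: "tor n i z $$ (a, b) = (if a \<noteq> b then 0 else if a = i then exp z
        else if a = n then exp (- z) else 1)" for z
      using that by (auto simp: tor_def)
    show ?thesis unfolding e
      by (cases "a = b"; cases "a = i"; cases "a = n") (auto intro!: derivative_eq_intros)
  qed
  then show ?thesis
    unfolding one_param_def using assms by (simp add: tor_levi tor_zero tor_add)
qed

lemma mat_mult_entry:
  assumes "A \<in> carrier_mat a b" "B \<in> carrier_mat b c" "i < a" "j < c"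
  shows "(A * B) $$ (i, j) = (\<Sum>l<b. A $$ (i, l) * B $$ (l, j))"
  using assms by (simp add: scalar_prod_def atLeast0LessThan)

text \<open>Coefficients of the differential at the identity. Only curves inside the Levi subgroup
  constrain them, because \<open>act\<close> is polynomial there, so they need not be unique. Thus
  \<open>dact\<close> is linear in \<open>Y\<close> by construction, but it is meaningful for
  \<open>Y\<close> in \<open>tang k n\<close>.\<close>

definition dact_coeff :: "nat \<Rightarrow> nat \<Rightarrow> rmod \<Rightarrow> nat \<Rightarrow> nat \<Rightarrow> nat \<Rightarrow> nat \<Rightarrow> complex" where
  "dact_coeff k n E a b = (SOME c. \<forall>\<gamma> Y. (\<forall>i<n + 1. \<forall>j<n + 1. \<gamma> 0 $$ (i, j) = 1\<^sub>m (n + 1) $$ (i, j)) \<longrightarrow>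
    (\<forall>z. \<gamma> z \<in> levi k n) \<longrightarrow>
    (\<forall>i<n + 1. \<forall>j<n + 1. ((\<lambda>z. \<gamma> z $$ (i, j)) has_field_derivative Y i j) (at (0::complex))) \<longrightarrow>
    ((\<lambda>z. act E (\<gamma> z) $$ (a, b)) has_field_derivative (\<Sum>i<n + 1. \<Sum>j<n + 1. c i j * Y i j)) (at 0))"

definition dact :: "nat \<Rightarrow> nat \<Rightarrow> rmod \<Rightarrow> (nat \<Rightarrow> nat \<Rightarrow> complex) \<Rightarrow> nat \<Rightarrow> nat \<Rightarrow> complex" where
  "dact k n E Y a b = (\<Sum>i<n + 1. \<Sum>j<n + 1. dact_coeff k n E a b i j * Y i j)"

lemma dact_chain:
  assumes "is_module k n E" "a < rdim E" "b < rdim E"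
    and "\<gamma> 0 = 1\<^sub>m (n + 1)" "\<And>z. \<gamma> z \<in> levi k n"
    and "\<And>i j. i < n + 1 \<Longrightarrow> j < n + 1 \<Longrightarrow> ((\<lambda>z. \<gamma> z $$ (i, j)) has_field_derivative Y i j) (at (0::complex))"
  shows "((\<lambda>z. act E (\<gamma> z) $$ (a, b)) has_field_derivative dact k n E Y a b) (at 0)"
proof -
  obtain f where f: "f \<in> poly_fun (n + 1)" "\<And>A. A \<in> levi k n \<Longrightarrow> act E A $$ (a, b) = f A"
    using assms(1-3) unfolding is_module_def by blast
  obtain c where c: "\<forall>\<gamma> Y. (\<forall>i<n + 1. \<forall>j<n + 1. \<gamma> 0 $$ (i, j) = 1\<^sub>m (n + 1) $$ (i, j)) \<longrightarrow>
    (\<forall>i<n + 1. \<forall>j<n + 1. ((\<lambda>z. \<gamma> z $$ (i, j)) has_field_derivative Y i j) (at (0::complex))) \<longrightarrow>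
    ((\<lambda>z. f (\<gamma> z)) has_field_derivative (\<Sum>i<n + 1. \<Sum>j<n + 1. c i j * Y i j)) (at 0)"
    using poly_fun_chain[OF f(1), of "1\<^sub>m (n + 1)"] by blast
  have ex: "\<exists>c. \<forall>\<gamma> Y. (\<forall>i<n + 1. \<forall>j<n + 1. \<gamma> 0 $$ (i, j) = 1\<^sub>m (n + 1) $$ (i, j)) \<longrightarrow>
    (\<forall>z. \<gamma> z \<in> levi k n) \<longrightarrow>
    (\<forall>i<n + 1. \<forall>j<n + 1. ((\<lambda>z. \<gamma> z $$ (i, j)) has_field_derivative Y i j) (at (0::complex))) \<longrightarrow>
    ((\<lambda>z. act E (\<gamma> z) $$ (a, b)) has_field_derivative (\<Sum>i<n + 1. \<Sum>j<n + 1. c i j * Y i j)) (at 0)"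
    using c f(2) by (intro exI[of _ c]) simp
  show ?thesis
    using someI_ex[OF ex] assms(4-6) unfolding dact_coeff_def[symmetric] dact_def by simp
qed

lemma one_param_conj:
  assumes "one_param k n \<gamma> Y" "g \<in> levi k n" "h \<in> levi k n" "g * h = 1\<^sub>m (n + 1)" "i < n + 1" "j < n + 1"
  shows "((\<lambda>z. (g * \<gamma> z * h) $$ (i, j)) has_field_derivative
    (\<Sum>l<n + 1. \<Sum>r<n + 1. g $$ (i, l) * Y l r * h $$ (r, j))) (at 0)"
proof -
  have gl: "\<gamma> z \<in> carrier_mat (n + 1) (n + 1)" for z using assms(1) levi_carrier by (auto simp: one_param_def)
  have c: "g \<in> carrier_mat (n + 1) (n + 1)" "h \<in> carrier_mat (n + 1) (n + 1)"
    using assms levi_carrier by auto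
  have e: "(g * \<gamma> z * h) $$ (i, j) = (\<Sum>l<n + 1. \<Sum>r<n + 1. g $$ (i, l) * \<gamma> z $$ (l, r) * h $$ (r, j))" for z
  proof -
    have "(g * \<gamma> z * h) $$ (i, j) = (\<Sum>r<n + 1. (g * \<gamma> z) $$ (i, r) * h $$ (r, j))"
      by (rule mat_mult_entry[OF mult_carrier_mat[OF c(1) gl] c(2) assms(5,6)])
    also have "\<dots> = (\<Sum>r<n + 1. \<Sum>l<n + 1. g $$ (i, l) * \<gamma> z $$ (l, r) * h $$ (r, j))"
      by (intro sum.cong refl) (simp add: mat_mult_entry[OF c(1) gl assms(5)] sum_distrib_right)
    finally show ?thesis by (subst sum.swap)
  qed
  show ?thesis unfolding e
    using assms(1) by (auto simp: one_param_def intro!: DERIV_sum derivative_eq_intros)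
qed

text \<open>Vectors are functions on the natural numbers: only the first \<open>d\<close> values are
  read, and the result vanishes from \<open>d'\<close> on. All modules thus share one type, to which
  \<open>cspace\<close> applies.\<close>

definition mop :: "nat \<Rightarrow> nat \<Rightarrow> (nat \<Rightarrow> nat \<Rightarrow> complex) \<Rightarrow> (nat \<Rightarrow> complex) \<Rightarrow> nat \<Rightarrow> complex" where
  "mop d' d M w = (\<lambda>i. if i < d' then \<Sum>j<d. M i j * w j else 0)"

lemma clin_mop: "clin (mop d' d M)"
  by (auto simp: clin_def mop_def fun_eq_iff algebra_simps sum.distrib sum_distrib_left)

lemma clin_mop_matrix: "clin (\<lambda>M. mop d' d M w)"
  by (auto simp: clin_def mop_def fun_eq_iff algebra_simps sum.distrib sum_distrib_left)

lemma mop_mop: "mop d'' d' M (mop d' d M' w) = mop d'' d (\<lambda>i j. \<Sum>l<d'. M i l * M' l j) w"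
proof
  fix i
  have "(\<Sum>j<d'. M i j * (\<Sum>l<d. M' j l * w l)) = (\<Sum>l<d. \<Sum>j<d'. M i j * M' j l * w l)"
    unfolding sum_distrib_left by (subst sum.swap) (simp add: mult.assoc)
  then show "mop d'' d' M (mop d' d M' w) i = mop d'' d (\<lambda>i j. \<Sum>l<d'. M i l * M' l j) w i"
    by (simp add: mop_def sum_distrib_right)
qed

lemma mop_cong: "(\<And>i j. i < d' \<Longrightarrow> j < d \<Longrightarrow> M i j = M' i j) \<Longrightarrow> mop d' d M w = mop d' d M' w"
  by (auto simp: mop_def fun_eq_iff intro!: sum.cong)

abbreviation aop :: "rmod \<Rightarrow> complex mat \<Rightarrow> (nat \<Rightarrow> complex) \<Rightarrow> nat \<Rightarrow> complex" where
  "aop E g \<equiv> mop (rdim E) (rdim E) (\<lambda>i j. act E g $$ (i, j))"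

abbreviation dop :: "nat \<Rightarrow> nat \<Rightarrow> rmod \<Rightarrow> (nat \<Rightarrow> nat \<Rightarrow> complex) \<Rightarrow> (nat \<Rightarrow> complex) \<Rightarrow> nat \<Rightarrow> complex" where
  "dop k n E Y \<equiv> mop (rdim E) (rdim E) (dact k n E Y)"

lemma clin_dact: "clin (dact k n E)"
  by (auto simp: clin_def dact_def fun_eq_iff algebra_simps sum.distrib sum_distrib_left)

lemma clin_dop: "clin (\<lambda>Y. dop k n E Y w)"
  using clin_comp[OF clin_mop_matrix clin_dact] .

lemma dact_cong: "(\<And>i j. i < n + 1 \<Longrightarrow> j < n + 1 \<Longrightarrow> Y i j = Y' i j) \<Longrightarrow> dact k n E Y = dact k n E Y'"
  by (auto simp: dact_def fun_eq_iff intro!: sum.cong)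

lemma act_carrier: "is_module k n E \<Longrightarrow> g \<in> levi k n \<Longrightarrow> act E g \<in> carrier_mat (rdim E) (rdim E)"
  by (simp add: is_module_def)

lemma act_mult_entry:
  assumes "is_module k n E" "g \<in> levi k n" "h \<in> levi k n" "a < rdim E" "b < rdim E"
  shows "act E (g * h) $$ (a, b) = (\<Sum>l<rdim E. act E g $$ (a, l) * act E h $$ (l, b))"
  using assms mat_mult_entry[OF act_carrier[OF assms(1,2)] act_carrier[OF assms(1,3)], of a b] by (simp add: is_module_def)

lemma aop_mult:
  assumes "is_module k n E" "g \<in> levi k n" "h \<in> levi k n"
  shows "aop E (g * h) w = aop E g (aop E h w)"
  unfolding mop_mop by (rule mop_cong) (simp add: act_mult_entry[OF assms])

lemma aop_one:
  assumes "is_module k n E" "\<And>i. i \<ge> rdim E \<Longrightarrow> w i = 0"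
  shows "aop E (1\<^sub>m (n + 1)) w = w"
proof
  fix i
  have "act E (1\<^sub>m (n + 1)) = 1\<^sub>m (rdim E)" using assms(1) by (simp add: is_module_def)
  moreover have "(\<Sum>j<rdim E. 1\<^sub>m (rdim E) $$ (i, j) * w j) = w i" if "i < rdim E"
    using that by (subst sum.remove[of _ i]) (auto intro!: sum.neutral)
  ultimately show "aop E (1\<^sub>m (n + 1)) w i = w i" using assms(2) by (auto simp: mop_def)
qed

text \<open>The derivative at 0 is transported to \<open>z\<close> by the homomorphism property,
  \<open>\<gamma> w\<close> being the product of \<open>\<gamma> z\<close> and
  \<open>\<gamma> (w - z)\<close>.\<close>

lemma act_deriv:
  assumes E: "is_module k n E" and g: "one_param k n \<gamma> Y" and ab: "a < rdim E" "b < rdim E"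
  shows "((\<lambda>z. act E (\<gamma> z) $$ (a, b)) has_field_derivative (\<Sum>l<rdim E. act E (\<gamma> z) $$ (a, l) * dact k n E Y l b)) (at z)"
proof -
  have l: "\<gamma> w \<in> levi k n" for w using g by (simp add: one_param_def)
  have "((\<lambda>w. act E (\<gamma> w) $$ (l, b)) has_field_derivative dact k n E Y l b) (at (z - z))" if "l < rdim E" for l
    using dact_chain[OF E that ab(2), of \<gamma> Y] g by (auto simp: one_param_def)
  then have "((\<lambda>w. act E (\<gamma> (w - z)) $$ (l, b)) has_field_derivative dact k n E Y l b) (at z)" if "l < rdim E" for l
    using that DERIV_shift[of "\<lambda>w. act E (\<gamma> w) $$ (l, b)" "dact k n E Y l b" z "- z"] by simp
  then have "((\<lambda>w. \<Sum>l<rdim E. act E (\<gamma> z) $$ (a, l) * act E (\<gamma> (w - z)) $$ (l, b)) has_field_derivative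
      (\<Sum>l<rdim E. act E (\<gamma> z) $$ (a, l) * dact k n E Y l b)) (at z)"
    by (intro DERIV_sum DERIV_cmult) auto
  moreover have "act E (\<gamma> w) $$ (a, b) = (\<Sum>l<rdim E. act E (\<gamma> z) $$ (a, l) * act E (\<gamma> (w - z)) $$ (l, b))" for w
  proof -
    have "\<gamma> w = \<gamma> z * \<gamma> (w - z)" using g unfolding one_param_def by (metis add.commute diff_add_cancel)
    then show ?thesis using act_mult_entry[OF E l l ab] by simp
  qed
  ultimately show ?thesis by simp
qed

lemma functional_expand:
  fixes \<psi> :: "(nat \<Rightarrow> complex) \<Rightarrow> complex"
  assumes "clin \<psi>" "\<And>i. i \<ge> d \<Longrightarrow> w i = 0"
  shows "\<psi> w = (\<Sum>i<d. w i * \<psi> (\<lambda>j. if j = i then 1 else 0))"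
proof -
  have "w = (\<Sum>i<d. w i *\<^sub>C (\<lambda>j. if j = i then 1 else 0))"
    by (rule ext) (auto simp: sum_fun_apply assms(2) if_distrib sum.delta cong: if_cong)
  then have "\<psi> w = \<psi> (\<Sum>i<d. w i *\<^sub>C (\<lambda>j. if j = i then 1 else 0))" by simp
  then show ?thesis by (simp add: clin_sum[OF assms(1)] clin_scale[OF assms(1)])
qed

text \<open>Composing with a functional replaces differentiation in the module by differentiation of
  a complex function.\<close>

lemma aop_deriv:
  fixes \<psi> :: "(nat \<Rightarrow> complex) \<Rightarrow> complex"
  assumes E: "is_module k n E" and g: "one_param k n \<gamma> Y" and \<psi>: "clin \<psi>"
  shows "((\<lambda>z. \<psi> (aop E (\<gamma> z) w)) has_field_derivative \<psi> (aop E (\<gamma> z) (dop k n E Y w))) (at z)"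
proof -
  have x: "\<psi> (mop (rdim E) (rdim E) M w) = (\<Sum>i<rdim E. (\<Sum>j<rdim E. M i j * w j) * \<psi> (\<lambda>j. if j = i then 1 else 0))" for M w
    using functional_expand[OF \<psi>, of "rdim E" "mop (rdim E) (rdim E) M w"] by (simp add: mop_def)
  show ?thesis
    unfolding mop_mop x
    by (intro DERIV_sum DERIV_cmult_right act_deriv[OF E g]) auto
qed

section \<open>The Lie algebra of the Levi subgroup and its bracket\<close>

definition com :: "nat \<Rightarrow> (nat \<Rightarrow> nat \<Rightarrow> complex) \<Rightarrow> (nat \<Rightarrow> nat \<Rightarrow> complex) \<Rightarrow> nat \<Rightarrow> nat \<Rightarrow> complex" where
  "com n Y Z a b = (\<Sum>l<n + 1. Y a l * Z l b - Z a l * Y l b)"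

lemma clin_com1: "clin (\<lambda>Y. com n Y Z)" and clin_com2: "clin (com n Y)"
  by (auto simp: clin_def com_def fun_eq_iff algebra_simps sum.distrib[symmetric] sum_distrib_left)

lemma com_cong:
  assumes "\<And>i j. i < n + 1 \<Longrightarrow> j < n + 1 \<Longrightarrow> Y i j = Y' i j" "\<And>i j. i < n + 1 \<Longrightarrow> j < n + 1 \<Longrightarrow> Z i j = Z' i j"
    and "a < n + 1" "b < n + 1"
  shows "com n Y Z a b = com n Y' Z' a b"
  unfolding com_def using assms by (intro sum.cong refl) auto

text \<open>The span of the velocities of one-parameter subgroups. Values outside the matrix range
  carry no information, hence the last rule.\<close>

inductive_set tang :: "nat \<Rightarrow> nat \<Rightarrow> (nat \<Rightarrow> nat \<Rightarrow> complex) set" for k n where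
  base: "one_param k n \<gamma> Y \<Longrightarrow> Y \<in> tang k n"
| add: "Y \<in> tang k n \<Longrightarrow> Z \<in> tang k n \<Longrightarrow> Y + Z \<in> tang k n"
| scale: "Y \<in> tang k n \<Longrightarrow> c *\<^sub>C Y \<in> tang k n"
| cong: "Y \<in> tang k n \<Longrightarrow> (\<And>i j. i < n + 1 \<Longrightarrow> j < n + 1 \<Longrightarrow> Y i j = Z i j) \<Longrightarrow> Z \<in> tang k n"

lemma tang_zero: "(\<lambda>_ _. 0) \<in> tang k n"
proof -
  have "one_param k n (\<lambda>_. 1\<^sub>m (n + 1)) (\<lambda>_ _. 0)" by (auto simp: one_param_def levi_one)
  then show ?thesis by (rule tang.base)
qed

lemma tang_sum: "finite A \<Longrightarrow> (\<And>i. i \<in> A \<Longrightarrow> f i \<in> tang k n) \<Longrightarrow> sum f A \<in> tang k n"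
proof (induction A rule: finite_induct)
  case empty
  have "0 = (\<lambda>_ _. 0 :: complex)" by (simp add: fun_eq_iff)
  then show ?case using tang_zero by simp
qed (auto intro: tang.add)

text \<open>The trace of \<open>YY n i j\<close> vanishes, so that it lies in the Lie algebra of the Levi subgroup.\<close>

definition YY :: "nat \<Rightarrow> nat \<Rightarrow> nat \<Rightarrow> nat \<Rightarrow> nat \<Rightarrow> complex" where
  "YY n i j = (\<lambda>a b. (if a = i \<and> b = j then 1 else 0) - (if i = j \<and> a = b then 1 / of_nat (n + 1) else 0))"

text \<open>Write E for matrix units and I for the identity. With \<open>H l\<close> equal to E_ll -
  E_nn, the sum of all \<open>H l\<close> is I - (n+1) E_nn, so that E_ii - I/(n+1) is
  \<open>H i\<close> minus this sum divided by n+1.\<close>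

lemma YY_tang:
  assumes "i < n + 1" "j < n + 1" "(i < k + 1) = (j < k + 1)"
  shows "YY n i j \<in> tang k n"
proof (cases "i = j")
  case False
  then have "YY n i j = (\<lambda>a b. if a = i \<and> b = j then 1 else 0)" by (auto simp: YY_def fun_eq_iff)
  then show ?thesis using tang.base[OF one_param_addrow[OF False assms]] by simp
next
  case True
  define H :: "nat \<Rightarrow> nat \<Rightarrow> nat \<Rightarrow> complex" where
    "H l = (\<lambda>a b. if l = n then 0 else if a = b \<and> a = l then 1 else if a = b \<and> a = n then - 1 else 0)" for l
  have H: "H l \<in> tang k n" if "l < n + 1" for l
  proof (cases "l = n")
    case True
    then show ?thesis using tang_zero by (simp add: H_def)
  next
    case False
    then show ?thesis using tang.base[OF one_param_tor[of l n k]] that by (auto simp: H_def)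
  qed
  have "H i + (- 1 / of_nat (n + 1)) *\<^sub>C (\<Sum>l<n + 1. H l) \<in> tang k n"
    by (intro tang.add tang.scale tang_sum H assms) auto
  then show ?thesis
  proof (rule tang.cong)
    fix a b assume ab: "a < n + 1" "b < n + 1"
    have s: "(\<Sum>l<n + 1. H l a b) = (if a \<noteq> b then 0 else if a = n then - of_nat n else 1)"
    proof (cases "a = n \<and> a = b")
      case True
      then have "(\<Sum>l<n + 1. H l a b) = (\<Sum>l<n. - 1)"
        by (intro sum.mono_neutral_cong_right) (auto simp: H_def)
      then show ?thesis using True by simp
    next
      case False
      then have "(\<Sum>l<n + 1. H l a b) = (\<Sum>l<n + 1. if l = a then (if a = b then 1 else 0) else 0)"
        using ab by (intro sum.cong refl) (auto simp: H_def)
      then show ?thesis using False ab by auto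
    qed
    have n0: "of_nat n + 1 \<noteq> (0::complex)"
      by (metis of_nat_Suc of_nat_eq_0_iff Suc_neq_Zero add.commute)
    have "(H i + (- 1 / of_nat (n + 1)) *\<^sub>C (\<Sum>l<n + 1. H l)) a b
        = H i a b + (- 1 / of_nat (n + 1)) * (if a \<noteq> b then 0 else if a = n then - of_nat n else 1)"
      by (simp add: sum_fun_apply s)
    also have "\<dots> = YY n i j a b"
      using True ab assms n0 by (auto simp: YY_def H_def field_simps)
    finally show "(H i + (- 1 / of_nat (n + 1)) *\<^sub>C (\<Sum>l<n + 1. H l)) a b = YY n i j a b" .
  qed
qed

text \<open>Scalar matrices do not contribute to commutators. On the right their contributions occur
  only if both conditions hold, and then they cancel.\<close>

lemma com_YY:
  assumes "i < n + 1" "j < n + 1" "l < n + 1" "r < n + 1" "a < n + 1" "b < n + 1"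
  shows "com n (YY n i j) (YY n l r) a b
    = (if j = l then YY n i r a b else 0) - (if i = r then YY n l j a b else 0)"
proof -
  let ?e = "\<lambda>i j a b. if a = i \<and> b = j then 1 else (0::complex)"
  have z: "com n Y (\<lambda>a b. if a = b then c else 0) a b = 0" "com n (\<lambda>a b. if a = b then c else 0) Y a b = 0"
    for Y :: "nat \<Rightarrow> nat \<Rightarrow> complex" and c
    unfolding com_def sum_subtractf
    using assms by (auto simp: if_distrib if_distribR sum.delta' sum.delta cong: if_cong)
  have d: "YY n i j = ?e i j - (\<lambda>a b. if a = b then (if i = j then 1 / of_nat (n + 1) else 0) else 0)" for i j
    by (auto simp: YY_def fun_eq_iff)
  have e: "com n (?e i j) (?e l r) a b = (if j = l then ?e i r a b else 0) - (if i = r then ?e l j a b else 0)"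
  proof -
    have "(\<Sum>c<n + 1. ?e i j a c * ?e l r c b) = (if j = l then ?e i r a b else 0)"
      using assms by (subst sum.remove[of _ j]) (auto intro!: sum.neutral)
    moreover have "(\<Sum>c<n + 1. ?e l r a c * ?e i j c b) = (if i = r then ?e l j a b else 0)"
      using assms by (subst sum.remove[of _ i]) (auto intro!: sum.neutral)
    ultimately show ?thesis unfolding com_def sum_subtractf by (simp only:)
  qed
  have "com n (YY n i j) (YY n l r) a b = com n (?e i j) (?e l r) a b"
    unfolding d clin_diff[OF clin_com1] clin_diff[OF clin_com2] minus_apply z by simp
  then show ?thesis unfolding e by (auto simp: YY_def)
qed

lemma dact_deriv_linear:
  assumes "\<And>i j. i < n + 1 \<Longrightarrow> j < n + 1 \<Longrightarrow> ((\<lambda>z. W z i j) has_field_derivative W' i j) (at x)"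
  shows "((\<lambda>z. dact k n E (W z) a b) has_field_derivative dact k n E W' a b) (at x)"
  unfolding dact_def using assms by (auto intro!: DERIV_sum DERIV_cmult)

text \<open>Both sides are the derivative at 0 of the identity between
  \<open>act E g * act E (\<gamma> z)\<close> and
  \<open>act E (g * \<gamma> z * h) * act E g\<close>.\<close>

lemma dact_conj:
  assumes E: "is_module k n E" and \<gamma>: "one_param k n \<gamma> Y"
    and g: "g \<in> levi k n" "h \<in> levi k n" "g * h = 1\<^sub>m (n + 1)" "h * g = 1\<^sub>m (n + 1)"
    and ab: "a < rdim E" "b < rdim E"
  shows "(\<Sum>l<rdim E. act E g $$ (a, l) * dact k n E Y l b)
    = (\<Sum>l<rdim E. dact k n E (\<lambda>i j. \<Sum>p<n + 1. \<Sum>q<n + 1. g $$ (i, p) * Y p q * h $$ (q, j)) a l * act E g $$ (l, b))"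
    (is "?L = ?R")
proof -
  have l: "\<gamma> z \<in> levi k n" "g * \<gamma> z * h \<in> levi k n" for z
    using \<gamma> g by (auto simp: one_param_def intro!: levi_mult)
  have c: "g \<in> carrier_mat (n + 1) (n + 1)" "h \<in> carrier_mat (n + 1) (n + 1)" "\<gamma> z \<in> carrier_mat (n + 1) (n + 1)" for z
    using levi_carrier[OF g(1)] levi_carrier[OF g(2)] levi_carrier[OF l(1)] by auto
  have "g * \<gamma> z * h * g = g * \<gamma> z" for z
    using c g(4) assoc_mult_mat[OF mult_carrier_mat[OF c(1) c(3)] c(2) c(1), of z] right_mult_one_mat[OF mult_carrier_mat[OF c(1) c(3)]]
    by simp
  then have eq: "(\<Sum>l<rdim E. act E g $$ (a, l) * act E (\<gamma> z) $$ (l, b))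
      = (\<Sum>l<rdim E. act E (g * \<gamma> z * h) $$ (a, l) * act E g $$ (l, b))" for z
    using act_mult_entry[OF E g(1) l(1)[of z] ab] act_mult_entry[OF E l(2)[of z] g(1) ab] by simp
  have "((\<lambda>z. \<Sum>l<rdim E. act E g $$ (a, l) * act E (\<gamma> z) $$ (l, b)) has_field_derivative ?L) (at 0)"
    using \<gamma> ab by (intro DERIV_sum DERIV_cmult dact_chain[OF E]) (auto simp: one_param_def)
  moreover have "((\<lambda>z. \<Sum>l<rdim E. act E (g * \<gamma> z * h) $$ (a, l) * act E g $$ (l, b)) has_field_derivative ?R) (at 0)"
  proof (intro DERIV_sum DERIV_cmult_right dact_chain[OF E])
    show "g * \<gamma> 0 * h = 1\<^sub>m (n + 1)" using \<gamma> g c by (simp add: one_param_def)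
  qed (use ab l one_param_conj[OF \<gamma> g(1-3)] in auto)
  ultimately show ?thesis unfolding eq by (rule DERIV_unique)
qed

lemma one_param_conj_deriv:
  assumes "one_param k n \<gamma> Y" "i < n + 1" "j < n + 1"
  shows "((\<lambda>z. \<Sum>p<n + 1. \<Sum>q<n + 1. \<gamma> z $$ (i, p) * Z p q * \<gamma> (- z) $$ (q, j)) has_field_derivative com n Y Z i j) (at 0)"
proof -
  have d: "((\<lambda>z. \<gamma> z $$ (a, b)) has_field_derivative Y a b) (at 0)" if "a < n + 1" "b < n + 1" for a b
    using assms(1) that by (simp add: one_param_def)
  have m: "((\<lambda>z. \<gamma> (- z) $$ (a, b)) has_field_derivative - Y a b) (at 0)" if "a < n + 1" "b < n + 1" for a b
    using DERIV_chain2[of "\<lambda>z. \<gamma> z $$ (a, b)" "Y a b" uminus 0 "- 1" UNIV] d[OF that]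
      DERIV_minus[OF DERIV_ident, of "0::complex"] by simp
  have g0: "\<gamma> 0 $$ (a, b) = (if a = b then 1 else 0)" if "a < n + 1" "b < n + 1" for a b
    using assms(1) that by (simp add: one_param_def)
  have "((\<lambda>z. \<Sum>p<n + 1. \<Sum>q<n + 1. \<gamma> z $$ (i, p) * Z p q * \<gamma> (- z) $$ (q, j)) has_field_derivative
      (\<Sum>p<n + 1. \<Sum>q<n + 1. (Y i p * Z p q) * \<gamma> (- 0) $$ (q, j) + (- Y q j) * (\<gamma> 0 $$ (i, p) * Z p q))) (at 0)"
    using assms(2,3) by (intro DERIV_sum DERIV_mult DERIV_cmult_right d m) auto
  also have "(\<Sum>p<n + 1. \<Sum>q<n + 1. (Y i p * Z p q) * \<gamma> (- 0) $$ (q, j) + (- Y q j) * (\<gamma> 0 $$ (i, p) * Z p q))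
      = (\<Sum>p<n + 1. \<Sum>q<n + 1. (if q = j then Y i p * Z p q else 0)) + (\<Sum>p<n + 1. \<Sum>q<n + 1. if p = i then - Z p q * Y q j else 0)"
    unfolding sum.distrib[symmetric] using assms(2,3) by (intro sum.cong refl) (auto simp: g0)
  also have "\<dots> = (\<Sum>p<n + 1. Y i p * Z p j) + (\<Sum>q<n + 1. - Z i q * Y q j)"
    using assms(2,3) by (subst (2) sum.swap) simp
  also have "\<dots> = com n Y Z i j" by (simp add: com_def sum_subtractf sum_negf)
  finally show ?thesis .
qed

text \<open>Differentiating \<open>dact_conj\<close> along a second one-parameter subgroup yields
  the bracket relation for velocities. It is bilinear, so it extends to \<open>tang\<close>, one
  argument at a time.\<close>

lemma dact_bracket:
  assumes E: "is_module k n E" and Y: "Y \<in> tang k n" and Z: "Z \<in> tang k n"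
    and ab: "a < rdim E" "b < rdim E"
  shows "(\<Sum>l<rdim E. dact k n E Y a l * dact k n E Z l b)
    = dact k n E (com n Y Z) a b + (\<Sum>l<rdim E. dact k n E Z a l * dact k n E Y l b)"
proof -
  have cg: "dact k n E (com n Y Z) = dact k n E (com n Y' Z')"
    if "\<And>i j. i < n + 1 \<Longrightarrow> j < n + 1 \<Longrightarrow> Y i j = Y' i j" "\<And>i j. i < n + 1 \<Longrightarrow> j < n + 1 \<Longrightarrow> Z i j = Z' i j" for Y Y' Z Z'
    using that by (intro dact_cong com_cong) auto
  have 1: "(\<Sum>l<rdim E. dact k n E Y a l * dact k n E Z l b)
    = dact k n E (com n Y Z) a b + (\<Sum>l<rdim E. dact k n E Z a l * dact k n E Y l b)"
    if "one_param k n \<gamma> Y" "one_param k n \<delta> Z" for \<gamma> \<delta> Y Z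
  proof -
    have l: "\<gamma> z \<in> levi k n" for z using that by (simp add: one_param_def)
    let ?W = "\<lambda>z i j. \<Sum>p<n + 1. \<Sum>q<n + 1. \<gamma> z $$ (i, p) * Z p q * \<gamma> (- z) $$ (q, j)"
    have eq: "(\<Sum>l<rdim E. act E (\<gamma> z) $$ (a, l) * dact k n E Z l b)
        = (\<Sum>l<rdim E. dact k n E (?W z) a l * act E (\<gamma> z) $$ (l, b))" for z
      by (rule dact_conj[OF E that(2) l l one_param_inverse[OF that(1)] ab])
    have d: "((\<lambda>z. act E (\<gamma> z) $$ (u, v)) has_field_derivative dact k n E Y u v) (at 0)"
      if "u < rdim E" "v < rdim E" for u v
      using \<open>one_param k n \<gamma> Y\<close> that by (intro dact_chain[OF E]) (auto simp: one_param_def)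
    have "((\<lambda>z. \<Sum>l<rdim E. act E (\<gamma> z) $$ (a, l) * dact k n E Z l b) has_field_derivative
        (\<Sum>l<rdim E. dact k n E Y a l * dact k n E Z l b)) (at 0)"
      using ab by (intro DERIV_sum DERIV_cmult_right d) auto
    moreover have "((\<lambda>z. \<Sum>l<rdim E. dact k n E (?W z) a l * act E (\<gamma> z) $$ (l, b)) has_field_derivative
        (\<Sum>l<rdim E. dact k n E (com n Y Z) a l * act E (\<gamma> 0) $$ (l, b) + dact k n E Y l b * dact k n E (?W 0) a l)) (at 0)"
      using ab by (intro DERIV_sum DERIV_mult d dact_deriv_linear one_param_conj_deriv[OF that(1)]) auto
    ultimately have e: "(\<Sum>l<rdim E. dact k n E Y a l * dact k n E Z l b)
      = (\<Sum>l<rdim E. dact k n E (com n Y Z) a l * act E (\<gamma> 0) $$ (l, b) + dact k n E Y l b * dact k n E (?W 0) a l)"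
      unfolding eq by (rule DERIV_unique)
    have g0: "\<gamma> 0 = 1\<^sub>m (n + 1)" "\<gamma> (- 0) = 1\<^sub>m (n + 1)" using that(1) by (simp_all add: one_param_def)
    have "?W 0 i j = Z i j" if "i < n + 1" "j < n + 1" for i j
    proof -
      have "?W 0 i j = (\<Sum>p<n + 1. \<Sum>q<n + 1. if q = j then (if p = i then Z p q else 0) else 0)"
        unfolding g0 using that by (intro sum.cong refl) auto
      then show ?thesis using that by simp
    qed
    then have "dact k n E (?W 0) = dact k n E Z" by (intro dact_cong) auto
    moreover have "(\<Sum>l<rdim E. dact k n E (com n Y Z) a l * act E (\<gamma> 0) $$ (l, b)) = dact k n E (com n Y Z) a b"
    proof -
      have "act E (\<gamma> 0) = 1\<^sub>m (rdim E)" using g0 E by (simp add: is_module_def)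
      then show ?thesis using ab by (subst sum.remove[of _ b]) (auto intro!: sum.neutral)
    qed
    ultimately show ?thesis unfolding e by (simp add: sum.distrib mult.commute)
  qed
  have 2: "(\<Sum>l<rdim E. dact k n E Y a l * dact k n E Z l b)
    = dact k n E (com n Y Z) a b + (\<Sum>l<rdim E. dact k n E Z a l * dact k n E Y l b)"
    if "one_param k n \<gamma> Y" for \<gamma> Y
    using Z
  proof (induction rule: tang.induct)
    case (base \<delta> Z)
    then show ?case using 1 that by blast
  next
    case (add Z Z')
    then show ?case
      unfolding clin_add[OF clin_dact] clin_add[OF clin_com2] by (simp add: ring_distribs sum.distrib add_ac)
  next
    case (scale Z c)
    then show ?case
      unfolding clin_scale[OF clin_dact] clin_scale[OF clin_com2]
      by (simp add: mult.left_commute mult.assoc sum_distrib_left[symmetric] distrib_left)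
  next
    case (cong Z Z')
    then show ?case using cg[of Y Y Z Z'] dact_cong[of n Z Z'] by simp
  qed
  show ?thesis
    using Y
  proof (induction rule: tang.induct)
    case (base \<delta> Z)
    then show ?case using 2 by blast
  next
    case (add Z Z')
    then show ?case
      unfolding clin_add[OF clin_dact] clin_add[OF clin_com1] by (simp add: ring_distribs sum.distrib add_ac)
  next
    case (scale Z c)
    then show ?case
      unfolding clin_scale[OF clin_dact] clin_scale[OF clin_com1]
      by (simp add: mult.left_commute mult.assoc sum_distrib_left[symmetric] distrib_left)
  next
    case (cong Y Y')
    then show ?case using cg[of Y Y' Z Z] dact_cong[of n Y Y'] by simp
  qed
qed

lemma dop_bracket:
  assumes "is_module k n E" "Y \<in> tang k n" "Z \<in> tang k n"
  shows "dop k n E Y (dop k n E Z w) - dop k n E Z (dop k n E Y w) = dop k n E (com n Y Z) w"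
proof -
  have "dop k n E Y (dop k n E Z w) = mop (rdim E) (rdim E)
      (dact k n E (com n Y Z) + (\<lambda>a b. \<Sum>l<rdim E. dact k n E Z a l * dact k n E Y l b)) w"
    unfolding mop_mop by (rule mop_cong) (simp add: dact_bracket[OF assms])
  then show ?thesis by (simp add: clin_add[OF clin_mop_matrix] mop_mop)
qed

section \<open>The adjoint action on the nilradical\<close>

definition eu :: "nat \<Rightarrow> nat \<times> nat \<Rightarrow> complex mat" where
  "eu n p = mat (n + 1) (n + 1) (\<lambda>ab. if ab = p then 1 else 0)"

definition Pos :: "nat \<Rightarrow> nat \<Rightarrow> (nat \<times> nat) set" where
  "Pos k n = {k + 1..n} \<times> {..k}"

lemma finite_Pos [simp]: "finite (Pos k n)"
  by (simp add: Pos_def)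

lemma eu_nilrad: "k < n \<Longrightarrow> p \<in> Pos k n \<Longrightarrow> eu n p \<in> nilrad k n"
  by (auto simp: eu_def nilrad_def Pos_def)

lemma nilrad_carrier: "x \<in> nilrad k n \<Longrightarrow> x \<in> carrier_mat (n + 1) (n + 1)"
  by (simp add: nilrad_def)

text \<open>\<open>F\<close> is linear on the nilradical only, so \<open>x\<close> is built up
  position by position through the truncations \<open>r S\<close>, which remain there.\<close>

lemma nil_expand:
  fixes F :: "complex mat \<Rightarrow> complex"
  assumes kn: "k < n" and add: "\<And>x y. x \<in> nilrad k n \<Longrightarrow> y \<in> nilrad k n \<Longrightarrow> F (x + y) = F x + F y"
    and sc: "\<And>c x. x \<in> nilrad k n \<Longrightarrow> F (c \<cdot>\<^sub>m x) = c * F x"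
    and x: "x \<in> nilrad k n"
  shows "F x = (\<Sum>p\<in>Pos k n. x $$ p * F (eu n p))"
proof -
  define r where "r S = mat (n + 1) (n + 1) (\<lambda>p. if p \<in> S then x $$ p else 0)" for S
  have rn: "r S \<in> nilrad k n" for S using x by (auto simp: r_def nilrad_def)
  have "F (r S) = (\<Sum>p\<in>S. x $$ p * F (eu n p))" if "finite S" "S \<subseteq> Pos k n" for S
    using that
  proof (induction S rule: finite_induct)
    case empty
    have "r {} = 0 \<cdot>\<^sub>m r {}" by (rule eq_matI) (auto simp: r_def)
    then show ?case using sc[OF rn, of 0 "{}"] by simp
  next
    case (insert p S)
    have p: "p \<in> Pos k n" using insert by auto
    have "r (insert p S) = x $$ p \<cdot>\<^sub>m eu n p + r S"
      using insert p by (intro eq_matI) (auto simp: r_def eu_def Pos_def)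
    moreover have "x $$ p \<cdot>\<^sub>m eu n p \<in> nilrad k n"
      using eu_nilrad[OF kn p] by (auto simp: nilrad_def)
    ultimately show ?case
      using add[OF _ rn] sc[OF eu_nilrad[OF kn p]] insert by simp
  qed
  from this[of "Pos k n"] have "F (r (Pos k n)) = (\<Sum>p\<in>Pos k n. x $$ p * F (eu n p))" by simp
  moreover have "r (Pos k n) = x"
    using x by (intro eq_matI) (auto simp: r_def nilrad_def Pos_def)
  ultimately show ?thesis by simp
qed

lemma adj_mat_levi:
  assumes "g \<in> levi k n" "h \<in> carrier_mat (n + 1) (n + 1)" "g * h = 1\<^sub>m (n + 1)"
  shows "adj_mat g = h"
proof -
  have g: "g \<in> carrier_mat (n + 1) (n + 1)" "adj_mat g \<in> carrier_mat (n + 1) (n + 1)"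
    "adj_mat g * g = 1\<^sub>m (n + 1)"
    using levi_carrier[OF assms(1)] adj_mat[of g "n + 1"] assms(1) by (auto simp: levi_def)
  have "adj_mat g = adj_mat g * (g * h)" using assms g by simp
  also have "\<dots> = (adj_mat g * g) * h" by (rule assoc_mult_mat[symmetric, OF g(2,1) assms(2)])
  finally show ?thesis using g assms(2) by simp
qed

lemma Ad_entry:
  assumes "g \<in> carrier_mat (n + 1) (n + 1)" "h \<in> carrier_mat (n + 1) (n + 1)" "x \<in> carrier_mat (n + 1) (n + 1)"
    "i < n + 1" "j < n + 1"
  shows "(g * x * h) $$ (i, j) = (\<Sum>p<n + 1. \<Sum>q<n + 1. g $$ (i, p) * x $$ (p, q) * h $$ (q, j))"
proof -
  have "(g * x * h) $$ (i, j) = (\<Sum>r<n + 1. (g * x) $$ (i, r) * h $$ (r, j))"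
    by (rule mat_mult_entry[OF mult_carrier_mat[OF assms(1,3)] assms(2,4,5)])
  also have "\<dots> = (\<Sum>r<n + 1. \<Sum>l<n + 1. g $$ (i, l) * x $$ (l, r) * h $$ (r, j))"
    by (intro sum.cong refl) (simp add: mat_mult_entry[OF assms(1,3,4)] sum_distrib_right)
  finally show ?thesis by (subst sum.swap)
qed

lemma conj_nilrad:
  assumes "g \<in> levi k n" "h \<in> levi k n" "x \<in> nilrad k n"
  shows "g * x * h \<in> nilrad k n"
proof -
  have c: "g \<in> carrier_mat (n + 1) (n + 1)" "h \<in> carrier_mat (n + 1) (n + 1)" "x \<in> carrier_mat (n + 1) (n + 1)"
    using assms levi_carrier nilrad_carrier by auto
  have "(g * x * h) $$ (i, j) = 0" if ij: "i < n + 1" "j < n + 1" "\<not> (k + 1 \<le> i \<and> j < k + 1)" for i j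
  proof -
    have "g $$ (i, p) * x $$ (p, q) * h $$ (q, j) = 0" if "p < n + 1" "q < n + 1" for p q
    proof (cases "k + 1 \<le> p \<and> q < k + 1")
      case True
      then have "g $$ (i, p) = 0 \<or> h $$ (q, j) = 0"
        using levi_block[OF assms(1), of i p] levi_block[OF assms(2), of q j] ij that by auto
      then show ?thesis by auto
    next
      case False
      then have "x $$ (p, q) = 0" using assms(3) that by (simp add: nilrad_def)
      then show ?thesis by simp
    qed
    then show ?thesis unfolding Ad_entry[OF c ij(1,2)] by (simp add: sum.neutral del: mult_eq_0_iff)
  qed
  then show ?thesis using c by (simp add: nilrad_def)
qed

lemma Ad_one_param:
  assumes "one_param k n \<gamma> Y"
  shows "Ad (\<gamma> z) x = \<gamma> z * x * \<gamma> (- z)"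
proof -
  have "\<gamma> z \<in> levi k n" "\<gamma> (- z) \<in> carrier_mat (n + 1) (n + 1)"
    using assms levi_carrier by (auto simp: one_param_def)
  then show ?thesis unfolding Ad_def
    by (subst adj_mat_levi[OF _ _ one_param_inverse(1)[OF assms]]) auto
qed

lemma Ad_one_param_nilrad:
  assumes "one_param k n \<gamma> Y" "x \<in> nilrad k n"
  shows "Ad (\<gamma> z) x \<in> nilrad k n"
  unfolding Ad_one_param[OF assms(1)] using assms by (intro conj_nilrad) (auto simp: one_param_def)

abbreviation ent :: "complex mat \<Rightarrow> nat \<Rightarrow> nat \<Rightarrow> complex" where
  "ent x \<equiv> \<lambda>i j. x $$ (i, j)"

lemma Ad_deriv:
  assumes "one_param k n \<gamma> Y" "x \<in> carrier_mat (n + 1) (n + 1)" "i < n + 1" "j < n + 1"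
  shows "((\<lambda>z. Ad (\<gamma> z) x $$ (i, j)) has_field_derivative com n Y (ent x) i j) (at 0)"
proof -
  have "\<gamma> z \<in> carrier_mat (n + 1) (n + 1)" for z using assms(1) levi_carrier by (auto simp: one_param_def)
  then have "Ad (\<gamma> z) x $$ (i, j) = (\<Sum>p<n + 1. \<Sum>q<n + 1. \<gamma> z $$ (i, p) * x $$ (p, q) * \<gamma> (- z) $$ (q, j))" for z
    unfolding Ad_one_param[OF assms(1)] using assms by (intro Ad_entry) auto
  then show ?thesis using one_param_conj_deriv[OF assms(1,3,4), of "ent x"] by simp
qed

lemma Ad_zero: "one_param k n \<gamma> Y \<Longrightarrow> x \<in> carrier_mat (n + 1) (n + 1) \<Longrightarrow> Ad (\<gamma> 0) x = x"
  by (subst Ad_one_param) (auto simp: one_param_def)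

section \<open>The infinitesimal form of equivariance\<close>

lemma intertwiner_deriv:
  assumes A: "is_module k n A" and B: "is_module k n B" and \<gamma>: "one_param k n \<gamma> Y"
    and uv: "u < rdim B" "v < rdim A"
    and eq: "\<And>z. (\<Sum>l<rdim A. H z u l * act A (\<gamma> z) $$ (l, v)) = (\<Sum>l<rdim B. act B (\<gamma> z) $$ (u, l) * H0 l v)"
    and d: "\<And>l. l < rdim A \<Longrightarrow> ((\<lambda>z. H z u l) has_field_derivative H' l) (at 0)"
    and H0: "\<And>l. l < rdim A \<Longrightarrow> H 0 u l = H0 u l"
  shows "H' v + (\<Sum>l<rdim A. H0 u l * dact k n A Y l v) = (\<Sum>l<rdim B. dact k n B Y u l * H0 l v)"
proof -
  have dA: "((\<lambda>z. act A (\<gamma> z) $$ (l, v)) has_field_derivative dact k n A Y l v) (at 0)" if "l < rdim A" for l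
    using \<gamma> uv that by (intro dact_chain[OF A]) (auto simp: one_param_def)
  have dB: "((\<lambda>z. act B (\<gamma> z) $$ (u, l)) has_field_derivative dact k n B Y u l) (at 0)" if "l < rdim B" for l
    using \<gamma> uv that by (intro dact_chain[OF B]) (auto simp: one_param_def)
  have "((\<lambda>z. \<Sum>l<rdim A. H z u l * act A (\<gamma> z) $$ (l, v)) has_field_derivative
      (\<Sum>l<rdim A. H' l * act A (\<gamma> 0) $$ (l, v) + dact k n A Y l v * H 0 u l)) (at 0)"
    by (intro DERIV_sum DERIV_mult d dA) auto
  moreover have "((\<lambda>z. \<Sum>l<rdim B. act B (\<gamma> z) $$ (u, l) * H0 l v) has_field_derivative
      (\<Sum>l<rdim B. dact k n B Y u l * H0 l v)) (at 0)"
    by (intro DERIV_sum DERIV_cmult_right dB) auto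
  ultimately have "(\<Sum>l<rdim A. H' l * act A (\<gamma> 0) $$ (l, v) + dact k n A Y l v * H 0 u l)
      = (\<Sum>l<rdim B. dact k n B Y u l * H0 l v)" unfolding eq by (rule DERIV_unique)
  moreover have "(\<Sum>l<rdim A. H' l * act A (\<gamma> 0) $$ (l, v)) = H' v"
  proof -
    have "act A (\<gamma> 0) = 1\<^sub>m (rdim A)" using \<gamma> A by (simp add: one_param_def is_module_def)
    then show ?thesis using uv by (subst sum.remove[of _ v]) (auto intro!: sum.neutral)
  qed
  ultimately show ?thesis by (simp add: sum.distrib H0 mult.commute)
qed

text \<open>The identity is linear in \<open>Y\<close> on both sides. The functional
  \<open>L\<close> stands for the terms in which \<open>Y\<close> acts on the nilradical, so that
  maps with one and with two nilradical arguments are covered together.\<close>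

lemma tang_intertwiner:
  assumes base: "\<And>\<gamma> Y. one_param k n \<gamma> Y \<Longrightarrow> L Y + (\<Sum>l<rdim A. F u l * dact k n A Y l v) = (\<Sum>l<rdim B. dact k n B Y u l * F l v)"
    and L: "clin L" "\<And>Y Z. (\<And>i j. i < n + 1 \<Longrightarrow> j < n + 1 \<Longrightarrow> Y i j = Z i j) \<Longrightarrow> L Y = L Z"
    and Y: "Y \<in> tang k n"
  shows "L Y + (\<Sum>l<rdim A. F u l * dact k n A Y l v) = (\<Sum>l<rdim B. dact k n B Y u l * F l (v::nat))"
  using Y
proof (induction rule: tang.induct)
  case (base \<gamma> Y)
  then show ?case using assms(1) by blast
next
  case (add Y Z)
  have s: "dact k n E (Y + Z) a b = dact k n E Y a b + dact k n E Z a b" for E a b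
    by (simp only: clin_add[OF clin_dact] plus_fun_apply)
  show ?case
    by (simp only: s clin_add[OF L(1)] ring_distribs sum.distrib add.IH[symmetric] add_ac)
next
  case (scale Y c)
  have "L (c *\<^sub>C Y) + (\<Sum>l<rdim A. F u l * dact k n A (c *\<^sub>C Y) l v)
    = c * (L Y + (\<Sum>l<rdim A. F u l * dact k n A Y l v))"
    unfolding clin_scale[OF clin_dact] clin_scale[OF L(1)]
    by (simp add: distrib_left sum_distrib_left mult.left_commute)
  also have "\<dots> = (\<Sum>l<rdim B. dact k n B (c *\<^sub>C Y) u l * F l v)"
    unfolding scale clin_scale[OF clin_dact] by (simp add: sum_distrib_left mult.assoc)
  finally show ?case .
next
  case (cong Y Z)
  then show ?case using L(2)[of Y Z] dact_cong[of n Y Z] by simp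
qed

lemma clin_com_sum: "clin (\<lambda>Y. \<Sum>p\<in>S. com n Y X (fst p) (snd p) * c p)"
proof -
  have "clin (\<lambda>Y. com n Y X a b * d)" for a b d
    by (rule clinI) (simp_all add: clin_add[OF clin_com1] clin_scale[OF clin_com1] ring_distribs)
  then show ?thesis by (intro clin_sum_fun)
qed

lemma com_sum_cong:
  assumes "\<And>i j. i < n + 1 \<Longrightarrow> j < n + 1 \<Longrightarrow> Y i j = Z i j"
  shows "(\<Sum>p\<in>Pos k n. com n Y X (fst p) (snd p) * c p) = (\<Sum>p\<in>Pos k n. com n Z X (fst p) (snd p) * c p)"
proof (intro sum.cong refl)
  fix p assume "p \<in> Pos k n"
  then have "com n Y X (fst p) (snd p) = com n Z X (fst p) (snd p)"
    using assms by (intro com_cong) (auto simp: Pos_def)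
  then show "com n Y X (fst p) (snd p) * c p = com n Z X (fst p) (snd p) * c p" by simp
qed

lemma Ext1_expand:
  assumes kn: "k < n" and f: "f \<in> Ext1_G k n A B" and x: "x \<in> nilrad k n" and uv: "u < rdim B" "v < rdim A"
  shows "f x $$ (u, v) = (\<Sum>p\<in>Pos k n. x $$ p * f (eu n p) $$ (u, v))"
proof (rule nil_expand[OF kn _ _ x])
  have c: "f x \<in> carrier_mat (rdim B) (rdim A)" if "x \<in> nilrad k n" for x
    using f that by (auto simp: Ext1_G_def)
  show "f (x + y) $$ (u, v) = f x $$ (u, v) + f y $$ (u, v)" if "x \<in> nilrad k n" "y \<in> nilrad k n" for x y
    using f that uv c[OF that(1)] c[OF that(2)] by (auto simp: Ext1_G_def)
  show "f (a \<cdot>\<^sub>m x) $$ (u, v) = a * f x $$ (u, v)" if "x \<in> nilrad k n" for a x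
    using f that uv c[OF that(1)] by (auto simp: Ext1_G_def)
qed

text \<open>The group identity is differentiated at 0. Because \<open>f\<close> is linear on the
  nilradical only, \<open>f (Ad (\<gamma> z) x)\<close> is differentiated through its expansion in
  matrix units; this is why f([Y,x]) appears as a sum over \<open>Pos k n\<close>.\<close>

lemma Ext1_lie:
  assumes kn: "k < n" and A: "is_module k n A" and B: "is_module k n B" and f: "f \<in> Ext1_G k n A B"
    and Y: "Y \<in> tang k n" and x: "x \<in> nilrad k n" and uv: "u < rdim B" "v < rdim A"
  shows "(\<Sum>p\<in>Pos k n. com n Y (ent x) (fst p) (snd p) * f (eu n p) $$ (u, v))
      + (\<Sum>l<rdim A. f x $$ (u, l) * dact k n A Y l v) = (\<Sum>l<rdim B. dact k n B Y u l * f x $$ (l, v))"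
proof (rule tang_intertwiner[OF _ clin_com_sum _ Y])
  fix \<gamma> Y assume \<gamma>: "one_param k n \<gamma> Y"
  have n: "Ad (\<gamma> z) x \<in> nilrad k n" for z using Ad_one_param_nilrad[OF \<gamma> x] .
  show "(\<Sum>p\<in>Pos k n. com n Y (ent x) (fst p) (snd p) * f (eu n p) $$ (u, v))
      + (\<Sum>l<rdim A. ent (f x) u l * dact k n A Y l v) = (\<Sum>l<rdim B. dact k n B Y u l * ent (f x) l v)"
  proof (rule intertwiner_deriv[OF A B \<gamma> uv])
    fix z
    have l: "\<gamma> z \<in> levi k n" using \<gamma> by (simp add: one_param_def)
    have c: "f x \<in> carrier_mat (rdim B) (rdim A)" "f (Ad (\<gamma> z) x) \<in> carrier_mat (rdim B) (rdim A)"
      using f n x by (auto simp: Ext1_G_def)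
    have "f (Ad (\<gamma> z) x) * act A (\<gamma> z) = act B (\<gamma> z) * f x" using f l x by (auto simp: Ext1_G_def)
    then show "(\<Sum>l<rdim A. f (Ad (\<gamma> z) x) $$ (u, l) * act A (\<gamma> z) $$ (l, v))
        = (\<Sum>l<rdim B. act B (\<gamma> z) $$ (u, l) * f x $$ (l, v))"
      using mat_mult_entry[OF c(2) act_carrier[OF A l] uv] mat_mult_entry[OF act_carrier[OF B l] c(1) uv] by simp
  next
    fix l assume l: "l < rdim A"
    show "((\<lambda>z. f (Ad (\<gamma> z) x) $$ (u, l)) has_field_derivative
        (\<Sum>p\<in>Pos k n. com n Y (ent x) (fst p) (snd p) * f (eu n p) $$ (u, l))) (at 0)"
      unfolding Ext1_expand[OF kn f n uv(1) l]
      using nilrad_carrier[OF x] Ad_deriv[OF \<gamma> nilrad_carrier[OF x]]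
      by (intro DERIV_sum DERIV_cmult_right) (auto simp: Pos_def)
    show "f (Ad (\<gamma> 0) x) $$ (u, l) = f x $$ (u, l)" using Ad_zero[OF \<gamma> nilrad_carrier[OF x]] by simp
  qed
qed (rule com_sum_cong)

lemma Ext2_expand:
  assumes kn: "k < n" and f: "f \<in> Ext2_G k n A B" and x: "x \<in> nilrad k n" and y: "y \<in> nilrad k n"
    and uv: "u < rdim B" "v < rdim A"
  shows "f x y $$ (u, v) = (\<Sum>p\<in>Pos k n. x $$ p * f (eu n p) y $$ (u, v))"
    and "f x y $$ (u, v) = (\<Sum>p\<in>Pos k n. y $$ p * f x (eu n p) $$ (u, v))"
proof -
  have c: "f x y \<in> carrier_mat (rdim B) (rdim A)" if "x \<in> nilrad k n" "y \<in> nilrad k n" for x y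
    using f that by (auto simp: Ext2_G_def)
  show "f x y $$ (u, v) = (\<Sum>p\<in>Pos k n. x $$ p * f (eu n p) y $$ (u, v))"
  proof (rule nil_expand[OF kn _ _ x])
    show "f (x + x') y $$ (u, v) = f x y $$ (u, v) + f x' y $$ (u, v)" if "x \<in> nilrad k n" "x' \<in> nilrad k n" for x x'
      using f that y uv carrier_matD[OF c[OF that(1) y]] carrier_matD[OF c[OF that(2) y]] by (auto simp: Ext2_G_def)
    show "f (a \<cdot>\<^sub>m x) y $$ (u, v) = a * f x y $$ (u, v)" if "x \<in> nilrad k n" for a x
      using f that y uv carrier_matD[OF c[OF that(1) y]] by (auto simp: Ext2_G_def)
  qed
  show "f x y $$ (u, v) = (\<Sum>p\<in>Pos k n. y $$ p * f x (eu n p) $$ (u, v))"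
  proof (rule nil_expand[OF kn _ _ y])
    show "f x (y + y') $$ (u, v) = f x y $$ (u, v) + f x y' $$ (u, v)" if "y \<in> nilrad k n" "y' \<in> nilrad k n" for y y'
      using f that x uv carrier_matD[OF c[OF x that(1)]] carrier_matD[OF c[OF x that(2)]] by (auto simp: Ext2_G_def)
    show "f x (a \<cdot>\<^sub>m y) $$ (u, v) = a * f x y $$ (u, v)" if "y \<in> nilrad k n" for a y
      using f that x uv carrier_matD[OF c[OF x that(1)]] by (auto simp: Ext2_G_def)
  qed
qed

lemma Ext2_lie:
  assumes kn: "k < n" and A: "is_module k n A" and B: "is_module k n B" and f: "f \<in> Ext2_G k n A B"
    and Y: "Y \<in> tang k n" and x: "x \<in> nilrad k n" and y: "y \<in> nilrad k n" and uv: "u < rdim B" "v < rdim A"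
  shows "(\<Sum>p\<in>Pos k n. com n Y (ent x) (fst p) (snd p) * f (eu n p) y $$ (u, v))
      + (\<Sum>p\<in>Pos k n. com n Y (ent y) (fst p) (snd p) * f x (eu n p) $$ (u, v))
      + (\<Sum>l<rdim A. f x y $$ (u, l) * dact k n A Y l v) = (\<Sum>l<rdim B. dact k n B Y u l * f x y $$ (l, v))"
proof (rule tang_intertwiner[OF _ clin_plus[OF clin_com_sum clin_com_sum] _ Y])
  fix \<gamma> Y assume \<gamma>: "one_param k n \<gamma> Y"
  have n: "Ad (\<gamma> z) x \<in> nilrad k n" "Ad (\<gamma> z) y \<in> nilrad k n" for z
    using Ad_one_param_nilrad[OF \<gamma> x] Ad_one_param_nilrad[OF \<gamma> y] .
  have z: "Ad (\<gamma> 0) x = x" "Ad (\<gamma> 0) y = y"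
    using Ad_zero[OF \<gamma> nilrad_carrier[OF x]] Ad_zero[OF \<gamma> nilrad_carrier[OF y]] .
  show "(\<Sum>p\<in>Pos k n. com n Y (ent x) (fst p) (snd p) * f (eu n p) y $$ (u, v))
      + (\<Sum>p\<in>Pos k n. com n Y (ent y) (fst p) (snd p) * f x (eu n p) $$ (u, v))
      + (\<Sum>l<rdim A. ent (f x y) u l * dact k n A Y l v) = (\<Sum>l<rdim B. dact k n B Y u l * ent (f x y) l v)"
  proof (rule intertwiner_deriv[OF A B \<gamma> uv])
    fix z
    have l: "\<gamma> z \<in> levi k n" using \<gamma> by (simp add: one_param_def)
    have c: "f x y \<in> carrier_mat (rdim B) (rdim A)" "f (Ad (\<gamma> z) x) (Ad (\<gamma> z) y) \<in> carrier_mat (rdim B) (rdim A)"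
      using f n x y by (auto simp: Ext2_G_def)
    have "f (Ad (\<gamma> z) x) (Ad (\<gamma> z) y) * act A (\<gamma> z) = act B (\<gamma> z) * f x y" using f l x y by (auto simp: Ext2_G_def)
    then show "(\<Sum>l<rdim A. f (Ad (\<gamma> z) x) (Ad (\<gamma> z) y) $$ (u, l) * act A (\<gamma> z) $$ (l, v))
        = (\<Sum>l<rdim B. act B (\<gamma> z) $$ (u, l) * f x y $$ (l, v))"
      using mat_mult_entry[OF c(2) act_carrier[OF A l] uv] mat_mult_entry[OF act_carrier[OF B l] c(1) uv] by simp
  next
    fix l assume l: "l < rdim A"
    have dx: "((\<lambda>z. Ad (\<gamma> z) x $$ p) has_field_derivative com n Y (ent x) (fst p) (snd p)) (at 0)"
      and dy: "((\<lambda>z. Ad (\<gamma> z) y $$ p) has_field_derivative com n Y (ent y) (fst p) (snd p)) (at 0)"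
      if "p \<in> Pos k n" for p
      using that Ad_deriv[OF \<gamma> nilrad_carrier[OF x]] Ad_deriv[OF \<gamma> nilrad_carrier[OF y]] by (auto simp: Pos_def)
    \<comment> \<open>After expanding both arguments the dependence on \<open>z\<close> sits in
      products of two entries, to which the product rule applies; each half is then summed up again
      to a bracket term.\<close>
    have e: "f (Ad (\<gamma> z) x) (Ad (\<gamma> z) y) $$ (u, l)
        = (\<Sum>p\<in>Pos k n. Ad (\<gamma> z) x $$ p * (\<Sum>q\<in>Pos k n. Ad (\<gamma> z) y $$ q * f (eu n p) (eu n q) $$ (u, l)))" for z
      unfolding Ext2_expand(1)[OF kn f n uv(1) l]
      by (intro sum.cong refl) (simp only: Ext2_expand(2)[OF kn f eu_nilrad[OF kn] n(2) uv(1) l])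
    have "((\<lambda>z. f (Ad (\<gamma> z) x) (Ad (\<gamma> z) y) $$ (u, l)) has_field_derivative
        (\<Sum>p\<in>Pos k n. com n Y (ent x) (fst p) (snd p) * (\<Sum>q\<in>Pos k n. Ad (\<gamma> 0) y $$ q * f (eu n p) (eu n q) $$ (u, l))
         + (\<Sum>q\<in>Pos k n. com n Y (ent y) (fst q) (snd q) * f (eu n p) (eu n q) $$ (u, l)) * Ad (\<gamma> 0) x $$ p)) (at 0)"
      unfolding e by (intro DERIV_sum DERIV_mult DERIV_cmult_right dx dy)
    also have "(\<Sum>p\<in>Pos k n. com n Y (ent x) (fst p) (snd p) * (\<Sum>q\<in>Pos k n. Ad (\<gamma> 0) y $$ q * f (eu n p) (eu n q) $$ (u, l))
         + (\<Sum>q\<in>Pos k n. com n Y (ent y) (fst q) (snd q) * f (eu n p) (eu n q) $$ (u, l)) * Ad (\<gamma> 0) x $$ p)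
      = (\<Sum>p\<in>Pos k n. com n Y (ent x) (fst p) (snd p) * f (eu n p) y $$ (u, l))
       + (\<Sum>p\<in>Pos k n. com n Y (ent y) (fst p) (snd p) * f x (eu n p) $$ (u, l))"
    proof -
      have "(\<Sum>q\<in>Pos k n. y $$ q * f (eu n p) (eu n q) $$ (u, l)) = f (eu n p) y $$ (u, l)" if "p \<in> Pos k n" for p
        using Ext2_expand(2)[OF kn f eu_nilrad[OF kn that] y uv(1) l] by simp
      moreover have "(\<Sum>p\<in>Pos k n. (\<Sum>q\<in>Pos k n. com n Y (ent y) (fst q) (snd q) * f (eu n p) (eu n q) $$ (u, l)) * x $$ p)
        = (\<Sum>q\<in>Pos k n. com n Y (ent y) (fst q) (snd q) * f x (eu n q) $$ (u, l))"
      proof -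
        have "(\<Sum>p\<in>Pos k n. (\<Sum>q\<in>Pos k n. com n Y (ent y) (fst q) (snd q) * f (eu n p) (eu n q) $$ (u, l)) * x $$ p)
          = (\<Sum>q\<in>Pos k n. \<Sum>p\<in>Pos k n. com n Y (ent y) (fst q) (snd q) * f (eu n p) (eu n q) $$ (u, l) * x $$ p)"
          unfolding sum_distrib_right by (rule sum.swap)
        also have "\<dots> = (\<Sum>q\<in>Pos k n. com n Y (ent y) (fst q) (snd q) * f x (eu n q) $$ (u, l))"
          by (intro sum.cong refl, subst Ext2_expand(1)[OF kn f x eu_nilrad[OF kn] uv(1) l])
            (auto simp: sum_distrib_left mult_ac)
        finally show ?thesis .
      qed
      ultimately show ?thesis unfolding z sum.distrib by simp
    qed
    finally show "((\<lambda>z. f (Ad (\<gamma> z) x) (Ad (\<gamma> z) y) $$ (u, l)) has_field_derivative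
       (\<Sum>p\<in>Pos k n. com n Y (ent x) (fst p) (snd p) * f (eu n p) y $$ (u, l))
       + (\<Sum>p\<in>Pos k n. com n Y (ent y) (fst p) (snd p) * f x (eu n p) $$ (u, l))) (at 0)" .
    show "f (Ad (\<gamma> 0) x) (Ad (\<gamma> 0) y) $$ (u, l) = f x y $$ (u, l)" using z by simp
  qed
next
  show "(\<Sum>p\<in>Pos k n. com n Y (ent x) (fst p) (snd p) * f (eu n p) y $$ (u, v))
      + (\<Sum>p\<in>Pos k n. com n Y (ent y) (fst p) (snd p) * f x (eu n p) $$ (u, v))
    = (\<Sum>p\<in>Pos k n. com n Z (ent x) (fst p) (snd p) * f (eu n p) y $$ (u, v))
      + (\<Sum>p\<in>Pos k n. com n Z (ent y) (fst p) (snd p) * f x (eu n p) $$ (u, v))"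
    if "\<And>i j. i < n + 1 \<Longrightarrow> j < n + 1 \<Longrightarrow> Y i j = Z i j" for Y Z
    using com_sum_cong[of n Y Z, OF that] by simp
qed

section \<open>Highest weight vectors\<close>

type_synonym 'v ops = "bool \<Rightarrow> nat \<Rightarrow> nat \<Rightarrow> 'v \<Rightarrow> 'v"

text \<open>Two commuting general linear Lie algebras, of ranks \<open>r True\<close> and \<open>r False\<close>, acting by the
  images \<open>X s i j\<close> of the matrix units; those with \<open>i < j\<close> are the raising operators.\<close>

locale lie_mod =
  fixes r :: "bool \<Rightarrow> nat" and X :: "'v::cspace ops"
  assumes lin: "clin (X s i j)"
    and bracket: "i \<in> {1..r s} \<Longrightarrow> j \<in> {1..r s} \<Longrightarrow> k \<in> {1..r t} \<Longrightarrow> l \<in> {1..r t} \<Longrightarrow>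
      X s i j (X t k l w) = X t k l (X s i j w)
        + (if s = t then (if j = k then X s i l w else 0) - (if i = l then X s k j w else 0) else 0)"

inductive_set low :: "(bool \<Rightarrow> nat) \<Rightarrow> 'v::cspace ops \<Rightarrow> 'v \<Rightarrow> 'v set" for r X v where
  base: "v \<in> low r X v"
| add: "w \<in> low r X v \<Longrightarrow> w' \<in> low r X v \<Longrightarrow> w + w' \<in> low r X v"
| scale: "w \<in> low r X v \<Longrightarrow> c *\<^sub>C w \<in> low r X v"
| lower: "w \<in> low r X v \<Longrightarrow> 1 \<le> j \<Longrightarrow> j < i \<Longrightarrow> i \<le> r s \<Longrightarrow> X s i j w \<in> low r X v"

lemma low_zero: "0 \<in> low r X v"
  using low.scale[OF low.base, of 0] by simp

lemma low_diff: "w \<in> low r X v \<Longrightarrow> w' \<in> low r X v \<Longrightarrow> w - w' \<in> low r X v"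
  using low.add[OF _ low.scale[of w' r X v "- 1"], of w] by simp

definition is_hw :: "(bool \<Rightarrow> nat) \<Rightarrow> 'v::cspace ops \<Rightarrow> 'v \<Rightarrow> (bool \<Rightarrow> nat \<Rightarrow> complex) \<Rightarrow> bool" where
  "is_hw r X v \<alpha> \<longleftrightarrow> (\<forall>s i j. 1 \<le> i \<longrightarrow> i < j \<longrightarrow> j \<le> r s \<longrightarrow> X s i j v = 0) \<and>
    (\<forall>s. \<forall>i\<in>{1..r s}. X s i i v = \<alpha> s i *\<^sub>C v)"

context lie_mod
begin

text \<open>An operator moved past the outermost lowering operator leaves commutators acting on a
  shorter word, and the induction hypothesis is for all operators at once. Hence \<open>low\<close>
  is the submodule generated by a highest weight vector.\<close>

lemma low_closed:
  assumes v: "is_hw r X v \<alpha>" and w: "w \<in> low r X v" and ij: "i \<in> {1..r s}" "j \<in> {1..r s}"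
  shows "X s i j w \<in> low r X v"
  using w ij
proof (induction arbitrary: s i j rule: low.induct)
  case base
  consider "j < i" | "i = j" | "i < j" by linarith
  then show ?case
  proof cases
    case 1
    then show ?thesis using base by (auto intro: low.base low.lower)
  next
    case 2
    then show ?thesis using v base by (auto simp: is_hw_def intro: low.base low.scale)
  next
    case 3
    then show ?thesis using v base low_zero by (auto simp: is_hw_def)
  qed
next
  case (add w w')
  then show ?case by (auto simp: clin_add[OF lin] intro: low.add)
next
  case (scale w c)
  then show ?case by (auto simp: clin_scale[OF lin] intro: low.scale)
next
  case (lower w l k t)
  have "X t k l (X s i j w) \<in> low r X v"
    by (rule low.lower[OF lower.IH[OF lower.prems] lower.hyps(2-4)])
  moreover have "X s i l w \<in> low r X v" if "s = t" using lower that by auto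
  moreover have "X s k j w \<in> low r X v" if "s = t" using lower that by auto
  ultimately have "X t k l (X s i j w)
      + (if s = t then (if j = k then X s i l w else 0) - (if i = l then X s k j w else 0) else 0) \<in> low r X v"
    by (auto intro: low.add low_diff low_zero)
  then show ?case using lower.hyps lower.prems by (subst bracket) auto
qed

text \<open>A grading element of the diagonal subalgebra: every lowering operator decreases its
  eigenvalue by a positive integer. This single operator replaces a decomposition into weight
  spaces.\<close>

definition height :: "'v \<Rightarrow> 'v" where
  "height w = (\<Sum>s\<in>UNIV. \<Sum>i=1..r s. (- of_nat i) *\<^sub>C X s i i w)"

lemma clin_height: "clin height"
  unfolding height_def[abs_def] by (intro clin_sum_fun clin_smul lin)

lemma height_lower:
  assumes "k \<in> {1..r t}" "l \<in> {1..r t}" "l < k"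
  shows "height (X t k l w) = X t k l (height w) - of_nat (k - l) *\<^sub>C X t k l w"
proof -
  have e: "height (X t k l w) = (\<Sum>s\<in>UNIV. \<Sum>i=1..r s. (- of_nat i) *\<^sub>C X t k l (X s i i w)
      + (if s = t \<and> i = k then (- of_nat i) *\<^sub>C X t k l w else 0)
      + (if s = t \<and> i = l then of_nat i *\<^sub>C X t k l w else 0))"
    unfolding height_def using assms
    by (intro sum.cong refl, subst bracket) (auto simp: scaleC_add_right)
  have e': "\<dots> = X t k l (height w)
      + (\<Sum>s\<in>UNIV. \<Sum>i=1..r s. if s = t \<and> i = k then (- of_nat i) *\<^sub>C X t k l w else 0)
      + (\<Sum>s\<in>UNIV. \<Sum>i=1..r s. if s = t \<and> i = l then of_nat i *\<^sub>C X t k l w else 0)"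
    unfolding sum.distrib height_def clin_sum[OF lin] clin_scale[OF lin] ..
  have "(\<Sum>s\<in>UNIV. \<Sum>i=1..r s. if s = t \<and> i = m then c i *\<^sub>C X t k l w else 0) = c m *\<^sub>C X t k l w"
    if "m \<in> {1..r t}" for m c
  proof -
    have "(\<Sum>i=1..r s. if s = t \<and> i = m then c i *\<^sub>C X t k l w else 0)
        = (if s = t then c m *\<^sub>C X t k l w else 0)" for s
      using that by (cases "s = t") (auto simp: sum.delta)
    then show ?thesis by (simp add: sum.delta)
  qed
  from this[of k "\<lambda>i. - of_nat i"] this[of l of_nat] assms
  have "(\<Sum>s\<in>UNIV. \<Sum>i=1..r s. if s = t \<and> i = k then (- of_nat i) *\<^sub>C X t k l w else 0)
      = - (of_nat k *\<^sub>C X t k l w)"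
    "(\<Sum>s\<in>UNIV. \<Sum>i=1..r s. if s = t \<and> i = l then of_nat i *\<^sub>C X t k l w else 0) = of_nat l *\<^sub>C X t k l w"
    by auto
  then show ?thesis
    unfolding e e' using assms(3) by (simp add: of_nat_diff cs.scale_left_diff_distrib)
qed

definition strict :: "'v \<Rightarrow> 'v set" where
  "strict v = cs.span {X s i j w | s i j w. w \<in> low r X v \<and> 1 \<le> j \<and> j < i \<and> i \<le> r s}"

lemma strict_lower: "w \<in> low r X v \<Longrightarrow> 1 \<le> j \<Longrightarrow> j < i \<Longrightarrow> i \<le> r s \<Longrightarrow> X s i j w \<in> strict v"
  unfolding strict_def by (intro cs.span_base) blast

lemma low_decomp:
  assumes "w \<in> low r X v"
  shows "\<exists>c. w - c *\<^sub>C v \<in> strict v"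
  using assms
proof (induction rule: low.induct)
  case base
  then show ?case by (intro exI[of _ 1]) (simp add: scaleC_one strict_def cs.span_zero)
next
  case (add w w')
  then obtain c c' where "w - c *\<^sub>C v \<in> strict v" "w' - c' *\<^sub>C v \<in> strict v" by blast
  then have "(w - c *\<^sub>C v) + (w' - c' *\<^sub>C v) \<in> strict v" unfolding strict_def by (rule cs.span_add)
  then show ?case by (intro exI[of _ "c + c'"]) (simp add: scaleC_add_left algebra_simps)
next
  case (scale w d)
  then obtain c where "w - c *\<^sub>C v \<in> strict v" by blast
  then have "d *\<^sub>C (w - c *\<^sub>C v) \<in> strict v" unfolding strict_def by (rule cs.span_scale)
  then show ?case by (intro exI[of _ "d * c"]) (simp add: cs.scale_right_diff_distrib)
next
  case (lower w j i s)
  then show ?case using strict_lower by (intro exI[of _ 0]) auto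
qed

lemma strict_diag:
  assumes v: "is_hw r X v \<alpha>" and w: "w \<in> strict v" and i: "i \<in> {1..r s}"
  shows "X s i i w \<in> strict v"
  using w unfolding strict_def
proof (induction rule: cs.span_induct_alt)
  case base
  then show ?case by (simp add: clin_zero[OF lin] cs.span_zero)
next
  case (step c x y)
  then obtain t k l w where x: "x = X t k l w" "w \<in> low r X v" "1 \<le> l" "l < k" "k \<le> r t" by blast
  have "X s i i x = X t k l (X s i i w) + (if s = t then (if i = k then x else 0) - (if i = l then x else 0) else 0)"
    unfolding x(1) using x i by (subst bracket) auto
  moreover have "X t k l (X s i i w) \<in> strict v" using x low_closed[OF v x(2) i i] by (intro strict_lower) auto
  moreover have "x \<in> strict v" using strict_lower x by auto
  ultimately have "X s i i x \<in> strict v" unfolding strict_def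
    by (auto intro!: cs.span_add cs.span_diff cs.span_zero)
  then show ?case using step unfolding strict_def
    by (simp add: clin_add[OF lin] clin_scale[OF lin] cs.span_add cs.span_scale)
qed

text \<open>With h the height of \<open>v\<close>, each vector of \<open>strict v\<close> is killed
  by a product of factors height - (h - m) with all m at least 1. On \<open>v\<close> the same
  product acts as the product of these m, which is not 0.\<close>

lemma hw_not_strict:
  assumes v: "is_hw r X v \<alpha>" "v \<noteq> 0"
  shows "v \<notin> strict v"
proof
  define h where "h = (\<Sum>s\<in>UNIV. \<Sum>i=1..r s. - (of_nat i * \<alpha> s i))"
  have hv: "height v = h *\<^sub>C v"
    unfolding height_def h_def cs.scale_sum_left using v
    by (intro sum.cong refl) (auto simp: is_hw_def)
  \<comment> \<open>Further roots do no harm, so two summands can be treated with a common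
    list.\<close>
  have mono: "shifts height (map (\<lambda>m. h - of_nat m) [a..<K']) w = 0"
    if "shifts height (map (\<lambda>m. h - of_nat m) [b..<K]) w = 0" "a \<le> b" "K \<le> K'" for a b K K' w
  proof (rule shifts_zero_mono[OF clin_height that(1)])
    have "mset_set {b..<K} \<subseteq># mset_set {a..<K'}" using that(2,3) by (intro subset_imp_msubset_mset_set) auto
    then show "mset (map (\<lambda>m. h - of_nat m) [b..<K]) \<subseteq># mset (map (\<lambda>m. h - of_nat m) [a..<K'])"
      by (simp add: image_mset_subseteq_mono del: mset_map add: mset_map)
  qed
  \<comment> \<open>A lowering operator moves the range of m from 0 on to \<open>i - j\<close> on,
    and so excludes m = 0.\<close>
  have hstep: "\<exists>K. shifts height (map (\<lambda>m. h - of_nat m) [1..<K]) (X s i j w) = 0"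
      if K: "shifts height (map (\<lambda>m. h - of_nat m) [0..<K]) w = 0" and ij: "1 \<le> j" "j < i" "i \<le> r s" for w K s i j
    proof -
      have "shifts height (map (\<lambda>c. c - of_nat (i - j)) (map (\<lambda>m. h - of_nat m) [0..<K])) (X s i j w) = 0"
        using ij by (subst shifts_translate[OF clin_height lin height_lower]) (auto simp: K clin_zero[OF lin])
      moreover have "map (\<lambda>c. c - of_nat (i - j)) (map (\<lambda>m. h - of_nat m) [0..<K])
          = map (\<lambda>m. h - of_nat m) [i - j..<K + (i - j)]"
        by (intro nth_equalityI) (auto simp: algebra_simps)
      ultimately show ?thesis using ij
        by (intro exI[of _ "K + (i - j)"] mono[of "i - j" "K + (i - j)" "X s i j w" 1]) auto
    qed
  have low: "\<exists>K. shifts height (map (\<lambda>m. h - of_nat m) [0..<K]) w = 0" if "w \<in> low r X v" for w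
      using that
    proof (induction rule: low.induct)
      case base
      show ?case by (intro exI[of _ "Suc 0"]) (simp add: shifts_Cons hv)
    next
      case (add w w')
      then obtain K K' where "shifts height (map (\<lambda>m. h - of_nat m) [0..<K]) w = 0"
        "shifts height (map (\<lambda>m. h - of_nat m) [0..<K']) w' = 0" by blast
      then have "shifts height (map (\<lambda>m. h - of_nat m) [0..<max K K']) w = 0"
        "shifts height (map (\<lambda>m. h - of_nat m) [0..<max K K']) w' = 0"
        using mono[of 0 K w 0 "max K K'"] mono[of 0 K' w' 0 "max K K'"] by auto
      then show ?case
        by (intro exI[of _ "max K K'"]) (simp add: clin_add[OF clin_shifts[OF clin_height]])
    next
      case (scale w c)
      then show ?case by (auto simp: clin_scale[OF clin_shifts[OF clin_height]])
    next
      case (lower w j i s)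
      then obtain K where "shifts height (map (\<lambda>m. h - of_nat m) [0..<K]) w = 0" by blast
      from hstep[OF this lower.hyps(2-4)] obtain K' where
        "shifts height (map (\<lambda>m. h - of_nat m) [1..<K']) (X s i j w) = 0" by blast
      from mono[OF this, of 0 K'] show ?case by auto
    qed
  have "\<exists>K. shifts height (map (\<lambda>m. h - of_nat m) [1..<K]) w = 0" if "w \<in> strict v" for w
    using that unfolding strict_def
  proof (induction rule: cs.span_induct_alt)
    case base
    then show ?case by (auto simp: clin_zero[OF clin_shifts[OF clin_height]])
  next
    case (step c x y)
    then obtain K K' where "shifts height (map (\<lambda>m. h - of_nat m) [1..<K]) x = 0"
      "shifts height (map (\<lambda>m. h - of_nat m) [1..<K']) y = 0" using step(1,2) hstep low by blast
    then have "shifts height (map (\<lambda>m. h - of_nat m) [1..<max K K']) x = 0"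
      "shifts height (map (\<lambda>m. h - of_nat m) [1..<max K K']) y = 0"
      using mono[of 1 K x 1 "max K K'"] mono[of 1 K' y 1 "max K K'"] by auto
    then show ?case
      by (intro exI[of _ "max K K'"])
        (simp add: clin_add[OF clin_shifts[OF clin_height]] clin_scale[OF clin_shifts[OF clin_height]])
  qed
  moreover assume "v \<in> strict v"
  ultimately obtain K where "shifts height (map (\<lambda>m. h - of_nat m) [1..<K]) v = 0" by blast
  then show False using v(2) by (auto simp: shifts_eigen[OF clin_height hv] prod_list_zero_iff)
qed

text \<open>The functional is the coordinate of \<open>v\<close> relative to
  \<open>strict v\<close>. Since diagonal operators preserve \<open>strict v\<close>, they act on
  this coordinate by the highest weight.\<close>

lemma hw_functional:
  assumes v: "is_hw r X v \<alpha>" "v \<noteq> 0"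
  obtains \<phi> :: "'v \<Rightarrow> complex" where "clin \<phi>" "\<phi> v = 1"
    "\<And>w s i j. w \<in> low r X v \<Longrightarrow> 1 \<le> j \<Longrightarrow> j < i \<Longrightarrow> i \<le> r s \<Longrightarrow> \<phi> (X s i j w) = 0"
    "\<And>w s i. w \<in> low r X v \<Longrightarrow> i \<in> {1..r s} \<Longrightarrow> \<phi> (X s i i w) = \<alpha> s i * \<phi> w"
proof -
  obtain \<phi> :: "'v \<Rightarrow> complex" where \<phi>: "clin \<phi>" "\<phi> v = 1" "\<And>w. w \<in> strict v \<Longrightarrow> \<phi> w = 0"
    using exists_functional[OF _ hw_not_strict[OF v]] cs.subspace_span unfolding strict_def by blast
  have "\<phi> (X s i i w) = \<alpha> s i * \<phi> w" if w: "w \<in> low r X v" and i: "i \<in> {1..r s}" for w s i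
  proof -
    obtain c where c: "w - c *\<^sub>C v \<in> strict v" using low_decomp[OF w] by blast
    have "\<phi> w = c" using \<phi>(3)[OF c] \<phi>(2) by (simp add: clin_diff[OF \<phi>(1)] clin_scale[OF \<phi>(1)])
    moreover have "\<phi> (X s i i w) = c * \<alpha> s i"
      using \<phi>(3)[OF strict_diag[OF v(1) c i]] \<phi>(2) v(1) i
      by (simp add: clin_diff[OF lin] clin_scale[OF lin] clin_diff[OF \<phi>(1)] clin_scale[OF \<phi>(1)] is_hw_def)
    ultimately show ?thesis by simp
  qed
  then show ?thesis using that \<phi> strict_lower by blast
qed

end

text \<open>\<open>sep\<close> expresses irreducibility: \<open>\<phi>\<close> detects nonzero submodules.\<close>

locale hw_mod = lie_mod r X for r and X :: "'v::cspace ops" +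
  fixes v :: 'v and \<alpha> :: "bool \<Rightarrow> nat \<Rightarrow> complex" and \<phi> :: "'v \<Rightarrow> complex"
  assumes hw: "is_hw r X v \<alpha>"
    and clin_phi: "clin \<phi>" and phi_v: "\<phi> v = 1"
    and phi_lower: "1 \<le> j \<Longrightarrow> j < i \<Longrightarrow> i \<le> r s \<Longrightarrow> \<phi> (X s i j w) = 0"
    and phi_diag: "i \<in> {1..r s} \<Longrightarrow> \<phi> (X s i i w) = \<alpha> s i * \<phi> w"
    and sep: "(\<And>w s i j. w \<in> S \<Longrightarrow> i \<in> {1..r s} \<Longrightarrow> j \<in> {1..r s} \<Longrightarrow> X s i j w \<in> S) \<Longrightarrow>
      (\<And>w. w \<in> S \<Longrightarrow> \<phi> w = 0) \<Longrightarrow> S \<subseteq> low r X v \<Longrightarrow> S \<subseteq> {0}"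
begin

lemma raise_v: "1 \<le> i \<Longrightarrow> i < j \<Longrightarrow> j \<le> r s \<Longrightarrow> X s i j v = 0"
  and diag_v: "i \<in> {1..r s} \<Longrightarrow> X s i i v = \<alpha> s i *\<^sub>C v"
  using hw by (auto simp: is_hw_def)

end

lemma low_sum_list: "(\<And>w. w \<in> set ws \<Longrightarrow> w \<in> low r X v) \<Longrightarrow> sum_list ws \<in> low r X v"
  by (induction ws) (auto intro: low_zero low.add)

locale hw_pair = A: hw_mod r XA vA \<alpha>A \<phi>A + B: hw_mod r XB vB \<alpha>B \<phi>B
  for r and XA :: "'a::cspace ops" and vA \<alpha>A \<phi>A and XB :: "'b::cspace ops" and vB \<alpha>B \<phi>B
begin

abbreviation "VA \<equiv> low r XA vA"
abbreviation "VB \<equiv> low r XB vB"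

text \<open>A family of operators which is stable under commutators vanishes if its matrix coefficients
  at the highest weight vectors vanish.\<close>

lemma family_zero:
  fixes FF :: "('a \<Rightarrow> 'b) set"
  assumes lin: "\<And>F. F \<in> FF \<Longrightarrow> clin F" and VB: "\<And>F w. F \<in> FF \<Longrightarrow> w \<in> VA \<Longrightarrow> F w \<in> VB"
    and com: "\<And>F s i j. F \<in> FF \<Longrightarrow> i \<in> {1..r s} \<Longrightarrow> j \<in> {1..r s} \<Longrightarrow>
      \<exists>Gs. set Gs \<subseteq> FF \<and> (\<forall>w\<in>VA. XB s i j (F w) = F (XA s i j w) + (\<Sum>G\<leftarrow>Gs. G w))"
    and v: "\<And>F. F \<in> FF \<Longrightarrow> \<phi>B (F vA) = 0"
    and F: "F \<in> FF" and w: "w \<in> VA"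
  shows "F w = 0"
proof -
  have sl: "\<phi>B (\<Sum>x\<leftarrow>xs. f x) = (\<Sum>x\<leftarrow>xs. \<phi>B (f x))" for xs :: "'c list" and f
    by (induction xs) (auto simp: clin_zero[OF B.clin_phi] clin_add[OF B.clin_phi])
  \<comment> \<open>A lowering operator on the argument is traded for one on the value, which the
    functional kills, plus other members of the family applied to a shorter word.\<close>
  have 1: "\<phi>B (F w) = 0" if "w \<in> VA" "F \<in> FF" for w F
    using that
  proof (induction arbitrary: F rule: low.induct)
    case (lower w j i s)
    then obtain Gs where Gs: "set Gs \<subseteq> FF" "XB s i j (F w) = F (XA s i j w) + (\<Sum>G\<leftarrow>Gs. G w)"
      using com[of F i s j] by fastforce
    have "(\<Sum>G\<leftarrow>Gs. \<phi>B (G w)) = 0"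
      using Gs(1) lower.IH by (induction Gs) auto
    then have "\<phi>B (F (XA s i j w)) = \<phi>B (XB s i j (F w))"
      by (simp add: Gs(2) clin_add[OF B.clin_phi] sl)
    then show ?case using lower by (simp add: B.phi_lower)
  qed (use v in \<open>auto simp: clin_add[OF lin] clin_scale[OF lin] clin_add[OF B.clin_phi] clin_scale[OF B.clin_phi]\<close>)
  \<comment> \<open>The finite sums of values of the family form a submodule on which the functional
    vanishes; irreducibility, in the form of \<open>sep\<close>, makes it zero.\<close>
  define S where "S = {(\<Sum>(F, w)\<leftarrow>L. F w) | L. set L \<subseteq> FF \<times> VA}"
  have "S \<subseteq> {0}"
  proof (rule B.sep)
    fix u assume "u \<in> S"
    then obtain L where L: "u = (\<Sum>(F, w)\<leftarrow>L. F w)" "set L \<subseteq> FF \<times> VA" unfolding S_def by blast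
    show "\<phi>B u = 0" unfolding L(1) sl using L(2) 1 by (induction L) auto
    show "XB s i j u \<in> S" if ij: "i \<in> {1..r s}" "j \<in> {1..r s}" for s i j
    proof -
      have "\<exists>L'. set L' \<subseteq> FF \<times> VA \<and> XB s i j (\<Sum>(F, w)\<leftarrow>L. F w) = (\<Sum>(F, w)\<leftarrow>L'. F w)"
        using L(2)
      proof (induction L)
        case Nil
        then show ?case by (intro exI[of _ "[]"]) (simp add: clin_zero[OF B.lin])
      next
        case (Cons p L)
        obtain F w where p: "p = (F, w)" "F \<in> FF" "w \<in> VA" using Cons.prems by (cases p) auto
        obtain L' where L': "set L' \<subseteq> FF \<times> VA" "XB s i j (\<Sum>(F, w)\<leftarrow>L. F w) = (\<Sum>(F, w)\<leftarrow>L'. F w)"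
          using Cons by auto
        obtain Gs where Gs: "set Gs \<subseteq> FF" "XB s i j (F w) = F (XA s i j w) + (\<Sum>G\<leftarrow>Gs. G w)"
          using com[OF p(2) ij] p(3) by auto
        have "XA s i j w \<in> VA" using A.low_closed[OF A.hw p(3) ij] .
        then show ?case using L' Gs p
          by (intro exI[of _ "(F, XA s i j w) # map (\<lambda>G. (G, w)) Gs @ L'"])
            (auto simp: clin_add[OF B.lin] comp_def add.assoc)
      qed
      then show ?thesis unfolding L(1) S_def by blast
    qed
  next
    have "(\<Sum>(F, w)\<leftarrow>L. F w) \<in> VB" if "set L \<subseteq> FF \<times> VA" for L
      by (rule low_sum_list) (use VB that in fastforce)
    then show "S \<subseteq> VB" unfolding S_def by blast
  qed
  moreover have "F w \<in> S" unfolding S_def using F w by (intro CollectI exI[of _ "[(F, w)]"]) auto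
  ultimately show ?thesis by auto
qed

end

section \<open>Tensoring with the nilradical\<close>

text \<open>The basis of \<open>\<N>\<close> is indexed by \<open>J r\<close>, the vector \<open>n\<^sub>p\<^sub>q\<close> corresponding to
  \<open>a True = p\<close>, \<open>a False = q\<close>; elements of the tensor product are functions on \<open>J r\<close>.\<close>

definition J :: "(bool \<Rightarrow> nat) \<Rightarrow> (bool \<Rightarrow> nat) set" where
  "J r = {a. \<forall>s. a s \<in> {1..r s}}"

lemma J_upd: "a \<in> J r \<Longrightarrow> i \<in> {1..r s} \<Longrightarrow> a(s := i) \<in> J r"
  by (auto simp: J_def)

lemma J_range: "a \<in> J r \<Longrightarrow> a s \<in> {1..r s}"
  by (auto simp: J_def)

text \<open>The Leibniz rule in coordinates. The matrix unit with indices \<open>i\<close>,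
  \<open>j\<close> sends basis vector \<open>j\<close> to basis vector \<open>i\<close>, so the
  coordinate at \<open>a\<close> receives the one at \<open>a(s := j)\<close>.\<close>

definition XM :: "(bool \<Rightarrow> nat) \<Rightarrow> 'v::cspace ops \<Rightarrow> ((bool \<Rightarrow> nat) \<Rightarrow> 'v) ops" where
  "XM r X s i j y = (\<lambda>a. if a \<in> J r then X s i j (y a) + (if a s = i then y (a(s := j)) else 0) else 0)"

text \<open>The mixed part of the Casimir element of factor \<open>s\<close>: the sum over all i, j
  of \<open>X s j i\<close> on the module tensored with the matrix unit (i, j) on the
  nilradical.\<close>

definition Om :: "(bool \<Rightarrow> nat) \<Rightarrow> 'v::cspace ops \<Rightarrow> bool \<Rightarrow> ((bool \<Rightarrow> nat) \<Rightarrow> 'v) \<Rightarrow> ((bool \<Rightarrow> nat) \<Rightarrow> 'v)" where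
  "Om r X s y = (\<lambda>a. if a \<in> J r then \<Sum>j=1..r s. X s j (a s) (y (a(s := j))) else 0)"

definition ten :: "(bool \<Rightarrow> nat) \<Rightarrow> 'v::zero \<Rightarrow> (bool \<Rightarrow> nat) \<Rightarrow> 'v" where
  "ten a w = (\<lambda>b. if b = a then w else 0)"

lemma clin_ten: "clin (ten a)"
  by (auto simp: clin_def ten_def fun_eq_iff)

context lie_mod
begin

lemma clin_XM: "clin (XM r X s i j)"
  by (auto simp: clin_def XM_def fun_eq_iff clin_add[OF lin] clin_scale[OF lin] scaleC_add_right)

lemma clin_Om: "clin (Om r X s)"
  by (auto simp: clin_def Om_def fun_eq_iff clin_add[OF lin] clin_scale[OF lin] sum.distrib cs.scale_sum_right)

lemma XM_lie_mod: "lie_mod r (XM r X)"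
proof
  show "clin (XM r X s i j)" for s i j by (rule clin_XM)
  fix i s j k t l and y :: "(bool \<Rightarrow> nat) \<Rightarrow> 'v"
  assume ij: "i \<in> {1..r s}" "j \<in> {1..r s}" "k \<in> {1..r t}" "l \<in> {1..r t}"
  show "XM r X s i j (XM r X t k l y) = XM r X t k l (XM r X s i j y)
      + (if s = t then (if j = k then XM r X s i l y else 0) - (if i = l then XM r X s k j y else 0) else 0)"
  proof
    fix a
    show "XM r X s i j (XM r X t k l y) a = (XM r X t k l (XM r X s i j y)
      + (if s = t then (if j = k then XM r X s i l y else 0) - (if i = l then XM r X s k j y else 0) else 0)) a"
    proof (cases "a \<in> J r")
      case True
      have J: "a(s := j) \<in> J r" "a(t := l) \<in> J r" using True ij by (auto intro!: J_upd)
      show ?thesis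
      proof (cases "s = t")
        case True
        then show ?thesis using \<open>a \<in> J r\<close> J ij bracket[OF ij, of "y a"]
          by (auto simp: XM_def clin_add[OF lin] clin_zero[OF lin])
      next
        case False
        then have "a(s := j, t := l) = a(t := l, s := j)" by auto
        then show ?thesis using \<open>a \<in> J r\<close> J ij False bracket[OF ij, of "y a"]
          by (auto simp: XM_def clin_add[OF lin] clin_zero[OF lin])
      qed
    qed (simp add: XM_def)
  qed
qed

text \<open>Invariance of the Casimir element. If \<open>s = t\<close>, one commutator term cancels
  against the action on the nilradical index, and the other one is the action on the index that the
  right-hand side contains.\<close>

lemma Om_XM:
  assumes kl: "k \<in> {1..r t}" "l \<in> {1..r t}"
  shows "XM r X t k l (Om r X s y) = Om r X s (XM r X t k l y)"
proof
  fix a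
  show "XM r X t k l (Om r X s y) a = Om r X s (XM r X t k l y) a"
  proof (cases "a \<in> J r")
    case a: True
    have as: "a s \<in> {1..r s}" using a by (rule J_range)
    have al: "a(t := l) \<in> J r" using a kl by (intro J_upd)
    have aj: "a(s := j) \<in> J r" if "j \<in> {1..r s}" for j using a that by (intro J_upd)
    let ?S = "\<lambda>f. \<Sum>j=1..r s. f j"
    have L: "XM r X t k l (Om r X s y) a = ?S (\<lambda>j. X t k l (X s j (a s) (y (a(s := j)))))
        + (if a t = k then ?S (\<lambda>j. X s j ((a(t := l)) s) (y (a(t := l, s := j)))) else 0)"
      using a al by (simp add: XM_def Om_def clin_sum[OF lin])
    have R: "Om r X s (XM r X t k l y) a = ?S (\<lambda>j. X s j (a s) (X t k l (y (a(s := j)))))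
        + ?S (\<lambda>j. X s j (a s) (if (a(s := j)) t = k then y (a(s := j, t := l)) else 0))"
      unfolding sum.distrib[symmetric] using a aj
      by (auto simp: Om_def XM_def clin_add[OF lin] intro!: sum.cong)
    show ?thesis
    proof (cases "s = t")
      case False
      have "X t k l (X s j (a s) w) = X s j (a s) (X t k l w)" if "j \<in> {1..r s}" for j w
        using bracket[OF kl that as, of w] False by simp
      moreover have "a(t := l, s := j) = a(s := j, t := l)" for j using False by auto
      ultimately show ?thesis unfolding L R using False
        by (auto simp: clin_zero[OF lin])
    next
      case True
      have "X t k l (X s j (a s) w) = X s j (a s) (X t k l w)
          + (if l = j then X s k (a s) w else 0) - (if k = a s then X s j l w else 0)" if "j \<in> {1..r s}" for j w
        using bracket[OF kl that[unfolded True] as[unfolded True], of w] True by auto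
      then have "?S (\<lambda>j. X t k l (X s j (a s) (y (a(s := j))))) = ?S (\<lambda>j. X s j (a s) (X t k l (y (a(s := j))))
          + (if j = l then X s k (a s) (y (a(s := l))) else 0) - (if k = a s then X s j l (y (a(s := j))) else 0))"
        by (intro sum.cong) auto
      also have "\<dots> = ?S (\<lambda>j. X s j (a s) (X t k l (y (a(s := j))))) + X s k (a s) (y (a(s := l)))
          - (if k = a s then ?S (\<lambda>j. X s j l (y (a(s := j)))) else 0)"
        using kl True by (auto simp: sum.distrib sum_subtractf)
      finally have 1: "?S (\<lambda>j. X t k l (X s j (a s) (y (a(s := j))))) = \<dots>" .
      have "?S (\<lambda>j. X s j (a s) (if (a(s := j)) t = k then y (a(s := j, t := l)) else 0))
          = ?S (\<lambda>j. if j = k then X s k (a s) (y (a(s := l))) else 0)"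
        using True by (intro sum.cong) (auto simp: clin_zero[OF lin])
      also have "\<dots> = X s k (a s) (y (a(s := l)))" using kl True by simp
      finally show ?thesis unfolding L R 1 using True by auto
    qed
  qed (simp add: XM_def Om_def)
qed

lemma Om_Om:
  assumes "s \<noteq> t"
  shows "Om r X s (Om r X t y) = Om r X t (Om r X s y)"
proof
  fix a
  show "Om r X s (Om r X t y) a = Om r X t (Om r X s y) a"
  proof (cases "a \<in> J r")
    case a: True
    have aj: "a(s := j) \<in> J r" if "j \<in> {1..r s}" for s j using a that by (intro J_upd)
    have "Om r X s (Om r X t y) a = (\<Sum>j=1..r s. \<Sum>l=1..r t. X s j (a s) (X t l (a t) (y (a(s := j, t := l)))))"
      using a aj assms by (auto simp: Om_def clin_sum[OF lin] intro!: sum.cong)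
    also have "\<dots> = (\<Sum>l=1..r t. \<Sum>j=1..r s. X t l (a t) (X s j (a s) (y (a(t := l, s := j)))))"
    proof (subst sum.swap, intro sum.cong refl)
      fix l j assume jl: "l \<in> {1..r t}" "j \<in> {1..r s}"
      have "a(s := j, t := l) = a(t := l, s := j)" using assms by auto
      then show "X s j (a s) (X t l (a t) (y (a(s := j, t := l)))) = X t l (a t) (X s j (a s) (y (a(t := l, s := j))))"
        using bracket[OF jl(2) J_range[OF a] jl(1) J_range[OF a]] assms by simp
    qed
    also have "\<dots> = Om r X t (Om r X s y) a"
      using a aj assms by (auto simp: Om_def clin_sum[OF lin] intro!: sum.cong)
    finally show ?thesis .
  qed (simp add: Om_def)
qed

lemma Om_ten:
  assumes a: "a \<in> J r"
  shows "Om r X s (ten a w) = (\<Sum>j=1..r s. ten (a(s := j)) (X s (a s) j w))"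
proof
  fix b
  have as: "a s \<in> {1..r s}" using a by (rule J_range)
  show "Om r X s (ten a w) b = (\<Sum>j=1..r s. ten (a(s := j)) (X s (a s) j w)) b"
  proof (cases "\<exists>j\<in>{1..r s}. b = a(s := j)")
    case True
    then obtain j where j: "j \<in> {1..r s}" "b = a(s := j)" by blast
    have b: "b \<in> J r" using j a by (auto intro: J_upd)
    have "Om r X s (ten a w) b = (\<Sum>i=1..r s. if i = a s then X s (a s) j w else 0)"
    proof -
      have "a(s := i) = a \<longleftrightarrow> i = a s" for i by (auto simp: fun_eq_iff)
      then have "X s i (b s) (ten a w (b(s := i))) = (if i = a s then X s (a s) j w else 0)" for i
        by (simp add: ten_def j(2) clin_zero[OF lin])
      then show ?thesis using b by (simp only: Om_def if_True)
    qed
    also have "\<dots> = (\<Sum>i=1..r s. if i = j then X s (a s) i w else 0)" using as j by simp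
    also have "\<dots> = (\<Sum>i=1..r s. ten (a(s := i)) (X s (a s) i w)) b"
    proof -
      have "b = a(s := i) \<longleftrightarrow> i = j" for i unfolding j(2) by (metis fun_upd_same)
      then show ?thesis by (simp add: sum_fun_apply ten_def)
    qed
    finally show ?thesis .
  next
    case False
    have "b(s := i) \<noteq> a" if "b \<in> J r" for i
    proof
      assume "b(s := i) = a"
      then have "b = a(s := b s)" by auto
      then show False using False J_range[OF that, of s] by blast
    qed
    then show ?thesis using False
      by (auto simp: Om_def sum_fun_apply ten_def clin_zero[OF lin] intro!: sum.neutral)
  qed
qed

lemma XM_ten:
  assumes a: "a \<in> J r" and ij: "i \<in> {1..r s}" "j \<in> {1..r s}"
  shows "XM r X s i j (ten a w) = ten a (X s i j w) + (if a s = j then ten (a(s := i)) w else 0)"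
proof
  fix b
  have "(b s = i \<and> b(s := j) = a) \<longleftrightarrow> (a s = j \<and> b = a(s := i))" by (auto simp: fun_eq_iff)
  moreover have "(if P then (if Q then w else 0) else 0) = (if P \<and> Q then w else 0)" for P Q by simp
  ultimately have "(if b s = i then ten a w (b(s := j)) else 0) = (if a s = j then ten (a(s := i)) w b else 0)"
    unfolding ten_def by (simp only:)
  moreover have "ten a u b = 0" "ten (a(s := i)) u b = 0" if "b \<notin> J r" for u :: 'v
    using that a J_upd[OF a ij(1)] by (auto simp: ten_def)
  moreover have "X s i j (ten a w b) = ten a (X s i j w) b" by (simp add: ten_def clin_zero[OF lin])
  ultimately show "XM r X s i j (ten a w) b = (ten a (X s i j w) + (if a s = j then ten (a(s := i)) w else 0)) b"
    by (cases "b \<in> J r") (simp_all add: XM_def)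
qed

end

lemma sum_split_at:
  fixes f :: "nat \<Rightarrow> 'c::ab_group_add"
  assumes "m \<in> {1..N}"
  shows "(\<Sum>j=1..N. f j) = (\<Sum>j\<in>{1..<m}. f j) + f m + (\<Sum>j\<in>{m<..N}. f j)"
proof -
  have "{1..N} = insert m ({1..<m} \<union> {m<..N})" using assms by auto
  moreover have "sum f ({1..<m} \<union> {m<..N}) = sum f {1..<m} + sum f {m<..N}"
    by (rule sum.union_disjoint) auto
  ultimately show ?thesis by (simp add: add_ac)
qed

context hw_mod
begin

text \<open>The content of the box which can be added in row \<open>i\<close>; it is the eigenvalue of \<open>Om\<close> on the
  corresponding component of the tensor product.\<close>

definition cont :: "bool \<Rightarrow> nat \<Rightarrow> complex" where
  "cont s i = \<alpha> s i - of_nat (i - 1)"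

text \<open>Up to lowering operators, \<open>Om\<close> acts on these tensors as a scalar: raising
  operators kill \<open>v\<close>, the diagonal one gives the weight, and each of the
  \<open>a s - 1\<close> lowering terms is an image under \<open>XM\<close> minus one copy of the
  tensor itself. The weight and these copies add up to the content.\<close>

lemma Om_ten_v:
  assumes a: "a \<in> J r"
  shows "Om r X s (ten a v) - cont s (a s) *\<^sub>C ten a v
    = (\<Sum>b\<in>{1..<a s}. XM r X s (a s) b (ten (a(s := b)) v))"
proof -
  have as: "a s \<in> {1..r s}" using a by (rule J_range)
  have "(\<Sum>b\<in>{1..<a s}. XM r X s (a s) b (ten (a(s := b)) v))
      = (\<Sum>b\<in>{1..<a s}. ten (a(s := b)) (X s (a s) b v) + ten a v)"
    using a as by (intro sum.cong refl, subst XM_ten) (auto intro: J_upd)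
  also have "\<dots> = (\<Sum>b\<in>{1..<a s}. ten (a(s := b)) (X s (a s) b v)) + of_nat (a s - 1) *\<^sub>C ten a v"
    by (simp add: sum.distrib cs.sum_constant_scale)
  finally have R: "(\<Sum>b\<in>{1..<a s}. XM r X s (a s) b (ten (a(s := b)) v)) = \<dots>" .
  have "(\<Sum>j\<in>{a s<..r s}. ten (a(s := j)) (X s (a s) j v)) = 0"
    using as by (intro sum.neutral ballI, subst raise_v) (auto simp: clin_zero[OF clin_ten])
  then have "Om r X s (ten a v) = (\<Sum>b\<in>{1..<a s}. ten (a(s := b)) (X s (a s) b v)) + \<alpha> s (a s) *\<^sub>C ten a v"
    unfolding Om_ten[OF a] using as by (subst sum_split_at[OF as]) (simp add: diag_v clin_scale[OF clin_ten])
  then show ?thesis unfolding R by (simp add: cont_def cs.scale_left_diff_distrib)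
qed

text \<open>The transpose of the preceding computation: \<open>\<phi>\<close> kills the images of
  lowering operators just as raising operators kill \<open>v\<close>.\<close>

lemma phi_Om:
  assumes a: "a \<in> J r"
  shows "\<phi> (Om r X s y a) = cont s (a s) * \<phi> (y a) + (\<Sum>b\<in>{1..<a s}. \<phi> (XM r X s b (a s) y (a(s := b))))"
proof -
  have as: "a s \<in> {1..r s}" using a by (rule J_range)
  have "(\<Sum>b\<in>{1..<a s}. \<phi> (XM r X s b (a s) y (a(s := b))))
      = (\<Sum>b\<in>{1..<a s}. \<phi> (X s b (a s) (y (a(s := b)))) + \<phi> (y a))"
    using a as by (intro sum.cong refl) (auto simp: XM_def J_upd clin_add[OF clin_phi])
  then have R: "(\<Sum>b\<in>{1..<a s}. \<phi> (XM r X s b (a s) y (a(s := b))))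
      = (\<Sum>b\<in>{1..<a s}. \<phi> (X s b (a s) (y (a(s := b))))) + of_nat (a s - 1) * \<phi> (y a)"
    by (simp add: sum.distrib)
  have "(\<Sum>j\<in>{a s<..r s}. \<phi> (X s j (a s) (y (a(s := j))))) = 0"
    using as by (intro sum.neutral ballI phi_lower) auto
  then have "\<phi> (Om r X s y a) = (\<Sum>b\<in>{1..<a s}. \<phi> (X s b (a s) (y (a(s := b))))) + \<alpha> s (a s) * \<phi> (y a)"
    using a as by (simp add: Om_def clin_sum[OF clin_phi] clin_add[OF clin_phi] sum_split_at[OF as] phi_diag)
  then show ?thesis unfolding R by (simp add: cont_def ring_distribs)
qed

end

section \<open>Casimir eigenvalues and products of equivariant maps\<close>

definition intertwining :: "(bool \<Rightarrow> nat) \<Rightarrow> 'a::cspace ops \<Rightarrow> 'b::cspace ops \<Rightarrow> 'a set \<Rightarrow> ((bool \<Rightarrow> nat) \<Rightarrow> 'a \<Rightarrow> 'b) \<Rightarrow> bool" where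
  "intertwining r XA XB V m \<longleftrightarrow> (\<forall>a\<in>J r. \<forall>s. \<forall>i\<in>{1..r s}. \<forall>j\<in>{1..r s}. \<forall>w\<in>V.
    XB s i j (m a w) = m a (XA s i j w) + (if a s = j then m (a(s := i)) w else 0))"

context hw_pair
begin

text \<open>The difference \<open>G\<close> of the two sides is again stable under commutators, so
  its highest weight coefficients decide. For an index other than \<open>d\<close> they vanish by
  weight. At \<open>d\<close> the diagonal term contributes the weight and each of the
  \<open>d s - 1\<close> lowering terms contributes -1, together the content of row
  \<open>d s\<close>.\<close>

lemma casimir_eigenvalue:
  assumes m: "\<And>a. a \<in> J r \<Longrightarrow> clin (m a)" "\<And>a w. a \<in> J r \<Longrightarrow> w \<in> VA \<Longrightarrow> m a w \<in> VB"
    and eq: "intertwining r XA XB VA m"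
    and d: "d \<in> J r" and wt: "\<And>s i. i \<in> {1..r s} \<Longrightarrow> \<alpha>B s i = \<alpha>A s i + (if d s = i then 1 else 0)"
    and a: "a \<in> J r" and w: "w \<in> VA"
  shows "(\<Sum>i=1..r s. m (a(s := i)) (XA s (a s) i w)) = A.cont s (d s) *\<^sub>C m a w"
proof -
  define G where "G a w = (\<Sum>i=1..r s. m (a(s := i)) (XA s (a s) i w)) - A.cont s (d s) *\<^sub>C m a w" for a w
  have X: "XB t i j (m a w) = m a (XA t i j w) + (if a t = j then m (a(t := i)) w else 0)"
    if "a \<in> J r" "i \<in> {1..r t}" "j \<in> {1..r t}" "w \<in> VA" for a t i j w
    using eq that by (auto simp: intertwining_def)
  have VA: "XA t i j w \<in> VA" if "w \<in> VA" "i \<in> {1..r t}" "j \<in> {1..r t}" for t i j w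
    using A.low_closed[OF A.hw] that by blast
  have com: "XB t k l (G a w) = G a (XA t k l w) + (if a t = l then G (a(t := k)) w else 0)"
    if a: "a \<in> J r" and kl: "k \<in> {1..r t}" "l \<in> {1..r t}" and w: "w \<in> VA" for a t k l w
  proof -
    have as: "a s \<in> {1..r s}" using a by (rule J_range)
    have aj: "a(s := j) \<in> J r" if "j \<in> {1..r s}" for j using a that by (intro J_upd)
    let ?S = "\<lambda>f. \<Sum>i=1..r s. f i"
    have e: "XB t k l (?S (\<lambda>i. m (a(s := i)) (XA s (a s) i w)))
      = ?S (\<lambda>i. m (a(s := i)) (XA t k l (XA s (a s) i w))
          + (if (a(s := i)) t = l then m (a(s := i, t := k)) (XA s (a s) i w) else 0))"
      unfolding clin_sum[OF B.lin] by (intro sum.cong refl X aj kl VA w as) auto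
    have main: "XB t k l (?S (\<lambda>i. m (a(s := i)) (XA s (a s) i w)))
      = ?S (\<lambda>i. m (a(s := i)) (XA s (a s) i (XA t k l w)))
        + (if a t = l then ?S (\<lambda>i. m (a(t := k, s := i)) (XA s ((a(t := k)) s) i w)) else 0)"
    proof (cases "s = t")
      case False
      have "XA t k l (XA s (a s) i w) = XA s (a s) i (XA t k l w)" if "i \<in> {1..r s}" for i
        using A.bracket[OF kl as that] False by simp
      moreover have "a(s := i, t := k) = a(t := k, s := i)" for i using False by auto
      ultimately show ?thesis unfolding e using False by (auto simp: sum.distrib)
    next
      case True
      have "m (a(s := i)) (XA t k l (XA s (a s) i w)) + (if (a(s := i)) t = l then m (a(s := i, t := k)) (XA s (a s) i w) else 0)
        = m (a(s := i)) (XA s (a s) i (XA t k l w)) + (if a s = l then m (a(s := i)) (XA s k i w) else 0)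
          - (if i = k then m (a(s := k)) (XA s (a s) l w) else 0)
          + (if i = l then m (a(s := k)) (XA s (a s) l w) else 0)" if i: "i \<in> {1..r s}" for i
      proof -
        have "XA t k l (XA s (a s) i w) = XA s (a s) i (XA t k l w)
            + ((if l = a s then XA s k i w else 0) - (if k = i then XA s (a s) l w else 0))"
          using A.bracket[OF kl as[unfolded True] i[unfolded True], of w] True by simp
        moreover have l: "clin (m (a(s := i)))" using m(1)[OF aj[OF i]] .
        moreover have "m (a(s := i)) (if c then x else 0) = (if c then m (a(s := i)) x else 0)" for c x
          by (simp add: clin_zero[OF l])
        ultimately have "m (a(s := i)) (XA t k l (XA s (a s) i w)) = m (a(s := i)) (XA s (a s) i (XA t k l w))
            + ((if l = a s then m (a(s := i)) (XA s k i w) else 0) - (if k = i then m (a(s := i)) (XA s (a s) l w) else 0))"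
          by (simp only: clin_add[OF l] clin_diff[OF l])
        then show ?thesis using True by auto
      qed
      then have "XB t k l (?S (\<lambda>i. m (a(s := i)) (XA s (a s) i w)))
        = ?S (\<lambda>i. m (a(s := i)) (XA s (a s) i (XA t k l w)) + (if a s = l then m (a(s := i)) (XA s k i w) else 0)
          - (if i = k then m (a(s := k)) (XA s (a s) l w) else 0)
          + (if i = l then m (a(s := k)) (XA s (a s) l w) else 0))"
        unfolding e by (intro sum.cong) auto
      also have "\<dots> = ?S (\<lambda>i. m (a(s := i)) (XA s (a s) i (XA t k l w)))
          + (if a s = l then ?S (\<lambda>i. m (a(s := i)) (XA s k i w)) else 0)"
        using kl True by (auto simp: sum.distrib sum_subtractf)
      finally show ?thesis using True by simp
    qed
    show ?thesis unfolding G_def clin_diff[OF B.lin] clin_scale[OF B.lin] main X[OF a kl w]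
      by (simp add: scaleC_add_right)
  qed
  have Gv: "\<phi>B (G a vA) = 0" if a: "a \<in> J r" for a
  proof (cases "a = d")
    case False
    then obtain t where t: "a t \<noteq> d t" by auto
    have at: "a t \<in> {1..r t}" using a by (rule J_range)
    have lG: "clin (G a)" unfolding G_def[abs_def]
      using a J_range[OF a] by (intro clin_sub clin_sum_fun clin_smul clin_comp[OF m(1)] A.lin m(1)) (auto intro: J_upd)
    have "XB t (a t) (a t) (G a vA) = (\<alpha>A t (a t) + 1) *\<^sub>C G a vA"
      using com[OF a at at low.base] at by (simp add: A.diag_v clin_scale[OF lG] scaleC_add_left scaleC_one)
    then have "\<alpha>B t (a t) * \<phi>B (G a vA) = (\<alpha>A t (a t) + 1) * \<phi>B (G a vA)"
      using B.phi_diag[OF at, of "G a vA"] by (simp only: clin_scale[OF B.clin_phi] scaleC_complex)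
    moreover have "\<alpha>B t (a t) = \<alpha>A t (a t)" using wt[OF at] t by simp
    ultimately show ?thesis by simp
  next
    case True
    have ds: "d s \<in> {1..r s}" using d by (rule J_range)
    have lo: "\<phi>B (m (d(s := i)) (XA s (d s) i vA)) = - \<phi>B (m d vA)" if i: "i \<in> {1..<d s}" for i
    proof -
      have "XB s (d s) i (m (d(s := i)) vA) = m (d(s := i)) (XA s (d s) i vA) + m d vA"
        using X[OF J_upd[OF d] ds, of i s i vA] i ds by (auto intro: low.base)
      moreover have "\<phi>B (XB s (d s) i (m (d(s := i)) vA)) = 0" using i ds by (intro B.phi_lower) auto
      ultimately show ?thesis by (simp add: clin_add[OF B.clin_phi] eq_neg_iff_add_eq_0)
    qed
    have up: "\<phi>B (m (d(s := i)) (XA s (d s) i vA)) = 0" if "i \<in> {d s<..r s}" for i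
    proof -
      have "XA s (d s) i vA = 0" using that ds by (intro A.raise_v) auto
      moreover have "clin (m (d(s := i)))" using that ds d by (intro m(1) J_upd) auto
      ultimately show ?thesis by (simp add: clin_zero[of "m (d(s := i))"] clin_zero[OF B.clin_phi])
    qed
    have "\<phi>B (\<Sum>i=1..r s. m (d(s := i)) (XA s (d s) i vA)) = A.cont s (d s) * \<phi>B (m d vA)"
      unfolding clin_sum[OF B.clin_phi] sum_split_at[OF ds]
      using lo up ds by (simp add: clin_add[OF B.clin_phi] clin_sum[OF B.clin_phi] A.diag_v
          clin_scale[OF m(1)[OF d]] clin_scale[OF B.clin_phi] A.cont_def ring_distribs of_nat_diff)
    then show ?thesis using True unfolding G_def
      by (simp add: clin_diff[OF B.clin_phi] clin_scale[OF B.clin_phi])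
  qed
  have "G a w = 0"
  proof (rule family_zero[of "G ` J r"])
    fix F assume "F \<in> G ` J r"
    then obtain a where F: "F = G a" "a \<in> J r" by blast
    show "clin F" unfolding F(1) G_def[abs_def]
      using F(2) J_range[OF F(2)] by (intro clin_sub clin_sum_fun clin_smul clin_comp[OF m(1)] A.lin m(1)) (auto intro: J_upd)
    show "F w \<in> VB" if w: "w \<in> VA" for w
    proof -
      have "(\<Sum>i\<in>I. m (a(s := i)) (XA s (a s) i w)) \<in> VB" if "I \<subseteq> {1..r s}" for I
      proof -
        have "finite I" using that finite_subset by blast
        then show ?thesis using that
        proof (induction I rule: finite_induct)
          case (insert i I)
          then have i: "i \<in> {1..r s}" by auto
          have "(\<Sum>i\<in>I. m (a(s := i)) (XA s (a s) i w)) \<in> VB" using insert.IH insert.prems by blast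
          then show ?case unfolding sum.insert[OF insert.hyps(1,2)]
            by (rule low.add[OF m(2)[OF J_upd[OF F(2) i] VA[OF w J_range[OF F(2)] i]]])
        qed (simp add: low_zero)
      qed
      then show ?thesis unfolding F(1) G_def using F(2) w by (auto intro!: low_diff low.scale m(2))
    qed
    show "\<phi>B (F vA) = 0" using Gv F by auto
    fix t k l assume kl: "k \<in> {1..r t}" "l \<in> {1..r t}"
    show "\<exists>Gs. set Gs \<subseteq> G ` J r \<and> (\<forall>w\<in>VA. XB t k l (F w) = F (XA t k l w) + (\<Sum>G\<leftarrow>Gs. G w))"
      unfolding F(1) using com[OF F(2) kl] J_upd[OF F(2) kl(1)]
      by (intro exI[of _ "if a t = l then [G (a(t := k))] else []"]) auto
  qed (use a w in auto)
  then show ?thesis by (simp add: G_def)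
qed

text \<open>Exchanging the entries of the two tensor factors on one side: the action of a simple
  reflection in Young's seminormal form.\<close>

lemma swap_coefficient:
  assumes m: "\<And>a. a \<in> J r \<Longrightarrow> clin (m a)" "\<And>a w. a \<in> J r \<Longrightarrow> w \<in> VA \<Longrightarrow> m a w \<in> VB"
    and eq: "intertwining r XA XB VA m"
    and d: "d \<in> J r" and wt: "\<And>s i. i \<in> {1..r s} \<Longrightarrow> \<alpha>B s i = \<alpha>A s i + (if d s = i then 1 else 0)"
    and m': "\<And>a. a \<in> J r \<Longrightarrow> clin (m' a)" and eq': "intertwining r XB XC VB m'"
    and \<phi>: "clin \<phi>" "\<And>s i j w. 1 \<le> j \<Longrightarrow> j < i \<Longrightarrow> i \<le> r s \<Longrightarrow> \<phi> (XC s i j w) = (0::complex)"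
    and a: "a \<in> J r" "a' \<in> J r" "a' s = d s"
  shows "(A.cont s (d s) - A.cont s (a s)) * \<phi> (m' a' (m a vA))
    = (if d s < a s then - \<phi> (m' (a'(s := a s)) (m (a(s := d s)) vA)) else 0)"
proof -
  define T where "T a' a = \<phi> (m' a' (m a vA))" for a' a
  have as: "a s \<in> {1..r s}" using a(1) by (rule J_range)
  have VA: "XA t i j w \<in> VA" if "w \<in> VA" "i \<in> {1..r t}" "j \<in> {1..r t}" for t i j w
    using A.low_closed[OF A.hw] that by blast
  \<comment> \<open>The lowering operator is moved to the left through both maps, where
    \<open>\<phi>\<close> kills it. The inner map always leaves a Leibniz term, the outer one only
    if \<open>i = d s\<close>; the latter is the exchanged coefficient.\<close>
  have lo: "\<phi> (m' a' (m (a(s := i)) (XA s (a s) i vA)))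
      = - (if i = d s then T (a'(s := a s)) (a(s := d s)) else 0) - T a' a" if i: "i \<in> {1..<a s}" for i
  proof -
    have i': "i \<in> {1..r s}" "a(s := i) \<in> J r" using i as a by (auto intro!: J_upd)
    have mV: "m (a(s := i)) vA \<in> VB" using m(2)[OF i'(2)] low.base by blast
    have e1: "XB s (a s) i (m (a(s := i)) vA) = m (a(s := i)) (XA s (a s) i vA) + m a vA"
      using eq[unfolded intertwining_def, rule_format, OF i'(2) as i'(1) low.base] by simp
    have e2: "XC s (a s) i (m' a' (m (a(s := i)) vA)) = m' a' (XB s (a s) i (m (a(s := i)) vA))
        + (if a' s = i then m' (a'(s := a s)) (m (a(s := i)) vA) else 0)"
      using eq' a i' as mV by (auto simp: intertwining_def)
    have "\<phi> (XC s (a s) i (m' a' (m (a(s := i)) vA))) = 0" using i as by (intro \<phi>(2)) auto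
    then have "0 = \<phi> (m' a' (m (a(s := i)) (XA s (a s) i vA))) + T a' a
        + (if i = d s then T (a'(s := a s)) (a(s := d s)) else 0)"
      unfolding e2 e1 clin_add[OF m'[OF a(2)]] using a(3)
      by (auto simp: clin_add[OF \<phi>(1)] clin_zero[OF \<phi>(1)] T_def)
    then show ?thesis by (metis (no_types, lifting) add_diff_cancel_right' diff_0 diff_diff_eq2 minus_diff_eq uminus_add_conv_diff)
  qed
  have up: "\<phi> (m' a' (m (a(s := i)) (XA s (a s) i vA))) = 0" if "i \<in> {a s<..r s}" for i
  proof -
    have "XA s (a s) i vA = 0" using that as by (intro A.raise_v) auto
    moreover have "clin (m (a(s := i)))" using that as a by (intro m(1) J_upd) auto
    ultimately show ?thesis
      by (simp add: clin_zero[of "m (a(s := i))"] clin_zero[OF \<phi>(1)] clin_zero[OF m'[OF a(2)]])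
  qed
  \<comment> \<open>Evaluating the Casimir sum once by its eigenvalue and once term by term gives a
    linear equation between the two coefficients.\<close>
  have cas: "A.cont s (d s) *\<^sub>C m a vA = (\<Sum>i=1..r s. m (a(s := i)) (XA s (a s) i vA))"
    by (rule casimir_eigenvalue[OF m eq d wt a(1) low.base, symmetric])
  have "A.cont s (d s) * T a' a = \<phi> (m' a' (A.cont s (d s) *\<^sub>C m a vA))"
    by (simp add: T_def clin_scale[OF \<phi>(1)] clin_scale[OF m'[OF a(2)]])
  also have "\<dots> = (\<Sum>i=1..r s. \<phi> (m' a' (m (a(s := i)) (XA s (a s) i vA))))"
    unfolding cas by (simp add: clin_sum[OF \<phi>(1)] clin_sum[OF m'[OF a(2)]])
  also have "\<dots> = (\<Sum>i\<in>{1..<a s}. - (if i = d s then T (a'(s := a s)) (a(s := d s)) else 0) - T a' a) + \<alpha>A s (a s) * T a' a"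
    unfolding sum_split_at[OF as] using lo up as
    by (simp add: A.diag_v clin_scale[OF m(1)[OF a(1)]] clin_scale[OF m'[OF a(2)]] clin_scale[OF \<phi>(1)] T_def)
  also have "(\<Sum>i\<in>{1..<a s}. - (if i = d s then T (a'(s := a s)) (a(s := d s)) else 0) - T a' a)
      = (if d s < a s then - T (a'(s := a s)) (a(s := d s)) else 0) - of_nat (a s - 1) * T a' a"
    using J_range[OF d, of s] by (auto simp: sum_subtractf sum_negf)
  finally show ?thesis unfolding T_def[symmetric] by (simp add: A.cont_def ring_distribs)
qed

end

section \<open>Existence of arrows\<close>

text \<open>\<open>b\<close> is a left eigenvector of the triangular matrix with diagonal entries
  \<open>c i\<close> and all entries below the diagonal equal to 1. Its tail sums \<open>B a\<close>
  satisfy a two-term recursion, which gives them as products; the total is the product of all (c_j -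
  c_i + 1)/(c_j - c_i), and \<open>nd\<close> keeps it from vanishing.\<close>

lemma left_eigenvector:
  fixes c :: "nat \<Rightarrow> complex"
  assumes j: "1 \<le> j" and ne: "\<And>i. i \<in> {1..<j} \<Longrightarrow> c i \<noteq> c j" and nd: "\<And>i. i \<in> {1..<j} \<Longrightarrow> c j - c i + 1 \<noteq> 0"
  obtains b where "b j = 1" "\<And>a. a \<in> {1..j} \<Longrightarrow> c a * b a + (\<Sum>p\<in>{a<..j}. b p) = c j * b a"
    "(\<Sum>p\<in>{1..j}. b p) \<noteq> 0"
proof -
  define B where "B a = (\<Prod>i\<in>{a..<j}. (c j - c i + 1) / (c j - c i))" for a
  define b where "b a = B a - (if a < j then B (Suc a) else 0)" for a
  have sum: "(\<Sum>p\<in>{a..j}. b p) = B a" if "a \<in> {1..j}" for a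
  proof -
    have "a \<le> j" using that by simp
    then show ?thesis
    proof (induction a rule: inc_induct)
      case (step a)
      have "{a..j} = insert a {Suc a..j}" using step by auto
      then show ?case using step by (simp add: b_def)
    qed (simp add: b_def)
  qed
  have "c a * b a + (\<Sum>p\<in>{a<..j}. b p) = c j * b a" if a: "a \<in> {1..j}" for a
  proof (cases "a = j")
    case False
    then have "(\<Sum>p\<in>{a<..j}. b p) = B (Suc a)"
      using sum[of "Suc a"] a False by (simp add: atLeastSucAtMost_greaterThanAtMost[symmetric])
    moreover have "B a = (c j - c a + 1) / (c j - c a) * B (Suc a)"
      using a False by (simp add: B_def prod.atLeast_Suc_lessThan)
    ultimately show ?thesis using a False ne[of a]
      by (simp add: b_def field_simps)
  qed simp
  moreover have "b j = 1" by (simp add: b_def B_def)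
  moreover have "(\<Sum>p\<in>{1..j}. b p) \<noteq> 0"
  proof -
    have "(c j - c i + 1) / (c j - c i) \<noteq> 0" if "i \<in> {1..<j}" for i
      using ne[OF that] nd[OF that] by simp
    then have "B 1 \<noteq> 0" unfolding B_def prod_zero_iff[OF finite_atLeastLessThan] by blast
    then show ?thesis using sum[of 1] j by simp
  qed
  ultimately show ?thesis using that by blast
qed

lemma mset_map_remove1:
  assumes "x \<in> set xs"
  shows "mset (map f xs) = mset (f x # map f (remove1 x xs))"
proof -
  have "mset xs = add_mset x (mset (remove1 x xs))" using assms by simp
  then show ?thesis unfolding mset_map mset.simps by (metis image_mset_add_mset)
qed

context hw_mod
begin

text \<open>A product over all rows except \<open>d s\<close>: up to a scalar, the projection onto
  the part of the tensor product where \<open>Om\<close> has the content of row \<open>d s\<close>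
  as eigenvalue.\<close>

definition Fs :: "(bool \<Rightarrow> nat) \<Rightarrow> bool \<Rightarrow> ((bool \<Rightarrow> nat) \<Rightarrow> 'v) \<Rightarrow> ((bool \<Rightarrow> nat) \<Rightarrow> 'v)" where
  "Fs d s = shifts (Om r X s) (map (cont s) (remove1 (d s) [1..<r s + 1]))"

definition FF :: "(bool \<Rightarrow> nat) \<Rightarrow> ((bool \<Rightarrow> nat) \<Rightarrow> 'v) \<Rightarrow> ((bool \<Rightarrow> nat) \<Rightarrow> 'v)" where
  "FF d y = Fs d True (Fs d False y)"

lemma clin_Fs: "clin (Fs d s)"
  unfolding Fs_def by (intro clin_shifts clin_Om)

lemma clin_FF: "clin (FF d)"
  unfolding FF_def[abs_def] by (intro clin_comp[OF clin_Fs] clin_Fs)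

lemma shifts_Om_XM:
  "k \<in> {1..r t} \<Longrightarrow> l \<in> {1..r t} \<Longrightarrow> XM r X t k l (shifts (Om r X s) cs y) = shifts (Om r X s) cs (XM r X t k l y)"
  using shifts_commute[of "XM r X t k l" "Om r X s", OF clin_XM clin_Om Om_XM] .

lemma FF_XM: "k \<in> {1..r t} \<Longrightarrow> l \<in> {1..r t} \<Longrightarrow> XM r X t k l (FF d y) = FF d (XM r X t k l y)"
  by (simp add: FF_def Fs_def shifts_Om_XM)

lemma Om_Fs: "Om r X s (Fs d t y) = Fs d t (Om r X s y)"
proof -
  have "Om r X s (Om r X t w) = Om r X t (Om r X s w)" for w by (cases "s = t") (simp, rule Om_Om)
  from shifts_commute[of "Om r X s" "Om r X t", OF clin_Om clin_Om this] show ?thesis unfolding Fs_def .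
qed

lemma Fs_Fs: "Fs d s (Fs d t y) = Fs d t (Fs d s y)"
proof -
  have "Fs d s (Om r X t w) = Om r X t (Fs d s w)" for w by (rule Om_Fs[symmetric])
  from shifts_commute[of "Fs d s" "Om r X t", OF clin_Fs clin_Om this]
  show ?thesis unfolding Fs_def[of d t] .
qed

text \<open>The factor of row \<open>a s\<close> turns the tensor into images, under lowering
  operators, of tensors with smaller index, and the remaining factors kill those by induction. This
  is why the rows up to \<open>a s\<close> suffice.\<close>

lemma shifts_kill:
  assumes "a \<in> J r" "{1..a s} \<subseteq> set is"
  shows "shifts (Om r X s) (map (cont s) is) (ten a v) = 0"
  using assms
proof (induction "a s" arbitrary: a "is" rule: less_induct)
  case less
  have as: "a s \<in> {1..r s}" "a s \<in> set is" using less.prems J_range[of a r s] by auto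
  let ?js = "remove1 (a s) is"
  have "mset (map (cont s) is) = mset (cont s (a s) # map (cont s) ?js)"
    by (rule mset_map_remove1[OF as(2), of "cont s"])
  then have "shifts (Om r X s) (map (cont s) is) (ten a v)
      = shifts (Om r X s) (cont s (a s) # map (cont s) ?js) (ten a v)" by (rule shifts_mset[OF clin_Om])
  also have "\<dots> = shifts (Om r X s) (map (cont s) ?js) (\<Sum>b\<in>{1..<a s}. XM r X s (a s) b (ten (a(s := b)) v))"
    by (simp only: shifts_Cons'[OF clin_Om] Om_ten_v[OF less.prems(1)])
  also have "\<dots> = (\<Sum>b\<in>{1..<a s}. XM r X s (a s) b (shifts (Om r X s) (map (cont s) ?js) (ten (a(s := b)) v)))"
    using as by (simp add: clin_sum[OF clin_shifts[OF clin_Om]] shifts_Om_XM)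
  also have "\<dots> = 0"
  proof (intro sum.neutral ballI)
    fix b assume b: "b \<in> {1..<a s}"
    have "x \<in> set ?js" if x: "x \<in> {1..b}" for x
    proof -
      have "x \<in> {1..a s}" "x \<noteq> a s" using x b by auto
      then show ?thesis using subsetD[OF less.prems(2)] by (simp add: in_set_remove1)
    qed
    then have "{1..b} \<subseteq> set ?js" by blast
    then have "shifts (Om r X s) (map (cont s) ?js) (ten (a(s := b)) v) = 0"
      using b as less.hyps[of "a(s := b)" ?js] J_upd[OF less.prems(1), of b s] by auto
    then show "XM r X s (a s) b (shifts (Om r X s) (map (cont s) ?js) (ten (a(s := b)) v)) = 0"
      by (simp add: clin_zero[OF clin_XM])
  qed
  finally show ?case .
qed

text \<open>The same triangular induction on the side of the functional, based on
  \<open>phi_Om\<close>; the raising operators commute with \<open>Om\<close> and are absorbed into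
  the arbitrary \<open>y\<close>.\<close>

lemma shifts_kill_dual:
  assumes "a \<in> J r" "{1..a s} \<subseteq> set is"
  shows "\<phi> (shifts (Om r X s) (map (cont s) is) y a) = 0"
  using assms
proof (induction "a s" arbitrary: a "is" y rule: less_induct)
  case less
  have as: "a s \<in> {1..r s}" "a s \<in> set is" using less.prems J_range[of a r s] by auto
  let ?js = "remove1 (a s) is"
  define z where "z = shifts (Om r X s) (map (cont s) ?js) y"
  have "mset (map (cont s) is) = mset (cont s (a s) # map (cont s) ?js)"
    by (rule mset_map_remove1[OF as(2), of "cont s"])
  then have "shifts (Om r X s) (map (cont s) is) y = shifts (Om r X s) (cont s (a s) # map (cont s) ?js) y"
    by (rule shifts_mset[OF clin_Om])
  also have "\<dots> = Om r X s z - cont s (a s) *\<^sub>C z" by (simp add: shifts_Cons z_def)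
  finally have "\<phi> (shifts (Om r X s) (map (cont s) is) y a)
      = (\<Sum>b\<in>{1..<a s}. \<phi> (XM r X s b (a s) z (a(s := b))))"
    using phi_Om[OF less.prems(1), of s z] by (simp add: clin_diff[OF clin_phi] clin_scale[OF clin_phi])
  also have "\<dots> = 0"
  proof (intro sum.neutral ballI)
    fix b assume b: "b \<in> {1..<a s}"
    have "x \<in> set ?js" if x: "x \<in> {1..b}" for x
    proof -
      have "x \<in> {1..a s}" "x \<noteq> a s" using x b by auto
      then show ?thesis using subsetD[OF less.prems(2)] by (simp add: in_set_remove1)
    qed
    then have "{1..b} \<subseteq> set ?js" by blast
    then have "\<phi> (shifts (Om r X s) (map (cont s) ?js) (XM r X s b (a s) y) (a(s := b))) = 0"
      using b as less.hyps[of "a(s := b)" ?js] J_upd[OF less.prems(1), of b s] by auto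
    then show "\<phi> (XM r X s b (a s) z (a(s := b))) = 0" using as b by (simp add: z_def shifts_Om_XM)
  qed
  finally show ?case .
qed

abbreviation "MV \<equiv> {y. (\<forall>a\<in>J r. y a \<in> low r X v) \<and> (\<forall>a. a \<notin> J r \<longrightarrow> y a = 0)}"

text \<open>By the Leibniz rule, a lowering operator on the module factor is \<open>XM\<close> minus
  a tensor with changed index, so the tensors of \<open>v\<close> generate all others under the
  action.\<close>

lemma ten_induct:
  assumes a: "a \<in> J r" and w: "w \<in> low r X v"
    and P0: "P 0" and Padd: "\<And>y z. P y \<Longrightarrow> P z \<Longrightarrow> P (y + z)" and Psc: "\<And>c y. P y \<Longrightarrow> P (c *\<^sub>C y)"
    and PX: "\<And>s i j y. i \<in> {1..r s} \<Longrightarrow> j \<in> {1..r s} \<Longrightarrow> P y \<Longrightarrow> P (XM r X s i j y)"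
    and Pv: "\<And>a. a \<in> J r \<Longrightarrow> P (ten a v)"
  shows "P (ten a w)"
  using w a
proof (induction arbitrary: a rule: low.induct)
  case base
  then show ?case by (rule Pv)
next
  case (add w w')
  then show ?case unfolding clin_add[OF clin_ten] by (intro Padd) auto
next
  case (scale w c)
  then show ?case unfolding clin_scale[OF clin_ten] by (intro Psc) auto
next
  case (lower w j i s)
  then have ij: "i \<in> {1..r s}" "j \<in> {1..r s}" by auto
  have "P (ten (a(s := i)) w)" using lower.IH[OF J_upd[OF lower.prems ij(1)]] .
  then have "P (if a s = j then ten (a(s := i)) w else 0)" using P0 by simp
  then have u: "P (- 1 *\<^sub>C (if a s = j then ten (a(s := i)) w else 0))" by (rule Psc)
  have "P (XM r X s i j (ten a w))" using PX[OF ij] lower by auto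
  moreover have "ten a (X s i j w) = XM r X s i j (ten a w) + - 1 *\<^sub>C (if a s = j then ten (a(s := i)) w else 0)"
    unfolding XM_ten[OF lower.prems ij] by (simp only: cs.scale_minus_left scaleC_one add.assoc add.right_inverse add_0_right)
  ultimately show ?case using Padd[OF _ u] by (simp only:)
qed

text \<open>The characteristic identity of \<open>Om\<close>: the contents of all rows exhaust its
  possible eigenvalues.\<close>

lemma shifts_all_zero:
  assumes "a \<in> J r" "w \<in> low r X v"
  shows "shifts (Om r X s) (map (cont s) [1..<r s + 1]) (ten a w) = 0"
  using assms
proof (rule ten_induct[where P = "\<lambda>y. shifts (Om r X s) (map (cont s) [1..<r s + 1]) y = 0"])
  fix a assume "a \<in> J r"
  then show "shifts (Om r X s) (map (cont s) [1..<r s + 1]) (ten a v) = 0"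
    using J_range[of a r s] by (intro shifts_kill) auto
next
  fix t i j y assume "i \<in> {1..r t}" "j \<in> {1..r t}" "shifts (Om r X s) (map (cont s) [1..<r s + 1]) y = 0"
  then show "shifts (Om r X s) (map (cont s) [1..<r s + 1]) (XM r X t i j y) = 0"
    by (simp add: shifts_Om_XM[symmetric] clin_zero[OF clin_XM])
qed (simp_all only: clin_zero[OF clin_shifts[OF clin_Om]] clin_add[OF clin_shifts[OF clin_Om]]
    clin_scale[OF clin_shifts[OF clin_Om]] add_0_right cs.scale_zero_right)

context
  fixes d assumes d: "d \<in> J r"
begin

lemma Om_Fs_ten:
  assumes "a \<in> J r" "w \<in> low r X v"
  shows "Om r X s (Fs d s (ten a w)) = cont s (d s) *\<^sub>C Fs d s (ten a w)"
proof -
  have ds: "d s \<in> {1..r s}" using d by (rule J_range)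
  have "mset (map (cont s) [1..<r s + 1]) = mset (cont s (d s) # map (cont s) (remove1 (d s) [1..<r s + 1]))"
    by (rule mset_map_remove1[of "d s" "[1..<r s + 1]" "cont s"]) (use ds in auto)
  then have "shifts (Om r X s) (cont s (d s) # map (cont s) (remove1 (d s) [1..<r s + 1])) (ten a w) = 0"
    using shifts_mset[OF clin_Om] shifts_all_zero[OF assms, of s] by metis
  then show ?thesis by (simp add: shifts_Cons Fs_def)
qed

lemma Om_FF_ten:
  assumes "a \<in> J r" "w \<in> low r X v"
  shows "Om r X s (FF d (ten a w)) = cont s (d s) *\<^sub>C FF d (ten a w)"
proof (cases s)
  case True
  have "Om r X True (FF d (ten a w)) = Fs d False (Om r X True (Fs d True (ten a w)))"
    unfolding FF_def Fs_Fs[of d True False] Om_Fs[of True d False] ..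
  then show ?thesis using True
    unfolding Om_Fs_ten[OF assms] clin_scale[OF clin_Fs] FF_def Fs_Fs[of d True False] by simp
next
  case False
  have "Om r X False (FF d (ten a w)) = Fs d True (Om r X False (Fs d False (ten a w)))"
    unfolding FF_def Om_Fs[of False d True] ..
  then show ?thesis using False
    unfolding Om_Fs_ten[OF assms] clin_scale[OF clin_Fs] FF_def by simp
qed

lemma Fs_kill: "a \<in> J r \<Longrightarrow> a s < d s \<Longrightarrow> Fs d s (ten a v) = 0"
  unfolding Fs_def using J_range[of a r s] by (intro shifts_kill) auto

lemma FF_kill: "a \<in> J r \<Longrightarrow> a s < d s \<Longrightarrow> FF d (ten a v) = 0"
  using Fs_kill[of a s]
  by (cases s) (simp add: FF_def Fs_Fs[of d True False] clin_zero[OF clin_Fs], simp add: FF_def clin_zero[OF clin_Fs])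

lemma Fs_kill_dual: "a \<in> J r \<Longrightarrow> a s < d s \<Longrightarrow> \<phi> (Fs d s y a) = 0"
  unfolding Fs_def using J_range[of a r s] by (intro shifts_kill_dual) auto

lemma FF_kill_dual: "a \<in> J r \<Longrightarrow> a s < d s \<Longrightarrow> \<phi> (FF d y a) = 0"
  using Fs_kill_dual[of a s] by (cases s) (simp add: FF_def, simp add: FF_def Fs_Fs[of d True False])

text \<open>The eigenvalue of \<open>Fs d s\<close> on its own image, hence the scalar by which it
  differs from a projection.\<close>

definition PP :: "bool \<Rightarrow> complex" where
  "PP s = (\<Prod>i\<leftarrow>remove1 (d s) [1..<r s + 1]. cont s (d s) - cont s i)"

lemma Fs_twice: "a \<in> J r \<Longrightarrow> w \<in> low r X v \<Longrightarrow> Fs d s (Fs d s (ten a w)) = PP s *\<^sub>C Fs d s (ten a w)"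
proof -
  assume a: "a \<in> J r" "w \<in> low r X v"
  have "shifts (Om r X s) cs (Fs d s (ten a w)) = (\<Prod>c\<leftarrow>cs. cont s (d s) - c) *\<^sub>C Fs d s (ten a w)" for cs
    by (rule shifts_eigen[OF clin_Om Om_Fs_ten[OF a]])
  from this[of "map (cont s) (remove1 (d s) [1..<r s + 1])"] show ?thesis
    by (simp only: Fs_def[of d s, symmetric] PP_def map_map comp_def)
qed

lemma FF_twice: "a \<in> J r \<Longrightarrow> w \<in> low r X v \<Longrightarrow> FF d (FF d (ten a w)) = (PP True * PP False) *\<^sub>C FF d (ten a w)"
proof -
  assume a: "a \<in> J r" "w \<in> low r X v"
  have "FF d (FF d (ten a w)) = Fs d True (Fs d False (Fs d False (Fs d True (ten a w))))"
    unfolding FF_def Fs_Fs[of d True False "ten a w"] ..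
  also have "\<dots> = Fs d False (Fs d False (Fs d True (Fs d True (ten a w))))"
    unfolding Fs_Fs[of d True False] ..
  also have "\<dots> = PP True *\<^sub>C Fs d True (Fs d False (Fs d False (ten a w)))"
    unfolding Fs_twice[OF a] clin_scale[OF clin_Fs] Fs_Fs[of d False True] ..
  also have "\<dots> = (PP True * PP False) *\<^sub>C FF d (ten a w)"
    unfolding Fs_twice[OF a] clin_scale[OF clin_Fs] FF_def scaleC_scaleC ..
  finally show ?thesis .
qed

lemma PP_nonzero:
  assumes "\<And>i. i \<in> {1..r s} \<Longrightarrow> i \<noteq> d s \<Longrightarrow> cont s i \<noteq> cont s (d s)"
  shows "PP s \<noteq> 0"
  using assms by (force simp: PP_def prod_list_zero_iff set_remove1_eq)

text \<open>Let \<open>L\<close> be the combination of diagonal coefficients with the left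
  eigenvector \<open>b\<close> as weights. Inserting \<open>Om\<close> multiplies \<open>L\<close>
  by the content of row \<open>d s\<close>, so inserting \<open>Fs\<close> multiplies it by
  \<open>PP s\<close>; and after \<open>Fs\<close> is inserted only the term of row
  \<open>d s\<close> survives, as \<open>Fs\<close> kills the smaller indices. The operator
  \<open>K\<close> stays general so that the two factors can be treated one after the other.\<close>

lemma diagonal_coefficient:
  assumes K: "clin K" "\<And>t k l y. k \<in> {1..r t} \<Longrightarrow> l \<in> {1..r t} \<Longrightarrow> XM r X t k l (K y) = K (XM r X t k l y)"
    "\<And>y. K (Om r X s y) = Om r X s (K y)"
    and a: "a \<in> J r" "a s = d s"
    and b: "b (d s) = 1" "\<And>a. a \<in> {1..d s} \<Longrightarrow> cont s a * b a + (\<Sum>p\<in>{a<..d s}. b p) = cont s (d s) * b a"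
  shows "\<phi> (K (Fs d s (ten a v)) a) = PP s * (\<Sum>i\<in>{1..d s}. b i * \<phi> (K (ten (a(s := i)) v) (a(s := i))))"
proof -
  have ds: "d s \<in> {1..r s}" using d by (rule J_range)
  have ai: "a(s := i) \<in> J r" if "i \<in> {1..d s}" for i using that ds a by (intro J_upd) auto
  define L where "L K = (\<Sum>i\<in>{1..d s}. b i * \<phi> (K (ten (a(s := i)) v) (a(s := i))))" for K :: "((bool \<Rightarrow> nat) \<Rightarrow> 'v) \<Rightarrow> ((bool \<Rightarrow> nat) \<Rightarrow> 'v)"
  have step: "\<phi> (K (Om r X s (ten (a(s := i)) v)) (a(s := i)))
      = cont s i * \<phi> (K (ten (a(s := i)) v) (a(s := i))) + (\<Sum>p\<in>{1..<i}. \<phi> (K (ten (a(s := p)) v) (a(s := p))))"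
    if K: "clin K" "\<And>t k l y. k \<in> {1..r t} \<Longrightarrow> l \<in> {1..r t} \<Longrightarrow> XM r X t k l (K y) = K (XM r X t k l y)"
      and i: "i \<in> {1..d s}" for K i
  proof -
    have "Om r X s (ten (a(s := i)) v) = cont s i *\<^sub>C ten (a(s := i)) v + (\<Sum>p\<in>{1..<i}. XM r X s i p (ten (a(s := p)) v))"
      using Om_ten_v[OF ai[OF i], of s] by (simp add: algebra_simps)
    then have "\<phi> (K (Om r X s (ten (a(s := i)) v)) (a(s := i)))
        = cont s i * \<phi> (K (ten (a(s := i)) v) (a(s := i)))
          + (\<Sum>p\<in>{1..<i}. \<phi> (K (XM r X s i p (ten (a(s := p)) v)) (a(s := i))))"
      by (simp add: clin_add[OF K(1)] clin_scale[OF K(1)] clin_sum[OF K(1)] sum_fun_apply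
          clin_add[OF clin_phi] clin_scale[OF clin_phi] clin_sum[OF clin_phi])
    also have "(\<Sum>p\<in>{1..<i}. \<phi> (K (XM r X s i p (ten (a(s := p)) v)) (a(s := i))))
        = (\<Sum>p\<in>{1..<i}. \<phi> (K (ten (a(s := p)) v) (a(s := p))))"
    proof (intro sum.cong refl)
      fix p assume p: "p \<in> {1..<i}"
      have "K (XM r X s i p (ten (a(s := p)) v)) (a(s := i))
          = X s i p (K (ten (a(s := p)) v) (a(s := i))) + K (ten (a(s := p)) v) (a(s := p))"
        using p i ds ai[OF i] by (subst K(2)[symmetric]) (auto simp: XM_def)
      then show "\<phi> (K (XM r X s i p (ten (a(s := p)) v)) (a(s := i))) = \<phi> (K (ten (a(s := p)) v) (a(s := p)))"
        using p i ds phi_lower[of p i s] by (simp add: clin_add[OF clin_phi])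
    qed
    finally show ?thesis .
  qed
  have Lstep: "L (\<lambda>y. K (Om r X s y)) = cont s (d s) * L K"
    if K: "clin K" "\<And>t k l y. k \<in> {1..r t} \<Longrightarrow> l \<in> {1..r t} \<Longrightarrow> XM r X t k l (K y) = K (XM r X t k l y)" for K
  proof -
    let ?r = "\<lambda>i. \<phi> (K (ten (a(s := i)) v) (a(s := i)))"
    have "L (\<lambda>y. K (Om r X s y)) = (\<Sum>i\<in>{1..d s}. b i * (cont s i * ?r i)) + (\<Sum>i\<in>{1..d s}. \<Sum>p\<in>{1..<i}. b i * ?r p)"
      unfolding L_def sum.distrib[symmetric]
    proof (intro sum.cong refl)
      fix i assume i: "i \<in> {1..d s}"
      show "b i * \<phi> (K (Om r X s (ten (a(s := i)) v)) (a(s := i))) = b i * (cont s i * ?r i) + (\<Sum>p\<in>{1..<i}. b i * ?r p)"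
        by (simp only: step[of K, OF K i] distrib_left sum_distrib_left)
    qed
    also have "(\<Sum>i\<in>{1..d s}. \<Sum>p\<in>{1..<i}. b i * ?r p) = (\<Sum>p\<in>{1..d s}. \<Sum>i\<in>{p<..d s}. b i * ?r p)"
    proof -
      have "(\<Sum>i\<in>{1..d s}. \<Sum>p\<in>{1..<i}. b i * ?r p) = (\<Sum>i\<in>{1..d s}. \<Sum>p\<in>{p. p \<in> {1..d s} \<and> p < i}. b i * ?r p)"
        by (intro sum.cong refl) auto
      also have "\<dots> = (\<Sum>p\<in>{1..d s}. \<Sum>i\<in>{i. i \<in> {1..d s} \<and> p < i}. b i * ?r p)"
        by (rule sum.swap_restrict) auto
      also have "\<dots> = (\<Sum>p\<in>{1..d s}. \<Sum>i\<in>{p<..d s}. b i * ?r p)"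
        by (intro sum.cong refl) auto
      finally show ?thesis .
    qed
    also have "(\<Sum>i\<in>{1..d s}. b i * (cont s i * ?r i)) + (\<Sum>p\<in>{1..d s}. \<Sum>i\<in>{p<..d s}. b i * ?r p)
        = (\<Sum>i\<in>{1..d s}. (cont s i * b i + (\<Sum>p\<in>{i<..d s}. b p)) * ?r i)"
      unfolding sum_distrib_right[symmetric] sum.distrib[symmetric]
      by (intro sum.cong refl) (simp add: ring_distribs mult_ac)
    also have "\<dots> = cont s (d s) * L K"
      unfolding L_def by (simp add: b(2) sum_distrib_left mult.assoc)
    finally show ?thesis .
  qed
  have Lsub: "L (\<lambda>y. K y - K' y) = L K - L K'" and Lsc: "L (\<lambda>y. c *\<^sub>C K y) = c * L K" for K K' c
    by (simp_all only: L_def minus_apply scaleC_fun_apply clin_diff[OF clin_phi] clin_scale[OF clin_phi]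
        scaleC_complex right_diff_distrib sum_subtractf sum_distrib_left mult.left_commute)
  have "L (\<lambda>y. K (shifts (Om r X s) cs y)) = (\<Prod>c\<leftarrow>cs. cont s (d s) - c) * L K" for cs
  proof (induction cs)
    case (Cons c cs)
    let ?K = "\<lambda>y. K (shifts (Om r X s) cs y)"
    have k: "clin ?K" by (intro clin_comp[OF K(1)] clin_shifts clin_Om)
    have x: "XM r X t k l (?K y) = ?K (XM r X t k l y)" if "k \<in> {1..r t}" "l \<in> {1..r t}" for t k l y
      using that by (simp add: K(2) shifts_Om_XM)
    have "K (shifts (Om r X s) (c # cs) y) = ?K (Om r X s y) - c *\<^sub>C ?K y" for y
      unfolding shifts_Cons'[OF clin_Om] clin_diff[OF clin_shifts[OF clin_Om]]
        clin_scale[OF clin_shifts[OF clin_Om]] clin_diff[OF K(1)] clin_scale[OF K(1)] ..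
    then have "L (\<lambda>y. K (shifts (Om r X s) (c # cs) y)) = L (\<lambda>y. ?K (Om r X s y) - c *\<^sub>C ?K y)"
      by (simp only:)
    also have "\<dots> = L (\<lambda>y. ?K (Om r X s y)) - c * L ?K"
      unfolding Lsub[of "\<lambda>y. ?K (Om r X s y)" "\<lambda>y. c *\<^sub>C ?K y"] Lsc[of c ?K] ..
    also have "L (\<lambda>y. ?K (Om r X s y)) = cont s (d s) * L ?K" using Lstep[of ?K, OF k x] .
    also have "cont s (d s) * L ?K - c * L ?K = (cont s (d s) - c) * L ?K" by (simp add: ring_distribs)
    finally show ?case by (simp add: Cons.IH)
  qed simp
  then have "L (\<lambda>y. K (Fs d s y)) = PP s * L K" by (simp add: Fs_def PP_def comp_def)
  moreover have "L (\<lambda>y. K (Fs d s y)) = \<phi> (K (Fs d s (ten a v)) a)"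
  proof -
    have "L (\<lambda>y. K (Fs d s y)) = (\<Sum>i\<in>{d s}. b i * \<phi> (K (Fs d s (ten (a(s := i)) v)) (a(s := i))))"
      unfolding L_def using ds ai
      by (intro sum.mono_neutral_right) (auto simp: Fs_kill clin_zero[OF K(1)] clin_zero[OF clin_phi])
    then show ?thesis using a(2)[symmetric] b(1) by simp
  qed
  ultimately show ?thesis by (simp add: L_def)
qed

text \<open>Guarantees that the projected component is nonzero. The previous lemma is used for the
  side of Q^* with the identity as \<open>K\<close>, and for the side of U with
  \<open>Fs d False\<close>. The result is a product of eigenvalues \<open>PP\<close>, nonzero by
  \<open>ne\<close>, and of entry sums of left eigenvectors, nonzero by \<open>nd\<close>.\<close>

lemma diagonal_nonzero:
  assumes ne: "\<And>s i. i \<in> {1..r s} \<Longrightarrow> i \<noteq> d s \<Longrightarrow> cont s i \<noteq> cont s (d s)"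
    and nd: "\<And>s i. i \<in> {1..<d s} \<Longrightarrow> cont s (d s) - cont s i + 1 \<noteq> 0"
  shows "\<phi> (FF d (ten d v) d) \<noteq> 0"
proof -
  have ds: "d s \<in> {1..r s}" for s using d by (rule J_range)
  have p: "1 \<le> d s" "\<And>i. i \<in> {1..<d s} \<Longrightarrow> cont s i \<noteq> cont s (d s)" for s
    using ds[of s] ne[of _ s] by auto
  obtain bT where bT: "bT (d True) = 1"
    "\<And>a. a \<in> {1..d True} \<Longrightarrow> cont True a * bT a + (\<Sum>p\<in>{a<..d True}. bT p) = cont True (d True) * bT a"
    "(\<Sum>p\<in>{1..d True}. bT p) \<noteq> 0"
    using left_eigenvector[where c = "cont True" and j = "d True", OF p nd] by blast
  obtain bF where bF: "bF (d False) = 1"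
    "\<And>a. a \<in> {1..d False} \<Longrightarrow> cont False a * bF a + (\<Sum>p\<in>{a<..d False}. bF p) = cont False (d False) * bF a"
    "(\<Sum>p\<in>{1..d False}. bF p) \<noteq> 0"
    using left_eigenvector[where c = "cont False" and j = "d False", OF p nd] by blast
  have 1: "\<phi> (Fs d False (ten (d(True := i)) v) (d(True := i))) = PP False * (\<Sum>p\<in>{1..d False}. bF p)"
    if i: "i \<in> {1..d True}" for i
  proof -
    have "d(True := i) \<in> J r" using i ds[of True] by (intro J_upd d) auto
    then show ?thesis
      using diagonal_coefficient[of "\<lambda>y. y" False, OF clin_id refl refl _ _ bF(1,2), of "d(True := i)"]
      by (simp add: ten_def phi_v)
  qed
  have "\<phi> (FF d (ten d v) d) = \<phi> (Fs d False (Fs d True (ten d v)) d)"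
    by (simp add: FF_def Fs_Fs[of d True False])
  also have "\<dots> = PP True * (\<Sum>i\<in>{1..d True}. bT i * \<phi> (Fs d False (ten (d(True := i)) v) (d(True := i))))"
    by (rule diagonal_coefficient[of "Fs d False" True, OF clin_Fs _ Om_Fs[symmetric] d refl bT(1,2)]) (simp_all add: Fs_def shifts_Om_XM)
  also have "\<dots> = PP True * PP False * ((\<Sum>i\<in>{1..d True}. bT i) * (\<Sum>p\<in>{1..d False}. bF p))"
  proof -
    have "(\<Sum>i\<in>{1..d True}. bT i * \<phi> (Fs d False (ten (d(True := i)) v) (d(True := i))))
        = (\<Sum>i\<in>{1..d True}. bT i) * (PP False * (\<Sum>p\<in>{1..d False}. bF p))"
      unfolding sum_distrib_right by (intro sum.cong refl) (simp only: 1)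
    then show ?thesis by simp
  qed
  finally show ?thesis using PP_nonzero[of True, OF ne] PP_nonzero[of False, OF ne] bT(3) bF(3) by simp
qed

end

end

context hw_pair
begin

section \<open>The graph of the projection onto an irreducible module\<close>

definition XP :: "(((bool \<Rightarrow> nat) \<Rightarrow> 'a) \<times> 'b) ops" where
  "XP s i j p = (XM r XA s i j (fst p), XB s i j (snd p))"

lemma clin_XP: "clin (XP s i j)"
  using A.clin_XM B.lin by (auto simp: clin_def XP_def scaleC_prod_def)

lemma XP_lie_mod: "lie_mod r XP"
proof -
  interpret M: lie_mod r "XM r XA" by (rule A.XM_lie_mod)
  show ?thesis
  proof
    show "clin (XP s i j)" for s i j by (rule clin_XP)
    fix i s j k t l p
    assume ij: "i \<in> {1..r s}" "j \<in> {1..r s}" "k \<in> {1..r t}" "l \<in> {1..r t}"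
    show "XP s i j (XP t k l p) = XP t k l (XP s i j p)
      + (if s = t then (if j = k then XP s i l p else 0) - (if i = l then XP s k j p else 0) else 0)"
      using M.bracket[OF ij, of "fst p"] B.bracket[OF ij, of "snd p"]
      by (cases "s = t"; cases "j = k"; cases "i = l") (simp_all add: XP_def prod_eq_iff)
  qed
qed

text \<open>The submodule of the sum of the tensor product and \<open>B\<close> generated by the pair of highest
  weight vectors is the graph of the projection of the tensor product onto \<open>B\<close>.\<close>

lemma exists_intertwiner:
  assumes d: "d \<in> J r" and wt: "\<And>s i. i \<in> {1..r s} \<Longrightarrow> \<alpha>B s i = \<alpha>A s i + (if d s = i then 1 else 0)"
    and ne: "\<And>s i. i \<in> {1..r s} \<Longrightarrow> i \<noteq> d s \<Longrightarrow> A.cont s i \<noteq> A.cont s (d s)"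
    and nd: "\<And>s i. i \<in> {1..<d s} \<Longrightarrow> A.cont s (d s) - A.cont s i + 1 \<noteq> 0"
  obtains f where "\<And>a w w'. a \<in> J r \<Longrightarrow> w \<in> VA \<Longrightarrow> w' \<in> VA \<Longrightarrow> f a (w + w') = f a w + f a w'"
    "\<And>a c w. a \<in> J r \<Longrightarrow> w \<in> VA \<Longrightarrow> f a (c *\<^sub>C w) = c *\<^sub>C f a w"
    "\<And>a w. a \<in> J r \<Longrightarrow> w \<in> VA \<Longrightarrow> f a w \<in> VB"
    "intertwining r XA XB VA f" "f d vA = vB"
proof -
  define F where "F = A.FF d"
  have lF: "clin F" unfolding F_def by (rule A.clin_FF)
  have FX: "XM r XA s i j (F y) = F (XM r XA s i j y)" if "i \<in> {1..r s}" "j \<in> {1..r s}" for s i j y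
    unfolding F_def using that by (rule A.FF_XM)
  \<comment> \<open>The highest weight vector of the component: a raising operator takes the index
    below \<open>d\<close>, where \<open>F\<close> vanishes.\<close>
  define z where "z = F (ten d vA)"
  define \<psi> where "\<psi> y = \<phi>A (F y d)" for y
  have ds: "d s \<in> {1..r s}" for s using d by (rule J_range)
  have kill: "F (ten a vA) = 0" if "a \<in> J r" "a s < d s" for a s
    unfolding F_def by (rule A.FF_kill[OF d that])
  have z: "is_hw r (XM r XA) z \<alpha>B"
    unfolding is_hw_def
  proof (intro conjI allI impI ballI)
    fix s i j assume ij: "1 \<le> i" "i < j" "j \<le> r s"
    have "XM r XA s i j z = F (ten d (XA s i j vA) + (if d s = j then ten (d(s := i)) vA else 0))"
      unfolding z_def using ij by (subst FX) (auto simp: A.XM_ten[OF d])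
    also have "\<dots> = 0"
      using ij kill[of "d(s := i)" s] J_upd[OF d, of i s]
      by (auto simp: A.raise_v clin_zero[OF clin_ten] clin_zero[OF lF])
    finally show "XM r XA s i j z = 0" .
  next
    fix s i assume i: "i \<in> {1..r s}"
    have "XM r XA s i i z = F (ten d (XA s i i vA) + (if d s = i then ten (d(s := i)) vA else 0))"
      unfolding z_def using i by (subst FX) (auto simp: A.XM_ten[OF d])
    also have "\<dots> = \<alpha>B s i *\<^sub>C z"
    proof -
      have t1: "ten d (XA s i i vA) = \<alpha>A s i *\<^sub>C ten d vA"
        using clin_scale[OF clin_ten, of d "\<alpha>A s i" vA] A.diag_v[OF i] by simp
      have t2: "(if d s = i then ten (d(s := i)) vA else 0) = (if d s = i then 1 else 0) *\<^sub>C ten d vA"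
        by (cases "d s = i") (auto simp: scaleC_one)
      show ?thesis
        unfolding t1 t2 scaleC_add_left[symmetric] clin_scale[OF lF] z_def
        by (rule arg_cong[of _ _ "\<lambda>c. c *\<^sub>C F (ten d vA)"]) (rule wt[OF i, symmetric])
    qed
    finally show "XM r XA s i i z = \<alpha>B s i *\<^sub>C z" .
  qed
  have lpsi: "clin \<psi>" unfolding \<psi>_def[abs_def]
    by (rule clinI) (simp_all only: clin_add[OF lF] clin_scale[OF lF] plus_fun_apply scaleC_fun_apply
        clin_add[OF A.clin_phi] clin_scale[OF A.clin_phi])
  have psi_lower: "\<psi> (XM r XA s i j y) = 0" if ij: "1 \<le> j" "j < i" "i \<le> r s" for s i j y
  proof -
    have "F (XM r XA s i j y) d = XA s i j (F y d) + (if d s = i then F y (d(s := j)) else 0)"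
      using ij d by (subst FX[symmetric]) (auto simp: XM_def)
    moreover have "\<phi>A (F y (d(s := j))) = 0" if "d s = i"
      unfolding F_def using ij that J_upd[OF d, of j s] by (intro A.FF_kill_dual[OF d, of _ s]) auto
    ultimately show ?thesis
      using A.phi_lower[OF ij] by (auto simp: \<psi>_def clin_add[OF A.clin_phi] clin_zero[OF A.clin_phi])
  qed
  \<comment> \<open>\<open>F\<close> squares to a nonzero multiple of itself, which reduces
    \<open>\<psi> z\<close> to the diagonal coefficient.\<close>
  have pz: "\<psi> z \<noteq> 0"
  proof -
    have "F (F (ten d vA)) = (A.PP d True * A.PP d False) *\<^sub>C F (ten d vA)"
      unfolding F_def by (rule A.FF_twice[OF d d low.base])
    then have "\<psi> z = A.PP d True * A.PP d False * \<phi>A (F (ten d vA) d)"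
      by (simp add: \<psi>_def z_def clin_scale[OF A.clin_phi])
    moreover have "A.PP d s \<noteq> 0" for s using A.PP_nonzero[OF d ne] by blast
    moreover have "\<phi>A (F (ten d vA) d) \<noteq> 0" unfolding F_def by (rule A.diagonal_nonzero[OF d ne nd])
    ultimately show ?thesis by simp
  qed
  interpret P: lie_mod r XP by (rule XP_lie_mod)
  define D where "D = low r XP (z, vB)"
  have hwD: "is_hw r XP (z, vB) \<alpha>B"
    using z B.hw unfolding is_hw_def XP_def by (simp add: zero_prod_def)
  have DX: "(XM r XA s i j y, XB s i j w) \<in> D" if "(y, w) \<in> D" "i \<in> {1..r s}" "j \<in> {1..r s}" for s i j y w
    using P.low_closed[OF hwD, of "(y, w)" i s j] that by (simp add: D_def XP_def)
  have Dadd: "(y + y', w + w') \<in> D" if "(y, w) \<in> D" "(y', w') \<in> D" for y y' w w'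
    using low.add[of "(y, w)" r XP "(z, vB)" "(y', w')"] that by (simp add: D_def)
  have Dsc: "(c *\<^sub>C y, c *\<^sub>C w) \<in> D" if "(y, w) \<in> D" for y w c
    using low.scale[of "(y, w)" r XP "(z, vB)" c] that by (simp add: D_def)
  have D0: "(0, 0) \<in> D" using low_zero[of r XP "(z, vB)"] by (simp add: D_def zero_prod_def)
  \<comment> \<open>Both functionals kill the images of lowering operators, so they stay
    proportional on everything generated by the pair of highest weight vectors.\<close>
  have Dpsi: "\<psi> (fst p) = \<psi> z * \<phi>B (snd p) \<and> snd p \<in> VB" if "p \<in> D" for p
    using that unfolding D_def
  proof (induction rule: low.induct)
    case base
    then show ?case by (simp add: B.phi_v low.base)
  next
    case (add w w')
    then show ?case
      by (simp only: fst_add snd_add clin_add[OF lpsi] clin_add[OF B.clin_phi] ring_distribs low.add simp_thms)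
  next
    case (scale w c)
    then show ?case
      by (simp only: scaleC_prod_def fst_conv snd_conv clin_scale[OF lpsi] clin_scale[OF B.clin_phi]
          low.scale simp_thms) (simp add: mult_ac)
  next
    case (lower w j i s)
    then show ?case by (auto simp: XP_def psi_lower B.phi_lower intro: low.lower)
  qed
  \<comment> \<open>The second components lying over 0 form a submodule of the irreducible target on
    which \<open>\<phi>B\<close> vanishes, because \<open>\<psi> z\<close> is nonzero.\<close>
  have uniq0: "w = 0" if "(0, w) \<in> D" for w
  proof -
    have "{w. (0, w) \<in> D} \<subseteq> {0}"
    proof (rule B.sep)
      show "XB s i j w \<in> {w. (0, w) \<in> D}" if "w \<in> {w. (0, w) \<in> D}" "i \<in> {1..r s}" "j \<in> {1..r s}" for w s i j
        using DX[of 0 w i s j] that by (simp add: clin_zero[OF A.clin_XM])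
      show "\<phi>B w = 0" if "w \<in> {w. (0, w) \<in> D}" for w
        using Dpsi[of "(0, w)"] that pz by (simp add: clin_zero[OF lpsi])
      show "{w. (0, w) \<in> D} \<subseteq> VB" using Dpsi by fastforce
    qed
    then show ?thesis using that by auto
  qed
  have uniq: "w = w'" if "(y, w) \<in> D" "(y, w') \<in> D" for y w w'
    using uniq0[of "w - w'"] Dadd[OF that(1) Dsc[OF that(2), of "- 1"]] by simp
  \<comment> \<open>Indices below \<open>d\<close> give 0 and \<open>d\<close> gives the generator.
    Above \<open>d\<close> the contents differ, so the eigenvalue equation of \<open>Om\<close> can
    be solved for the projected tensor in terms of lowering operators on smaller indices.\<close>
  have range_v: "\<exists>u. (F (ten a vA), u) \<in> D" if "a \<in> J r" for a
    using that
  proof (induction "a True + a False" arbitrary: a rule: less_induct)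
    case less
    consider s where "a s < d s" | "a = d" | s where "d s < a s"
    proof -
      have "a = d \<or> (\<exists>s. a s \<noteq> d s)" by auto
      then show ?thesis using that linorder_neqE_nat by blast
    qed
    then show ?case
    proof cases
      case 1
      then show ?thesis using kill[OF less.prems] D0 by auto
    next
      case 2
      have "(z, vB) \<in> D" unfolding D_def by (rule low.base)
      then show ?thesis unfolding 2 z_def by blast
    next
      case 3
      have as: "a s \<in> {1..r s}" using less.prems by (rule J_range)
      have c: "A.cont s (d s) - A.cont s (a s) \<noteq> 0" using ne[OF as] 3 by auto
      have "(A.cont s (d s) - A.cont s (a s)) *\<^sub>C F (ten a vA) = F (Om r XA s (ten a vA) - A.cont s (a s) *\<^sub>C ten a vA)"
      proof -
        have "F (Om r XA s (ten a vA)) = Om r XA s (F (ten a vA))"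
          unfolding F_def A.FF_def A.Om_Fs ..
        also have "\<dots> = A.cont s (d s) *\<^sub>C F (ten a vA)"
          unfolding F_def by (rule A.Om_FF_ten[OF d less.prems low.base])
        finally show ?thesis by (simp only: clin_diff[OF lF] clin_scale[OF lF] cs.scale_left_diff_distrib)
      qed
      also have "\<dots> = (\<Sum>b\<in>{1..<a s}. XM r XA s (a s) b (F (ten (a(s := b)) vA)))"
        unfolding A.Om_ten_v[OF less.prems] clin_sum[OF lF] using as by (intro sum.cong refl FX[symmetric]) auto
      finally have e: "(A.cont s (d s) - A.cont s (a s)) *\<^sub>C F (ten a vA) = \<dots>" .
      have "\<exists>u. (\<Sum>b\<in>I. XM r XA s (a s) b (F (ten (a(s := b)) vA)), u) \<in> D" if "finite I" "I \<subseteq> {1..<a s}" for I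
        using that
      proof (induction I rule: finite_induct)
        case empty
        show ?case unfolding sum.empty using D0 by blast
      next
        case (insert b I)
        then have b: "b \<in> {1..<a s}" "b \<in> {1..r s}" using as by auto
        have "(a(s := b)) True + (a(s := b)) False < a True + a False" using b by (cases s) auto
        then obtain u where u: "(F (ten (a(s := b)) vA), u) \<in> D"
          using less.hyps J_upd[OF less.prems b(2)] by blast
        obtain u' where "(\<Sum>b\<in>I. XM r XA s (a s) b (F (ten (a(s := b)) vA)), u') \<in> D"
          using insert.IH insert.prems by blast
        from Dadd[OF DX[OF u as b(2)] this] show ?case unfolding sum.insert[OF insert.hyps(1,2)] by blast
      qed
      from this[OF finite_atLeastLessThan subset_refl]
      obtain u where "((A.cont s (d s) - A.cont s (a s)) *\<^sub>C F (ten a vA), u) \<in> D"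
        unfolding e by blast
      from Dsc[OF this, of "inverse (A.cont s (d s) - A.cont s (a s))"] show ?thesis
        unfolding scaleC_scaleC left_inverse[OF c] scaleC_one by blast
    qed
  qed
  have range: "\<exists>u. (F (ten a w), u) \<in> D" if "a \<in> J r" "w \<in> VA" for a w
    using that
  proof (rule A.ten_induct[where P = "\<lambda>y. \<exists>u. (F y, u) \<in> D"])
    show "\<exists>u. (F 0, u) \<in> D" unfolding clin_zero[OF lF] using D0 by blast
    show "\<exists>u. (F (y + z), u) \<in> D" if "\<exists>u. (F y, u) \<in> D" "\<exists>u. (F z, u) \<in> D" for y z
      using that Dadd unfolding clin_add[OF lF] by blast
    show "\<exists>u. (F (c *\<^sub>C y), u) \<in> D" if "\<exists>u. (F y, u) \<in> D" for c y
      using that Dsc unfolding clin_scale[OF lF] by blast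
    show "\<exists>u. (F (XM r XA s i j y), u) \<in> D" if "i \<in> {1..r s}" "j \<in> {1..r s}" "\<exists>u. (F y, u) \<in> D" for s i j y
      using that DX unfolding FX[OF that(1,2), symmetric] by blast
  qed (rule range_v)
  define f where "f a w = (THE u. (F (ten a w), u) \<in> D)" for a w
  have fI: "f a w = u" if "(F (ten a w), u) \<in> D" for a w u
    unfolding f_def using that uniq by blast
  have f: "(F (ten a w), f a w) \<in> D" if "a \<in> J r" "w \<in> VA" for a w
    using range[OF that] fI by auto
  show ?thesis
  proof (rule that[of f])
    show "f a (w + w') = f a w + f a w'" if "a \<in> J r" "w \<in> VA" "w' \<in> VA" for a w w'
      using Dadd[OF f[OF that(1,2)] f[OF that(1,3)]]
      by (intro fI) (simp only: clin_add[OF clin_ten] clin_add[OF lF])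
    show "f a (c *\<^sub>C w) = c *\<^sub>C f a w" if "a \<in> J r" "w \<in> VA" for a c w
      using Dsc[OF f[OF that]] by (intro fI) (simp only: clin_scale[OF clin_ten] clin_scale[OF lF])
    show "f a w \<in> VB" if "a \<in> J r" "w \<in> VA" for a w
      using Dpsi[OF f[OF that]] by simp
    show "f d vA = vB" by (rule fI) (simp add: D_def z_def[symmetric] low.base)
    show "intertwining r XA XB VA f"
      unfolding intertwining_def
    proof (intro ballI allI)
      fix a s i j w assume a: "a \<in> J r" and ij: "i \<in> {1..r s}" "j \<in> {1..r s}" and w: "w \<in> VA"
      have aw: "XA s i j w \<in> VA" using A.low_closed[OF A.hw w ij] .
      have 1: "(F (ten a (XA s i j w)) + F (if a s = j then ten (a(s := i)) w else 0), XB s i j (f a w)) \<in> D"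
        using DX[OF f[OF a w] ij] unfolding FX[OF ij] A.XM_ten[OF a ij] clin_add[OF lF] .
      have 2: "(F (if a s = j then ten (a(s := i)) w else 0), if a s = j then f (a(s := i)) w else 0) \<in> D"
        using f[OF J_upd[OF a ij(1)] w] D0 clin_zero[OF lF] by (cases "a s = j") (simp_all only: if_True if_False simp_thms)
      from uniq[OF 1 Dadd[OF f[OF a aw] 2]]
      show "XB s i j (f a w) = f a (XA s i j w) + (if a s = j then f (a(s := i)) w else 0)" .
    qed
  qed
qed

end

section \<open>Irreducible modules of the Levi subgroup\<close>

abbreviation Supp :: "nat \<Rightarrow> (nat \<Rightarrow> complex) set" where
  "Supp d \<equiv> {w. \<forall>i\<ge>d. w i = 0}"

lemma mop_Supp: "mop d' d M w \<in> Supp d'"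
  by (simp add: mop_def)

text \<open>The coefficient of \<epsilon>_{i+1} in the weight, written so that \<epsilon>_{n+1} has
  coefficient 0; \<open>i\<close> is a matrix index, counted from 0.\<close>

definition Lw :: "nat \<Rightarrow> weight \<Rightarrow> nat \<Rightarrow> int" where
  "Lw n c i = (\<Sum>r=i + 1..n. c r)"

definition HH :: "nat \<Rightarrow> nat \<Rightarrow> nat \<Rightarrow> nat \<Rightarrow> complex" where
  "HH n i = (\<lambda>a b. if a = b \<and> a = i then 1 else if a = b \<and> a = n then - 1 else 0)"

lemma YY_offdiag: "i \<noteq> j \<Longrightarrow> YY n i j = (\<lambda>a b. if a = i \<and> b = j then 1 else 0)"
  by (auto simp: YY_def fun_eq_iff)

lemma HH_YY: "i < n \<Longrightarrow> a < n + 1 \<Longrightarrow> b < n + 1 \<Longrightarrow> HH n i a b = (YY n i i - YY n n n) a b"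
  by (auto simp: HH_def YY_def)

lemma dop_HH: "i < n \<Longrightarrow> dop k n E (HH n i) w = dop k n E (YY n i i) w - dop k n E (YY n n n) w"
proof -
  assume i: "i < n"
  have "dact k n E (HH n i) = dact k n E (YY n i i - YY n n n)"
    by (rule dact_cong) (rule HH_YY[OF i])
  then have "dop k n E (HH n i) w = dop k n E (YY n i i - YY n n n) w" by (simp only:)
  also have "\<dots> = dop k n E (YY n i i) w - dop k n E (YY n n n) w" by (rule clin_diff[OF clin_dop])
  finally show ?thesis .
qed

lemma YY_sum: "a < n + 1 \<Longrightarrow> b < n + 1 \<Longrightarrow> (\<Sum>l<n + 1. YY n l l) a b = 0"
proof -
  assume ab: "a < n + 1" "b < n + 1"
  have n0: "of_nat n + 1 \<noteq> (0::complex)"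
    by (metis of_nat_Suc of_nat_eq_0_iff Suc_neq_Zero add.commute)
  have "(\<Sum>l<n + 1. YY n l l) a b
      = (\<Sum>l<n + 1. if l = a then (if a = b then 1 else 0) else 0) - (\<Sum>l<n + 1. if a = b then 1 / of_nat (n + 1) else 0)"
    unfolding sum_fun_apply sum_subtractf[symmetric] by (intro sum.cong refl) (auto simp: YY_def)
  then show ?thesis using ab n0 by (auto simp: sum.delta)
qed

text \<open>The diagonal operators are determined by the \<open>HH n i\<close>, since the trace acts as \<open>0\<close>.\<close>

lemma dop_diag:
  assumes "\<And>i. i < n \<Longrightarrow> dop k n E (HH n i) w = of_int (l i) *\<^sub>C w" "l n = 0" "i < n + 1"
  shows "dop k n E (YY n i i) w = (of_int (l i) - (\<Sum>j<n + 1. of_int (l j)) / of_nat (n + 1)) *\<^sub>C w"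
proof -
  let ?D = "\<lambda>i. dop k n E (YY n i i) w"
  have e: "?D j = of_int (l j) *\<^sub>C w + ?D n" if "j < n + 1" for j
  proof (cases "j = n")
    case False
    then have j: "j < n" using that by simp
    have "?D j - ?D n = of_int (l j) *\<^sub>C w"
      unfolding dop_HH[OF j, symmetric] by (rule assms(1)[OF j])
    then show ?thesis unfolding diff_eq_eq .
  next
    case True
    then show ?thesis using assms(2) by (simp only: of_int_0 cs.scale_zero_left add_0_left)
  qed
  have "dact k n E (\<Sum>j<n + 1. YY n j j) = dact k n E 0"
    by (rule dact_cong) (simp only: YY_sum zero_fun_apply)
  then have "0 = dop k n E (\<Sum>j<n + 1. YY n j j) w"
    using clin_zero[OF clin_dop, of E k n w] by (simp only:)
  also have "\<dots> = (\<Sum>j<n + 1. ?D j)" by (rule clin_sum[OF clin_dop])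
  also have "\<dots> = (\<Sum>j<n + 1. of_int (l j) *\<^sub>C w) + (\<Sum>j<n + 1. ?D n)"
    unfolding sum.distrib[symmetric] by (rule sum.cong[OF refl]) (rule e, simp)
  also have "\<dots> = (\<Sum>j<n + 1. of_int (l j)) *\<^sub>C w + of_nat (n + 1) *\<^sub>C ?D n"
    unfolding cs.scale_sum_left cs.sum_constant_scale card_lessThan ..
  finally have "0 = (\<Sum>j<n + 1. of_int (l j)) *\<^sub>C w + of_nat (n + 1) *\<^sub>C ?D n" .
  from this[symmetric] have "of_nat (n + 1) *\<^sub>C ?D n = (- (\<Sum>j<n + 1. of_int (l j))) *\<^sub>C w"
    unfolding cs.scale_minus_left by (rule minus_unique[symmetric])
  then have "inverse (of_nat (n + 1)) *\<^sub>C (of_nat (n + 1) *\<^sub>C ?D n)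
      = inverse (of_nat (n + 1)) *\<^sub>C ((- (\<Sum>j<n + 1. of_int (l j))) *\<^sub>C w)" by (rule arg_cong)
  moreover have "inverse (of_nat (n + 1)) * of_nat (n + 1) = (1::complex)"
    by (intro left_inverse) (metis of_nat_eq_0_iff add_is_0 zero_neq_one)
  ultimately have "?D n = (- (\<Sum>j<n + 1. of_int (l j)) / of_nat (n + 1)) *\<^sub>C w"
    unfolding scaleC_scaleC by (simp only: scaleC_one) (simp add: field_simps)
  then show ?thesis unfolding e[OF assms(3)] by (simp only: scaleC_add_left[symmetric]) simp
qed

text \<open>The functionals in \<open>\<Psi>\<close> cut out \<open>S\<close>. For w in
  \<open>S\<close> the functions \<psi>(\<gamma>(z) w) form a linear differential system, since the
  velocity maps \<open>S\<close> to itself, and all of them start at 0. So one-parameter subgroups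
  preserve \<open>S\<close>, and with them the group that they generate.\<close>

lemma levi_invariant:
  fixes S :: "(nat \<Rightarrow> complex) set" and \<Psi> :: "((nat \<Rightarrow> complex) \<Rightarrow> complex) set"
  assumes E: "is_module k n E" and S: "S \<subseteq> Supp (rdim E)"
    and \<Psi>: "\<And>\<psi>. \<psi> \<in> \<Psi> \<Longrightarrow> clin \<psi>" "\<And>\<psi> w. \<psi> \<in> \<Psi> \<Longrightarrow> w \<in> S \<Longrightarrow> \<psi> w = 0"
      "\<And>w. w \<in> Supp (rdim E) \<Longrightarrow> (\<And>\<psi>. \<psi> \<in> \<Psi> \<Longrightarrow> \<psi> w = 0) \<Longrightarrow> w \<in> S"
    and Y: "\<And>i j w. i < n + 1 \<Longrightarrow> j < n + 1 \<Longrightarrow> (i < k + 1) = (j < k + 1) \<Longrightarrow> w \<in> S \<Longrightarrow> dop k n E (YY n i j) w \<in> S"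
    and g: "g \<in> levi k n" and w: "w \<in> S"
  shows "aop E g w \<in> S"
proof -
  have one: "aop E (\<gamma> z) w \<in> S"
    if \<gamma>: "one_param k n \<gamma> Z" and Zw: "\<And>w. w \<in> S \<Longrightarrow> dop k n E Z w \<in> S" and w0: "w \<in> S" for \<gamma> Z z w
  proof (rule \<Psi>(3)[OF mop_Supp])
    fix \<psi> assume psi: "\<psi> \<in> \<Psi>"
    show "\<psi> (aop E (\<gamma> z) w) = 0"
    proof (rule entire_system_zero[of "\<lambda>w. w \<in> S" "\<lambda>w z. \<psi> (aop E (\<gamma> z) w)"])
      fix w assume w: "w \<in> S"
      have "\<gamma> 0 = 1\<^sub>m (n + 1)" using \<gamma> by (simp add: one_param_def)
      moreover have "w \<in> Supp (rdim E)" using S w by blast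
      ultimately have "aop E (\<gamma> 0) w = w" using aop_one[OF E, of w] by simp
      then show "\<psi> (aop E (\<gamma> 0) w) = 0" using \<Psi>(2)[OF psi w] by simp
      show "\<exists>ss. (\<forall>s'\<in>set ss. s' \<in> S) \<and>
          (\<forall>z. ((\<lambda>z. \<psi> (aop E (\<gamma> z) w)) has_field_derivative (\<Sum>s'\<leftarrow>ss. \<psi> (aop E (\<gamma> z) s'))) (at z))"
      proof (intro exI conjI ballI allI)
        show "s' \<in> S" if "s' \<in> set [dop k n E Z w]" for s' using that Zw[OF w] by simp
        show "((\<lambda>z. \<psi> (aop E (\<gamma> z) w)) has_field_derivative (\<Sum>s'\<leftarrow>[dop k n E Z w]. \<psi> (aop E (\<gamma> z) s'))) (at z)" for z
          using aop_deriv[OF E \<gamma> \<Psi>(1)[OF psi], of w z] by simp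
      qed
    qed (rule w0)
  qed
  have sub: "w - w' \<in> S" if ww: "w \<in> S" "w' \<in> S" for w w'
  proof (rule \<Psi>(3))
    have "w \<in> Supp (rdim E)" "w' \<in> Supp (rdim E)" using S ww by auto
    then show "w - w' \<in> Supp (rdim E)" by simp
    show "\<psi> (w - w') = 0" if "\<psi> \<in> \<Psi>" for \<psi>
      using clin_diff[OF \<Psi>(1)[OF that], of w w'] \<Psi>(2)[OF that ww(1)] \<Psi>(2)[OF that ww(2)] by simp
  qed
  have "g \<in> Gen k n" using g by (rule levi_Gen)
  then show ?thesis using w
  proof (induction arbitrary: w rule: Gen.induct)
    case one
    then have "w \<in> Supp (rdim E)" using S by blast
    then show ?case using aop_one[OF E, of w] one by simp
  next
    case (addrow i j z)
    show ?case
      by (rule one[OF one_param_addrow[OF addrow(1-4)] _ addrow.prems])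
        (rule Y[OF addrow(2-4), unfolded YY_offdiag[OF addrow(1)]])
  next
    case (tor i z)
    have "dop k n E (HH n i) w \<in> S" if "w \<in> S" for w
      unfolding dop_HH[OF tor(1)] using that tor(1) by (intro sub Y) auto
    then show ?case unfolding HH_def by (rule one[OF one_param_tor[OF tor(1)] _ tor.prems])
  next
    case (mult A B)
    then show ?case unfolding aop_mult[OF E Gen_levi[OF mult(1)] Gen_levi[OF mult(2)]] by blast
  qed
qed

text \<open>Carries irreducibility from subspaces of column vectors over to sets of functions;
  passing to the first \<open>rdim E\<close> values is injective on \<open>Supp\<close>.\<close>

lemma irreducible_Supp:
  assumes E: "is_irreducible k n E" and S: "S \<subseteq> Supp (rdim E)" "cs.subspace S"
    and inv: "\<And>g w. g \<in> levi k n \<Longrightarrow> w \<in> S \<Longrightarrow> aop E g w \<in> S"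
  shows "S = {0} \<or> S = Supp (rdim E)"
proof -
  let ?d = "rdim E"
  define W where "W = vec ?d ` S"
  have m: "is_module k n E" using E by (simp add: is_irreducible_def)
  have "VectorSpace.subspace class_ring W (module_vec TYPE(complex) ?d)"
  proof -
    have vs: "vectorspace class_ring (module_vec TYPE(complex) ?d)" by (rule vec_vs)
    have "submodule class_ring W (module_vec TYPE(complex) ?d)"
    proof (rule submodule.intro)
      show "Module.module class_ring (module_vec TYPE(complex) ?d)" using vs by (simp add: vectorspace_def)
      show "W \<subseteq> carrier (module_vec TYPE(complex) ?d)" by (auto simp: W_def module_vec_simps)
      show "x \<oplus>\<^bsub>module_vec TYPE(complex) ?d\<^esub> y \<in> W" if xy: "x \<in> W" "y \<in> W" for x y
      proof -
        obtain f h where "x = vec ?d f" "y = vec ?d h" "f \<in> S" "h \<in> S" using xy by (auto simp: W_def)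
        then have "x + y = vec ?d (f + h)" "f + h \<in> S" using S(2) by (auto simp: cs.subspace_add intro!: eq_vecI)
        then show ?thesis by (auto simp: W_def module_vec_simps)
      qed
      show "\<zero>\<^bsub>module_vec TYPE(complex) ?d\<^esub> \<in> W"
        using cs.subspace_0[OF S(2)] by (auto simp: W_def module_vec_simps intro!: image_eqI[of _ _ 0] eq_vecI)
      show "c \<odot>\<^bsub>module_vec TYPE(complex) ?d\<^esub> x \<in> W" if x: "x \<in> W" for c x
      proof -
        obtain f where "x = vec ?d f" "f \<in> S" using x by (auto simp: W_def)
        then have "c \<cdot>\<^sub>v x = vec ?d (c *\<^sub>C f)" "c *\<^sub>C f \<in> S" using S(2) by (auto simp: cs.subspace_scale intro!: eq_vecI)
        then show ?thesis by (auto simp: W_def module_vec_simps)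
      qed
    qed
    then show ?thesis using vs by (simp add: VectorSpace.subspace_def)
  qed
  moreover have "act E g *\<^sub>v x \<in> W" if g: "g \<in> levi k n" and x: "x \<in> W" for g x
  proof -
    obtain f where f: "x = vec ?d f" "f \<in> S" using x by (auto simp: W_def)
    have "act E g *\<^sub>v x = vec ?d (aop E g f)"
      using act_carrier[OF m g] by (intro eq_vecI) (auto simp: f(1) mop_def scalar_prod_def atLeast0LessThan)
    then show ?thesis using inv[OF g f(2)] by (auto simp: W_def)
  qed
  ultimately have "W = {0\<^sub>v ?d} \<or> W = carrier_vec ?d" using E unfolding is_irreducible_def by blast
  moreover have inj: "f = h" if "f \<in> Supp ?d" "h \<in> Supp ?d" "vec ?d f = vec ?d h" for f h
  proof
    fix i
    show "f i = h i" using that by (cases "i < ?d") (auto dest: arg_cong[of _ _ "\<lambda>v. v $ i"])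
  qed
  ultimately show ?thesis
  proof (elim disjE)
    assume W0: "W = {0\<^sub>v ?d}"
    have "f = 0" if "f \<in> S" for f
    proof -
      have "vec ?d f = 0\<^sub>v ?d" using that W0 by (auto simp: W_def)
      moreover have "vec ?d 0 = (0\<^sub>v ?d :: complex vec)" by (rule eq_vecI) auto
      ultimately show ?thesis using inj[of f 0] that S(1) by auto
    qed
    then show ?thesis using cs.subspace_0[OF S(2)] by auto
  next
    assume W: "W = carrier_vec ?d"
    have "f \<in> S" if f: "f \<in> Supp ?d" for f
    proof -
      have "vec ?d f \<in> W" unfolding W by simp
      then obtain h where "h \<in> S" "vec ?d f = vec ?d h" by (auto simp: W_def)
      then show ?thesis using inj[of f h] f S(1) by auto
    qed
    then show ?thesis using S(1) by auto
  qed
qed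

section \<open>The Levi subgroup as a pair of general linear Lie algebras\<close>

definition rr :: "nat \<Rightarrow> nat \<Rightarrow> bool \<Rightarrow> nat" where
  "rr k n s = (if s then k + 1 else n - k)"

text \<open>The weights of \<open>U\<close> are \<open>-\<epsilon>\<^sub>k\<^sub>+\<^sub>1, \<dots>, -\<epsilon>\<^sub>1\<close> in decreasing order; hence the
  reversal of indices and the sign on this side.\<close>

definition XX :: "nat \<Rightarrow> nat \<Rightarrow> rmod \<Rightarrow> (nat \<Rightarrow> complex) ops" where
  "XX k n E s i j = (if s then (\<lambda>w. - dop k n E (YY n (k + 1 - j) (k + 1 - i)) w) else dop k n E (YY n (k + i) (k + j)))"

text \<open>The eigenvalues of the diagonal operators on a vector of weight \<open>c\<close>. The
  operators come from traceless matrices, hence the average that is subtracted; on the side of U,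
  reversal and sign follow \<open>XX\<close>.\<close>

definition al :: "nat \<Rightarrow> nat \<Rightarrow> weight \<Rightarrow> bool \<Rightarrow> nat \<Rightarrow> complex" where
  "al k n c s i = (if s then - (of_int (Lw n c (k + 1 - i)) - (\<Sum>j<n + 1. of_int (Lw n c j)) / of_nat (n + 1))
    else of_int (Lw n c (k + i)) - (\<Sum>j<n + 1. of_int (Lw n c j)) / of_nat (n + 1))"

lemma clin_XX: "clin (XX k n E s i j)"
  by (cases s) (auto simp: XX_def clin_mop clin_def minus_add_distrib clin_add[OF clin_mop] clin_scale[OF clin_mop])

lemma XX_Supp: "XX k n E s i j w \<in> Supp (rdim E)"
  by (auto simp: XX_def mop_def)

lemma dop_bracket_YY:
  assumes E: "is_module k n E" and ij: "i < n + 1" "j < n + 1" "(i < k + 1) = (j < k + 1)"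
    and lr: "l < n + 1" "r < n + 1" "(l < k + 1) = (r < k + 1)"
  shows "dop k n E (YY n i j) (dop k n E (YY n l r) w) = dop k n E (YY n l r) (dop k n E (YY n i j) w)
    + ((if j = l then dop k n E (YY n i r) w else 0) - (if i = r then dop k n E (YY n l j) w else 0))"
proof -
  have "dact k n E (com n (YY n i j) (YY n l r))
      = dact k n E ((if j = l then YY n i r else 0) - (if i = r then YY n l j else 0))"
    using ij lr by (intro dact_cong) (simp add: com_YY)
  then have "dop k n E (com n (YY n i j) (YY n l r)) w
      = dop k n E ((if j = l then YY n i r else 0) - (if i = r then YY n l j else 0)) w" by (simp only:)
  also have "\<dots> = dop k n E (if j = l then YY n i r else 0) w - dop k n E (if i = r then YY n l j else 0) w"
    by (rule clin_diff[OF clin_dop])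
  also have "\<dots> = (if j = l then dop k n E (YY n i r) w else 0) - (if i = r then dop k n E (YY n l j) w else 0)"
    using clin_zero[OF clin_dop, of E k n w] by (cases "j = l"; cases "i = r") (simp_all only: if_True if_False simp_thms)
  finally have "dop k n E (com n (YY n i j) (YY n l r)) w = \<dots>" .
  then show ?thesis
    using dop_bracket[OF E YY_tang[OF ij] YY_tang[OF lr], of w] unfolding diff_eq_eq by (simp only: add.commute)
qed

text \<open>Transposing, reversing the order of the indices and changing the sign is an automorphism
  of the general linear Lie algebra. Operators of different factors commute because their index
  ranges are disjoint.\<close>

lemma XX_lie_mod:
  assumes E: "is_module k n E" and kn: "k < n"
  shows "lie_mod (rr k n) (XX k n E)"
proof
  show "clin (XX k n E s i j)" for s i j by (rule clin_XX)
  fix i s j l t r and w :: "nat \<Rightarrow> complex"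
  assume r: "i \<in> {1..rr k n s}" "j \<in> {1..rr k n s}" "l \<in> {1..rr k n t}" "r \<in> {1..rr k n t}"
  let ?D = "\<lambda>i j. dop k n E (YY n i j)"
  show "XX k n E s i j (XX k n E t l r w) = XX k n E t l r (XX k n E s i j w)
      + (if s = t then (if j = l then XX k n E s i r w else 0) - (if i = r then XX k n E s l j w else 0) else 0)"
  proof (cases s; cases t)
    assume st: s t
    have X: "XX k n E s i j = (\<lambda>w. - ?D (k + 1 - j) (k + 1 - i) w)" for i j using st by (simp add: XX_def)
    have X': "XX k n E t i j = (\<lambda>w. - ?D (k + 1 - j) (k + 1 - i) w)" for i j using st by (simp add: XX_def)
    have e: "k + 1 - i = k + 1 - r \<longleftrightarrow> i = r" "k + 1 - j = k + 1 - l \<longleftrightarrow> j = l" using r st by (auto simp: rr_def)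
    have "?D (k + 1 - j) (k + 1 - i) (?D (k + 1 - r) (k + 1 - l) w) = ?D (k + 1 - r) (k + 1 - l) (?D (k + 1 - j) (k + 1 - i) w)
        + ((if k + 1 - i = k + 1 - r then ?D (k + 1 - j) (k + 1 - l) w else 0)
         - (if k + 1 - j = k + 1 - l then ?D (k + 1 - r) (k + 1 - i) w else 0))"
      using r st kn by (intro dop_bracket_YY[OF E]) (auto simp: rr_def)
    then show ?thesis using st unfolding X X' clin_minus[OF clin_mop] e
      by (cases "i = r"; cases "j = l") simp_all
  next
    assume st: s "\<not> t"
    have "?D (k + 1 - j) (k + 1 - i) (?D (k + l) (k + r) w) = ?D (k + l) (k + r) (?D (k + 1 - j) (k + 1 - i) w)
        + ((if k + 1 - i = k + l then ?D (k + 1 - j) (k + r) w else 0)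
         - (if k + 1 - j = k + r then ?D (k + l) (k + 1 - i) w else 0))"
      using r st kn by (intro dop_bracket_YY[OF E]) (auto simp: rr_def)
    moreover have "k + 1 - i \<noteq> k + l" "k + 1 - j \<noteq> k + r" using r st by (auto simp: rr_def)
    ultimately have "?D (k + 1 - j) (k + 1 - i) (?D (k + l) (k + r) w) = ?D (k + l) (k + r) (?D (k + 1 - j) (k + 1 - i) w)"
      by simp
    then show ?thesis using st by (simp add: XX_def clin_minus[OF clin_mop])
  next
    assume st: "\<not> s" t
    have "?D (k + i) (k + j) (?D (k + 1 - r) (k + 1 - l) w) = ?D (k + 1 - r) (k + 1 - l) (?D (k + i) (k + j) w)
        + ((if k + j = k + 1 - r then ?D (k + i) (k + 1 - l) w else 0)
         - (if k + i = k + 1 - l then ?D (k + 1 - r) (k + j) w else 0))"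
      using r st kn by (intro dop_bracket_YY[OF E]) (auto simp: rr_def)
    moreover have "k + j \<noteq> k + 1 - r" "k + i \<noteq> k + 1 - l" using r st by (auto simp: rr_def)
    ultimately have "?D (k + i) (k + j) (?D (k + 1 - r) (k + 1 - l) w) = ?D (k + 1 - r) (k + 1 - l) (?D (k + i) (k + j) w)"
      by simp
    then show ?thesis using st by (simp add: XX_def clin_minus[OF clin_mop])
  next
    assume st: "\<not> s" "\<not> t"
    have "?D (k + i) (k + j) (?D (k + l) (k + r) w) = ?D (k + l) (k + r) (?D (k + i) (k + j) w)
        + ((if k + j = k + l then ?D (k + i) (k + r) w else 0) - (if k + i = k + r then ?D (k + l) (k + j) w else 0))"
      using r st kn by (intro dop_bracket_YY[OF E]) (auto simp: rr_def)
    then show ?thesis using st by (cases "i = r"; cases "j = l") (simp_all add: XX_def)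
  qed
qed

lemma YY_XX:
  assumes "i < n + 1" "j < n + 1" "(i < k + 1) = (j < k + 1)" "k < n"
  shows "\<exists>s a b. a \<in> {1..rr k n s} \<and> b \<in> {1..rr k n s} \<and>
    (\<forall>w. dop k n E (YY n i j) w = (if s then - 1 else 1) *\<^sub>C XX k n E s a b w)"
proof (cases "i < k + 1")
  case True
  then show ?thesis using assms
    by (intro exI[of _ True] exI[of _ "k + 1 - j"] exI[of _ "k + 1 - i"]) (auto simp: XX_def rr_def scaleC_one)
next
  case False
  then show ?thesis using assms
    by (intro exI[of _ False] exI[of _ "i - k"] exI[of _ "j - k"]) (auto simp: XX_def rr_def scaleC_one)
qed

definition fv :: "nat \<Rightarrow> complex vec \<Rightarrow> nat \<Rightarrow> complex" where
  "fv d v = (\<lambda>i. if i < d then v $ i else 0)"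

lemma act_fv:
  assumes "A \<in> carrier_mat d' d" "v \<in> carrier_vec d"
  shows "mop d' d (ent A) (fv d v) = fv d' (A *\<^sub>v v)"
  using assms by (auto simp: mop_def fv_def scalar_prod_def atLeast0LessThan fun_eq_iff)

lemma weight_char_tor:
  assumes "i < n"
  shows "weight_char n c (tor n i z) = exp (of_int (Lw n c i) * z)"
proof -
  have "(\<Prod>j<m. tor n i z $$ (j, j)) = (if i < m then exp z else 1)" if "m \<in> {1..n}" for m
  proof -
    have "(\<Prod>j<m. tor n i z $$ (j, j)) = (\<Prod>j<m. if j = i then exp z else 1)"
      using that by (intro prod.cong refl) (auto simp: tor_def)
    then show ?thesis by (simp add: prod.delta)
  qed
  then have "weight_char n c (tor n i z) = (\<Prod>m=1..n. if i < m then exp (of_int (c m) * z) else 1)"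
    unfolding weight_char_def by (intro prod.cong refl) (auto simp: exp_power_int)
  also have "\<dots> = (\<Prod>m=i + 1..n. exp (of_int (c m) * z))"
    by (rule prod.mono_neutral_cong_right) auto
  also have "\<dots> = exp (\<Sum>m=i + 1..n. of_int (c m) * z)" by (simp add: exp_sum)
  finally show ?thesis by (simp add: Lw_def sum_distrib_right)
qed

text \<open>The eigenvalue equation is differentiated at 0; with \<open>c = 0\<close> it covers
  vectors fixed by a unipotent subgroup.\<close>

lemma dop_eigen:
  assumes E: "is_module k n E" and g: "one_param k n \<gamma> Y" and v: "v \<in> carrier_vec (rdim E)"
    and e: "\<And>z. act E (\<gamma> z) *\<^sub>v v = exp (c * z) \<cdot>\<^sub>v v"
  shows "dop k n E Y (fv (rdim E) v) = c *\<^sub>C fv (rdim E) v"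
proof
  fix i
  let ?v = "fv (rdim E) v"
  have l: "\<gamma> z \<in> levi k n" for z using g by (simp add: one_param_def)
  have "aop E (\<gamma> z) ?v i = exp (c * z) * ?v i" for z
    unfolding act_fv[OF act_carrier[OF E l] v] e using v by (auto simp: fv_def)
  then have 1: "((\<lambda>z. exp (c * z) * ?v i) has_field_derivative aop E (\<gamma> 0) (dop k n E Y ?v) i) (at 0)"
    using aop_deriv[OF E g clin_apply[of i], of ?v 0] by simp
  have 2: "((\<lambda>z. exp (c * z) * ?v i) has_field_derivative c * ?v i) (at 0)"
    by (auto intro!: derivative_eq_intros)
  have "aop E (\<gamma> 0) (dop k n E Y ?v) = dop k n E Y ?v"
    using aop_one[OF E, of "dop k n E Y ?v"] g by (simp add: one_param_def mop_def)
  then show "dop k n E Y ?v i = (c *\<^sub>C ?v) i" using DERIV_unique[OF 1 2] by simp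
qed

lemma maximal_is_hw:
  assumes E: "is_module k n E" and v: "is_maximal_vector k n E c v" and kn: "k < n"
  shows "is_hw (rr k n) (XX k n E) (fv (rdim E) v) (al k n c)"
proof -
  have vc: "v \<in> carrier_vec (rdim E)" using v by (simp add: is_maximal_vector_def)
  let ?v = "fv (rdim E) v"
  have up: "dop k n E (YY n i j) ?v = 0" if ij: "i < j" "j < n + 1" "(i < k + 1) = (j < k + 1)" for i j
  proof -
    have ne: "i \<noteq> j" "i < n + 1" using ij by auto
    have "addrow_mat (n + 1) z i j \<in> unipotent k n" for z :: complex
      using addrow_levi[OF ne(1,2) ij(2,3)] ne ij by (auto simp: unipotent_def upper_triangular_def)
    then have e: "act E (addrow_mat (n + 1) z i j) *\<^sub>v v = exp (0 * z) \<cdot>\<^sub>v v" for z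
      using v vc by (simp add: is_maximal_vector_def)
    have "dop k n E (YY n i j) ?v = 0 *\<^sub>C ?v"
      unfolding YY_offdiag[OF ne(1)] by (rule dop_eigen[OF E one_param_addrow[OF ne(1,2) ij(2,3)] vc e])
    then show ?thesis by simp
  qed
  have H: "dop k n E (HH n i) ?v = of_int (Lw n c i) *\<^sub>C ?v" if i: "i < n" for i
  proof -
    have "tor n i z \<in> torus n" for z
      using tor_levi[OF i, of z k] by (auto simp: torus_def levi_def diagonal_mat_def tor_def)
    then have "act E (tor n i z) *\<^sub>v v = exp (of_int (Lw n c i) * z) \<cdot>\<^sub>v v" for z
      using v weight_char_tor[OF i] by (simp add: is_maximal_vector_def)
    then show ?thesis using dop_eigen[OF E one_param_tor[OF i] vc] by (simp only: HH_def)
  qed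
  have diag: "dop k n E (YY n i i) ?v = (of_int (Lw n c i) - (\<Sum>j<n + 1. of_int (Lw n c j)) / of_nat (n + 1)) *\<^sub>C ?v"
    if "i < n + 1" for i
    using H that by (intro dop_diag) (auto simp: Lw_def)
  show ?thesis
    unfolding is_hw_def
  proof (intro conjI allI impI ballI)
    fix s i j assume ij: "1 \<le> i" "i < j" "j \<le> rr k n s"
    show "XX k n E s i j ?v = 0"
    proof (cases s)
      case True
      then show ?thesis using ij kn up[of "k + 1 - j" "k + 1 - i"] by (simp add: XX_def rr_def)
    next
      case False
      then show ?thesis using ij kn up[of "k + i" "k + j"] by (simp add: XX_def rr_def)
    qed
  next
    fix s i assume i: "i \<in> {1..rr k n s}"
    show "XX k n E s i i ?v = al k n c s i *\<^sub>C ?v"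
    proof (cases s)
      case True
      then have "XX k n E s i i ?v = - dop k n E (YY n (k + 1 - i) (k + 1 - i)) ?v" by (simp add: XX_def)
      then show ?thesis using i kn True diag[of "k + 1 - i"]
        by (simp only: al_def if_True cs.scale_minus_left)
    next
      case False
      then have "k + i < n + 1" using i kn by (auto simp: rr_def)
      then show ?thesis using diag[of "k + i"] False by (simp add: XX_def al_def del: sum.lessThan_Suc of_nat_add)
    qed
  qed
qed

lemma low_subspace: "cs.subspace (low r X v)"
  by (auto simp: cs.subspace_def low_zero intro: low.add low.scale)

lemma low_subset_Supp:
  assumes "v \<in> Supp (rdim E)"
  shows "low r (XX k n E) v \<subseteq> Supp (rdim E)"
proof
  fix w assume "w \<in> low r (XX k n E) v"
  then show "w \<in> Supp (rdim E)"
    by (induction rule: low.induct) (use assms XX_Supp in auto)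
qed

text \<open>A subspace stable under \<open>XX\<close> is stable under the Levi subgroup, by
  \<open>levi_invariant\<close> with all functionals that vanish on it. Applied to the submodule
  generated by the maximal vector this gives the whole space; applied to the span of a stable set it
  gives \<open>sep\<close>.\<close>

theorem irreducible_hw_mod:
  assumes irr: "is_irreducible k n E" and v: "is_maximal_vector k n E c v" and kn: "k < n"
  shows "low (rr k n) (XX k n E) (fv (rdim E) v) = Supp (rdim E)"
    and "\<exists>\<phi>. hw_mod (rr k n) (XX k n E) (fv (rdim E) v) (al k n c) \<phi>"
proof -
  have E: "is_module k n E" using irr by (simp add: is_irreducible_def)
  let ?v = "fv (rdim E) v" let ?X = "XX k n E" let ?r = "rr k n"
  interpret L: lie_mod ?r ?X by (rule XX_lie_mod[OF E kn])
  have hw: "is_hw ?r ?X ?v (al k n c)" by (rule maximal_is_hw[OF E v kn])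
  have vS: "?v \<in> Supp (rdim E)" by (simp add: fv_def)
  have v0: "?v \<noteq> 0"
  proof
    assume "?v = 0"
    then have "v $ i = 0" if "i < rdim E" for i using that by (auto simp: fv_def fun_eq_iff split: if_splits)
    then have "v = 0\<^sub>v (rdim E)" using v by (intro eq_vecI) (auto simp: is_maximal_vector_def)
    then show False using v by (simp add: is_maximal_vector_def)
  qed
  have YX: "dop k n E (YY n i j) w \<in> S"
    if S: "\<And>w s i j. w \<in> S \<Longrightarrow> i \<in> {1..?r s} \<Longrightarrow> j \<in> {1..?r s} \<Longrightarrow> ?X s i j w \<in> S" "cs.subspace S"
      and ij: "i < n + 1" "j < n + 1" "(i < k + 1) = (j < k + 1)" and w: "w \<in> S" for S i j w
  proof -
    obtain s a b where ab: "a \<in> {1..?r s}" "b \<in> {1..?r s}"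
      "\<forall>w. dop k n E (YY n i j) w = (if s then - 1 else 1) *\<^sub>C ?X s a b w"
      using YY_XX[OF ij kn, of E] by blast
    show ?thesis unfolding ab(3)[rule_format] by (rule cs.subspace_scale[OF S(2) S(1)[OF w ab(1,2)]])
  qed
  have sepa: "w \<in> S" if S: "cs.subspace S" and \<psi>: "\<And>\<psi>. \<psi> \<in> {\<psi>. clin \<psi> \<and> (\<forall>w\<in>S. \<psi> w = (0::complex))} \<Longrightarrow> \<psi> w = 0"
    for S and w :: "nat \<Rightarrow> complex"
  proof (rule ccontr)
    assume "w \<notin> S"
    then obtain \<psi> :: "(nat \<Rightarrow> complex) \<Rightarrow> complex" where "clin \<psi>" "\<psi> w = 1" "\<forall>w\<in>S. \<psi> w = 0"
      using exists_functional[OF S] by blast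
    then show False using \<psi>[of \<psi>] by simp
  qed
  show lowS: "low ?r ?X ?v = Supp (rdim E)"
  proof -
    let ?S = "low ?r ?X ?v"
    let ?\<Psi> = "{\<psi>. clin \<psi> \<and> (\<forall>w\<in>?S. \<psi> w = (0::complex))}"
    have "aop E g w \<in> ?S" if "g \<in> levi k n" "w \<in> ?S" for g w
    proof (rule levi_invariant[OF E low_subset_Supp[OF vS], of ?\<Psi>])
      show "w \<in> ?S" if "\<And>\<psi>. \<psi> \<in> ?\<Psi> \<Longrightarrow> \<psi> w = 0" for w
        by (rule sepa[OF low_subspace that])
      show "dop k n E (YY n i j) w \<in> ?S" if "i < n + 1" "j < n + 1" "(i < k + 1) = (j < k + 1)" "w \<in> ?S" for i j w
        by (rule YX[OF _ low_subspace that]) (rule L.low_closed[OF hw])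
    qed (use that in auto)
    then have "?S = {0} \<or> ?S = Supp (rdim E)"
      by (rule irreducible_Supp[OF irr low_subset_Supp[OF vS] low_subspace])
    then show ?thesis using v0 low.base[of ?v ?r ?X] by auto
  qed
  obtain \<phi>0 :: "(nat \<Rightarrow> complex) \<Rightarrow> complex" where \<phi>0: "clin \<phi>0" "\<phi>0 ?v = 1"
    "\<And>w s i j. w \<in> Supp (rdim E) \<Longrightarrow> 1 \<le> j \<Longrightarrow> j < i \<Longrightarrow> i \<le> ?r s \<Longrightarrow> \<phi>0 (?X s i j w) = 0"
    "\<And>w s i. w \<in> Supp (rdim E) \<Longrightarrow> i \<in> {1..?r s} \<Longrightarrow> \<phi>0 (?X s i i w) = al k n c s i * \<phi>0 w"
    using L.hw_functional[OF hw v0] unfolding lowS by blast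
  \<comment> \<open>\<open>hw_mod\<close> asks for identities on all functions, whereas
    \<open>\<phi>0\<close> satisfies them on \<open>Supp\<close> only; truncation bridges the
    gap.\<close>
  define tr :: "(nat \<Rightarrow> complex) \<Rightarrow> nat \<Rightarrow> complex" where "tr w = (\<lambda>i. if i < rdim E then w i else 0)" for w
  have tr: "clin tr" "tr w \<in> Supp (rdim E)" "w \<in> Supp (rdim E) \<Longrightarrow> tr w = w" for w
    unfolding tr_def clin_def fun_eq_iff by (simp_all add: not_less)
  have Xtr: "?X s i j (tr w) = ?X s i j w" for s i j w
  proof -
    have "mop (rdim E) (rdim E) M (tr w) = mop (rdim E) (rdim E) M w" for M
      by (auto simp: mop_def tr_def intro!: sum.cong)
    then show ?thesis by (simp add: XX_def)
  qed
  define \<phi> where "\<phi> w = \<phi>0 (tr w)" for w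
  have trX: "tr (?X s i j w) = ?X s i j w" for s i j w by (rule tr(3)[OF XX_Supp])
  have clphi: "clin \<phi>" unfolding \<phi>_def[abs_def] by (rule clin_comp[OF \<phi>0(1) tr(1)])
  have phiv: "\<phi> ?v = 1" by (simp add: \<phi>_def tr(3)[OF vS] \<phi>0(2))
  have "hw_mod ?r ?X ?v (al k n c) \<phi>"
  proof
    show "is_hw ?r ?X ?v (al k n c)" "clin \<phi>" "\<phi> ?v = 1" by (fact hw clphi phiv)+
    show "\<phi> (?X s i j w) = 0" if "1 \<le> j" "j < i" "i \<le> ?r s" for s i j w
      using \<phi>0(3)[OF tr(2) that, of w] by (simp add: \<phi>_def trX Xtr)
    show "\<phi> (?X s i i w) = al k n c s i * \<phi> w" if "i \<in> {1..?r s}" for s i w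
      using \<phi>0(4)[OF tr(2) that, of w] by (simp add: \<phi>_def trX Xtr)
    fix S0 assume S0: "\<And>w s i j. w \<in> S0 \<Longrightarrow> i \<in> {1..?r s} \<Longrightarrow> j \<in> {1..?r s} \<Longrightarrow> ?X s i j w \<in> S0"
      "\<And>w. w \<in> S0 \<Longrightarrow> \<phi> w = 0" "S0 \<subseteq> low ?r ?X ?v"
    define S where "S = cs.span S0"
    have sub: "cs.subspace S" unfolding S_def by (rule cs.subspace_span)
    have phiS: "\<phi> w = 0" if "w \<in> S" for w
    proof -
      have "cs.subspace {w. \<phi> w = 0}"
        unfolding cs.subspace_def by (simp add: clin_zero[OF clphi] clin_add[OF clphi] clin_scale[OF clphi])
      then show ?thesis using cs.span_induct[OF that[unfolded S_def], of "\<lambda>w. \<phi> w = 0"] S0(2) by auto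
    qed
    have SS: "S \<subseteq> Supp (rdim E)"
      using cs.span_minimal[OF _ low_subspace] S0(3) unfolding S_def lowS[symmetric] by blast
    have SX: "?X s i j w \<in> S" if "w \<in> S" "i \<in> {1..?r s}" "j \<in> {1..?r s}" for w s i j
    proof -
      have "cs.subspace {w. ?X s i j w \<in> S}"
        using sub unfolding cs.subspace_def
        by (simp add: clin_zero[OF clin_XX] clin_add[OF clin_XX] clin_scale[OF clin_XX])
      then show ?thesis
        using cs.span_induct[OF that(1)[unfolded S_def], of "\<lambda>w. ?X s i j w \<in> S"] S0(1)[OF _ that(2,3)]
        unfolding S_def by (auto intro: cs.span_base)
    qed
    let ?\<Psi> = "{\<psi>. clin \<psi> \<and> (\<forall>w\<in>S. \<psi> w = (0::complex))}"
    have "aop E g w \<in> S" if "g \<in> levi k n" "w \<in> S" for g w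
    proof (rule levi_invariant[OF E SS, of ?\<Psi>])
      show "w \<in> S" if "\<And>\<psi>. \<psi> \<in> ?\<Psi> \<Longrightarrow> \<psi> w = 0" for w
        by (rule sepa[OF sub that])
      show "dop k n E (YY n i j) w \<in> S" if "i < n + 1" "j < n + 1" "(i < k + 1) = (j < k + 1)" "w \<in> S" for i j w
        by (rule YX[OF _ sub that]) (rule SX)
    qed (use that in auto)
    then have "S = {0} \<or> S = Supp (rdim E)" by (rule irreducible_Supp[OF irr SS sub])
    moreover have "?v \<notin> S" using phiS phiv by force
    ultimately have "S = {0}" using vS by auto
    then show "S0 \<subseteq> {0}" using cs.span_superset[of S0] by (simp add: S_def)
  qed
  then show "\<exists>\<phi>. hw_mod ?r ?X ?v (al k n c) \<phi>" by blast
qed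

section \<open>Equivariant maps and intertwining operators\<close>

text \<open>The position of the matrix unit spanning the weight space of n_{p,q}, with row and
  column counted from 0; \<open>qs\<close> is the inverse.\<close>

definition ps :: "nat \<Rightarrow> (bool \<Rightarrow> nat) \<Rightarrow> nat \<times> nat" where
  "ps k a = (k + a False, k + 1 - a True)"

definition qs :: "nat \<Rightarrow> nat \<times> nat \<Rightarrow> bool \<Rightarrow> nat" where
  "qs k p = (\<lambda>s. if s then k + 1 - snd p else fst p - k)"

lemma J_rr: "a \<in> J (rr k n) \<longleftrightarrow> a True \<in> {1..k + 1} \<and> a False \<in> {1..n - k}"
  by (auto simp: J_def rr_def split: if_splits)

lemma ps_Pos: "k < n \<Longrightarrow> a \<in> J (rr k n) \<Longrightarrow> ps k a \<in> Pos k n"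
  by (auto simp: J_rr ps_def Pos_def)

lemma qs_J: "k < n \<Longrightarrow> p \<in> Pos k n \<Longrightarrow> qs k p \<in> J (rr k n)"
  by (auto simp: J_rr qs_def Pos_def)

lemma ps_qs: "p \<in> Pos k n \<Longrightarrow> ps k (qs k p) = p"
  by (auto simp: ps_def qs_def Pos_def)

lemma qs_ps: "a \<in> J (rr k n) \<Longrightarrow> qs k (ps k a) = a"
  by (auto simp: J_rr ps_def qs_def fun_eq_iff)

lemma com_eu:
  assumes p: "p \<in> Pos k n" and ij: "i < n + 1" "j < n + 1" "(i < k + 1) = (j < k + 1)"
    and q: "q \<in> Pos k n"
  shows "com n (YY n i j) (ent (eu n p)) (fst q) (snd q)
    = (if j = fst p then (if q = (i, snd p) then 1 else 0) else 0) - (if i = snd p then (if q = (fst p, j) then 1 else 0) else 0)"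
proof -
  have p': "fst p < n + 1" "snd p < n + 1" "fst p \<noteq> snd p" "k + 1 \<le> fst p" "snd p < k + 1" using p by (auto simp: Pos_def)
  have q': "fst q < n + 1" "snd q < n + 1" using q by (auto simp: Pos_def)
  have "com n (YY n i j) (ent (eu n p)) (fst q) (snd q) = com n (YY n i j) (YY n (fst p) (snd p)) (fst q) (snd q)"
    using p' q' by (intro com_cong) (auto simp: eu_def YY_offdiag prod_eq_iff)
  also have "\<dots> = (if j = fst p then YY n i (snd p) (fst q) (snd q) else 0) - (if i = snd p then YY n (fst p) j (fst q) (snd q) else 0)"
    by (rule com_YY) (use p' q' ij in auto)
  also have "\<dots> = (if j = fst p then (if q = (i, snd p) then 1 else 0) else 0) - (if i = snd p then (if q = (fst p, j) then 1 else 0) else 0)"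
    using p' ij by (auto simp: YY_def prod_eq_iff)
  finally show ?thesis .
qed

lemma com_eu_sum:
  assumes p: "p \<in> Pos k n" and ij: "i < n + 1" "j < n + 1" "(i < k + 1) = (j < k + 1)"
  shows "(\<Sum>q\<in>Pos k n. com n (YY n i j) (ent (eu n p)) (fst q) (snd q) * g q)
    = (if j = fst p then g (i, snd p) else 0) - (if i = snd p then g (fst p, j) else 0 :: complex)"
proof -
  have "(\<Sum>q\<in>Pos k n. com n (YY n i j) (ent (eu n p)) (fst q) (snd q) * g q)
    = (\<Sum>q\<in>Pos k n. if q = (i, snd p) then (if j = fst p then g q else 0) else 0)
      - (\<Sum>q\<in>Pos k n. if q = (fst p, j) then (if i = snd p then g q else 0) else 0)"
    unfolding sum_subtractf[symmetric]
  proof (intro sum.cong refl)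
    fix q assume q: "q \<in> Pos k n"
    show "com n (YY n i j) (ent (eu n p)) (fst q) (snd q) * g q
      = (if q = (i, snd p) then (if j = fst p then g q else 0) else 0) - (if q = (fst p, j) then (if i = snd p then g q else 0) else 0)"
      unfolding com_eu[OF p ij q] by auto
  qed
  moreover have "(i, snd p) \<in> Pos k n" if "j = fst p" using p ij that by (auto simp: Pos_def)
  moreover have "(fst p, j) \<in> Pos k n" if "i = snd p" using p ij that by (auto simp: Pos_def)
  ultimately show ?thesis by (auto simp: sum.delta)
qed

text \<open>Infinitesimal equivariance in terms of matrix positions, before the indices are
  rearranged as in \<open>intertwining\<close>. The two conditional terms are the products of a
  matrix unit of the nilradical with the acting one from the left and from the right.\<close>

definition dop_inter :: "nat \<Rightarrow> nat \<Rightarrow> rmod \<Rightarrow> rmod \<Rightarrow> (nat \<Rightarrow> complex) set \<Rightarrow>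
    (nat \<times> nat \<Rightarrow> (nat \<Rightarrow> complex) \<Rightarrow> nat \<Rightarrow> complex) \<Rightarrow> bool" where
  "dop_inter k n A B V fo \<longleftrightarrow> (\<forall>p\<in>Pos k n. \<forall>i<n + 1. \<forall>j<n + 1. \<forall>w\<in>V. (i < k + 1) = (j < k + 1) \<longrightarrow>
    dop k n B (YY n i j) (fo p w) = fo p (dop k n A (YY n i j) w)
      + ((if j = fst p then fo (i, snd p) w else 0) - (if i = snd p then fo (fst p, j) w else 0)))"

lemma dop_inter_intertwining:
  assumes kn: "k < n" and l: "\<And>p. clin (fo p)"
    and d: "dop_inter k n A B V fo"
  shows "intertwining (rr k n) (XX k n A) (XX k n B) V (\<lambda>a. fo (ps k a))"
  unfolding intertwining_def
proof (intro ballI allI)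
  fix a s i j w assume a: "a \<in> J (rr k n)" and ij: "i \<in> {1..rr k n s}" "j \<in> {1..rr k n s}" and w: "w \<in> V"
  have p: "ps k a \<in> Pos k n" using ps_Pos[OF kn a] .
  have a': "a True \<in> {1..k + 1}" "a False \<in> {1..n - k}" using a by (auto simp: J_rr)
  show "XX k n B s i j (fo (ps k a) w) = fo (ps k a) (XX k n A s i j w) + (if a s = j then fo (ps k (a(s := i))) w else 0)"
  proof (cases s)
    case True
    have r: "k + 1 - j < n + 1" "k + 1 - i < n + 1" "(k + 1 - j < k + 1) = (k + 1 - i < k + 1)"
      using ij True kn by (auto simp: rr_def)
    have "dop k n B (YY n (k + 1 - j) (k + 1 - i)) (fo (ps k a) w) = fo (ps k a) (dop k n A (YY n (k + 1 - j) (k + 1 - i)) w)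
      + ((if k + 1 - i = fst (ps k a) then fo (k + 1 - j, snd (ps k a)) w else 0)
         - (if k + 1 - j = snd (ps k a) then fo (fst (ps k a), k + 1 - i) w else 0))"
      using d[unfolded dop_inter_def, rule_format, OF p r(1,2) w r(3)] .
    moreover have "k + 1 - i \<noteq> fst (ps k a)" using ij a' True by (auto simp: ps_def rr_def)
    moreover have "k + 1 - j = snd (ps k a) \<longleftrightarrow> a s = j" using ij a' True by (auto simp: ps_def rr_def)
    moreover have "(fst (ps k a), k + 1 - i) = ps k (a(s := i))" using True by (simp add: ps_def)
    ultimately have "dop k n B (YY n (k + 1 - j) (k + 1 - i)) (fo (ps k a) w) = fo (ps k a) (dop k n A (YY n (k + 1 - j) (k + 1 - i)) w)
      - (if a s = j then fo (ps k (a(s := i))) w else 0)" by simp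
    then show ?thesis using True by (simp add: XX_def clin_minus[OF l])
  next
    case False
    have r: "k + i < n + 1" "k + j < n + 1" "(k + i < k + 1) = (k + j < k + 1)"
      using ij False kn by (auto simp: rr_def)
    have "dop k n B (YY n (k + i) (k + j)) (fo (ps k a) w) = fo (ps k a) (dop k n A (YY n (k + i) (k + j)) w)
      + ((if k + j = fst (ps k a) then fo (k + i, snd (ps k a)) w else 0)
         - (if k + i = snd (ps k a) then fo (fst (ps k a), k + j) w else 0))"
      using d[unfolded dop_inter_def, rule_format, OF p r(1,2) w r(3)] .
    moreover have "k + i \<noteq> snd (ps k a)" using ij a' False by (auto simp: ps_def rr_def)
    moreover have "k + j = fst (ps k a) \<longleftrightarrow> a s = j" using False by (auto simp: ps_def)
    moreover have "(k + i, snd (ps k a)) = ps k (a(s := i))" using False by (simp add: ps_def)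
    ultimately have "dop k n B (YY n (k + i) (k + j)) (fo (ps k a) w) = fo (ps k a) (dop k n A (YY n (k + i) (k + j)) w)
      + (if a s = j then fo (ps k (a(s := i))) w else 0)" by simp
    then show ?thesis using False by (simp add: XX_def)
  qed
qed

text \<open>The map is controlled on \<open>V\<close> only; its compatibility with signs is assumed
  there because of the sign in \<open>XX\<close> on the side of U.\<close>

lemma intertwining_dop_inter:
  assumes kn: "k < n" and l: "\<And>a w. a \<in> J (rr k n) \<Longrightarrow> w \<in> V \<Longrightarrow> f a (- w) = - f a w"
    and V: "\<And>Y w. w \<in> V \<Longrightarrow> dop k n A Y w \<in> V"
    and d: "intertwining (rr k n) (XX k n A) (XX k n B) V f"
  shows "dop_inter k n A B V (\<lambda>p. f (qs k p))"
  unfolding dop_inter_def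
proof (intro ballI allI impI)
  fix p i j w assume p: "p \<in> Pos k n" and ij: "i < n + 1" "j < n + 1" and w: "w \<in> V" and b: "(i < k + 1) = (j < k + 1)"
  let ?a = "qs k p"
  have a: "?a \<in> J (rr k n)" by (rule qs_J[OF kn p])
  have p': "k + 1 \<le> fst p" "fst p \<le> n" "snd p \<le> k" using p by (auto simp: Pos_def)
  show "dop k n B (YY n i j) (f ?a w) = f ?a (dop k n A (YY n i j) w)
      + ((if j = fst p then f (qs k (i, snd p)) w else 0) - (if i = snd p then f (qs k (fst p, j)) w else 0))"
  proof (cases "i < k + 1")
    case True
    have r: "k + 1 - j \<in> {1..rr k n True}" "k + 1 - i \<in> {1..rr k n True}" using True b by (auto simp: rr_def)
    have "XX k n B True (k + 1 - j) (k + 1 - i) (f ?a w) = f ?a (XX k n A True (k + 1 - j) (k + 1 - i) w)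
        + (if ?a True = k + 1 - i then f (?a(True := k + 1 - j)) w else 0)"
      using d[unfolded intertwining_def, rule_format, OF a r w] .
    moreover have "?a True = k + 1 - i \<longleftrightarrow> i = snd p" using True p' by (auto simp: qs_def)
    moreover have "?a(True := k + 1 - j) = qs k (fst p, j)" by (auto simp: qs_def fun_eq_iff)
    moreover have "k + 1 - (k + 1 - i) = i" "k + 1 - (k + 1 - j) = j" using True b by auto
    moreover have "j \<noteq> fst p" using True b p' by auto
    ultimately show ?thesis using l[OF a V[OF w, of "YY n i j"]] by (simp add: XX_def) (auto split: if_splits simp: minus_equation_iff[of "dop k n B Y w" for Y w])
  next
    case False
    have r: "i - k \<in> {1..rr k n False}" "j - k \<in> {1..rr k n False}" using False b ij kn by (auto simp: rr_def)
    have "XX k n B False (i - k) (j - k) (f ?a w) = f ?a (XX k n A False (i - k) (j - k) w)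
        + (if ?a False = j - k then f (?a(False := i - k)) w else 0)"
      using d[unfolded intertwining_def, rule_format, OF a r w] .
    moreover have "?a False = j - k \<longleftrightarrow> j = fst p" using False b p' by (auto simp: qs_def)
    moreover have "?a(False := i - k) = qs k (i, snd p)" by (auto simp: qs_def fun_eq_iff)
    moreover have "k + (i - k) = i" "k + (j - k) = j" using False b by auto
    moreover have "i \<noteq> snd p" using False p' by auto
    ultimately show ?thesis by (simp add: XX_def)
  qed
qed

definition fop :: "nat \<Rightarrow> rmod \<Rightarrow> rmod \<Rightarrow> (complex mat \<Rightarrow> complex mat) \<Rightarrow> nat \<times> nat \<Rightarrow> (nat \<Rightarrow> complex) \<Rightarrow> nat \<Rightarrow> complex" where
  "fop n A B f p = mop (rdim B) (rdim A) (ent (f (eu n p)))"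

lemma clin_fop: "clin (fop n A B f p)"
  unfolding fop_def by (rule clin_mop)

lemma mop_dop_eq:
  assumes "\<And>u v. u < dB \<Longrightarrow> v < dA \<Longrightarrow>
    C u v + (\<Sum>l<dA. M u l * DA l v) = (\<Sum>l<dB. DB u l * M l v)"
  shows "mop dB dB DB (mop dB dA M w) = mop dB dA M (mop dA dA DA w) + mop dB dA C w"
proof -
  have "mop dB dB DB (mop dB dA M w) = mop dB dA ((\<lambda>u v. \<Sum>l<dA. M u l * DA l v) + C) w"
    unfolding mop_mop
  proof (rule mop_cong)
    fix u v assume "u < dB" "v < dA"
    then show "(\<Sum>l<dB. DB u l * M l v) = ((\<lambda>u v. \<Sum>l<dA. M u l * DA l v) + C) u v"
      by (simp only: assms[OF \<open>u < dB\<close> \<open>v < dA\<close>, symmetric] plus_fun_apply add.commute)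
  qed
  then show ?thesis unfolding clin_add[OF clin_mop_matrix] mop_mop .
qed

lemma mop_if: "mop dB dA (\<lambda>u v. (if c then M u v else 0) - (if c' then M' u v else 0)) w
    = (if c then mop dB dA M w else 0) - (if c' then mop dB dA M' w else 0)"
  by (cases c; cases c') (auto simp: mop_def fun_eq_iff sum_subtractf left_diff_distrib sum_negf)

lemma Ext1_dop_inter:
  assumes kn: "k < n" and A: "is_module k n A" and B: "is_module k n B" and f: "f \<in> Ext1_G k n A B"
  shows "dop_inter k n A B UNIV (fop n A B f)"
  unfolding dop_inter_def
proof (intro ballI allI impI)
  fix p i j w assume p: "p \<in> Pos k n" and ij: "i < n + 1" "j < n + 1" and b: "(i < k + 1) = (j < k + 1)"
  have "dop k n B (YY n i j) (mop (rdim B) (rdim A) (ent (f (eu n p))) w)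
    = mop (rdim B) (rdim A) (ent (f (eu n p))) (dop k n A (YY n i j) w)
      + mop (rdim B) (rdim A) (\<lambda>u v. (if j = fst p then ent (f (eu n (i, snd p))) u v else 0)
        - (if i = snd p then ent (f (eu n (fst p, j))) u v else 0)) w"
  proof (rule mop_dop_eq)
    fix u v assume uv: "u < rdim B" "v < rdim A"
    show "((if j = fst p then ent (f (eu n (i, snd p))) u v else 0) - (if i = snd p then ent (f (eu n (fst p, j))) u v else 0))
      + (\<Sum>l<rdim A. ent (f (eu n p)) u l * dact k n A (YY n i j) l v) = (\<Sum>l<rdim B. dact k n B (YY n i j) u l * ent (f (eu n p)) l v)"
      using Ext1_lie[OF kn A B f YY_tang[OF ij b] eu_nilrad[OF kn p] uv]
      unfolding com_eu_sum[OF p ij b, of "\<lambda>p. f (eu n p) $$ (u, v)"] .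
  qed
  then show "dop k n B (YY n i j) (fop n A B f p w) = fop n A B f p (dop k n A (YY n i j) w)
      + ((if j = fst p then fop n A B f (i, snd p) w else 0) - (if i = snd p then fop n A B f (fst p, j) w else 0))"
    unfolding mop_if fop_def .
qed

lemma Ext1_intertwining:
  assumes "k < n" "is_module k n A" "is_module k n B" "f \<in> Ext1_G k n A B"
  shows "intertwining (rr k n) (XX k n A) (XX k n B) UNIV (\<lambda>a. fop n A B f (ps k a))"
  by (rule dop_inter_intertwining[OF assms(1) clin_fop Ext1_dop_inter[OF assms]])

text \<open>Equivariance with two nilradical arguments, shared by composites of two arrows, their
  wedges and elements of Ext^2.\<close>

definition bi_inter :: "(bool \<Rightarrow> nat) \<Rightarrow> 'a::cspace ops \<Rightarrow> 'b::cspace ops \<Rightarrow>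
    ((bool \<Rightarrow> nat) \<Rightarrow> (bool \<Rightarrow> nat) \<Rightarrow> 'a \<Rightarrow> 'b) \<Rightarrow> bool" where
  "bi_inter r XA XB G \<longleftrightarrow> (\<forall>a\<in>J r. \<forall>a'\<in>J r. \<forall>s. \<forall>i\<in>{1..r s}. \<forall>j\<in>{1..r s}. \<forall>w.
    XB s i j (G a a' w) = G a a' (XA s i j w) + (if a s = j then G (a(s := i)) a' w else 0)
      + (if a' s = j then G a (a'(s := i)) w else 0))"

lemma Ext2_bi_inter:
  assumes kn: "k < n" and A: "is_module k n A" and B: "is_module k n B" and f: "f \<in> Ext2_G k n A B"
  shows "bi_inter (rr k n) (XX k n A) (XX k n B) (\<lambda>a a'. mop (rdim B) (rdim A) (ent (f (eu n (ps k a)) (eu n (ps k a')))))"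
  unfolding bi_inter_def
proof (intro ballI allI)
  fix a a' s i j w
  assume a: "a \<in> J (rr k n)" "a' \<in> J (rr k n)" and ij: "i \<in> {1..rr k n s}" "j \<in> {1..rr k n s}"
  let ?p = "ps k a" let ?q = "ps k a'"
  let ?M = "\<lambda>p q. mop (rdim B) (rdim A) (ent (f (eu n p) (eu n q)))"
  have p: "?p \<in> Pos k n" "?q \<in> Pos k n" using ps_Pos[OF kn] a by auto
  have R: "a True \<in> {1..k + 1}" "a False \<in> {1..n - k}" "a' True \<in> {1..k + 1}" "a' False \<in> {1..n - k}" using a by (auto simp: J_rr)
  have main: "dop k n B (YY n i j) (?M ?p ?q w) = ?M ?p ?q (dop k n A (YY n i j) w)
      + (((if j = fst ?p then ?M (i, snd ?p) ?q w else 0) - (if i = snd ?p then ?M (fst ?p, j) ?q w else 0))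
       + ((if j = fst ?q then ?M ?p (i, snd ?q) w else 0) - (if i = snd ?q then ?M ?p (fst ?q, j) w else 0)))"
    if ij: "i < n + 1" "j < n + 1" "(i < k + 1) = (j < k + 1)" for i j
  proof -
    let ?C = "\<lambda>u v. (if j = fst ?p then ent (f (eu n (i, snd ?p)) (eu n ?q)) u v else 0) - (if i = snd ?p then ent (f (eu n (fst ?p, j)) (eu n ?q)) u v else 0)"
    let ?C' = "\<lambda>u v. (if j = fst ?q then ent (f (eu n ?p) (eu n (i, snd ?q))) u v else 0) - (if i = snd ?q then ent (f (eu n ?p) (eu n (fst ?q, j))) u v else 0)"
    have "dop k n B (YY n i j) (?M ?p ?q w) = ?M ?p ?q (dop k n A (YY n i j) w) + mop (rdim B) (rdim A) (?C + ?C') w"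
    proof (rule mop_dop_eq)
      fix u v assume uv: "u < rdim B" "v < rdim A"
      show "(?C + ?C') u v + (\<Sum>l<rdim A. ent (f (eu n ?p) (eu n ?q)) u l * dact k n A (YY n i j) l v)
        = (\<Sum>l<rdim B. dact k n B (YY n i j) u l * ent (f (eu n ?p) (eu n ?q)) l v)"
        using Ext2_lie[OF kn A B f YY_tang[OF ij] eu_nilrad[OF kn p(1)] eu_nilrad[OF kn p(2)] uv]
        unfolding com_eu_sum[OF p(1) ij, of "\<lambda>p. f (eu n p) (eu n ?q) $$ (u, v)"]
          com_eu_sum[OF p(2) ij, of "\<lambda>p. f (eu n ?p) (eu n p) $$ (u, v)"] plus_fun_apply .
    qed
    then show ?thesis unfolding clin_add[OF clin_mop_matrix] mop_if .
  qed
  show "XX k n B s i j (?M ?p ?q w) = ?M ?p ?q (XX k n A s i j w) + (if a s = j then ?M (ps k (a(s := i))) ?q w else 0)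
      + (if a' s = j then ?M ?p (ps k (a'(s := i))) w else 0)"
  proof (cases s)
    case True
    have r: "k + 1 - j < n + 1" "k + 1 - i < n + 1" "(k + 1 - j < k + 1) = (k + 1 - i < k + 1)"
      using ij True kn by (auto simp: rr_def)
    have e: "k + 1 - i \<noteq> fst ?p" "k + 1 - i \<noteq> fst ?q" "k + 1 - j = snd ?p \<longleftrightarrow> a s = j" "k + 1 - j = snd ?q \<longleftrightarrow> a' s = j"
      "(fst ?p, k + 1 - i) = ps k (a(s := i))" "(fst ?q, k + 1 - i) = ps k (a'(s := i))"
      using ij R True by (auto simp: ps_def rr_def)
    have "dop k n B (YY n (k + 1 - j) (k + 1 - i)) (?M ?p ?q w) = ?M ?p ?q (dop k n A (YY n (k + 1 - j) (k + 1 - i)) w)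
        - (if a s = j then ?M (ps k (a(s := i))) ?q w else 0) - (if a' s = j then ?M ?p (ps k (a'(s := i))) w else 0)"
      using main[OF r] e by simp
    then show ?thesis using True by (simp add: XX_def clin_minus[OF clin_mop])
  next
    case False
    have r: "k + i < n + 1" "k + j < n + 1" "(k + i < k + 1) = (k + j < k + 1)"
      using ij False kn by (auto simp: rr_def)
    have e: "k + i \<noteq> snd ?p" "k + i \<noteq> snd ?q" "k + j = fst ?p \<longleftrightarrow> a s = j" "k + j = fst ?q \<longleftrightarrow> a' s = j"
      "(k + i, snd ?p) = ps k (a(s := i))" "(k + i, snd ?q) = ps k (a'(s := i))"
      using ij R False by (auto simp: ps_def rr_def)
    have "dop k n B (YY n (k + i) (k + j)) (?M ?p ?q w) = ?M ?p ?q (dop k n A (YY n (k + i) (k + j)) w)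
        + (if a s = j then ?M (ps k (a(s := i))) ?q w else 0) + (if a' s = j then ?M ?p (ps k (a'(s := i))) w else 0)"
      using main[OF r] e by simp
    then show ?thesis using False by (simp add: XX_def)
  qed
qed

context hw_pair
begin

text \<open>The operators \<open>G a a'\<close> form a family as in \<open>family_zero\<close>: the
  two Leibniz terms in a commutator are again members of it.\<close>

lemma bi_inter_zero:
  assumes l: "\<And>a a'. clin (G a a')" and V: "\<And>a a' w. G a a' w \<in> VB" and b: "bi_inter r XA XB G"
    and z: "\<And>a a'. a \<in> J r \<Longrightarrow> a' \<in> J r \<Longrightarrow> \<phi>B (G a a' vA) = 0"
    and aw: "a \<in> J r" "a' \<in> J r" "w \<in> VA"
  shows "G a a' w = 0"
proof (rule family_zero[of "{G a a' | a a'. a \<in> J r \<and> a' \<in> J r}"])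
  fix F s i j assume "F \<in> {G a a' | a a'. a \<in> J r \<and> a' \<in> J r}" and ij: "i \<in> {1..r s}" "j \<in> {1..r s}"
  then obtain a a' where F: "F = G a a'" "a \<in> J r" "a' \<in> J r" by blast
  let ?Gs = "(if a s = j then [G (a(s := i)) a'] else []) @ (if a' s = j then [G a (a'(s := i))] else [])"
  have "set ?Gs \<subseteq> {G a a' | a a'. a \<in> J r \<and> a' \<in> J r}"
    using F J_upd[OF F(2) ij(1)] J_upd[OF F(3) ij(1)] by auto
  moreover have "XB s i j (F w) = F (XA s i j w) + (\<Sum>G\<leftarrow>?Gs. G w)" for w
    using b[unfolded bi_inter_def, rule_format, OF F(2,3) ij, of w] F(1) by simp
  ultimately show "\<exists>Gs. set Gs \<subseteq> {G a a' | a a'. a \<in> J r \<and> a' \<in> J r} \<and> (\<forall>w\<in>VA. XB s i j (F w) = F (XA s i j w) + (\<Sum>G\<leftarrow>Gs. G w))"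
    by blast
qed (use assms in auto)

text \<open>The diagonal operator \<open>i\<close> scales the coefficient by one eigenvalue when
  read at the source and by a different one when read at the target.\<close>

lemma bi_inter_weight:
  assumes l: "clin (G a a')" and b: "bi_inter r XA XB G" and a: "a \<in> J r" "a' \<in> J r"
    and w: "i \<in> {1..r s}" "\<alpha>B s i \<noteq> \<alpha>A s i + (if a s = i then 1 else 0) + (if a' s = i then 1 else 0)"
  shows "\<phi>B (G a a' vA) = 0"
proof -
  have u: "a(s := i) = a" if "a s = i" for a :: "bool \<Rightarrow> nat" using that by auto
  have "XB s i i (G a a' vA) = (\<alpha>A s i + (if a s = i then 1 else 0) + (if a' s = i then 1 else 0)) *\<^sub>C G a a' vA"
    using b[unfolded bi_inter_def, rule_format, OF a w(1) w(1), of vA] u[of a] u[of a']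
    by (auto simp: A.diag_v[OF w(1)] clin_scale[OF l] scaleC_add_left scaleC_one)
  then have "\<alpha>B s i * \<phi>B (G a a' vA)
      = (\<alpha>A s i + (if a s = i then 1 else 0) + (if a' s = i then 1 else 0)) * \<phi>B (G a a' vA)"
    using B.phi_diag[OF w(1), of "G a a' vA"] by (simp only: clin_scale[OF B.clin_phi] scaleC_complex)
  then show ?thesis using w(2) by (metis mult_right_cancel)
qed

end

section \<open>Existence of equivariant maps\<close>

lemma adj_mat_mult:
  assumes g: "g \<in> levi k n" and h: "h \<in> levi k n"
  shows "adj_mat (g * h) = adj_mat h * adj_mat g"
proof -
  let ?m = "n + 1"
  note as = assoc_mult_mat[of _ ?m ?m _ ?m _ ?m]
  have c: "g \<in> carrier_mat ?m ?m" "h \<in> carrier_mat ?m ?m" using g h levi_carrier by auto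
  have a: "adj_mat g \<in> carrier_mat ?m ?m" "g * adj_mat g = 1\<^sub>m ?m" "adj_mat h \<in> carrier_mat ?m ?m" "h * adj_mat h = 1\<^sub>m ?m"
    using adj_mat[OF c(1)] adj_mat[OF c(2)] g h by (auto simp: levi_def)
  have "g * h * (adj_mat h * adj_mat g) = g * (h * (adj_mat h * adj_mat g))"
    using a c by (intro as) auto
  also have "h * (adj_mat h * adj_mat g) = h * adj_mat h * adj_mat g"
    using a c by (intro as[symmetric]) auto
  also have "\<dots> = adj_mat g" using a by simp
  finally have "g * h * (adj_mat h * adj_mat g) = 1\<^sub>m ?m" using a by simp
  then show ?thesis using a by (intro adj_mat_levi[OF levi_mult[OF g h]]) auto
qed

lemma Ad_mult:
  assumes g: "g \<in> levi k n" and h: "h \<in> levi k n" and x: "x \<in> carrier_mat (n + 1) (n + 1)"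
  shows "Ad (g * h) x = Ad g (Ad h x)"
proof -
  let ?m = "n + 1"
  note as = assoc_mult_mat[of _ ?m ?m _ ?m _ ?m]
  have c: "g \<in> carrier_mat ?m ?m" "h \<in> carrier_mat ?m ?m" using g h levi_carrier by auto
  have a: "adj_mat g \<in> carrier_mat ?m ?m" "adj_mat h \<in> carrier_mat ?m ?m"
    using adj_mat[OF c(1)] adj_mat[OF c(2)] by auto
  have "g * h * x * (adj_mat h * adj_mat g) = g * h * x * adj_mat h * adj_mat g"
    using a c x by (intro as[symmetric]) auto
  moreover have "g * h * x = g * (h * x)" using a c x by (intro as) auto
  moreover have "g * (h * x) * adj_mat h = g * (h * x * adj_mat h)" using a c x by (intro as) auto
  ultimately show ?thesis unfolding Ad_def adj_mat_mult[OF g h] by (simp only:)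
qed

lemma Ad_add:
  assumes "g \<in> carrier_mat m m" "x \<in> carrier_mat m m" "y \<in> carrier_mat m m"
  shows "Ad g (x + y) = Ad g x + Ad g y"
  unfolding Ad_def using assms adj_mat(1)[OF assms(1)]
  by (subst mult_add_distrib_mat[of _ m m _ m], simp_all, subst add_mult_distrib_mat[of _ m m _ _ m], simp_all)

lemma Ad_smult:
  assumes "g \<in> carrier_mat m m" "x \<in> carrier_mat m m"
  shows "Ad g (c \<cdot>\<^sub>m x) = c \<cdot>\<^sub>m Ad g x"
  unfolding Ad_def using assms adj_mat(1)[OF assms(1)]
  by (subst mult_smult_distrib[of _ m m _ m], simp_all, subst mult_smult_assoc_mat[of _ m m _ m], simp_all)

lemma Ad_expand:
  assumes kn: "k < n" and g: "g \<in> levi k n" and x: "x \<in> nilrad k n" and q: "fst q < n + 1" "snd q < n + 1"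
  shows "Ad g x $$ q = (\<Sum>p\<in>Pos k n. x $$ p * Ad g (eu n p) $$ q)"
proof (rule nil_expand[OF kn _ _ x])
  have gc: "g \<in> carrier_mat (n + 1) (n + 1)" by (rule levi_carrier[OF g])
  have c: "Ad g x \<in> carrier_mat (n + 1) (n + 1)" if "x \<in> nilrad k n" for x
    using gc nilrad_carrier[OF that] adj_mat(1)[OF gc] by (auto simp: Ad_def)
  show "Ad g (x + y) $$ q = Ad g x $$ q + Ad g y $$ q" if "x \<in> nilrad k n" "y \<in> nilrad k n" for x y
    using c[OF that(1)] c[OF that(2)] q by (cases q) (simp add: Ad_add[OF gc nilrad_carrier[OF that(1)] nilrad_carrier[OF that(2)]])
  show "Ad g (a \<cdot>\<^sub>m x) $$ q = a * Ad g x $$ q" if "x \<in> nilrad k n" for a x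
    using c[OF that] q by (cases q) (simp add: Ad_smult[OF gc nilrad_carrier[OF that]])
qed

text \<open>The derivative at 0 is moved to \<open>z\<close> with \<open>Ad (\<gamma> z)\<close>
  applied last, so the values \<open>Ad (\<gamma> z) (eu n p')\<close> reappear and the system of
  differential equations closes up.\<close>

lemma Ad_eu_deriv:
  assumes kn: "k < n" and \<gamma>: "one_param k n \<gamma> Y" and p: "p \<in> Pos k n" and q: "q \<in> Pos k n"
  shows "((\<lambda>z. Ad (\<gamma> z) (eu n p) $$ q) has_field_derivative
    (\<Sum>p'\<in>Pos k n. com n Y (ent (eu n p)) (fst p') (snd p') * Ad (\<gamma> z) (eu n p') $$ q)) (at z)"
proof -
  have l: "\<gamma> z \<in> levi k n" for z using \<gamma> by (simp add: one_param_def)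
  have q': "fst q < n + 1" "snd q < n + 1" using q by (auto simp: Pos_def)
  have e: "Ad (\<gamma> (z + h)) (eu n p) $$ q = (\<Sum>p'\<in>Pos k n. Ad (\<gamma> h) (eu n p) $$ p' * Ad (\<gamma> z) (eu n p') $$ q)" for h
  proof -
    have "\<gamma> (z + h) = \<gamma> z * \<gamma> h" using \<gamma> by (simp add: one_param_def)
    then show ?thesis
      using Ad_expand[OF kn l Ad_one_param_nilrad[OF \<gamma> eu_nilrad[OF kn p], of h] q', of z]
        Ad_mult[OF l l nilrad_carrier[OF eu_nilrad[OF kn p]], of z h] by simp
  qed
  have "((\<lambda>h. Ad (\<gamma> h) (eu n p) $$ p') has_field_derivative com n Y (ent (eu n p)) (fst p') (snd p')) (at 0)"
    if "p' \<in> Pos k n" for p'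
    using Ad_deriv[OF \<gamma> nilrad_carrier[OF eu_nilrad[OF kn p]], of "fst p'" "snd p'"] that by (auto simp: Pos_def)
  then have "((\<lambda>h. Ad (\<gamma> (z + h)) (eu n p) $$ q) has_field_derivative
    (\<Sum>p'\<in>Pos k n. com n Y (ent (eu n p)) (fst p') (snd p') * Ad (\<gamma> z) (eu n p') $$ q)) (at (z - z))"
    unfolding e by (auto intro!: DERIV_sum DERIV_cmult_right)
  from DERIV_shift[of "\<lambda>h. Ad (\<gamma> (z + h)) (eu n p) $$ q" _ z "- z"] this show ?thesis by simp
qed

text \<open>The defects \<open>R\<close> of equivariance, for all positions and all vectors
  together, satisfy a linear differential system and vanish at 0.\<close>

lemma one_param_equivariant:
  assumes kn: "k < n" and A: "is_module k n A" and B: "is_module k n B" and \<gamma>: "one_param k n \<gamma> Y"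
    and lo: "\<And>p. clin (fo p)" and fS: "\<And>p w. fo p w \<in> Supp (rdim B)"
    and H: "\<And>p w. p \<in> Pos k n \<Longrightarrow> w \<in> Supp (rdim A) \<Longrightarrow> dop k n B Y (fo p w) = fo p (dop k n A Y w)
      + (\<Sum>q\<in>Pos k n. com n Y (ent (eu n p)) (fst q) (snd q) *\<^sub>C fo q w)"
    and p: "p \<in> Pos k n" and w: "w \<in> Supp (rdim A)"
  shows "(\<Sum>q\<in>Pos k n. Ad (\<gamma> z) (eu n p) $$ q *\<^sub>C fo q (aop A (\<gamma> z) w)) = aop B (\<gamma> z) (fo p w)"
proof
  fix u :: nat
  define c where "c p q = com n Y (ent (eu n p)) (fst q) (snd q)" for p q
  define R where "R s z = (\<Sum>q\<in>Pos k n. Ad (\<gamma> z) (eu n (fst s)) $$ q * fo q (aop A (\<gamma> z) (snd s)) u) - aop B (\<gamma> z) (fo (fst s) (snd s)) u"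
    for s and z :: complex
  have Rsc: "R (p, c *\<^sub>C w) z = c * R (p, w) z" for p c w z
    unfolding R_def fst_conv snd_conv clin_scale[OF lo] clin_scale[OF clin_mop] scaleC_fun_apply scaleC_complex
    by (simp only: right_diff_distrib sum_distrib_left mult.left_commute)
  have "R (p, w) z = 0"
  proof (rule entire_system_zero[where R = R and s = "(p, w)" and P = "\<lambda>s. fst s \<in> Pos k n \<and> snd s \<in> Supp (rdim A)"])
    fix s :: "(nat \<times> nat) \<times> (nat \<Rightarrow> complex)" assume s: "fst s \<in> Pos k n \<and> snd s \<in> Supp (rdim A)"
    have g0: "\<gamma> 0 = 1\<^sub>m (n + 1)" using \<gamma> by (simp add: one_param_def)
    have "(\<Sum>q\<in>Pos k n. Ad (\<gamma> 0) (eu n (fst s)) $$ q * fo q (aop A (\<gamma> 0) (snd s)) u) = fo (fst s) (snd s) u"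
    proof -
      have e: "eu n (fst s) $$ q = (if q = fst s then 1 else 0)" if "q \<in> Pos k n" for q
        using that by (cases q) (auto simp: Pos_def eu_def)
      have o: "aop A (1\<^sub>m (n + 1)) (snd s) = snd s" using s by (intro aop_one[OF A]) simp
      have "(\<Sum>q\<in>Pos k n. eu n (fst s) $$ q * fo q (snd s) u) = (\<Sum>q\<in>Pos k n. if q = fst s then fo q (snd s) u else 0)"
        by (intro sum.cong refl) (simp add: e)
      then show ?thesis
        unfolding Ad_zero[OF \<gamma> nilrad_carrier[OF eu_nilrad[OF kn conjunct1[OF s]]]] unfolding g0 o using s by (simp add: sum.delta)
    qed
    then show "R s 0 = 0" using s fS by (simp add: R_def g0 aop_one[OF B])
  next
    fix s :: "(nat \<times> nat) \<times> (nat \<Rightarrow> complex)" assume s: "fst s \<in> Pos k n \<and> snd s \<in> Supp (rdim A)"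
    obtain p w where pw: "s = (p, w)" by (cases s)
    have p: "p \<in> Pos k n" and w: "w \<in> Supp (rdim A)" using s pw by auto
    obtain ps where ps: "set ps = Pos k n" "distinct ps" using finite_distinct_list[OF finite_Pos] by blast
    \<comment> \<open>The derivative of the defect at (p, w): the operator on the module contributes
      the index (p, Y w), the bracket with the nilradical the indices p' with \<open>w\<close>
      scaled.\<close>
    let ?ss = "(p, dop k n A Y w) # map (\<lambda>p'. (p', c p p' *\<^sub>C w)) ps"
    have "(R s has_field_derivative (\<Sum>s'\<leftarrow>?ss. R s' z)) (at z)" for z
    proof -
      have l: "clin (\<lambda>x. fo q x u)" for q by (simp add: clin_def clin_add[OF lo] clin_scale[OF lo] scaleC_fun_apply)
      have D1: "((\<lambda>z. \<Sum>q\<in>Pos k n. Ad (\<gamma> z) (eu n p) $$ q * fo q (aop A (\<gamma> z) w) u) has_field_derivative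
        (\<Sum>q\<in>Pos k n. (\<Sum>p'\<in>Pos k n. c p p' * Ad (\<gamma> z) (eu n p') $$ q) * fo q (aop A (\<gamma> z) w) u
          + fo q (aop A (\<gamma> z) (dop k n A Y w)) u * Ad (\<gamma> z) (eu n p) $$ q)) (at z)"
        unfolding c_def
        by (intro DERIV_sum DERIV_mult Ad_eu_deriv[OF kn \<gamma> p] aop_deriv[OF A \<gamma> l])
      have D2: "((\<lambda>z. aop B (\<gamma> z) (fo p w) u) has_field_derivative aop B (\<gamma> z) (dop k n B Y (fo p w)) u) (at z)"
        by (rule aop_deriv[OF B \<gamma> clin_apply])
      have E: "(\<Sum>q\<in>Pos k n. (\<Sum>p'\<in>Pos k n. c p p' * Ad (\<gamma> z) (eu n p') $$ q) * fo q (aop A (\<gamma> z) w) u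
          + fo q (aop A (\<gamma> z) (dop k n A Y w)) u * Ad (\<gamma> z) (eu n p) $$ q) - aop B (\<gamma> z) (dop k n B Y (fo p w)) u
        = R (p, dop k n A Y w) z + (\<Sum>p'\<in>Pos k n. c p p' * R (p', w) z)"
      proof -
        have "aop B (\<gamma> z) (dop k n B Y (fo p w)) = aop B (\<gamma> z) (fo p (dop k n A Y w))
            + (\<Sum>q\<in>Pos k n. c p q *\<^sub>C aop B (\<gamma> z) (fo q w))"
          unfolding H[OF p w] c_def clin_add[OF clin_mop] clin_sum[OF clin_mop] clin_scale[OF clin_mop] ..
        then have 1: "aop B (\<gamma> z) (dop k n B Y (fo p w)) u = aop B (\<gamma> z) (fo p (dop k n A Y w)) u
            + (\<Sum>q\<in>Pos k n. c p q * aop B (\<gamma> z) (fo q w) u)"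
          by (simp only: plus_fun_apply sum_fun_apply scaleC_fun_apply scaleC_complex)
        have 2: "(\<Sum>q\<in>Pos k n. (\<Sum>p'\<in>Pos k n. c p p' * Ad (\<gamma> z) (eu n p') $$ q) * fo q (aop A (\<gamma> z) w) u)
          = (\<Sum>p'\<in>Pos k n. c p p' * (\<Sum>q\<in>Pos k n. Ad (\<gamma> z) (eu n p') $$ q * fo q (aop A (\<gamma> z) w) u))"
          unfolding sum_distrib_left sum_distrib_right by (subst sum.swap) (simp add: mult.assoc)
        show ?thesis unfolding 1 sum.distrib 2 R_def fst_conv snd_conv right_diff_distrib sum_subtractf
          by (simp add: mult.commute)
      qed
      have F: "(\<Sum>s'\<leftarrow>?ss. R s' z) = R (p, dop k n A Y w) z + (\<Sum>p'\<in>Pos k n. c p p' * R (p', w) z)"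
        by (simp add: Rsc comp_def sum_list_distinct_conv_sum_set[OF ps(2)] ps(1))
      have R: "R s = (\<lambda>z. (\<Sum>q\<in>Pos k n. Ad (\<gamma> z) (eu n p) $$ q * fo q (aop A (\<gamma> z) w) u) - aop B (\<gamma> z) (fo p w) u)"
        unfolding pw R_def[abs_def] fst_conv snd_conv ..
      show ?thesis unfolding R F E[symmetric] by (rule DERIV_diff[OF D1 D2])
    qed
    moreover have "\<forall>s'\<in>set ?ss. fst s' \<in> Pos k n \<and> snd s' \<in> Supp (rdim A)"
      using p w ps mop_Supp[of "rdim A" "rdim A" "dact k n A Y" w] by simp
    ultimately show "\<exists>ss. (\<forall>s'\<in>set ss. fst s' \<in> Pos k n \<and> snd s' \<in> Supp (rdim A)) \<and>
      (\<forall>z. (R s has_field_derivative (\<Sum>s'\<leftarrow>ss. R s' z)) (at z))" by blast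
  qed (use p w in simp)
  then show "(\<Sum>q\<in>Pos k n. Ad (\<gamma> z) (eu n p) $$ q *\<^sub>C fo q (aop A (\<gamma> z) w)) u = aop B (\<gamma> z) (fo p w) u"
    by (simp add: R_def sum_fun_apply scaleC_fun_apply)
qed

lemma dop_inter_YY:
  assumes d: "dop_inter k n A B V fo" and p: "p \<in> Pos k n" and w: "w \<in> V"
    and ij: "i < n + 1" "j < n + 1" "(i < k + 1) = (j < k + 1)"
  shows "dop k n B (YY n i j) (fo p w) = fo p (dop k n A (YY n i j) w)
      + (\<Sum>q\<in>Pos k n. com n (YY n i j) (ent (eu n p)) (fst q) (snd q) *\<^sub>C fo q w)"
proof
  fix u
  have "(\<Sum>q\<in>Pos k n. com n (YY n i j) (ent (eu n p)) (fst q) (snd q) *\<^sub>C fo q w) u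
    = ((if j = fst p then fo (i, snd p) w else 0) - (if i = snd p then fo (fst p, j) w else 0)) u"
    unfolding sum_fun_apply scaleC_fun_apply scaleC_complex com_eu_sum[OF p ij] by (cases "j = fst p"; cases "i = snd p") simp_all
  then show "dop k n B (YY n i j) (fo p w) u = (fo p (dop k n A (YY n i j) w)
      + (\<Sum>q\<in>Pos k n. com n (YY n i j) (ent (eu n p)) (fst q) (snd q) *\<^sub>C fo q w)) u"
    unfolding d[unfolded dop_inter_def, rule_format, OF p ij(1,2) w ij(3)] plus_fun_apply by simp
qed

lemma mop_unit: "u < d' \<Longrightarrow> v < d \<Longrightarrow> mop d' d M (\<lambda>j. if j = v then 1 else 0) u = M u v"
  by (simp add: mop_def if_distrib sum.delta cong: if_cong)

text \<open>Integrates infinitesimal equivariance. It holds along one-parameter subgroups, is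
  inherited by products, and by \<open>levi_Gen\<close> these exhaust the Levi subgroup.\<close>

lemma dop_inter_Ext1:
  assumes kn: "k < n" and A: "is_module k n A" and B: "is_module k n B"
    and d: "dop_inter k n A B (Supp (rdim A)) (\<lambda>p. mop (rdim B) (rdim A) (M p))"
  shows "(\<lambda>x. mat (rdim B) (rdim A) (\<lambda>(u, v). \<Sum>p\<in>Pos k n. x $$ p * M p u v)) \<in> Ext1_G k n A B"
proof -
  let ?fo = "\<lambda>p. mop (rdim B) (rdim A) (M p)"
  define F where "F x = mat (rdim B) (rdim A) (\<lambda>(u, v). \<Sum>p\<in>Pos k n. x $$ p * M p u v)" for x
  have Fm: "mop (rdim B) (rdim A) (ent (F x)) w = (\<Sum>p\<in>Pos k n. x $$ p *\<^sub>C ?fo p w)" for x w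
  proof -
    have "mop (rdim B) (rdim A) (ent (F x)) w = mop (rdim B) (rdim A) (\<Sum>p\<in>Pos k n. x $$ p *\<^sub>C M p) w"
      by (rule mop_cong) (simp add: F_def sum_fun_apply scaleC_fun_apply)
    then show ?thesis unfolding clin_sum[OF clin_mop_matrix] clin_scale[OF clin_mop_matrix] .
  qed
  let ?Q = "\<lambda>g. g \<in> levi k n \<and> (\<forall>x\<in>nilrad k n. Ad g x \<in> nilrad k n \<and> (\<forall>w\<in>Supp (rdim A).
    mop (rdim B) (rdim A) (ent (F (Ad g x))) (aop A g w) = aop B g (mop (rdim B) (rdim A) (ent (F x)) w)))"
  have par: "?Q (\<gamma> z)"
    if \<gamma>: "one_param k n \<gamma> Y" and H: "\<And>p w. p \<in> Pos k n \<Longrightarrow> w \<in> Supp (rdim A) \<Longrightarrow> dop k n B Y (?fo p w) = ?fo p (dop k n A Y w)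
      + (\<Sum>q\<in>Pos k n. com n Y (ent (eu n p)) (fst q) (snd q) *\<^sub>C ?fo q w)" for \<gamma> Y z
  proof (intro conjI ballI)
    show l: "\<gamma> z \<in> levi k n" using \<gamma> by (simp add: one_param_def)
    fix x assume x: "x \<in> nilrad k n"
    show "Ad (\<gamma> z) x \<in> nilrad k n" by (rule Ad_one_param_nilrad[OF \<gamma> x])
    fix w assume w: "w \<in> Supp (rdim A)"
    have "(\<Sum>q\<in>Pos k n. Ad (\<gamma> z) x $$ q *\<^sub>C ?fo q (aop A (\<gamma> z) w))
      = (\<Sum>q\<in>Pos k n. \<Sum>p\<in>Pos k n. x $$ p *\<^sub>C Ad (\<gamma> z) (eu n p) $$ q *\<^sub>C ?fo q (aop A (\<gamma> z) w))"
    proof (intro sum.cong refl)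
      fix q assume "q \<in> Pos k n"
      then have "fst q < n + 1" "snd q < n + 1" by (auto simp: Pos_def)
      then show "Ad (\<gamma> z) x $$ q *\<^sub>C ?fo q (aop A (\<gamma> z) w) = (\<Sum>p\<in>Pos k n. x $$ p *\<^sub>C Ad (\<gamma> z) (eu n p) $$ q *\<^sub>C ?fo q (aop A (\<gamma> z) w))"
        by (simp only: Ad_expand[OF kn l x] cs.scale_sum_left scaleC_scaleC)
    qed
    also have "\<dots> = (\<Sum>p\<in>Pos k n. x $$ p *\<^sub>C (\<Sum>q\<in>Pos k n. Ad (\<gamma> z) (eu n p) $$ q *\<^sub>C ?fo q (aop A (\<gamma> z) w)))"
      unfolding cs.scale_sum_right by (rule sum.swap)
    also have "\<dots> = (\<Sum>p\<in>Pos k n. x $$ p *\<^sub>C aop B (\<gamma> z) (?fo p w))"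
      by (intro sum.cong refl arg_cong2[where f = scaleC] one_param_equivariant[OF kn A B \<gamma> clin_mop mop_Supp H _ w]) auto
    also have "\<dots> = aop B (\<gamma> z) (\<Sum>p\<in>Pos k n. x $$ p *\<^sub>C ?fo p w)"
      unfolding clin_sum[OF clin_mop] clin_scale[OF clin_mop] ..
    finally show "mop (rdim B) (rdim A) (ent (F (Ad (\<gamma> z) x))) (aop A (\<gamma> z) w) = aop B (\<gamma> z) (mop (rdim B) (rdim A) (ent (F x)) w)"
      unfolding Fm .
  qed
  have Q: "?Q g" if "g \<in> Gen k n" for g
    using that
  proof (induction rule: Gen.induct)
    case one
    show ?case
    proof (intro conjI ballI)
      show l: "1\<^sub>m (n + 1) \<in> levi k n" by (rule levi_one)
      fix x assume x: "x \<in> nilrad k n"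
      have "adj_mat (1\<^sub>m (n + 1)) = (1\<^sub>m (n + 1) :: complex mat)" by (rule adj_mat_levi[OF l]) auto
      then have e: "Ad (1\<^sub>m (n + 1)) x = x" using nilrad_carrier[OF x] by (simp add: Ad_def)
      then show "Ad (1\<^sub>m (n + 1)) x \<in> nilrad k n" using x by simp
      fix w assume w: "w \<in> Supp (rdim A)"
      have a: "aop A (1\<^sub>m (n + 1)) w = w" using w by (intro aop_one[OF A]) simp
      have b: "aop B (1\<^sub>m (n + 1)) (mop (rdim B) (rdim A) (ent (F x)) w) = mop (rdim B) (rdim A) (ent (F x)) w"
        by (intro aop_one[OF B]) (simp add: mop_def)
      show "mop (rdim B) (rdim A) (ent (F (Ad (1\<^sub>m (n + 1)) x))) (aop A (1\<^sub>m (n + 1)) w)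
        = aop B (1\<^sub>m (n + 1)) (mop (rdim B) (rdim A) (ent (F x)) w)" unfolding e a b ..
    qed
  next
    case (addrow i j z)
    have "one_param k n (\<lambda>z. addrow_mat (n + 1) z i j) (YY n i j)"
      unfolding YY_offdiag[OF addrow(1)] by (rule one_param_addrow[OF addrow])
    from par[OF this dop_inter_YY[OF d _ _ addrow(2,3,4)]] show ?case .
  next
    case (tor i z)
    have o: "one_param k n (tor n i) (HH n i)" unfolding HH_def by (rule one_param_tor[OF tor])
    have H: "dop k n B (HH n i) (?fo p w) = ?fo p (dop k n A (HH n i) w)
      + (\<Sum>q\<in>Pos k n. com n (HH n i) (ent (eu n p)) (fst q) (snd q) *\<^sub>C ?fo q w)"
      if p: "p \<in> Pos k n" and w: "w \<in> Supp (rdim A)" for p w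
    proof -
      have c: "com n (HH n i) (ent (eu n p)) (fst q) (snd q)
        = com n (YY n i i) (ent (eu n p)) (fst q) (snd q) - com n (YY n n n) (ent (eu n p)) (fst q) (snd q)"
        if q: "q \<in> Pos k n" for q
      proof -
        have "com n (HH n i) (ent (eu n p)) (fst q) (snd q) = com n (YY n i i - YY n n n) (ent (eu n p)) (fst q) (snd q)"
          using q by (intro com_cong HH_YY[OF tor]) (auto simp: Pos_def)
        then show ?thesis unfolding clin_diff[OF clin_com1] by simp
      qed
      have i: "i < n + 1" "n < n + 1" using tor by auto
      have S: "(\<Sum>q\<in>Pos k n. com n (HH n i) (ent (eu n p)) (fst q) (snd q) *\<^sub>C ?fo q w)
        = (\<Sum>q\<in>Pos k n. com n (YY n i i) (ent (eu n p)) (fst q) (snd q) *\<^sub>C ?fo q w)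
          - (\<Sum>q\<in>Pos k n. com n (YY n n n) (ent (eu n p)) (fst q) (snd q) *\<^sub>C ?fo q w)"
        unfolding sum_subtractf[symmetric] by (intro sum.cong refl) (simp only: c cs.scale_left_diff_distrib)
      show ?thesis
        unfolding S dop_HH[OF tor] dop_inter_YY[OF d p w i(1) i(1) refl] dop_inter_YY[OF d p w i(2) i(2) refl]
          clin_diff[OF clin_mop] by (rule add_diff_add)
    qed
    from par[OF o H] show ?case .
  next
    case (mult g h)
    show ?case
    proof (intro conjI ballI)
      have l: "g \<in> levi k n" "h \<in> levi k n" using mult.IH by (simp_all only:)
      then show "g * h \<in> levi k n" by (rule levi_mult)
      fix x assume x: "x \<in> nilrad k n"
      have e: "Ad (g * h) x = Ad g (Ad h x)" using l nilrad_carrier[OF x] by (rule Ad_mult)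
      note ig = conjunct2[OF mult.IH(1), rule_format] and ih = conjunct2[OF mult.IH(2), rule_format]
      have hx: "Ad h x \<in> nilrad k n" using ih[OF x] by (rule conjunct1)
      show "Ad (g * h) x \<in> nilrad k n" unfolding e using ig[OF hx] by (rule conjunct1)
      fix w assume w: "w \<in> Supp (rdim A)"
      show "mop (rdim B) (rdim A) (ent (F (Ad (g * h) x))) (aop A (g * h) w)
        = aop B (g * h) (mop (rdim B) (rdim A) (ent (F x)) w)"
        unfolding e aop_mult[OF A l] aop_mult[OF B l]
          conjunct2[OF ig[OF hx], rule_format, OF mop_Supp] conjunct2[OF ih[OF x], rule_format, OF w] ..
    qed
  qed
  have eq: "F (Ad g x) * act A g = act B g * F x" if g: "g \<in> levi k n" and x: "x \<in> nilrad k n" for g x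
  proof (rule eq_matI)
    have cA: "act A g \<in> carrier_mat (rdim A) (rdim A)" and cB: "act B g \<in> carrier_mat (rdim B) (rdim B)"
      using act_carrier[OF A g] act_carrier[OF B g] by auto
    have cF: "F x \<in> carrier_mat (rdim B) (rdim A)" for x by (simp add: F_def)
    fix u v assume "u < dim_row (act B g * F x)" "v < dim_col (act B g * F x)"
    then have uv: "u < rdim B" "v < rdim A" using cB cF[of x] by auto
    have "mop (rdim B) (rdim A) (ent (F (Ad g x))) (aop A g (\<lambda>j. if j = v then 1 else 0))
      = aop B g (mop (rdim B) (rdim A) (ent (F x)) (\<lambda>j. if j = v then 1 else 0))"
      using Q[OF levi_Gen[OF g]] x uv by auto
    from fun_cong[OF this, of u] show "(F (Ad g x) * act A g) $$ (u, v) = (act B g * F x) $$ (u, v)"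
      unfolding mop_mop mop_unit[OF uv] mat_mult_entry[OF cF cA uv] mat_mult_entry[OF cB cF uv] .
  qed (use act_carrier[OF A g] act_carrier[OF B g] in \<open>auto simp: F_def\<close>)
  have "F \<in> Ext1_G k n A B"
    unfolding Ext1_G_def
  proof (intro CollectI conjI ballI allI eq)
    fix x y assume "x \<in> nilrad k n" "y \<in> nilrad k n"
    then have xy: "x \<in> carrier_mat (n + 1) (n + 1)" "y \<in> carrier_mat (n + 1) (n + 1)" by (auto dest: nilrad_carrier)
    have p: "(x + y) $$ p = x $$ p + y $$ p" if "p \<in> Pos k n" for p
      using that xy by (cases p) (auto simp: Pos_def)
    show "F (x + y) = F x + F y"
      unfolding F_def by (rule eq_matI) (auto simp: p distrib_right sum.distrib)
  next
    fix c x assume "x \<in> nilrad k n"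
    then have x: "x \<in> carrier_mat (n + 1) (n + 1)" by (auto dest: nilrad_carrier)
    have p: "(c \<cdot>\<^sub>m x) $$ p = c * x $$ p" if "p \<in> Pos k n" for p
      using that x by (cases p) (auto simp: Pos_def)
    show "F (c \<cdot>\<^sub>m x) = c \<cdot>\<^sub>m F x"
      unfolding F_def by (rule eq_matI) (auto simp: p mult.assoc sum_distrib_left)
  qed (auto simp: F_def)
  then show ?thesis unfolding F_def[abs_def] .
qed

section \<open>Weights of paths\<close>

definition mk :: "nat \<Rightarrow> nat \<Rightarrow> bool \<Rightarrow> nat" where
  "mk p q = (\<lambda>s. if s then p else q)"

text \<open>The difference of the lengths of rows \<open>i\<close> and \<open>i + 1\<close> of the
  partition belonging to factor \<open>s\<close>.\<close>

definition dl :: "nat \<Rightarrow> weight \<Rightarrow> bool \<Rightarrow> nat \<Rightarrow> int" where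
  "dl k c s i = (if s then c (k + 1 - i) else c (k + 1 + i))"

text \<open>The axial distance between rows \<open>a\<close> and \<open>b\<close>. It unites
  \<open>ptilde\<close> and \<open>qtilde\<close>, so that both factors are treated by one
  argument.\<close>

definition cdist :: "nat \<Rightarrow> weight \<Rightarrow> bool \<Rightarrow> nat \<Rightarrow> nat \<Rightarrow> int" where
  "cdist k c s a b = (\<Sum>i = a..<b. dl k c s i) + int b - int a"

lemma ptilde_cdist: "ptilde k c a b = cdist k c True a b" and qtilde_cdist: "qtilde k c a b = cdist k c False a b"
  by (simp_all add: ptilde_def qtilde_def cdist_def dl_def)

lemma mk_J: "k < n \<Longrightarrow> p \<in> {1..k + 1} \<Longrightarrow> q \<in> {1..n - k} \<Longrightarrow> mk p q \<in> J (rr k n)"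
  by (auto simp: J_rr mk_def)

lemma fund_weight_sum: "(\<Sum>r = i + 1..n. fund_weight n a r) = (if a \<in> {i + 1..n} then 1 else 0)"
proof -
  have "(\<Sum>r = i + 1..n. fund_weight n a r) = (\<Sum>r = i + 1..n. if r = a then (if a \<in> {1..n} then 1 else 0) else 0)"
    by (intro sum.cong) (auto simp: fund_weight_def)
  then show ?thesis by (simp add: sum.delta)
qed

lemma Lw_eps:
  assumes "a \<in> {1..n + 1}" "i \<le> n"
  shows "Lw n (eps n a) i = (if i + 1 = a then 1 else 0) - (if a = n + 1 then 1 else 0)"
  unfolding Lw_def eps_def sum_subtractf fund_weight_sum using assms by auto

text \<open>The last correction occurs when \<epsilon>_{n+1} is added: keeping its coefficient at 0
  lowers all the others by 1.\<close>

lemma Lw_shift: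
  assumes "k < n" "p \<in> {1..k + 1}" "q \<in> {1..n - k}" "j < n + 1"
  shows "Lw n (shift k n c p q) j = Lw n c j + (if j = k + q then 1 else 0) - (if j = k + 1 - p then 1 else 0) - (if q = n - k then 1 else 0)"
proof -
  have "Lw n (shift k n c p q) j = Lw n c j + (Lw n (eps n (k + 1 + q)) j - Lw n (eps n (k + 2 - p)) j)"
    unfolding Lw_def shift_def nil_weight_eps[OF assms(2,3,1)] sum.distrib sum_subtractf ..
  moreover have "k + 1 + q \<in> {1..n + 1}" "k + 2 - p \<in> {1..n + 1}" "j \<le> n" using assms by auto
  moreover have "k + 2 - p \<noteq> n + 1" "j + 1 = k + 2 - p \<longleftrightarrow> j = k + 1 - p" "j + 1 = k + 1 + q \<longleftrightarrow> j = k + q" "k + 1 + q = n + 1 \<longleftrightarrow> q = n - k"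
    using assms by auto
  ultimately show ?thesis by (simp only: Lw_eps) simp
qed

lemma Lw_average_shift:
  assumes "k < n" "p \<in> {1..k + 1}" "q \<in> {1..n - k}"
  shows "(\<Sum>j<n + 1. of_int (Lw n (shift k n c p q) j)) / of_nat (n + 1)
    = (\<Sum>j<n + 1. of_int (Lw n c j)) / of_nat (n + 1) - (if q = n - k then 1 else 0 :: complex)"
proof -
  have "(\<Sum>j<n + 1. of_int (Lw n (shift k n c p q) j) :: complex)
    = (\<Sum>j<n + 1. of_int (Lw n c j) + (if j = k + q then 1 else 0) - (if j = k + 1 - p then 1 else 0) - (if q = n - k then 1 else 0))"
    by (intro sum.cong refl) (subst Lw_shift[OF assms], auto)
  also have "\<dots> = (\<Sum>j<n + 1. of_int (Lw n c j)) - of_nat (n + 1) * (if q = n - k then 1 else 0)"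
    unfolding sum_subtractf sum.distrib using assms by (auto simp: sum.delta)
  finally show ?thesis by (simp add: field_simps del: of_nat_Suc of_nat_add)
qed

text \<open>The normalization correction changes the coefficients and their average alike and
  disappears, so a step of the quiver raises a single entry in each factor.\<close>

lemma al_shift:
  assumes "k < n" "p \<in> {1..k + 1}" "q \<in> {1..n - k}" "i \<in> {1..rr k n s}"
  shows "al k n (shift k n c p q) s i = al k n c s i + (if mk p q s = i then 1 else 0)"
proof (cases s)
  case True
  have "k + 1 - i < n + 1" "k + 1 - i \<noteq> k + q" "k + 1 - i = k + 1 - p \<longleftrightarrow> p = i" using assms True by (auto simp: rr_def)
  then show ?thesis
    using Lw_shift[OF assms(1-3), of "k + 1 - i" c] True
    unfolding al_def Lw_average_shift[OF assms(1-3)] mk_def by auto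
next
  case False
  have "k + i < n + 1" "k + i \<noteq> k + 1 - p" using assms False by (auto simp: rr_def)
  then show ?thesis
    using Lw_shift[OF assms(1-3), of "k + i" c] False
    unfolding al_def Lw_average_shift[OF assms(1-3)] mk_def by auto
qed

lemma Lw_Suc: "i < n \<Longrightarrow> Lw n c i = c (i + 1) + Lw n c (i + 1)"
  unfolding Lw_def Suc_eq_plus1[symmetric] by (subst sum.atLeast_Suc_atMost) auto

lemma al_diff:
  assumes "k < n" "1 \<le> i" "i < rr k n s"
  shows "al k n c s i - al k n c s (i + 1) = of_int (dl k c s i)"
proof (cases s)
  case True
  have "k + 1 - (i + 1) < n" "k + 1 - (i + 1) + 1 = k + 1 - i" using assms True by (auto simp: rr_def)
  then show ?thesis using Lw_Suc[of "k + 1 - (i + 1)" n c] True by (simp add: al_def dl_def)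
next
  case False
  have "k + i < n" using assms False by (auto simp: rr_def)
  then show ?thesis using Lw_Suc[of "k + i" n c] False by (simp add: al_def dl_def add.assoc add.commute[of 1 i])
qed

lemma content_diff:
  assumes kn: "k < n" and a: "1 \<le> a"
  shows "a \<le> b \<Longrightarrow> b \<le> rr k n s \<Longrightarrow>
    (al k n c s a - of_nat (a - 1)) - (al k n c s b - of_nat (b - 1)) = of_int (cdist k c s a b)"
proof (induction b rule: dec_induct)
  case (step b)
  have "(al k n c s a - of_nat (a - 1)) - (al k n c s b - of_nat (b - 1)) = of_int (cdist k c s a b)"
    using step by simp
  moreover have "al k n c s b - al k n c s (Suc b) = of_int (dl k c s b)"
    unfolding Suc_eq_plus1 using step a by (intro al_diff[OF kn]) auto
  moreover have "cdist k c s a (Suc b) = cdist k c s a b + dl k c s b + 1"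
    using step by (simp add: cdist_def)
  moreover have "of_nat (Suc b - 1) = of_nat (b - 1) + (1::complex)"
    using step a by (cases b) auto
  ultimately show ?case by (simp add: algebra_simps)
qed (simp add: cdist_def)

lemma dl_shift:
  assumes kn: "k < n" and pq: "p \<in> {1..k + 1}" "q \<in> {1..n - k}" and i: "1 \<le> i" "i < rr k n s"
  shows "dl k (shift k n c p q) s i = dl k c s i + (if mk p q s = i then 1 else 0) - (if mk p q s = i + 1 then 1 else 0)"
proof -
  have "i \<in> {1..rr k n s}" "i + 1 \<in> {1..rr k n s}" using i by auto
  then have "of_int (dl k (shift k n c p q) s i) = (of_int (dl k c s i + (if mk p q s = i then 1 else 0) - (if mk p q s = i + 1 then 1 else 0)) :: complex)"
    unfolding al_diff[OF kn i, symmetric] of_int_diff of_int_add by (simp add: al_shift[OF kn pq])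
  then show ?thesis by (simp only: of_int_eq_iff)
qed

lemma D1_zero: "c \<in> D1 k n \<Longrightarrow> i \<notin> {1..n} \<Longrightarrow> c i = 0"
  by (auto simp: D1_def)

lemma D1_iff:
  assumes "k < n"
  shows "c \<in> D1 k n \<longleftrightarrow> (\<forall>i. i \<notin> {1..n} \<longrightarrow> c i = 0) \<and> (\<forall>s. \<forall>i\<in>{1..<rr k n s}. 0 \<le> dl k c s i)"
proof
  assume c: "c \<in> D1 k n"
  have "0 \<le> dl k c s i" if i: "i \<in> {1..<rr k n s}" for s i
  proof -
    have "(if s then k + 1 - i else k + 1 + i) \<in> {1..n} - {k + 1}" using i assms by (auto simp: rr_def split: if_splits)
    then have "0 \<le> c (if s then k + 1 - i else k + 1 + i)" using c by (simp only: D1_def mem_Collect_eq)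
    then show ?thesis by (simp add: dl_def split: if_splits)
  qed
  then show "(\<forall>i. i \<notin> {1..n} \<longrightarrow> c i = 0) \<and> (\<forall>s. \<forall>i\<in>{1..<rr k n s}. 0 \<le> dl k c s i)"
    using c by (auto simp: D1_def)
next
  assume r: "(\<forall>i. i \<notin> {1..n} \<longrightarrow> c i = 0) \<and> (\<forall>s. \<forall>i\<in>{1..<rr k n s}. 0 \<le> dl k c s i)"
  have "0 \<le> c i" if i: "i \<in> {1..n} - {k + 1}" for i
  proof (cases "i < k + 1")
    case True
    then have "0 \<le> dl k c True (k + 1 - i)" using r i by (auto simp: rr_def)
    then show ?thesis using True by (simp add: dl_def)
  next
    case False
    then have "i - (k + 1) \<in> {1..<rr k n False}" using i by (auto simp: rr_def)
    then have "0 \<le> dl k c False (i - (k + 1))" using r by blast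
    then show ?thesis using False by (simp add: dl_def)
  qed
  then show "c \<in> D1 k n" using r by (auto simp: D1_def)
qed

lemma shift_outside:
  assumes "c \<in> D1 k n" "i \<notin> {1..n}"
  shows "shift k n c p q i = 0"
  using assms D1_zero[OF assms] by (auto simp: shift_def nil_weight_def simple_root_def)

text \<open>Only the difference just above the row that receives the box decreases.\<close>

lemma shift_D1:
  assumes kn: "k < n" and c: "c \<in> D1 k n" and pq: "p \<in> {1..k + 1}" "q \<in> {1..n - k}"
  shows "shift k n c p q \<in> D1 k n \<longleftrightarrow> (\<forall>s. 2 \<le> mk p q s \<longrightarrow> 1 \<le> dl k c s (mk p q s - 1))"
proof
  assume s: "shift k n c p q \<in> D1 k n"
  show "\<forall>s. 2 \<le> mk p q s \<longrightarrow> 1 \<le> dl k c s (mk p q s - 1)"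
  proof (intro allI impI)
    fix s assume m: "2 \<le> mk p q s"
    have "mk p q s - 1 \<in> {1..<rr k n s}" using m pq kn by (auto simp: mk_def rr_def)
    moreover from this s have "0 \<le> dl k (shift k n c p q) s (mk p q s - 1)" unfolding D1_iff[OF kn] by blast
    ultimately show "1 \<le> dl k c s (mk p q s - 1)" using m by (subst (asm) dl_shift[OF kn pq]) (auto split: if_splits)
  qed
next
  assume m: "\<forall>s. 2 \<le> mk p q s \<longrightarrow> 1 \<le> dl k c s (mk p q s - 1)"
  have "0 \<le> dl k (shift k n c p q) s i" if i: "i \<in> {1..<rr k n s}" for s i
  proof -
    have "0 \<le> dl k c s i" using c i unfolding D1_iff[OF kn] by blast
    moreover have "1 \<le> dl k c s i" if "mk p q s = i + 1" using m[rule_format, of s] that i by simp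
    ultimately show ?thesis using i by (subst dl_shift[OF kn pq]) auto
  qed
  then show "shift k n c p q \<in> D1 k n" using shift_outside[OF c] unfolding D1_iff[OF kn] by blast
qed

text \<open>Row differences are nonnegative, so the last one bounds their sum from below; the 1
  comes from the row indices.\<close>

lemma cdist_ge:
  assumes kn: "k < n" and c: "c \<in> D1 k n" and ab: "1 \<le> a" "a < b" "b \<le> rr k n s"
  shows "dl k c s (b - 1) + 1 \<le> cdist k c s a b"
proof -
  have "0 \<le> dl k c s i" if "i \<in> {a..<b}" for i using c that ab unfolding D1_iff[OF kn] by auto
  then have "dl k c s (b - 1) \<le> (\<Sum>i = a..<b. dl k c s i)" using ab by (intro member_le_sum) auto
  then show ?thesis using ab by (simp add: cdist_def)
qed

lemma cdist_pos:
  assumes kn: "k < n" and c: "c \<in> D1 k n" and ab: "1 \<le> a" "a < b" "b \<le> rr k n s"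
  shows "1 \<le> cdist k c s a b"
proof -
  have "b - 1 \<in> {1..<rr k n s}" using ab by auto
  then have "0 \<le> dl k c s (b - 1)" using c unfolding D1_iff[OF kn] by blast
  then show ?thesis using cdist_ge[OF assms] by simp
qed

section \<open>Arrows between all neighbouring vertices\<close>

lemma family_hw:
  assumes "k < n" "is_irreducible_family k n E v" "c \<in> D1 k n"
  shows "is_module k n (E c)"
    and "low (rr k n) (XX k n (E c)) (fv (rdim (E c)) (v c)) = Supp (rdim (E c))"
    and "\<exists>\<phi>. hw_mod (rr k n) (XX k n (E c)) (fv (rdim (E c)) (v c)) (al k n c) \<phi>"
proof -
  have i: "is_irreducible k n (E c)" "is_maximal_vector k n (E c) c (v c)"
    using assms(2,3) by (auto simp: is_irreducible_family_def)
  then show "is_module k n (E c)" by (simp add: is_irreducible_def)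
  show "low (rr k n) (XX k n (E c)) (fv (rdim (E c)) (v c)) = Supp (rdim (E c))"
    "\<exists>\<phi>. hw_mod (rr k n) (XX k n (E c)) (fv (rdim (E c)) (v c)) (al k n c) \<phi>"
    using irreducible_hw_mod[OF i assms(1)] by auto
qed

text \<open>The hypotheses of \<open>exists_intertwiner\<close> hold since contents strictly
  decrease from row to row, and since a row that can take a box never lies at distance 1 from a row
  above it.\<close>

theorem arrow_exists:
  assumes kn: "k < n" and fam: "is_irreducible_family k n E v" and c: "c \<in> D1 k n"
    and pq: "p \<in> {1..k + 1}" "q \<in> {1..n - k}" and mu: "shift k n c p q \<in> D1 k n"
  shows "arrow k n E c (shift k n c p q)"
proof -
  let ?mu = "shift k n c p q" let ?A = "E c" let ?B = "E ?mu" let ?d = "mk p q"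
  let ?e = "\<lambda>v j. if j = v then 1 else (0::complex)"
  note A = family_hw[OF kn fam c] and B = family_hw[OF kn fam mu]
  obtain \<phi>A where hA: "hw_mod (rr k n) (XX k n ?A) (fv (rdim ?A) (v c)) (al k n c) \<phi>A" using A(3) by blast
  obtain \<phi>B where hB: "hw_mod (rr k n) (XX k n ?B) (fv (rdim ?B) (v ?mu)) (al k n ?mu) \<phi>B" using B(3) by blast
  interpret hw_pair "rr k n" "XX k n ?A" "fv (rdim ?A) (v c)" "al k n c" \<phi>A "XX k n ?B" "fv (rdim ?B) (v ?mu)" "al k n ?mu" \<phi>B
    using hA hB by (rule hw_pair.intro)
  have d: "?d \<in> J (rr k n)" by (rule mk_J[OF kn pq])
  have ds: "?d s \<in> {1..rr k n s}" for s by (rule J_range[OF d])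
  have ne: "A.cont s i \<noteq> A.cont s (?d s)" if i: "i \<in> {1..rr k n s}" "i \<noteq> ?d s" for s i
  proof (cases "i < ?d s")
    case True
    have "A.cont s i - A.cont s (?d s) = of_int (cdist k c s i (?d s))"
      unfolding A.cont_def using i ds[of s] True by (intro content_diff[OF kn]) auto
    moreover have "1 \<le> cdist k c s i (?d s)" using i ds[of s] True by (intro cdist_pos[OF kn c]) auto
    ultimately show ?thesis by auto
  next
    case False
    have "A.cont s (?d s) - A.cont s i = of_int (cdist k c s (?d s) i)"
      unfolding A.cont_def using i ds[of s] False by (intro content_diff[OF kn]) auto
    moreover have "1 \<le> cdist k c s (?d s) i" using i ds[of s] False by (intro cdist_pos[OF kn c]) auto
    ultimately show ?thesis by auto
  qed
  have nd: "A.cont s (?d s) - A.cont s i + 1 \<noteq> 0" if i: "i \<in> {1..<?d s}" for s i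
  proof -
    have "A.cont s i - A.cont s (?d s) = of_int (cdist k c s i (?d s))"
      unfolding A.cont_def using i ds[of s] by (intro content_diff[OF kn]) auto
    moreover have "1 \<le> dl k c s (?d s - 1)" using mu i unfolding shift_D1[OF kn c pq] by auto
    moreover have "dl k c s (?d s - 1) + 1 \<le> cdist k c s i (?d s)" using i ds[of s] by (intro cdist_ge[OF kn c]) auto
    moreover have "A.cont s (?d s) - A.cont s i + 1 = 1 - (A.cont s i - A.cont s (?d s))" by simp
    ultimately show ?thesis by simp
  qed
  obtain f where f: "\<And>a w w'. a \<in> J (rr k n) \<Longrightarrow> w \<in> VA \<Longrightarrow> w' \<in> VA \<Longrightarrow> f a (w + w') = f a w + f a w'"
    "\<And>a c w. a \<in> J (rr k n) \<Longrightarrow> w \<in> VA \<Longrightarrow> f a (c *\<^sub>C w) = c *\<^sub>C f a w"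
    "\<And>a w. a \<in> J (rr k n) \<Longrightarrow> w \<in> VA \<Longrightarrow> f a w \<in> VB"
    "intertwining (rr k n) (XX k n ?A) (XX k n ?B) VA f" "f ?d (fv (rdim ?A) (v c)) = fv (rdim ?B) (v ?mu)"
    using exists_intertwiner[OF d al_shift[OF kn pq] ne nd] by metis
  note f = f[unfolded A(2) B(2)]
  \<comment> \<open>The intertwiner is linear on \<open>Supp\<close> only; its matrix is read off on
    the standard basis, and \<open>fM\<close> shows that it reproduces the values on
    \<open>Supp\<close>.\<close>
  let ?M = "\<lambda>p u v. f (qs k p) (?e v) u"
  have fM: "mop (rdim ?B) (rdim ?A) (?M p) w = f (qs k p) w" if p: "p \<in> Pos k n" and w: "w \<in> Supp (rdim ?A)" for p w
  proof -
    have a: "qs k p \<in> J (rr k n)" by (rule qs_J[OF kn p])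
    have eS: "?e v \<in> Supp (rdim ?A)" if "v < rdim ?A" for v using that by auto
    have S: "(\<Sum>v\<in>S. w v *\<^sub>C ?e v) \<in> Supp (rdim ?A) \<and> f (qs k p) (\<Sum>v\<in>S. w v *\<^sub>C ?e v) = (\<Sum>v\<in>S. w v *\<^sub>C f (qs k p) (?e v))"
      if "finite S" "S \<subseteq> {..<rdim ?A}" for S
      using that
    proof (induction S rule: finite_induct)
      case empty
      have "f (qs k p) (0 *\<^sub>C 0) = 0 *\<^sub>C f (qs k p) 0" by (rule f(2)[OF a]) simp
      then have z: "f (qs k p) 0 = 0" by (simp only: cs.scale_zero_left)
      show ?case unfolding sum.empty by (rule conjI[OF _ z]) simp
    next
      case (insert b S)
      have b: "?e b \<in> Supp (rdim ?A)" using insert eS by auto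
      then have wb: "w b *\<^sub>C ?e b \<in> Supp (rdim ?A)" unfolding mem_Collect_eq scaleC_fun_apply by simp
      from insert.prems have "S \<subseteq> {..<rdim ?A}" by blast
      note IH = conjunct1[OF insert.IH[OF this]] conjunct2[OF insert.IH[OF this]]
      have "w b *\<^sub>C ?e b + (\<Sum>v\<in>S. w v *\<^sub>C ?e v) \<in> Supp (rdim ?A)"
        using wb IH(1) unfolding mem_Collect_eq plus_fun_apply by simp
      moreover have "f (qs k p) (w b *\<^sub>C ?e b + (\<Sum>v\<in>S. w v *\<^sub>C ?e v)) = w b *\<^sub>C f (qs k p) (?e b) + (\<Sum>v\<in>S. w v *\<^sub>C f (qs k p) (?e v))"
        unfolding f(1)[OF a wb IH(1)] f(2)[OF a b] IH(2) ..
      ultimately show ?case unfolding sum.insert[OF insert(1,2)] by (rule conjI)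
    qed
    have ew: "w = (\<Sum>v<rdim ?A. w v *\<^sub>C ?e v)"
    proof
      fix u show "w u = (\<Sum>v<rdim ?A. w v *\<^sub>C ?e v) u"
        using w unfolding sum_fun_apply scaleC_fun_apply scaleC_complex
        by (auto simp: if_distrib sum.delta' sum.delta cong: if_cong)
    qed
    have e: "f (qs k p) w = (\<Sum>v<rdim ?A. w v *\<^sub>C f (qs k p) (?e v))"
      using arg_cong[OF ew, of "f (qs k p)"] unfolding conjunct2[OF S[OF finite_lessThan subset_refl]] .
    have fw: "f (qs k p) w \<in> Supp (rdim ?B)" by (rule f(3)[OF a w])
    show ?thesis
    proof
      fix u show "mop (rdim ?B) (rdim ?A) (?M p) w u = f (qs k p) w u"
      proof (cases "u < rdim ?B")
        case True
        have "f (qs k p) w u = (\<Sum>v<rdim ?A. w v * f (qs k p) (?e v) u)"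
          unfolding e sum_fun_apply scaleC_fun_apply scaleC_complex ..
        then show ?thesis using True by (simp only: mop_def if_True mult.commute)
      next
        case False
        then show ?thesis using fw by (simp add: mop_def)
      qed
    qed
  qed
  have "dop_inter k n ?A ?B (Supp (rdim ?A)) (\<lambda>p. f (qs k p))"
  proof (rule intertwining_dop_inter[OF kn _ mop_Supp f(4)])
    fix a w assume aw: "a \<in> J (rr k n)" "w \<in> Supp (rdim ?A)"
    have "f a ((- 1) *\<^sub>C w) = (- 1) *\<^sub>C f a w" by (rule f(2)[OF aw])
    then show "f a (- w) = - f a w" by simp
  qed
  then have di: "dop_inter k n ?A ?B (Supp (rdim ?A)) (\<lambda>p. mop (rdim ?B) (rdim ?A) (?M p))"
    unfolding dop_inter_def
  proof (intro ballI allI impI)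
    fix p i j w
    assume H: "\<forall>p\<in>Pos k n. \<forall>i<n + 1. \<forall>j<n + 1. \<forall>w\<in>Supp (rdim ?A). (i < k + 1) = (j < k + 1) \<longrightarrow>
      dop k n ?B (YY n i j) (f (qs k p) w) = f (qs k p) (dop k n ?A (YY n i j) w)
      + ((if j = fst p then f (qs k (i, snd p)) w else 0) - (if i = snd p then f (qs k (fst p, j)) w else 0))"
      and p: "p \<in> Pos k n" and ij: "i < n + 1" "j < n + 1" and w: "w \<in> Supp (rdim ?A)" and b: "(i < k + 1) = (j < k + 1)"
    have c1: "(if j = fst p then mop (rdim ?B) (rdim ?A) (?M (i, snd p)) w else 0) = (if j = fst p then f (qs k (i, snd p)) w else 0)"
      using p ij b by (auto intro!: fM[OF _ w] simp: Pos_def)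
    have c2: "(if i = snd p then mop (rdim ?B) (rdim ?A) (?M (fst p, j)) w else 0) = (if i = snd p then f (qs k (fst p, j)) w else 0)"
      using p ij b by (auto intro!: fM[OF _ w] simp: Pos_def)
    show "dop k n ?B (YY n i j) (mop (rdim ?B) (rdim ?A) (?M p) w) = mop (rdim ?B) (rdim ?A) (?M p) (dop k n ?A (YY n i j) w)
      + ((if j = fst p then mop (rdim ?B) (rdim ?A) (?M (i, snd p)) w else 0) - (if i = snd p then mop (rdim ?B) (rdim ?A) (?M (fst p, j)) w else 0))"
      unfolding c1 c2 fM[OF p w] fM[OF p mop_Supp] by (rule H[rule_format, OF p ij w b])
  qed
  let ?F = "\<lambda>x. mat (rdim ?B) (rdim ?A) (\<lambda>(u, v). \<Sum>p\<in>Pos k n. x $$ p * ?M p u v)"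
  have F: "?F \<in> Ext1_G k n ?A ?B" by (rule dop_inter_Ext1[OF kn A(1) B(1) di])
  let ?p = "ps k ?d"
  have p: "?p \<in> Pos k n" by (rule ps_Pos[OF kn d])
  have nz: "?F (eu n ?p) \<noteq> 0\<^sub>m (rdim ?B) (rdim ?A)"
  proof
    assume z: "?F (eu n ?p) = 0\<^sub>m (rdim ?B) (rdim ?A)"
    have "?M ?p u v = 0" if uv: "u < rdim ?B" "v < rdim ?A" for u v
    proof -
      have e: "eu n ?p $$ r = (if r = ?p then 1 else 0)" if "r \<in> Pos k n" for r
        using that by (cases r) (auto simp: Pos_def eu_def)
      have "?F (eu n ?p) $$ (u, v) = (\<Sum>r\<in>Pos k n. eu n ?p $$ r * ?M r u v)"
        using uv by simp
      also have "\<dots> = (\<Sum>r\<in>Pos k n. if r = ?p then ?M ?p u v else 0)"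
        by (intro sum.cong refl) (simp add: e)
      finally have "?F (eu n ?p) $$ (u, v) = (\<Sum>r\<in>Pos k n. if r = ?p then ?M ?p u v else 0)" .
      then show ?thesis using z uv p by (simp add: sum.delta)
    qed
    then have "mop (rdim ?B) (rdim ?A) (?M ?p) (fv (rdim ?A) (v c)) = 0" by (simp add: mop_def fun_eq_iff)
    then have "fv (rdim ?B) (v ?mu) = 0"
      using fM[OF p, of "fv (rdim ?A) (v c)"] f(5) unfolding qs_ps[OF d] by (simp add: fv_def)
    then have "\<phi>B (fv (rdim ?B) (v ?mu)) = 0" using clin_zero[OF B.clin_phi] by simp
    then show False using B.phi_v by simp
  qed
  show ?thesis
    unfolding arrow_def by (intro conjI c mu bexI[OF _ F] bexI[OF _ eu_nilrad[OF kn p]]) (rule nz)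
qed

section \<open>The Yoneda product on highest weight vectors\<close>

lemma intertwining_mono: "intertwining r XA XB UNIV f \<Longrightarrow> intertwining r XA XB V f"
  by (auto simp: intertwining_def)

lemma bi_inter_comp:
  assumes m': "intertwining r XB XC UNIV m'" "\<And>a. clin (m' a)" and m: "intertwining r XA XB UNIV m"
  shows "bi_inter r XA XC (\<lambda>a a' w. m' a (m a' w))"
  unfolding bi_inter_def
proof (intro ballI allI)
  fix a a' s i j w assume a: "a \<in> J r" "a' \<in> J r" and ij: "i \<in> {1..r s}" "j \<in> {1..r s}"
  have "XB s i j (m a' w) = m a' (XA s i j w) + (if a' s = j then m (a'(s := i)) w else 0)"
    by (rule m[unfolded intertwining_def, rule_format, OF a(2) ij UNIV_I])
  moreover have "XC s i j (m' a (m a' w)) = m' a (XB s i j (m a' w)) + (if a s = j then m' (a(s := i)) (m a' w) else 0)"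
    by (rule m'(1)[unfolded intertwining_def, rule_format, OF a(1) ij UNIV_I])
  ultimately show "XC s i j (m' a (m a' w)) = m' a (m a' (XA s i j w)) + (if a s = j then m' (a(s := i)) (m a' w) else 0)
      + (if a' s = j then m' a (m (a'(s := i)) w) else 0)"
    by (cases "a' s = j") (simp_all only: clin_add[OF m'(2)] clin_zero[OF m'(2)] simp_thms if_True if_False add_0_right add_0_left add_ac)
qed

lemma bi_inter_flip:
  assumes "bi_inter r XA XB G"
  shows "bi_inter r XA XB (\<lambda>a a'. G a' a)"
  unfolding bi_inter_def
proof (intro ballI allI)
  fix a a' s i j w assume a: "a \<in> J r" "a' \<in> J r" and ij: "i \<in> {1..r s}" "j \<in> {1..r s}"
  show "XB s i j (G a' a w) = G a' a (XA s i j w) + (if a s = j then G a' (a(s := i)) w else 0) + (if a' s = j then G (a'(s := i)) a w else 0)"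
    unfolding assms[unfolded bi_inter_def, rule_format, OF a(2,1) ij] by (simp only: add_ac)
qed

lemma bi_inter_diff:
  assumes "bi_inter r XA XB G" "bi_inter r XA XB H" "\<And>s i j. clin (XB s i j)"
  shows "bi_inter r XA XB (\<lambda>a a' w. G a a' w - H a a' w)"
  unfolding bi_inter_def
proof (intro ballI allI)
  fix a a' s i j w assume a: "a \<in> J r" "a' \<in> J r" and ij: "i \<in> {1..r s}" "j \<in> {1..r s}"
  show "XB s i j (G a a' w - H a a' w) = G a a' (XA s i j w) - H a a' (XA s i j w)
      + (if a s = j then G (a(s := i)) a' w - H (a(s := i)) a' w else 0) + (if a' s = j then G a (a'(s := i)) w - H a (a'(s := i)) w else 0)"
    unfolding clin_diff[OF assms(3)] assms(1)[unfolded bi_inter_def, rule_format, OF a ij] assms(2)[unfolded bi_inter_def, rule_format, OF a ij]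
    by (cases "a s = j"; cases "a' s = j") (simp_all only: simp_thms if_True if_False add_0_right add_diff_add)
qed

lemma bi_inter_sum:
  assumes "\<And>P. P \<in> S \<Longrightarrow> bi_inter r XA XB (G P)" "\<And>s i j. clin (XB s i j)"
  shows "bi_inter r XA XB (\<lambda>a a' w. \<Sum>P\<in>S. c P *\<^sub>C G P a a' w)"
  unfolding bi_inter_def
proof (intro ballI allI)
  fix a a' s i j w assume a: "a \<in> J r" "a' \<in> J r" and ij: "i \<in> {1..r s}" "j \<in> {1..r s}"
  have "XB s i j (\<Sum>P\<in>S. c P *\<^sub>C G P a a' w) = (\<Sum>P\<in>S. c P *\<^sub>C G P a a' (XA s i j w)
      + (if a s = j then c P *\<^sub>C G P (a(s := i)) a' w else 0) + (if a' s = j then c P *\<^sub>C G P a (a'(s := i)) w else 0))"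
    unfolding clin_sum[OF assms(2)] clin_scale[OF assms(2)]
  proof (intro sum.cong refl)
    fix P assume "P \<in> S"
    show "c P *\<^sub>C XB s i j (G P a a' w) = c P *\<^sub>C G P a a' (XA s i j w)
      + (if a s = j then c P *\<^sub>C G P (a(s := i)) a' w else 0) + (if a' s = j then c P *\<^sub>C G P a (a'(s := i)) w else 0)"
      unfolding assms(1)[OF \<open>P \<in> S\<close>, unfolded bi_inter_def, rule_format, OF a ij]
      by (cases "a s = j"; cases "a' s = j") (simp_all only: simp_thms if_True if_False add_0_right scaleC_add_right)
  qed
  then show "XB s i j (\<Sum>P\<in>S. c P *\<^sub>C G P a a' w) = (\<Sum>P\<in>S. c P *\<^sub>C G P a a' (XA s i j w))
      + (if a s = j then \<Sum>P\<in>S. c P *\<^sub>C G P (a(s := i)) a' w else 0) + (if a' s = j then \<Sum>P\<in>S. c P *\<^sub>C G P a (a'(s := i)) w else 0)"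
    by (cases "a s = j"; cases "a' s = j") (simp_all only: simp_thms if_True if_False add_0_right sum.distrib)
qed

section \<open>Weight vectors in the nilradical\<close>

lemma tor_entry:
  assumes "l < n" "a < n + 1" "b < n + 1"
  shows "tor n l z $$ (a, b) = (if a = b then exp (of_int ((if a = l then 1 else 0) - (if a = n then 1 else 0)) * z) else 0)"
  using assms by (auto simp: tor_def)

lemma exp_of_int_inj: "(\<And>z. exp (of_int a * z) = exp (of_int b * z :: complex)) \<Longrightarrow> a = b"
proof -
  assume "\<And>z. exp (of_int a * z) = exp (of_int b * z :: complex)"
  from this[of 1] have "exp (complex_of_real (of_int a)) = exp (complex_of_real (of_int b))" by simp
  then have "exp (real_of_int a) = exp (real_of_int b)" unfolding exp_of_real of_real_eq_iff .
  then show ?thesis by simp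
qed

text \<open>Two exponent equations share the unknown truth values \<open>I\<close> and
  \<open>Q\<close>; comparing them excludes a nonzero entry in a wrong column.\<close>

lemma flags_contradiction:
  assumes "(if a then 1 else 0) - (if I then 1 else 0) - (if b then 1 else 0) = (if c then 1 else 0) - (if d then 1 else 0) - (if Q then 1 else (0::int))"
    and "(if a' then 1 else 0) - (if I then 1 else 0) - (if b' then 1 else 0) = (if c' then 1 else 0) - (if d' then 1 else 0) - (if Q then 1 else (0::int))"
    and "\<not> a" b "\<not> c" "\<not> d" "\<not> a'" "\<not> b'" "\<not> c'" d'
  shows False
  using assms by (cases I; cases Q) simp_all

lemma flags_Q:
  assumes "(if a then 1 else 0) - (if I then 1 else 0) - (if b then 1 else 0) = (if c then 1 else 0) - (if d then 1 else 0) - (if Q then 1 else (0::int))"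
    and "\<not> a" I b "\<not> c" d
  shows Q
  using assms by (cases Q) simp_all

lemma flags_c:
  assumes "(if a then 1 else 0) - (if I then 1 else 0) - (if b then 1 else 0) = (if c then 1 else 0) - (if d then 1 else 0) - (if Q then 1 else (0::int))"
    and a "\<not> I" "\<not> b" "\<not> d"
  shows c
  using assms by (cases c; cases Q) simp_all

text \<open>The weights of the nilradical have multiplicity one. At a nonzero entry (i, j) the
  exponents under all curves \<open>tor n l\<close> must be those of n_{p,q}; testing l = j and l =
  k + 1 - p fixes the column, and one further test the row. Row \<open>n\<close> is a case of its
  own, as it has no curve.\<close>

lemma torus_eigenvector:
  assumes kn: "k < n" and pq: "p \<in> {1..k + 1}" "q \<in> {1..n - k}" and x: "x \<in> nilrad k n"
    and w: "\<And>A. A \<in> torus n \<Longrightarrow> Ad A x = weight_char n (nil_weight k n p q) A \<cdot>\<^sub>m x"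
  shows "x = x $$ (k + q, k + 1 - p) \<cdot>\<^sub>m eu n (k + q, k + 1 - p)"
proof (rule eq_matI)
  have xc: "x \<in> carrier_mat (n + 1) (n + 1)" by (rule nilrad_carrier[OF x])
  have L: "Lw n (nil_weight k n p q) l = (if l = k + q then 1 else 0) - (if l = k + 1 - p then 1 else 0) - (if q = n - k then 1 else 0)"
    if "l < n + 1" for l
    using Lw_shift[OF kn pq that, of "\<lambda>_. 0"] by (simp add: shift_def Lw_def)
  have key: "(if i = l then 1 else 0) - (if i = n then 1 else 0) - (if j = l then 1 else 0)
      = (if l = k + q then 1 else 0) - (if l = k + 1 - p then 1 else 0) - (if q = n - k then 1 else (0::int))"
    if ij: "i < n + 1" "j < k + 1" and nz: "x $$ (i, j) \<noteq> 0" and l: "l < n" for i j l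
  proof -
    have jn: "j < n + 1" "j \<noteq> n" using ij kn by auto
    let ?d = "(if i = l then 1 else 0) - (if i = n then 1 else 0) - (if j = l then 1 else (0::int))"
    have "exp (of_int ?d * z) = exp (of_int (Lw n (nil_weight k n p q) l) * z)" for z :: complex
    proof -
      have t: "tor n l z \<in> torus n" using tor_levi[OF l, of z k] by (auto simp: torus_def levi_def tor_def diagonal_mat_def)
      have c: "tor n l z \<in> carrier_mat (n + 1) (n + 1)" for z by (simp add: tor_def)
      have "Ad (tor n l z) x $$ (i, j) = (\<Sum>r<n + 1. \<Sum>s<n + 1. tor n l z $$ (i, r) * x $$ (r, s) * tor n l (- z) $$ (s, j))"
        unfolding Ad_one_param[OF one_param_tor[OF l, where k = k]] by (rule Ad_entry[OF c c xc ij(1) jn(1)])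
      also have "\<dots> = (\<Sum>r<n + 1. \<Sum>s<n + 1. if s = j then (if r = i then tor n l z $$ (i, i) * x $$ (i, j) * tor n l (- z) $$ (j, j) else 0) else 0)"
        using ij(1) jn(1) by (intro sum.cong refl) (auto simp: tor_entry[OF l])
      also have "\<dots> = tor n l z $$ (i, i) * x $$ (i, j) * tor n l (- z) $$ (j, j)"
        using ij jn by (simp add: sum.delta)
      also have "\<dots> = exp (of_int ((if i = l then 1 else 0) - (if i = n then 1 else 0)) * z) * x $$ (i, j) * exp (of_int (if j = l then 1 else 0) * (- z))"
        using jn by (simp add: tor_entry[OF l ij(1) ij(1)] tor_entry[OF l jn(1) jn(1)])
      also have "\<dots> = exp (of_int ?d * z) * x $$ (i, j)"
        by (simp add: exp_add[symmetric] algebra_simps)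
      finally have h1: "Ad (tor n l z) x $$ (i, j) = exp (of_int ?d * z) * x $$ (i, j)" .
      have h2: "Ad (tor n l z) x $$ (i, j) = exp (of_int (Lw n (nil_weight k n p q) l) * z) * x $$ (i, j)"
        unfolding w[OF t] weight_char_tor[OF l] using xc ij(1) jn(1) by simp
      show ?thesis by (rule mult_right_cancel[OF nz, THEN iffD1, OF trans[OF h1[symmetric] h2]])
    qed
    then have "?d = Lw n (nil_weight k n p q) l" by (rule exp_of_int_inj)
    then show ?thesis using L[of l] l by simp
  qed
  fix i j assume "i < dim_row (x $$ (k + q, k + 1 - p) \<cdot>\<^sub>m eu n (k + q, k + 1 - p))" "j < dim_col (x $$ (k + q, k + 1 - p) \<cdot>\<^sub>m eu n (k + q, k + 1 - p))"
  then have ij: "i < n + 1" "j < n + 1" by (auto simp: eu_def)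
  have "i = k + q \<and> j = k + 1 - p" if nz: "x $$ (i, j) \<noteq> 0"
  proof -
    have "k + 1 \<le> i \<and> j < k + 1"
    proof (rule ccontr)
      assume nb: "\<not> (k + 1 \<le> i \<and> j < k + 1)"
      have "\<forall>i<n + 1. \<forall>j<n + 1. \<not> (k + 1 \<le> i \<and> j < k + 1) \<longrightarrow> x $$ (i, j) = 0"
        using x unfolding nilrad_def mem_Collect_eq by (rule conjunct2)
      from this[THEN spec, THEN mp, OF ij(1), THEN spec, THEN mp, OF ij(2), THEN mp, OF nb] have "x $$ (i, j) = 0" .
      then show False using nz by simp
    qed
    note b = conjunct1[OF this] conjunct2[OF this]
    note K = key[OF ij(1) b(2) nz]
    have "j = k + 1 - p"
    proof (rule ccontr)
      assume j: "j \<noteq> k + 1 - p"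
      have l: "j < n" "k + 1 - p < n" using b kn pq by auto
      have d: "i \<noteq> j" "j \<noteq> k + q" "i \<noteq> k + 1 - p" "k + 1 - p \<noteq> k + q" "k + 1 - p \<noteq> j" using j b pq by auto
      show False by (rule flags_contradiction[OF K[OF l(1)] K[OF l(2)] d(1) refl d(2) j d(3) j d(4) refl])
    qed
    note jp = this
    then have d: "i \<noteq> j" "k + 1 - p \<noteq> k + q" "i \<noteq> k + 1 - p" using b pq by auto
    have "i = k + q"
    proof (cases "i = n")
      case True
      have "j < n" using b kn by auto
      have jq: "j \<noteq> k + q" using d(2) jp by simp
      have "q = n - k" by (rule flags_Q[OF K[OF \<open>j < n\<close>] d(1) True refl jq jp])
      then show ?thesis using True kn by simp
    next
      case False
      then have "i < n" using ij by auto
      show ?thesis by (rule flags_c[OF K[OF \<open>i < n\<close>] refl False d(1)[symmetric] d(3)])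
    qed
    then show ?thesis using jp by simp
  qed
  then have z: "x $$ (i, j) = 0" if "(i, j) \<noteq> (k + q, k + 1 - p)" using that by blast
  have e: "(x $$ (k + q, k + 1 - p) \<cdot>\<^sub>m eu n (k + q, k + 1 - p)) $$ (i, j)
      = x $$ (k + q, k + 1 - p) * (if (i, j) = (k + q, k + 1 - p) then 1 else 0)"
    using ij by (simp add: eu_def)
  show "x $$ (i, j) = (x $$ (k + q, k + 1 - p) \<cdot>\<^sub>m eu n (k + q, k + 1 - p)) $$ (i, j)"
  proof (cases "(i, j) = (k + q, k + 1 - p)")
    case True
    show ?thesis unfolding e by (simp only: True if_True simp_thms mult_1_right)
  next
    case False
    show ?thesis unfolding e z[OF False] by (simp only: False if_False mult_zero_right)
  qed
qed (use nilrad_carrier[OF x] in \<open>auto simp: eu_def\<close>)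

text \<open>The exchange factor for a path that fills row \<open>a\<close> before row
  \<open>b\<close>, with the distance measured at the source of the path.\<close>

definition kap :: "nat \<Rightarrow> weight \<Rightarrow> bool \<Rightarrow> nat \<Rightarrow> nat \<Rightarrow> complex" where
  "kap k c s a b = (if a < b then - 1 / of_int (cdist k c s a b) else 0)"

locale normalized_quiver =
  fixes k n :: nat and E :: "weight \<Rightarrow> rmod" and v :: "weight \<Rightarrow> complex vec"
    and nv :: "nat \<Rightarrow> nat \<Rightarrow> complex mat" and m :: "weight \<Rightarrow> nat \<Rightarrow> nat \<Rightarrow> complex mat \<Rightarrow> complex mat"
  assumes kn: "k < n" and fam: "is_irreducible_family k n E v" and eig: "is_eigenbasis k n nv"
    and norm: "is_normalized k n E v nv m"
begin

abbreviation vv :: "weight \<Rightarrow> nat \<Rightarrow> complex" where "vv c \<equiv> fv (rdim (E c)) (v c)"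

lemma nv_eu: "\<exists>x y. \<forall>p\<in>{1..k + 1}. \<forall>q\<in>{1..n - k}. x p * y q \<noteq> (0::complex) \<and> nv p q = (x p * y q) \<cdot>\<^sub>m eu n (ps k (mk p q))"
proof -
  obtain x y where xy: "\<forall>p\<in>{1..k + 1}. \<forall>q\<in>{1..n - k}. nv p q $$ (k + q, k + 1 - p) = x p * y q"
    using eig unfolding is_eigenbasis_def by blast
  have "x p * y q \<noteq> 0 \<and> nv p q = (x p * y q) \<cdot>\<^sub>m eu n (ps k (mk p q))" if pq: "p \<in> {1..k + 1}" "q \<in> {1..n - k}" for p q
  proof -
    have e: "nv p q \<in> nilrad k n" "nv p q \<noteq> 0\<^sub>m (n + 1) (n + 1)"
      "\<And>A. A \<in> torus n \<Longrightarrow> Ad A (nv p q) = weight_char n (nil_weight k n p q) A \<cdot>\<^sub>m nv p q"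
      using eig pq unfolding is_eigenbasis_def by blast+
    have 1: "nv p q = (x p * y q) \<cdot>\<^sub>m eu n (ps k (mk p q))"
      using torus_eigenvector[OF kn pq e(1,3)] xy pq by (simp add: ps_def mk_def)
    moreover have "(0::complex) \<cdot>\<^sub>m eu n (ps k (mk p q)) = 0\<^sub>m (n + 1) (n + 1)" by (auto simp: eu_def)
    ultimately show ?thesis using e(2) by metis
  qed
  then show ?thesis by blast
qed

lemma arrowI:
  "c \<in> D1 k n \<Longrightarrow> p \<in> {1..k + 1} \<Longrightarrow> q \<in> {1..n - k} \<Longrightarrow> shift k n c p q \<in> D1 k n \<Longrightarrow> arrow k n E c (shift k n c p q)"
  using arrow_exists[OF kn fam] by blast

lemma m_Ext1:
  assumes "c \<in> D1 k n" "p \<in> {1..k + 1}" "q \<in> {1..n - k}" "shift k n c p q \<in> D1 k n"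
  shows "m c p q \<in> Ext1_G k n (E c) (E (shift k n c p q))"
    and "m c p q (nv p q) *\<^sub>v v c = v (shift k n c p q)"
  using norm arrowI[OF assms] assms(2,3) unfolding is_normalized_def by blast+

lemma fop_vv:
  assumes c: "c \<in> D1 k n" "p \<in> {1..k + 1}" "q \<in> {1..n - k}" "shift k n c p q \<in> D1 k n"
    and xi: "nv p q = \<xi> \<cdot>\<^sub>m eu n (ps k (mk p q))"
  shows "\<xi> *\<^sub>C fop n (E c) (E (shift k n c p q)) (m c p q) (ps k (mk p q)) (vv c) = vv (shift k n c p q)"
proof -
  let ?mu = "shift k n c p q" let ?e = "eu n (ps k (mk p q))"
  have e: "?e \<in> nilrad k n" by (rule eu_nilrad[OF kn ps_Pos[OF kn mk_J[OF kn c(2,3)]]])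
  have f: "m c p q (nv p q) = \<xi> \<cdot>\<^sub>m m c p q ?e" "m c p q ?e \<in> carrier_mat (rdim (E ?mu)) (rdim (E c))"
    using m_Ext1(1)[OF c] e unfolding xi Ext1_G_def by auto
  have vc: "v c \<in> carrier_vec (rdim (E c))"
    using fam c(1) by (auto simp: is_irreducible_family_def is_maximal_vector_def)
  have "vv ?mu = mop (rdim (E ?mu)) (rdim (E c)) (ent (m c p q (nv p q))) (vv c)"
    using act_fv[of "m c p q (nv p q)" "rdim (E ?mu)" "rdim (E c)" "v c"] f vc m_Ext1(2)[OF c] by simp
  also have "\<dots> = mop (rdim (E ?mu)) (rdim (E c)) (\<xi> *\<^sub>C ent (m c p q ?e)) (vv c)"
    using f by (intro mop_cong) (simp add: scaleC_fun_apply)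
  finally show ?thesis unfolding clin_scale[OF clin_mop_matrix] fop_def by simp
qed

text \<open>The highest weight coefficient of a composite of two arrows, with index \<open>a\<close>
  fed into the inner map and \<open>b\<close> into the outer one.\<close>

definition TT :: "weight \<Rightarrow> nat \<Rightarrow> nat \<Rightarrow> nat \<Rightarrow> nat \<Rightarrow> ((nat \<Rightarrow> complex) \<Rightarrow> complex) \<Rightarrow> (bool \<Rightarrow> nat) \<Rightarrow> (bool \<Rightarrow> nat) \<Rightarrow> complex" where
  "TT c p q p' q' \<phi> b a = \<phi> (fop n (E (shift k n c p q)) (E (shift k n (shift k n c p q) p' q')) (m (shift k n c p q) p' q') (ps k b)
    (fop n (E c) (E (shift k n c p q)) (m c p q) (ps k a) (vv c)))"

text \<open>On its own indices a path carries maximal vectors to maximal vectors; the scalars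
  convert matrix units into the vectors \<open>nv\<close>.\<close>

lemma TT_diag:
  assumes c: "c \<in> D1 k n" "p \<in> {1..k + 1}" "q \<in> {1..n - k}" "shift k n c p q \<in> D1 k n"
    and c': "p' \<in> {1..k + 1}" "q' \<in> {1..n - k}" "shift k n (shift k n c p q) p' q' \<in> D1 k n"
    and \<phi>: "clin \<phi>" "\<phi> (vv (shift k n (shift k n c p q) p' q')) = 1"
    and xi: "nv p q = \<xi> \<cdot>\<^sub>m eu n (ps k (mk p q))" "nv p' q' = \<xi>' \<cdot>\<^sub>m eu n (ps k (mk p' q'))"
  shows "\<xi> * \<xi>' * TT c p q p' q' \<phi> (mk p' q') (mk p q) = 1"
proof -
  let ?mu = "shift k n c p q"
  have "\<xi>' *\<^sub>C fop n (E ?mu) (E (shift k n ?mu p' q')) (m ?mu p' q') (ps k (mk p' q'))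
      (\<xi> *\<^sub>C fop n (E c) (E ?mu) (m c p q) (ps k (mk p q)) (vv c)) = vv (shift k n ?mu p' q')"
    unfolding fop_vv[OF c xi(1)] by (rule fop_vv[OF c(4) c' xi(2)])
  then have "\<phi> (\<xi>' *\<^sub>C fop n (E ?mu) (E (shift k n ?mu p' q')) (m ?mu p' q') (ps k (mk p' q'))
      (\<xi> *\<^sub>C fop n (E c) (E ?mu) (m c p q) (ps k (mk p q)) (vv c))) = 1" using \<phi>(2) by simp
  then show ?thesis unfolding clin_scale[OF clin_fop] clin_scale[OF \<phi>(1)] TT_def scaleC_complex by (simp add: ac_simps)
qed

text \<open>\<open>swap_coefficient\<close> is applied to the exchanged pair of indices, so that the
  original pair is on its right-hand side. The content difference is nonzero in either order of the
  rows; hence the exchanged coefficient vanishes whenever that right-hand side does.\<close>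

lemma TT_swap:
  assumes c: "c \<in> D1 k n" "p \<in> {1..k + 1}" "q \<in> {1..n - k}" "shift k n c p q \<in> D1 k n"
    and c': "p' \<in> {1..k + 1}" "q' \<in> {1..n - k}" "shift k n (shift k n c p q) p' q' \<in> D1 k n"
    and \<phi>: "hw_mod (rr k n) (XX k n (E (shift k n (shift k n c p q) p' q'))) (vv (shift k n (shift k n c p q) p' q'))
      (al k n (shift k n (shift k n c p q) p' q')) \<phi>"
    and a: "a \<in> J (rr k n)" "b \<in> J (rr k n)" "a s = mk p q s" "b s \<noteq> mk p q s"
  shows "TT c p q p' q' \<phi> (b(s := a s)) (a(s := b s)) = kap k c s (a s) (b s) * TT c p q p' q' \<phi> b a"
proof -
  let ?mu = "shift k n c p q" let ?c'' = "shift k n ?mu p' q'"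
  note A = family_hw[OF kn fam c(1)] and B = family_hw[OF kn fam c(4)] and C = family_hw[OF kn fam c'(3)]
  obtain \<phi>A where hA: "hw_mod (rr k n) (XX k n (E c)) (vv c) (al k n c) \<phi>A" using A(3) by blast
  obtain \<phi>B where hB: "hw_mod (rr k n) (XX k n (E ?mu)) (vv ?mu) (al k n ?mu) \<phi>B" using B(3) by blast
  interpret hw_pair "rr k n" "XX k n (E c)" "vv c" "al k n c" \<phi>A "XX k n (E ?mu)" "vv ?mu" "al k n ?mu" \<phi>B
    using hA hB by (rule hw_pair.intro)
  interpret C: hw_mod "rr k n" "XX k n (E ?c'')" "vv ?c''" "al k n ?c''" \<phi> by (rule \<phi>)
  let ?m = "\<lambda>a. fop n (E c) (E ?mu) (m c p q) (ps k a)"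
  let ?m' = "\<lambda>a. fop n (E ?mu) (E ?c'') (m ?mu p' q') (ps k a)"
  have i1: "intertwining (rr k n) (XX k n (E c)) (XX k n (E ?mu)) V ?m"
    and i2: "intertwining (rr k n) (XX k n (E ?mu)) (XX k n (E ?c'')) V ?m'" for V
    by (rule intertwining_mono[OF Ext1_intertwining[OF kn A(1) B(1) m_Ext1(1)[OF c]]],
        rule intertwining_mono[OF Ext1_intertwining[OF kn B(1) C(1) m_Ext1(1)[OF c(4) c']]])
  have as: "a s \<in> {1..rr k n s}" "b s \<in> {1..rr k n s}" using a(1,2) J_range by auto
  have mV: "?m a w \<in> VB" for a w unfolding B(2) fop_def by (rule mop_Supp)
  have u: "(b(s := a s))(s := (a(s := b s)) s) = b" "(a(s := b s))(s := mk p q s) = a" using a(3) by auto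
  have "(A.cont s (mk p q s) - A.cont s ((a(s := b s)) s)) * \<phi> (?m' (b(s := a s)) (?m (a(s := b s)) (vv c)))
    = (if mk p q s < (a(s := b s)) s then - \<phi> (?m' ((b(s := a s))(s := (a(s := b s)) s)) (?m ((a(s := b s))(s := mk p q s)) (vv c))) else 0)"
    by (rule swap_coefficient[where m = ?m and m' = ?m' and d = "mk p q" and \<phi> = \<phi> and a = "a(s := b s)" and a' = "b(s := a s)" and s = s
          and XC = "XX k n (E ?c'')"];
        (rule clin_fop mV i1 i2 mk_J[OF kn c(2,3)] C.clin_phi J_upd[OF a(1) as(2)] J_upd[OF a(2) as(1)]
          | (rule al_shift[OF kn c(2,3)], assumption) | (rule C.phi_lower; assumption) | (use a in simp)))
  then have e: "(A.cont s (a s) - A.cont s (b s)) * TT c p q p' q' \<phi> (b(s := a s)) (a(s := b s))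
      = (if a s < b s then - TT c p q p' q' \<phi> b a else 0)"
    unfolding u TT_def using a(3) by simp
  show ?thesis
  proof (cases "a s < b s")
    case True
    have "A.cont s (a s) - A.cont s (b s) = of_int (cdist k c s (a s) (b s))"
      unfolding A.cont_def using as True by (intro content_diff[OF kn]) auto
    moreover have "1 \<le> cdist k c s (a s) (b s)" using as True by (intro cdist_pos[OF kn c(1)]) auto
    ultimately show ?thesis using e True by (simp add: kap_def field_simps)
  next
    case False
    have "A.cont s (b s) - A.cont s (a s) = of_int (cdist k c s (b s) (a s))"
      unfolding A.cont_def using as False a by (intro content_diff[OF kn]) auto
    moreover have "1 \<le> cdist k c s (b s) (a s)" using as False a by (intro cdist_pos[OF kn c(1)]) auto
    ultimately have "A.cont s (a s) - A.cont s (b s) \<noteq> 0" by auto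
    then show ?thesis using e False by (simp add: kap_def)
  qed
qed

end

section \<open>The relations as scalar equations\<close>

lemma wedge_entry:
  assumes f: "f \<in> Ext1_G k n A B" and g: "g \<in> Ext1_G k n B C" and xy: "x \<in> nilrad k n" "y \<in> nilrad k n"
    and uw: "u < rdim C" "w < rdim A"
  shows "wedge g f x y $$ (u, w) = (\<Sum>l<rdim B. g x $$ (u, l) * f y $$ (l, w)) - (\<Sum>l<rdim B. g y $$ (u, l) * f x $$ (l, w))"
proof -
  have c: "f z \<in> carrier_mat (rdim B) (rdim A)" "g z \<in> carrier_mat (rdim C) (rdim B)" if "z \<in> nilrad k n" for z
    using f g that by (auto simp: Ext1_G_def)
  have "wedge g f x y $$ (u, w) = (g x * f y) $$ (u, w) - (g y * f x) $$ (u, w)"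
    unfolding wedge_def using c[OF xy(1)] c[OF xy(2)] uw by (intro index_minus_mat) auto
  then show ?thesis
    unfolding mat_mult_entry[OF c(2)[OF xy(1)] c(1)[OF xy(2)] uw] mat_mult_entry[OF c(2)[OF xy(2)] c(1)[OF xy(1)] uw] .
qed

lemma sum_bilinear:
  fixes x y :: "'p \<Rightarrow> complex"
  shows "(\<Sum>l\<in>L. (\<Sum>p\<in>S. x p * a p l) * (\<Sum>q\<in>S. y q * b q l)) = (\<Sum>p\<in>S. \<Sum>q\<in>S. x p * y q * (\<Sum>l\<in>L. a p l * b q l))"
proof -
  have "(\<Sum>l\<in>L. (\<Sum>p\<in>S. x p * a p l) * (\<Sum>q\<in>S. y q * b q l)) = (\<Sum>l\<in>L. \<Sum>p\<in>S. \<Sum>q\<in>S. x p * y q * (a p l * b q l))"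
    unfolding sum_product by (intro sum.cong refl) (simp only: ac_simps)
  also have "\<dots> = (\<Sum>p\<in>S. \<Sum>l\<in>L. \<Sum>q\<in>S. x p * y q * (a p l * b q l))" by (rule sum.swap)
  also have "\<dots> = (\<Sum>p\<in>S. \<Sum>q\<in>S. \<Sum>l\<in>L. x p * y q * (a p l * b q l))"
    by (intro sum.cong refl) (rule sum.swap)
  finally show ?thesis unfolding sum_distrib_left .
qed

lemma wedge_expand:
  assumes kn: "k < n" and f: "f \<in> Ext1_G k n A B" and g: "g \<in> Ext1_G k n B C" and xy: "x \<in> nilrad k n" "y \<in> nilrad k n"
    and uw: "u < rdim C" "w < rdim A"
  shows "wedge g f x y $$ (u, w) = (\<Sum>p\<in>Pos k n. \<Sum>q\<in>Pos k n. x $$ p * y $$ q * wedge g f (eu n p) (eu n q) $$ (u, w))"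
proof -
  have 1: "(\<Sum>l<rdim B. g x $$ (u, l) * f y $$ (l, w))
    = (\<Sum>p\<in>Pos k n. \<Sum>q\<in>Pos k n. x $$ p * y $$ q * (\<Sum>l<rdim B. g (eu n p) $$ (u, l) * f (eu n q) $$ (l, w)))"
    if xy: "x \<in> nilrad k n" "y \<in> nilrad k n" for x y
    unfolding sum_bilinear[symmetric]
    by (intro sum.cong refl arg_cong2[where f = times] Ext1_expand[OF kn g xy(1)] Ext1_expand[OF kn f xy(2)]) (use uw in auto)
  have 2: "(\<Sum>l<rdim B. g y $$ (u, l) * f x $$ (l, w))
    = (\<Sum>p\<in>Pos k n. \<Sum>q\<in>Pos k n. x $$ p * y $$ q * (\<Sum>l<rdim B. g (eu n q) $$ (u, l) * f (eu n p) $$ (l, w)))"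
    unfolding 1[OF xy(2,1)] by (subst sum.swap) (intro sum.cong refl, simp only: ac_simps)
  have 3: "x $$ p * y $$ q * wedge g f (eu n p) (eu n q) $$ (u, w)
    = x $$ p * y $$ q * (\<Sum>l<rdim B. g (eu n p) $$ (u, l) * f (eu n q) $$ (l, w))
      - x $$ p * y $$ q * (\<Sum>l<rdim B. g (eu n q) $$ (u, l) * f (eu n p) $$ (l, w))"
    if "p \<in> Pos k n" "q \<in> Pos k n" for p q
    unfolding wedge_entry[OF f g eu_nilrad[OF kn that(1)] eu_nilrad[OF kn that(2)] uw] by (rule right_diff_distrib)
  have "(\<Sum>p\<in>Pos k n. \<Sum>q\<in>Pos k n. x $$ p * y $$ q * wedge g f (eu n p) (eu n q) $$ (u, w))
    = (\<Sum>p\<in>Pos k n. \<Sum>q\<in>Pos k n. x $$ p * y $$ q * (\<Sum>l<rdim B. g (eu n p) $$ (u, l) * f (eu n q) $$ (l, w))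
      - x $$ p * y $$ q * (\<Sum>l<rdim B. g (eu n q) $$ (u, l) * f (eu n p) $$ (l, w)))"
    by (intro sum.cong refl 3)
  then show ?thesis unfolding wedge_entry[OF f g xy uw] 1[OF xy] 2 sum_subtractf by (rule sym)
qed

lemma mk_simps [simp]: "mk p q True = p" "mk p q False = q" "(mk p q)(True := r) = mk r q" "(mk p q)(False := r) = mk p r"
  by (auto simp: mk_def fun_eq_iff)

context normalized_quiver
begin

text \<open>By \<open>arrow_exists\<close> an arrow is nothing but a step inside
  \<open>D1 k n\<close>.\<close>

lemma paths_iff:
  assumes "c \<in> D1 k n" "c'' \<in> D1 k n"
  shows "(p, q, p', q') \<in> paths k n E c c'' \<longleftrightarrow> p \<in> {1..k + 1} \<and> q \<in> {1..n - k} \<and> p' \<in> {1..k + 1} \<and> q' \<in> {1..n - k} \<and>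
    shift k n c p q \<in> D1 k n \<and> c'' = shift k n (shift k n c p q) p' q'"
proof
  assume "(p, q, p', q') \<in> paths k n E c c''"
  then show "p \<in> {1..k + 1} \<and> q \<in> {1..n - k} \<and> p' \<in> {1..k + 1} \<and> q' \<in> {1..n - k} \<and>
    shift k n c p q \<in> D1 k n \<and> c'' = shift k n (shift k n c p q) p' q'"
    unfolding paths_def arrow_def by blast
next
  assume r: "p \<in> {1..k + 1} \<and> q \<in> {1..n - k} \<and> p' \<in> {1..k + 1} \<and> q' \<in> {1..n - k} \<and>
    shift k n c p q \<in> D1 k n \<and> c'' = shift k n (shift k n c p q) p' q'"
  then have "arrow k n E c (shift k n c p q)" "arrow k n E (shift k n c p q) c''"
    using arrowI[OF assms(1), of p q] arrowI[of "shift k n c p q" p' q'] assms(2) by auto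
  then show "(p, q, p', q') \<in> paths k n E c c''" using r unfolding paths_def by blast
qed

definition pmap :: "(weight \<Rightarrow> nat \<Rightarrow> nat \<Rightarrow> complex mat) \<Rightarrow> weight \<Rightarrow> nat \<times> nat \<times> nat \<times> nat \<Rightarrow> complex mat" where
  "pmap g c P = path_map k n g c (fst P) (fst (snd P)) (fst (snd (snd P))) (snd (snd (snd P)))"

definition wp :: "weight \<Rightarrow> nat \<times> nat \<times> nat \<times> nat \<Rightarrow> complex mat \<Rightarrow> complex mat \<Rightarrow> complex mat" where
  "wp c P = wedge (m (shift k n c (fst P) (fst (snd P))) (fst (snd (snd P))) (snd (snd (snd P)))) (m c (fst P) (fst (snd P)))"

text \<open>The wedge of a path as an operator on functions, at the matrix units with indices
  \<open>a\<close> and \<open>a'\<close>. The target \<open>E c''\<close> is fixed independently of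
  the path, so sums over paths make sense at once.\<close>

definition wf :: "weight \<Rightarrow> weight \<Rightarrow> nat \<times> nat \<times> nat \<times> nat \<Rightarrow> (bool \<Rightarrow> nat) \<Rightarrow> (bool \<Rightarrow> nat) \<Rightarrow> (nat \<Rightarrow> complex) \<Rightarrow> nat \<Rightarrow> complex" where
  "wf c c'' P a a' w = (case P of (p, q, p', q') \<Rightarrow>
    fop n (E (shift k n c p q)) (E c'') (m (shift k n c p q) p' q') (ps k a) (fop n (E c) (E (shift k n c p q)) (m c p q) (ps k a') w)
    - fop n (E (shift k n c p q)) (E c'') (m (shift k n c p q) p' q') (ps k a') (fop n (E c) (E (shift k n c p q)) (m c p q) (ps k a) w))"

lemma clin_wf: "clin (wf c c'' P a a')"
proof (cases P)
  case (fields p q p' q')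
  show ?thesis unfolding fields wf_def[abs_def] prod.case
    by (rule clin_sub[OF clin_comp[OF clin_fop clin_fop] clin_comp[OF clin_fop clin_fop]])
qed

lemma wf_Supp: "wf c c'' P a a' w \<in> Supp (rdim (E c''))"
  by (cases P) (simp add: wf_def fop_def mop_def)

lemma wf_flip: "wf c c'' P a' a w = - wf c c'' P a a' w"
  by (cases P) (simp only: wf_def prod.case minus_diff_eq)

lemma wf_TT:
  assumes "clin \<phi>"
  shows "\<phi> (wf c (shift k n (shift k n c p q) p' q') (p, q, p', q') a a' (vv c)) = TT c p q p' q' \<phi> a a' - TT c p q p' q' \<phi> a' a"
  unfolding wf_def prod.case TT_def clin_diff[OF assms] ..

context
  fixes c c'' :: weight
  assumes c: "c \<in> D1 k n" and c'': "c'' \<in> D1 k n"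
begin

lemma path_Ext1:
  assumes "(p, q, p', q') \<in> paths k n E c c''"
  shows "m c p q \<in> Ext1_G k n (E c) (E (shift k n c p q))"
    and "m (shift k n c p q) p' q' \<in> Ext1_G k n (E (shift k n c p q)) (E c'')"
    and "is_module k n (E c)" "is_module k n (E (shift k n c p q))" "is_module k n (E c'')"
proof -
  note P = assms[unfolded paths_iff[OF c c'']]
  show "m c p q \<in> Ext1_G k n (E c) (E (shift k n c p q))" using P by (intro m_Ext1(1)[OF c]) auto
  have "m (shift k n c p q) p' q' \<in> Ext1_G k n (E (shift k n c p q)) (E (shift k n (shift k n c p q) p' q'))"
    using P c'' by (intro m_Ext1(1)) auto
  then show "m (shift k n c p q) p' q' \<in> Ext1_G k n (E (shift k n c p q)) (E c'')" using P by simp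
  show "is_module k n (E c)" "is_module k n (E (shift k n c p q))" "is_module k n (E c'')"
    using family_hw(1)[OF kn fam] c c'' P by auto
qed

lemma wf_wedge:
  assumes P: "P \<in> paths k n E c c''" and a: "a \<in> J (rr k n)" "a' \<in> J (rr k n)"
  shows "wf c c'' P a a' w = mop (rdim (E c'')) (rdim (E c)) (ent (wp c P (eu n (ps k a)) (eu n (ps k a')))) w"
proof (cases P)
  case (fields p q p' q')
  note e = eu_nilrad[OF kn ps_Pos[OF kn a(1)]] eu_nilrad[OF kn ps_Pos[OF kn a(2)]]
  let ?mu = "shift k n c p q"
  let ?S = "\<lambda>a a' u w. \<Sum>l<rdim (E ?mu). m ?mu p' q' (eu n (ps k a)) $$ (u, l) * m c p q (eu n (ps k a')) $$ (l, w)"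
  have "mop (rdim (E c'')) (rdim (E c)) (ent (wp c P (eu n (ps k a)) (eu n (ps k a')))) w
    = mop (rdim (E c'')) (rdim (E c)) (?S a a' - ?S a' a) w"
  proof (rule mop_cong)
    fix u w assume "u < rdim (E c'')" "w < rdim (E c)"
    then show "ent (wp c P (eu n (ps k a)) (eu n (ps k a'))) u w = (?S a a' - ?S a' a) u w"
      unfolding fields wp_def fst_conv snd_conv
      using wedge_entry[OF path_Ext1(1,2)[OF P[unfolded fields]] e, of u w] by simp
  qed
  then show ?thesis unfolding clin_diff[OF clin_mop_matrix] fields wf_def prod.case fop_def mop_mop by (rule sym)
qed

lemma bi_inter_wf:
  assumes P: "P \<in> paths k n E c c''"
  shows "bi_inter (rr k n) (XX k n (E c)) (XX k n (E c'')) (wf c c'' P)"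
proof (cases P)
  case (fields p q p' q')
  note e = path_Ext1[OF P[unfolded fields]]
  note b = bi_inter_comp[OF Ext1_intertwining[OF kn e(4,5,2)] clin_fop Ext1_intertwining[OF kn e(3,4,1)]]
  show ?thesis unfolding fields wf_def[abs_def] prod.case
    by (rule bi_inter_diff[OF b bi_inter_flip[OF b] clin_XX])
qed

context
  fixes \<phi>
  assumes \<phi>: "hw_mod (rr k n) (XX k n (E c'')) (vv c'') (al k n c'') \<phi>"
begin

lemma clin_\<phi>: "clin \<phi>"
  using \<phi> by (rule hw_mod.clin_phi)

text \<open>The combination \<open>G\<close> of the wedges is equivariant, so
  \<open>bi_inter_zero\<close> applies to it, and bilinearity extends the result from matrix units
  to the nilradical. The scalars \<open>co\<close> are arbitrary so that any entry of the path maps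
  can be inserted.\<close>

lemma relation_iff:
  "(\<forall>x\<in>nilrad k n. \<forall>y\<in>nilrad k n. \<forall>u<rdim (E c''). \<forall>w<rdim (E c). (\<Sum>P\<in>paths k n E c c''. co P * wp c P x y $$ (u, w)) = 0)
    \<longleftrightarrow> (\<forall>a\<in>J (rr k n). \<forall>a'\<in>J (rr k n). (\<Sum>P\<in>paths k n E c c''. co P * \<phi> (wf c c'' P a a' (vv c))) = 0)"
  (is "?L \<longleftrightarrow> ?R")
proof -
  note A = family_hw[OF kn fam c] and B = family_hw[OF kn fam c'']
  obtain \<phi>A where hA: "hw_mod (rr k n) (XX k n (E c)) (vv c) (al k n c) \<phi>A" using A(3) by blast
  interpret hw_pair "rr k n" "XX k n (E c)" "vv c" "al k n c" \<phi>A "XX k n (E c'')" "vv c''" "al k n c''" \<phi>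
    using hA \<phi> by (rule hw_pair.intro)
  define G where "G a a' w = (\<Sum>P\<in>paths k n E c c''. co P *\<^sub>C wf c c'' P a a' w)" for a a' w
  have \<phi>G: "\<phi> (G a a' w) = (\<Sum>P\<in>paths k n E c c''. co P * \<phi> (wf c c'' P a a' w))" for a a' w
    unfolding G_def clin_sum[OF clin_\<phi>] clin_scale[OF clin_\<phi>] scaleC_complex ..
  have Gm: "G a a' w = mop (rdim (E c'')) (rdim (E c)) (\<Sum>P\<in>paths k n E c c''. co P *\<^sub>C ent (wp c P (eu n (ps k a)) (eu n (ps k a')))) w"
    if "a \<in> J (rr k n)" "a' \<in> J (rr k n)" for a a' w
    unfolding G_def clin_sum[OF clin_mop_matrix] clin_scale[OF clin_mop_matrix]
    by (intro sum.cong refl arg_cong2[where f = scaleC] wf_wedge that)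
  have Ge: "(\<Sum>P\<in>paths k n E c c''. co P *\<^sub>C ent (wp c P x y)) u w = (\<Sum>P\<in>paths k n E c c''. co P * wp c P x y $$ (u, w))" for x y u w
    unfolding sum_fun_apply scaleC_fun_apply scaleC_complex ..
  have b: "bi_inter (rr k n) (XX k n (E c)) (XX k n (E c'')) G"
    unfolding G_def[abs_def] by (rule bi_inter_sum[OF bi_inter_wf clin_XX])
  have lG: "clin (G a a')" for a a'
    unfolding G_def[abs_def] by (intro clin_sum_fun clin_smul clin_wf)
  have GS: "G a a' w \<in> VB" for a a' w
    unfolding B(2) G_def using wf_Supp[of c c''] by (simp add: sum_fun_apply scaleC_fun_apply)
  show ?thesis
  proof
    assume L: ?L
    show ?R
    proof (intro ballI)
      fix a a' assume a: "a \<in> J (rr k n)" "a' \<in> J (rr k n)"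
      have "G a a' (vv c) = mop (rdim (E c'')) (rdim (E c)) 0 (vv c)"
        unfolding Gm[OF a]
      proof (rule mop_cong)
        fix u w assume uw: "u < rdim (E c'')" "w < rdim (E c)"
        have "(\<Sum>P\<in>paths k n E c c''. co P * wp c P (eu n (ps k a)) (eu n (ps k a')) $$ (u, w)) = 0"
          by (rule L[rule_format, OF eu_nilrad[OF kn ps_Pos[OF kn a(1)]] eu_nilrad[OF kn ps_Pos[OF kn a(2)]] uw])
        then show "(\<Sum>P\<in>paths k n E c c''. co P *\<^sub>C ent (wp c P (eu n (ps k a)) (eu n (ps k a')))) u w = 0 u w"
          unfolding Ge by simp
      qed
      then have "\<phi> (G a a' (vv c)) = 0" unfolding clin_zero[OF clin_mop_matrix] by (simp only: clin_zero[OF clin_\<phi>])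
      then show "(\<Sum>P\<in>paths k n E c c''. co P * \<phi> (wf c c'' P a a' (vv c))) = 0" unfolding \<phi>G .
    qed
  next
    assume R: ?R
    have z: "\<phi> (G a a' (vv c)) = 0" if "a \<in> J (rr k n)" "a' \<in> J (rr k n)" for a a'
      unfolding \<phi>G by (rule R[rule_format, OF that])
    have e: "(\<Sum>P\<in>paths k n E c c''. co P * wp c P (eu n p) (eu n q) $$ (u, w)) = 0"
      if pq: "p \<in> Pos k n" "q \<in> Pos k n" and uw: "u < rdim (E c'')" "w < rdim (E c)" for p q u w
    proof -
      note a = qs_J[OF kn pq(1)] qs_J[OF kn pq(2)]
      have "G (qs k p) (qs k q) (\<lambda>j. if j = w then 1 else 0) = 0"
        by (rule bi_inter_zero[where G = G, OF lG GS b _ a]) (rule z, assumption, assumption, use uw in \<open>auto simp: A(2)\<close>)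
      from fun_cong[OF this, of u] show ?thesis
        unfolding Gm[OF a] ps_qs[OF pq(1)] ps_qs[OF pq(2)] mop_unit[OF uw] Ge by simp
    qed
    show ?L
    proof (intro ballI allI impI)
      fix x y u w assume xy: "x \<in> nilrad k n" "y \<in> nilrad k n" and uw: "u < rdim (E c'')" "w < rdim (E c)"
      have "(\<Sum>P\<in>paths k n E c c''. co P * wp c P x y $$ (u, w))
        = (\<Sum>P\<in>paths k n E c c''. co P * (\<Sum>p\<in>Pos k n. \<Sum>q\<in>Pos k n. x $$ p * y $$ q * wp c P (eu n p) (eu n q) $$ (u, w)))"
      proof (intro sum.cong refl arg_cong2[where f = times])
        fix P assume P: "P \<in> paths k n E c c''"
        obtain p q p' q' where f: "P = (p, q, p', q')" by (cases P)
        show "wp c P x y $$ (u, w) = (\<Sum>p\<in>Pos k n. \<Sum>q\<in>Pos k n. x $$ p * y $$ q * wp c P (eu n p) (eu n q) $$ (u, w))"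
          unfolding f wp_def fst_conv snd_conv by (rule wedge_expand[OF kn path_Ext1(1,2)[OF P[unfolded f]] xy uw])
      qed
      also have "\<dots> = (\<Sum>P\<in>paths k n E c c''. \<Sum>p\<in>Pos k n. \<Sum>q\<in>Pos k n. x $$ p * y $$ q * (co P * wp c P (eu n p) (eu n q) $$ (u, w)))"
        unfolding sum_distrib_left by (intro sum.cong refl) (simp only: ac_simps)
      also have "\<dots> = (\<Sum>p\<in>Pos k n. \<Sum>P\<in>paths k n E c c''. \<Sum>q\<in>Pos k n. x $$ p * y $$ q * (co P * wp c P (eu n p) (eu n q) $$ (u, w)))"
        by (rule sum.swap)
      also have "\<dots> = (\<Sum>p\<in>Pos k n. \<Sum>q\<in>Pos k n. \<Sum>P\<in>paths k n E c c''. x $$ p * y $$ q * (co P * wp c P (eu n p) (eu n q) $$ (u, w)))"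
        by (intro sum.cong refl) (rule sum.swap)
      also have "\<dots> = (\<Sum>p\<in>Pos k n. \<Sum>q\<in>Pos k n. x $$ p * y $$ q * 0)"
        unfolding sum_distrib_left[symmetric] by (intro sum.cong refl arg_cong2[where f = times] e uw)
      finally show "(\<Sum>P\<in>paths k n E c c''. co P * wp c P x y $$ (u, w)) = 0" by simp
    qed
  qed
qed

lemma relations_hold_iff:
  "relations_hold k n E m dV g c c'' \<longleftrightarrow> (\<forall>i<dV c''. \<forall>j<dV c. \<forall>a\<in>J (rr k n). \<forall>a'\<in>J (rr k n).
    (\<Sum>P\<in>paths k n E c c''. pmap g c P $$ (i, j) * \<phi> (wf c c'' P a a' (vv c))) = 0)"
  unfolding relation_iff[of "\<lambda>P. pmap g c P $$ (i, j)" for i j, symmetric]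
proof
  assume H: "relations_hold k n E m dV g c c''"
  show "\<forall>i<dV c''. \<forall>j<dV c. \<forall>x\<in>nilrad k n. \<forall>y\<in>nilrad k n. \<forall>u<rdim (E c''). \<forall>w<rdim (E c).
      (\<Sum>P\<in>paths k n E c c''. pmap g c P $$ (i, j) * wp c P x y $$ (u, w)) = 0"
  proof (intro allI impI ballI)
    fix i j x y u w assume h: "i < dV c''" "j < dV c" "x \<in> nilrad k n" "y \<in> nilrad k n" "u < rdim (E c'')" "w < rdim (E c)"
    show "(\<Sum>P\<in>paths k n E c c''. pmap g c P $$ (i, j) * wp c P x y $$ (u, w)) = 0"
      using H[unfolded relations_hold_def case_prod_unfold, rule_format, OF h(3,4,1,2,5,6)] unfolding pmap_def wp_def .
  qed
next
  assume H: "\<forall>i<dV c''. \<forall>j<dV c. \<forall>x\<in>nilrad k n. \<forall>y\<in>nilrad k n. \<forall>u<rdim (E c''). \<forall>w<rdim (E c).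
      (\<Sum>P\<in>paths k n E c c''. pmap g c P $$ (i, j) * wp c P x y $$ (u, w)) = 0"
  show "relations_hold k n E m dV g c c''"
    unfolding relations_hold_def case_prod_unfold
  proof (intro allI impI ballI)
    fix x y i j u w assume h: "x \<in> nilrad k n" "y \<in> nilrad k n" "i < dV c''" "j < dV c" "u < rdim (E c'')" "w < rdim (E c)"
    show "(\<Sum>P\<in>paths k n E c c''. path_map k n g c (fst P) (fst (snd P)) (fst (snd (snd P))) (snd (snd (snd P))) $$ (i, j)
        * wedge (m (shift k n c (fst P) (fst (snd P))) (fst (snd (snd P))) (snd (snd (snd P)))) (m c (fst P) (fst (snd P))) x y $$ (u, w)) = 0"
      using H[rule_format, OF h(3,4,1,2,5,6)] unfolding pmap_def wp_def .
  qed
qed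

lemma wf_weight:
  assumes P: "P \<in> paths k n E c c''" and a: "a \<in> J (rr k n)" "a' \<in> J (rr k n)"
    and w: "i \<in> {1..rr k n s}" "al k n c'' s i \<noteq> al k n c s i + (if a s = i then 1 else 0) + (if a' s = i then 1 else 0)"
  shows "\<phi> (wf c c'' P a a' (vv c)) = 0"
proof -
  obtain \<phi>A where hA: "hw_mod (rr k n) (XX k n (E c)) (vv c) (al k n c) \<phi>A" using family_hw(3)[OF kn fam c] by blast
  interpret hw_pair "rr k n" "XX k n (E c)" "vv c" "al k n c" \<phi>A "XX k n (E c'')" "vv c''" "al k n c''" \<phi>
    using hA \<phi> by (rule hw_pair.intro)
  show ?thesis by (rule bi_inter_weight[OF clin_wf bi_inter_wf[OF P] a w])
qed

text \<open>The four ways to insert the two boxes: as in the path, exchanged on one side, or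
  exchanged on both. The double exchange is an exchange on the side of U followed by one on the side
  of Q^*.\<close>

lemma path_values:
  assumes P: "(p, q, p', q') \<in> paths k n E c c''"
    and xy: "\<forall>p\<in>{1..k + 1}. \<forall>q\<in>{1..n - k}. x p * y q \<noteq> (0::complex) \<and> nv p q = (x p * y q) \<cdot>\<^sub>m eu n (ps k (mk p q))"
  shows "x p * y q * (x p' * y q') * TT c p q p' q' \<phi> (mk p' q') (mk p q) = 1"
    and "p \<noteq> p' \<Longrightarrow> x p * y q * (x p' * y q') * TT c p q p' q' \<phi> (mk p q') (mk p' q) = kap k c True p p'"
    and "q \<noteq> q' \<Longrightarrow> x p * y q * (x p' * y q') * TT c p q p' q' \<phi> (mk p' q) (mk p q') = kap k c False q q'"
    and "p \<noteq> p' \<Longrightarrow> q \<noteq> q' \<Longrightarrow> x p * y q * (x p' * y q') * TT c p q p' q' \<phi> (mk p q) (mk p' q') = kap k c False q q' * kap k c True p p'"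
proof -
  have r: "p \<in> {1..k + 1}" "q \<in> {1..n - k}" "p' \<in> {1..k + 1}" "q' \<in> {1..n - k}" "shift k n c p q \<in> D1 k n"
    and e: "c'' = shift k n (shift k n c p q) p' q'"
    using P unfolding paths_iff[OF c c''] by auto
  have \<phi>1: "\<phi> (vv c'') = 1" using \<phi> by (rule hw_mod.phi_v)
  note J = mk_J[OF kn r(1,2)] mk_J[OF kn r(3,4)] mk_J[OF kn r(1,4)] mk_J[OF kn r(3,2)]
  note sw = TT_swap[OF c r(1,2,5,3,4) c''[unfolded e] \<phi>[unfolded e]]
  show 1: "x p * y q * (x p' * y q') * TT c p q p' q' \<phi> (mk p' q') (mk p q) = 1"
    using TT_diag[OF c r(1,2,5,3,4) c''[unfolded e] clin_\<phi> \<phi>1[unfolded e] conjunct2[OF bspec[OF bspec[OF xy r(1)] r(2)]] conjunct2[OF bspec[OF bspec[OF xy r(3)] r(4)]]] .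
  have T: "TT c p q p' q' \<phi> (mk p q') (mk p' q) = kap k c True p p' * TT c p q p' q' \<phi> (mk p' q') (mk p q)" if "p \<noteq> p'"
    using sw[OF J(1,2), of True] that by simp
  show 2: "x p * y q * (x p' * y q') * TT c p q p' q' \<phi> (mk p q') (mk p' q) = kap k c True p p'" if "p \<noteq> p'"
    unfolding T[OF that] mult.left_commute[of _ "kap k c True p p'"] 1 by simp
  have F: "TT c p q p' q' \<phi> (mk p' q) (mk p q') = kap k c False q q' * TT c p q p' q' \<phi> (mk p' q') (mk p q)" if "q \<noteq> q'"
    using sw[OF J(1,2), of False] that by simp
  show "x p * y q * (x p' * y q') * TT c p q p' q' \<phi> (mk p' q) (mk p q') = kap k c False q q'" if "q \<noteq> q'"
    unfolding F[OF that] mult.left_commute[of _ "kap k c False q q'"] 1 by simp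
  have TF: "TT c p q p' q' \<phi> (mk p q) (mk p' q') = kap k c False q q' * TT c p q p' q' \<phi> (mk p q') (mk p' q)" if "q \<noteq> q'"
    using sw[OF J(4,3), of False] that by simp
  show "x p * y q * (x p' * y q') * TT c p q p' q' \<phi> (mk p q) (mk p' q') = kap k c False q q' * kap k c True p p'"
    if "p \<noteq> p'" "q \<noteq> q'"
    unfolding TF[OF that(2)] mult.left_commute[of _ "kap k c False q q'"] 2[OF that(1)] ..
qed

end

end

end

section \<open>Pairs of boxes\<close>

lemma delta_pair:
  assumes "\<And>i. i \<in> {a, b} \<Longrightarrow> (if a = i then 1 else 0) + (if b = i then 1 else 0) = (if c = i then 1 else 0) + (if d = i then 1 else (0::complex))"
  shows "(a = c \<and> b = d) \<or> (a = d \<and> b = c)"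
  using assms[of a] assms[of b]
  by (cases "c = a"; cases "d = a"; cases "c = b"; cases "d = b"; cases "a = b") auto

lemma al_shift2:
  assumes "k < n" "p \<in> {1..k + 1}" "q \<in> {1..n - k}" "p' \<in> {1..k + 1}" "q' \<in> {1..n - k}" "i \<in> {1..rr k n s}"
  shows "al k n (shift k n (shift k n c p q) p' q') s i = al k n c s i + ((if mk p q s = i then 1 else 0) + (if mk p' q' s = i then 1 else 0))"
  unfolding al_shift[OF assms(1,4,5,6)] al_shift[OF assms(1,2,3,6)] by (rule add.assoc)

lemma shift2:
  assumes "k < n" "p \<in> {1..k + 1}" "q \<in> {1..n - k}" "p' \<in> {1..k + 1}" "q' \<in> {1..n - k}"
  shows "shift k n (shift k n c p q) p' q' = (\<lambda>j. c j + (eps n (k + 1 + q) j + eps n (k + 1 + q') j) - (eps n (k + 2 - p) j + eps n (k + 2 - p') j))"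
  unfolding shift_def nil_weight_eps[OF assms(2,3,1)] nil_weight_eps[OF assms(4,5,1)] by (rule ext) linarith

text \<open>The final weight records an unordered pair of rows for each factor. The orders in the
  two factors are independent of each other, which accounts for four candidate paths.\<close>

lemma shift2_eq_iff:
  assumes kn: "k < n" and r: "p \<in> {1..k + 1}" "q \<in> {1..n - k}" "p' \<in> {1..k + 1}" "q' \<in> {1..n - k}"
    and r': "p1 \<in> {1..k + 1}" "q1 \<in> {1..n - k}" "p2 \<in> {1..k + 1}" "q2 \<in> {1..n - k}"
  shows "shift k n (shift k n c p1 q1) p2 q2 = shift k n (shift k n c p q) p' q'
    \<longleftrightarrow> (p = p1 \<and> p' = p2 \<or> p = p2 \<and> p' = p1) \<and> (q = q1 \<and> q' = q2 \<or> q = q2 \<and> q' = q1)"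
proof
  assume e: "shift k n (shift k n c p1 q1) p2 q2 = shift k n (shift k n c p q) p' q'"
  have m: "(mk p q s = mk p1 q1 s \<and> mk p' q' s = mk p2 q2 s) \<or> (mk p q s = mk p2 q2 s \<and> mk p' q' s = mk p1 q1 s)" for s
  proof (rule delta_pair)
    fix i assume "i \<in> {mk p q s, mk p' q' s}"
    then have iR: "i \<in> {1..rr k n s}" using J_range[OF mk_J[OF kn r(1,2)], of s] J_range[OF mk_J[OF kn r(3,4)], of s] by auto
    show "(if mk p q s = i then 1 else 0) + (if mk p' q' s = i then 1 else 0) = (if mk p1 q1 s = i then 1 else 0) + (if mk p2 q2 s = i then 1 else (0::complex))"
      using trans[OF al_shift2[OF kn r iR, of c, symmetric] al_shift2[OF kn r' iR, of c, unfolded e]] by (rule add_left_cancel[THEN iffD1])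
  qed
  show "(p = p1 \<and> p' = p2 \<or> p = p2 \<and> p' = p1) \<and> (q = q1 \<and> q' = q2 \<or> q = q2 \<and> q' = q1)"
    using m[of True] m[of False] by simp
next
  assume "(p = p1 \<and> p' = p2 \<or> p = p2 \<and> p' = p1) \<and> (q = q1 \<and> q' = q2 \<or> q = q2 \<and> q' = q1)"
  then show "shift k n (shift k n c p1 q1) p2 q2 = shift k n (shift k n c p q) p' q'"
    unfolding shift2[OF kn r] shift2[OF kn r'] by (elim conjE disjE) (simp_all only: add.commute)
qed

lemma bundle_weight_D1:
  assumes kn: "k < n" and p: "is_partition (k + 1) \<alpha>" "is_partition (n - k) \<beta>"
  shows "bundle_weight k n \<alpha> \<beta> t \<in> D1 k n"
  unfolding D1_iff[OF kn]
proof (intro conjI allI impI ballI)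
  fix i assume i: "i \<notin> {1..n}"
  have f: "fund_weight n a i = 0" for a using i by (auto simp: fund_weight_def)
  then show "bundle_weight k n \<alpha> \<beta> t i = 0" by (simp add: bundle_weight_def eps_def)
next
  fix s i assume i: "i \<in> {1..<rr k n s}"
  show "0 \<le> dl k (bundle_weight k n \<alpha> \<beta> t) s i"
  proof (cases s)
    case True
    then have "i \<in> {1..k}" "i + 1 \<in> {1..k + 1}" "i \<in> {1..k + 1}" using i by (auto simp: rr_def)
    then show ?thesis using p(1) True by (simp add: dl_def bundle_weight_coeff(1)[OF kn] is_partition_def)
  next
    case False
    then have "i \<in> {1..<n - k}" "i + 1 \<in> {1..n - k}" "i \<in> {1..n - k}" using i by (auto simp: rr_def)
    then show ?thesis using p(2) False by (simp add: dl_def bundle_weight_coeff(2)[OF kn] is_partition_def)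
  qed
qed

lemma mk_eqI: "a True = p \<Longrightarrow> a False = q \<Longrightarrow> a = mk p q"
  unfolding mk_def fun_eq_iff all_bool_eq by simp

locale two_boxes = normalized_quiver +
  fixes c c'' :: weight and p1 p2 q1 q2 :: nat
  assumes c: "c \<in> D1 k n" and c'': "c'' \<in> D1 k n" and c''_eq: "c'' = shift k n (shift k n c p1 q1) p2 q2"
    and r: "p1 \<in> {1..k + 1}" "q1 \<in> {1..n - k}" "p2 \<in> {1..k + 1}" "q2 \<in> {1..n - k}"
begin

text \<open>By weight only the pair with both indices equal to (p1, q1) could contribute, and there
  an alternating form vanishes.\<close>

lemma Ext2_zero:
  assumes eq: "p1 = p2" "q1 = q2"
  shows "Ext2_G_zero k n (E c) (E c'')"
  unfolding Ext2_G_zero_def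
proof (intro ballI)
  fix f x y assume f: "f \<in> Ext2_G k n (E c) (E c'')" and xy: "x \<in> nilrad k n" "y \<in> nilrad k n"
  note A = family_hw[OF kn fam c] and B = family_hw[OF kn fam c'']
  obtain \<phi>A where hA: "hw_mod (rr k n) (XX k n (E c)) (vv c) (al k n c) \<phi>A" using A(3) by blast
  obtain \<phi> where \<phi>: "hw_mod (rr k n) (XX k n (E c'')) (vv c'') (al k n c'') \<phi>" using B(3) by blast
  interpret hw_pair "rr k n" "XX k n (E c)" "vv c" "al k n c" \<phi>A "XX k n (E c'')" "vv c''" "al k n c''" \<phi>
    using hA \<phi> by (rule hw_pair.intro)
  let ?G = "\<lambda>a a'. mop (rdim (E c'')) (rdim (E c)) (ent (f (eu n (ps k a)) (eu n (ps k a'))))"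
  have b: "bi_inter (rr k n) (XX k n (E c)) (XX k n (E c'')) ?G" by (rule Ext2_bi_inter[OF kn A(1) B(1) f])
  have z: "\<phi> (?G a a' (vv c)) = 0" if a: "a \<in> J (rr k n)" "a' \<in> J (rr k n)" for a a'
  proof (cases "a = mk p1 q1 \<and> a' = mk p1 q1")
    case True
    have "f (eu n (ps k a)) (eu n (ps k a')) = 0\<^sub>m (rdim (E c'')) (rdim (E c))"
      using f eu_nilrad[OF kn ps_Pos[OF kn a(1)]] True by (simp add: Ext2_G_def)
    then have "?G a a' (vv c) = 0" by (simp add: mop_def fun_eq_iff)
    then show ?thesis by (simp only: clin_zero[OF B.clin_phi])
  next
    case False
    then obtain s where s: "a s \<noteq> mk p1 q1 s \<or> a' s \<noteq> mk p1 q1 s" by (auto simp: fun_eq_iff)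
    have t: "\<exists>i\<in>{1..rr k n s}. (if a s = i then 1 else 0) + (if a' s = i then 1 else 0) \<noteq> (if mk p1 q1 s = i then 1 else 0) + (if mk p2 q2 s = i then 1 else (0::complex))"
    proof (rule ccontr)
      assume nt: "\<not> ?thesis"
      have "(a s = mk p1 q1 s \<and> a' s = mk p2 q2 s) \<or> (a s = mk p2 q2 s \<and> a' s = mk p1 q1 s)"
      proof (rule delta_pair)
        fix i assume "i \<in> {a s, a' s}"
        then have "i \<in> {1..rr k n s}" using J_range[OF a(1), of s] J_range[OF a(2), of s] by auto
        then show "(if a s = i then 1 else 0) + (if a' s = i then 1 else 0) = (if mk p1 q1 s = i then 1 else 0) + (if mk p2 q2 s = i then 1 else (0::complex))"
          using nt by blast
      qed
      then show False using s eq by auto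
    qed
    then obtain i where i: "i \<in> {1..rr k n s}" "(if a s = i then 1 else 0) + (if a' s = i then 1 else 0) \<noteq> (if mk p1 q1 s = i then 1 else 0) + (if mk p2 q2 s = i then 1 else (0::complex))" by blast
    show ?thesis
    proof (rule bi_inter_weight[OF clin_mop b a i(1)])
      show "al k n c'' s i \<noteq> al k n c s i + (if a s = i then 1 else 0) + (if a' s = i then 1 else 0)"
        unfolding c''_eq al_shift2[OF kn r i(1)] add.assoc using i(2) unfolding add_left_cancel by (rule not_sym)
    qed
  qed
  have e: "f (eu n p) (eu n q) $$ (u, w) = 0" if pq: "p \<in> Pos k n" "q \<in> Pos k n" and uw: "u < rdim (E c'')" "w < rdim (E c)" for p q u w
  proof -
    have V: "?G a a' w \<in> VB" for a a' w unfolding B(2) by (rule mop_Supp)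
    have "?G (qs k p) (qs k q) (\<lambda>j. if j = w then 1 else 0) = 0"
      by (rule bi_inter_zero[where G = ?G, OF clin_mop V b _ qs_J[OF kn pq(1)] qs_J[OF kn pq(2)]]) (rule z, assumption, assumption, use uw in \<open>auto simp: A(2)\<close>)
    from fun_cong[OF this, of u] show ?thesis unfolding mop_unit[OF uw] ps_qs[OF pq(1)] ps_qs[OF pq(2)] by simp
  qed
  have e2: "f x (eu n q) $$ (u, w) = 0" if "q \<in> Pos k n" "u < rdim (E c'')" "w < rdim (E c)" for q u w
    unfolding Ext2_expand(1)[OF kn f xy(1) eu_nilrad[OF kn that(1)] that(2,3)] by (intro sum.neutral ballI) (simp add: e that)
  show "f x y = 0\<^sub>m (rdim (E c'')) (rdim (E c))"
  proof (rule eq_matI)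
    fix u w assume "u < dim_row (0\<^sub>m (rdim (E c'')) (rdim (E c)) :: complex mat)" "w < dim_col (0\<^sub>m (rdim (E c'')) (rdim (E c)) :: complex mat)"
    then have uw: "u < rdim (E c'')" "w < rdim (E c)" by auto
    show "f x y $$ (u, w) = 0\<^sub>m (rdim (E c'')) (rdim (E c)) $$ (u, w)"
      unfolding Ext2_expand(2)[OF kn f xy uw] index_zero_mat(1)[OF uw] by (intro sum.neutral ballI) (simp add: e2 uw)
  qed (use f xy in \<open>auto simp: Ext2_G_def\<close>)
qed

section \<open>The paths between the two weights and their coefficients\<close>

abbreviation "P1 \<equiv> (p1, q1, p2, q2)"
abbreviation "P2 \<equiv> (p1, q2, p2, q1)"
abbreviation "P3 \<equiv> (p2, q1, p1, q2)"
abbreviation "P4 \<equiv> (p2, q2, p1, q1)"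

text \<open>Row \<open>d\<close> of factor \<open>s\<close> can take a box. A neighbour is a vertex
  iff this holds in both factors.\<close>

definition good :: "bool \<Rightarrow> nat \<Rightarrow> bool" where
  "good s d \<longleftrightarrow> (2 \<le> d \<longrightarrow> 1 \<le> dl k c s (d - 1))"

lemma shift_good: "p \<in> {1..k + 1} \<Longrightarrow> q \<in> {1..n - k} \<Longrightarrow> shift k n c p q \<in> D1 k n \<longleftrightarrow> good True p \<and> good False q"
  by (subst shift_D1[OF kn c]) (simp_all add: good_def all_bool_eq conj_commute)

lemma mem_paths: "(p, q, p', q') \<in> paths k n E c c'' \<longleftrightarrow> (p, q, p', q') \<in> {P1, P2, P3, P4} \<and> good True p \<and> good False q"
proof -
  have "(p, q, p', q') \<in> paths k n E c c'' \<longleftrightarrow> p \<in> {1..k + 1} \<and> q \<in> {1..n - k} \<and> p' \<in> {1..k + 1} \<and> q' \<in> {1..n - k} \<and>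
      (good True p \<and> good False q) \<and> c'' = shift k n (shift k n c p q) p' q'"
    unfolding paths_iff[OF c c''] by (intro conj_cong refl) (rule shift_good; assumption)
  also have "\<dots> \<longleftrightarrow> p \<in> {1..k + 1} \<and> q \<in> {1..n - k} \<and> p' \<in> {1..k + 1} \<and> q' \<in> {1..n - k} \<and>
      (good True p \<and> good False q) \<and> (p = p1 \<and> p' = p2 \<or> p = p2 \<and> p' = p1) \<and> (q = q1 \<and> q' = q2 \<or> q = q2 \<and> q' = q1)"
    unfolding c''_eq by (intro conj_cong refl) (rule shift2_eq_iff[OF kn _ _ _ _ r]; assumption)
  also have "\<dots> \<longleftrightarrow> (p, q, p', q') \<in> {P1, P2, P3, P4} \<and> good True p \<and> good False q"
    using r by auto
  finally show ?thesis .
qed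

lemma dl_c'':
  assumes "1 \<le> i" "i < rr k n s"
  shows "0 \<le> dl k c s i + (if mk p1 q1 s = i then 1 else 0) - (if mk p1 q1 s = i + 1 then 1 else 0)
    + (if mk p2 q2 s = i then 1 else 0) - (if mk p2 q2 s = i + 1 then 1 else 0)"
proof -
  have "i \<in> {1..<rr k n s}" using assms by auto
  then have "0 \<le> dl k c'' s i" using c'' unfolding D1_iff[OF kn] by blast
  then show ?thesis unfolding c''_eq dl_shift[OF kn r(3,4) assms] dl_shift[OF kn r(1,2) assms] .
qed

text \<open>Otherwise this row would exceed the row above it after both boxes are added, and
  \<open>c''\<close> would not lie in \<open>D1 k n\<close>.\<close>

lemma good_first:
  assumes "mk p1 q1 s \<le> mk p2 q2 s"
  shows "good s (mk p1 q1 s)"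
  unfolding good_def
proof
  assume g: "2 \<le> mk p1 q1 s"
  have i: "1 \<le> mk p1 q1 s - 1" "mk p1 q1 s - 1 < rr k n s" using g J_range[OF mk_J[OF kn r(1,2)], of s] by auto
  have d: "mk p1 q1 s \<noteq> mk p1 q1 s - 1" "mk p2 q2 s \<noteq> mk p1 q1 s - 1" "mk p1 q1 s - 1 + 1 = mk p1 q1 s" using g assms by auto
  show "1 \<le> dl k c s (mk p1 q1 s - 1)" using dl_c''[OF i] d by (simp split: if_splits)
qed

text \<open>Distance 1 means adjacent rows of equal length, where the lower one cannot be filled
  first. If the rows are not adjacent, membership of \<open>c''\<close> in \<open>D1 k n\<close>
  already leaves room above the lower row, and the distance exceeds 1.\<close>

lemma good_second:
  assumes l: "mk p1 q1 s < mk p2 q2 s"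
  shows "good s (mk p2 q2 s) \<longleftrightarrow> cdist k c s (mk p1 q1 s) (mk p2 q2 s) \<noteq> 1"
proof -
  let ?a = "mk p1 q1 s" let ?b = "mk p2 q2 s"
  have ab: "1 \<le> ?a" "?b \<le> rr k n s" using J_range[OF mk_J[OF kn r(1,2)], of s] J_range[OF mk_J[OF kn r(3,4)], of s] by auto
  have i: "1 \<le> ?b - 1" "?b - 1 < rr k n s" using ab l by auto
  have g2: "2 \<le> ?b" using ab l by auto
  note ge = cdist_ge[OF kn c ab(1) l ab(2)]
  show ?thesis
  proof
    assume "good s ?b"
    then show "cdist k c s ?a ?b \<noteq> 1" using ge g2 by (auto simp: good_def)
  next
    assume n1: "cdist k c s ?a ?b \<noteq> 1"
    have "1 \<le> dl k c s (?b - 1)"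
    proof (cases "?a = ?b - 1")
      case True
      then have "{?a..<?b} = {?a}" using l by auto
      then have "cdist k c s ?a ?b = dl k c s (?b - 1) + 1" using True l by (simp add: cdist_def)
      moreover have "?b - 1 \<in> {1..<rr k n s}" using i by auto
      moreover from this have "0 \<le> dl k c s (?b - 1)" using c unfolding D1_iff[OF kn] by blast
      ultimately show ?thesis using n1 by simp
    next
      case False
      have "?a \<noteq> ?b - 1 + 1" "?b \<noteq> ?b - 1" "?b - 1 + 1 = ?b" using l g2 by auto
      then show ?thesis using dl_c''[OF i] False by simp
    qed
    then show "good s ?b" by (simp add: good_def)
  qed
qed

definition Zf :: "(nat \<Rightarrow> complex) \<Rightarrow> (nat \<Rightarrow> complex) \<Rightarrow> complex" where
  "Zf x y = x p1 * y q1 * (x p2 * y q2)"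

definition rel :: "((nat \<Rightarrow> complex) \<Rightarrow> complex) \<Rightarrow> (nat \<times> nat \<times> nat \<times> nat \<Rightarrow> complex) \<Rightarrow> bool" where
  "rel \<phi> co \<longleftrightarrow> (\<forall>a\<in>J (rr k n). \<forall>a'\<in>J (rr k n). (\<Sum>P\<in>paths k n E c c''. co P * \<phi> (wf c c'' P a a' (vv c))) = 0)"

context
  fixes \<phi>
  assumes \<phi>: "hw_mod (rr k n) (XX k n (E c'')) (vv c'') (al k n c'') \<phi>"
begin

text \<open>Weights leave only the four arrangements of the given rows, and antisymmetry of the
  wedge pairs them up: two scalar equations remain.\<close>

lemma rel_iff:
  "rel \<phi> co \<longleftrightarrow> (\<Sum>P\<in>paths k n E c c''. co P * \<phi> (wf c c'' P (mk p2 q2) (mk p1 q1) (vv c))) = 0 \<and>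
    (\<Sum>P\<in>paths k n E c c''. co P * \<phi> (wf c c'' P (mk p2 q1) (mk p1 q2) (vv c))) = 0" (is "_ \<longleftrightarrow> ?A \<and> ?B")
proof -
  define S where "S a a' = (\<Sum>P\<in>paths k n E c c''. co P * \<phi> (wf c c'' P a a' (vv c)))" for a a'
  have flip: "S a' a = - S a a'" for a a'
    unfolding S_def wf_flip[of c c'' _ a' a] clin_minus[OF clin_\<phi>[OF c c'' \<phi>]] mult_minus_right sum_negf ..
  have J: "mk p2 q2 \<in> J (rr k n)" "mk p1 q1 \<in> J (rr k n)" "mk p2 q1 \<in> J (rr k n)" "mk p1 q2 \<in> J (rr k n)"
    using mk_J[OF kn] r by auto
  have "S a a' = 0" if AB: "S (mk p2 q2) (mk p1 q1) = 0" "S (mk p2 q1) (mk p1 q2) = 0" and a: "a \<in> J (rr k n)" "a' \<in> J (rr k n)" for a a'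
  proof (cases "\<exists>s. \<exists>i\<in>{1..rr k n s}. (if a s = i then 1 else 0) + (if a' s = i then 1 else 0) \<noteq> (if mk p1 q1 s = i then 1 else 0) + (if mk p2 q2 s = i then 1 else (0::complex))")
    case True
    then obtain s i where i: "i \<in> {1..rr k n s}" "(if a s = i then 1 else 0) + (if a' s = i then 1 else 0) \<noteq> (if mk p1 q1 s = i then 1 else 0) + (if mk p2 q2 s = i then 1 else (0::complex))" by blast
    have "al k n c'' s i \<noteq> al k n c s i + (if a s = i then 1 else 0) + (if a' s = i then 1 else 0)"
      unfolding c''_eq al_shift2[OF kn r i(1)] add.assoc using i(2) unfolding add_left_cancel by (rule not_sym)
    from wf_weight[OF c c'' \<phi> _ a i(1) this] show ?thesis unfolding S_def by (intro sum.neutral ballI) simp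
  next
    case False
    have m: "(a s = mk p1 q1 s \<and> a' s = mk p2 q2 s) \<or> (a s = mk p2 q2 s \<and> a' s = mk p1 q1 s)" for s
    proof (rule delta_pair)
      fix i assume "i \<in> {a s, a' s}"
      then have "i \<in> {1..rr k n s}" using J_range[OF a(1), of s] J_range[OF a(2), of s] by auto
      then show "(if a s = i then 1 else 0) + (if a' s = i then 1 else 0) = (if mk p1 q1 s = i then 1 else 0) + (if mk p2 q2 s = i then 1 else (0::complex))"
        using False by blast
    qed
    have "a = mk p1 q1 \<and> a' = mk p2 q2 \<or> a = mk p2 q2 \<and> a' = mk p1 q1 \<or> a = mk p1 q2 \<and> a' = mk p2 q1 \<or> a = mk p2 q1 \<and> a' = mk p1 q2"
      using m[of True] m[of False] unfolding mk_simps by (elim disjE conjE) (blast intro: mk_eqI)+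
    then show ?thesis using AB flip[of "mk p1 q1" "mk p2 q2"] flip[of "mk p1 q2" "mk p2 q1"] by auto
  qed
  then show ?thesis unfolding rel_def S_def[symmetric] using J by blast
qed

text \<open>\<open>Zf x y\<close> is the same for all four paths; here the product form of the
  eigenvectors enters. Each value is a difference of two coefficients of \<open>path_values\<close>,
  since the wedge antisymmetrizes.\<close>

lemma scaled_values:
  assumes P: "(p, q, p', q') \<in> paths k n E c c''"
    and xy: "\<forall>p\<in>{1..k + 1}. \<forall>q\<in>{1..n - k}. x p * y q \<noteq> (0::complex) \<and> nv p q = (x p * y q) \<cdot>\<^sub>m eu n (ps k (mk p q))"
    and q: "q \<noteq> q'"
  shows "p \<noteq> p' \<Longrightarrow> Zf x y * \<phi> (wf c c'' (p, q, p', q') (mk p' q') (mk p q) (vv c)) = 1 - kap k c False q q' * kap k c True p p'"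
    and "p \<noteq> p' \<Longrightarrow> Zf x y * \<phi> (wf c c'' (p, q, p', q') (mk p' q) (mk p q') (vv c)) = kap k c False q q' - kap k c True p p'"
    and "p = p' \<Longrightarrow> Zf x y * \<phi> (wf c c'' (p, q, p', q') (mk p' q') (mk p q) (vv c)) = 1 - kap k c False q q'"
    and "\<phi> (wf c c'' (p, q, p', q') a' a (vv c)) = - \<phi> (wf c c'' (p, q, p', q') a a' (vv c))"
proof -
  have e: "c'' = shift k n (shift k n c p q) p' q'" using P unfolding paths_iff[OF c c''] by auto
  have m: "(p, q, p', q') \<in> {P1, P2, P3, P4}" using P unfolding mem_paths by blast
  then have Z: "Zf x y = x p * y q * (x p' * y q')" unfolding Zf_def by (auto simp: ac_simps)
  note l = clin_\<phi>[OF c c'' \<phi>]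
  have W: "\<phi> (wf c c'' (p, q, p', q') a a' (vv c)) = TT c p q p' q' \<phi> a a' - TT c p q p' q' \<phi> a' a" for a a'
    using wf_TT[OF l, of c p q p' q' a a'] unfolding e[symmetric] .
  note v = path_values[OF c c'' \<phi> P xy]
  show "Zf x y * \<phi> (wf c c'' (p, q, p', q') (mk p' q') (mk p q) (vv c)) = 1 - kap k c False q q' * kap k c True p p'" if "p \<noteq> p'"
    unfolding W Z right_diff_distrib using v(1) v(4)[OF that q] by (simp only:)
  show "Zf x y * \<phi> (wf c c'' (p, q, p', q') (mk p' q) (mk p q') (vv c)) = kap k c False q q' - kap k c True p p'" if "p \<noteq> p'"
    unfolding W Z right_diff_distrib using v(2)[OF that] v(3)[OF q] by (simp only:)
  show "Zf x y * \<phi> (wf c c'' (p, q, p', q') (mk p' q') (mk p q) (vv c)) = 1 - kap k c False q q'" if "p = p'"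
    unfolding W Z right_diff_distrib using v(1) v(3)[OF q] that by (simp only:)
  show "\<phi> (wf c c'' (p, q, p', q') a' a (vv c)) = - \<phi> (wf c c'' (p, q, p', q') a a' (vv c))"
    unfolding wf_flip[of c c'' _ a' a] clin_minus[OF l] ..
qed

end

end

section \<open>The resulting linear equations\<close>

lemma sum_single: "sum h {A} = (h A :: complex)"
  by simp

lemma sum_pair: "A \<noteq> B \<Longrightarrow> sum h {A, B} = h A + (h B :: complex)"
  by simp

lemma sum_quad: "distinct [A, B, C, D] \<Longrightarrow> sum h {A, B, C, D} = h A + h B + h C + (h D :: complex)"
  by (simp add: add.assoc)

text \<open>\<open>y\<close> and \<open>z\<close> are the exchange factors on the sides of Q^* and
  U. The two equations reappear in the opposite order and with opposite sign.\<close>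

lemma coefficients_i1:
  fixes a b d e y z :: complex
  shows "(a * (1 - y * z) + b * - z + d * - y + e * - 1 = 0 \<and> a * (y - z) + b * 1 + d * - 1 + e * 0 = 0)
    \<longleftrightarrow> ((- y + z) * a - b + d = 0 \<and> (z * y - 1) * a + z * b + y * d + e = 0)"
proof -
  have 1: "a * (1 - y * z) + b * - z + d * - y + e * - 1 = - ((z * y - 1) * a + z * b + y * d + e)"
    by (simp add: algebra_simps)
  have 2: "a * (y - z) + b * 1 + d * - 1 + e * 0 = - ((- y + z) * a - b + d)"
    by (simp add: algebra_simps)
  show ?thesis unfolding 1 2 neg_equal_0_iff_equal by (rule conj_commute)
qed

text \<open>With exchange factor -1 on the side of U the two equations become proportional, so a
  single relation is left.\<close>

lemma coefficients_i2:
  fixes a b y :: complex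
  shows "(a * (1 - y * - 1) + b * - (- 1) = 0 \<and> a * (y - - 1) + b * 1 = 0) \<longleftrightarrow> (- y - 1) * a - b = 0"
proof -
  have 1: "a * (1 - y * - 1) + b * - (- 1) = - ((- y - 1) * a - b)" by (simp add: algebra_simps)
  have 2: "a * (y - - 1) + b * 1 = - ((- y - 1) * a - b)" by (simp add: algebra_simps)
  show ?thesis unfolding 1 2 neg_equal_0_iff_equal by (rule conj_absorb)
qed

text \<open>The same collapse with exchange factor -1 on the side of Q^*.\<close>

lemma coefficients_i3:
  fixes a b z :: complex
  shows "(a * (1 - - 1 * z) + b * - (- 1) = 0 \<and> a * (- 1 - z) + b * - 1 = 0) \<longleftrightarrow> (1 + z) * a + b = 0"
proof -
  have 1: "a * (1 - - 1 * z) + b * - (- 1) = (1 + z) * a + b" by (simp add: algebra_simps)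
  have 2: "a * (- 1 - z) + b * - 1 = - ((1 + z) * a + b)" by (simp add: algebra_simps)
  show ?thesis unfolding 1 2 neg_equal_0_iff_equal by (rule conj_absorb)
qed

lemma coefficients_ii1:
  fixes a b y :: complex
  shows "(a * (1 - y) + b * - 1 = 0 \<and> a * (y - 1) + b * 1 = 0) \<longleftrightarrow> (1 - y) * a - b = 0"
proof -
  have 1: "a * (1 - y) + b * - 1 = (1 - y) * a - b" by (simp add: algebra_simps)
  have 2: "a * (y - 1) + b * 1 = - ((1 - y) * a - b)" by (simp add: algebra_simps)
  show ?thesis unfolding 1 2 neg_equal_0_iff_equal by (rule conj_absorb)
qed

lemma coefficients_ii2: "(a * (1 - - 1) = 0 \<and> a * (- 1 - 1) = 0) \<longleftrightarrow> a = (0 :: complex)"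
  by auto

context two_boxes
begin

lemma relations_hold_rel:
  assumes \<phi>: "hw_mod (rr k n) (XX k n (E c'')) (vv c'') (al k n c'') \<phi>"
  shows "relations_hold k n E m dV g c c'' \<longleftrightarrow> (\<forall>i<dV c''. \<forall>j<dV c. rel \<phi> (\<lambda>P. pmap g c P $$ (i, j)))"
  unfolding relations_hold_iff[OF c c'' \<phi>] rel_def ..

lemma pmap_carrier:
  assumes "is_quiver_rep k n E dV g" and P: "(p, q, p', q') \<in> paths k n E c c''"
  shows "path_map k n g c p q p' q' \<in> carrier_mat (dV c'') (dV c)"
proof -
  have a: "p \<in> {1..k + 1}" "q \<in> {1..n - k}" "p' \<in> {1..k + 1}" "q' \<in> {1..n - k}" "arrow k n E c (shift k n c p q)"
    "arrow k n E (shift k n c p q) (shift k n (shift k n c p q) p' q')" and e: "c'' = shift k n (shift k n c p q) p' q'"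
    using P unfolding paths_def by auto
  have g: "g c p q \<in> carrier_mat (dV (shift k n c p q)) (dV c)"
    "g (shift k n c p q) p' q' \<in> carrier_mat (dV (shift k n (shift k n c p q) p' q')) (dV (shift k n c p q))"
    using assms(1) a unfolding is_quiver_rep_def by blast+
  show ?thesis unfolding path_map_def e by (rule mult_carrier_mat[OF g(2,1)])
qed

lemma paths_good: "paths k n E c c'' = {P \<in> {P1, P2, P3, P4}. good True (fst P) \<and> good False (fst (snd P))}"
proof -
  have "P \<in> paths k n E c c'' \<longleftrightarrow> P \<in> {P \<in> {P1, P2, P3, P4}. good True (fst P) \<and> good False (fst (snd P))}" for P
    by (cases P) (simp add: mem_paths)
  then show ?thesis by blast
qed

context
  fixes \<phi> x y
  assumes \<phi>: "hw_mod (rr k n) (XX k n (E c'')) (vv c'') (al k n c'') \<phi>"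
    and xy: "\<forall>p\<in>{1..k + 1}. \<forall>q\<in>{1..n - k}. x p * y q \<noteq> (0::complex) \<and> nv p q = (x p * y q) \<cdot>\<^sub>m eu n (ps k (mk p q))"
    and q12: "q1 < q2"
begin

abbreviation "VA P \<equiv> Zf x y * \<phi> (wf c c'' P (mk p2 q2) (mk p1 q1) (vv c))"
abbreviation "VB P \<equiv> Zf x y * \<phi> (wf c c'' P (mk p2 q1) (mk p1 q2) (vv c))"
abbreviation "kT \<equiv> kap k c True p1 p2"
abbreviation "kF \<equiv> kap k c False q1 q2"

lemma rel_sums: "rel \<phi> co \<longleftrightarrow> (\<Sum>P\<in>paths k n E c c''. co P * VA P) = 0 \<and> (\<Sum>P\<in>paths k n E c c''. co P * VB P) = 0"
proof -
  have Z: "Zf x y \<noteq> 0" using bspec[OF bspec[OF xy r(1)] r(2)] bspec[OF bspec[OF xy r(3)] r(4)] by (simp add: Zf_def)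
  have s: "(\<Sum>P\<in>paths k n E c c''. co P * (Zf x y * h P)) = Zf x y * (\<Sum>P\<in>paths k n E c c''. co P * h P)" for h
    unfolding sum_distrib_left by (intro sum.cong refl) (simp only: ac_simps)
  show ?thesis unfolding rel_iff[OF \<phi>] s using Z by simp
qed

lemma good_first': "p1 \<le> p2 \<Longrightarrow> good True p1" "good False q1"
  using good_first[of True] good_first[of False] q12 by simp_all

lemma good_second': "p1 < p2 \<Longrightarrow> good True p2 \<longleftrightarrow> cdist k c True p1 p2 \<noteq> 1" "good False q2 \<longleftrightarrow> cdist k c False q1 q2 \<noteq> 1"
  using good_second[of True] good_second[of False] q12 by simp_all

lemma kap_flip: "p1 < p2 \<Longrightarrow> kap k c True p2 p1 = 0" "kap k c False q2 q1 = 0"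
  using q12 by (simp_all add: kap_def)

text \<open>In a factor where a path fills the lower row first, its exchange factor is 0. For
  \<open>P3\<close> and \<open>P4\<close> the tested arrangements list the nilradical arguments in
  the reverse of the natural order, whence the additional signs.\<close>

lemma values_lt:
  assumes p: "p1 < p2"
  shows "P1 \<in> paths k n E c c'' \<Longrightarrow> VA P1 = 1 - kF * kT \<and> VB P1 = kF - kT"
    and "P2 \<in> paths k n E c c'' \<Longrightarrow> VA P2 = - kT \<and> VB P2 = 1"
    and "P3 \<in> paths k n E c c'' \<Longrightarrow> VA P3 = - kF \<and> VB P3 = - 1"
    and "P4 \<in> paths k n E c c'' \<Longrightarrow> VA P4 = - 1 \<and> VB P4 = 0"
proof -
  have ne: "p1 \<noteq> p2" "p2 \<noteq> p1" "q1 \<noteq> q2" "q2 \<noteq> q1" using p q12 by auto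
  note kf = kap_flip(1)[OF p] kap_flip(2)
  show "VA P1 = 1 - kF * kT \<and> VB P1 = kF - kT" if P: "P1 \<in> paths k n E c c''"
    using scaled_values(1,2)[OF \<phi> P xy ne(3) ne(1)] by simp
  show "VA P2 = - kT \<and> VB P2 = 1" if P: "P2 \<in> paths k n E c c''"
    using scaled_values(1,2)[OF \<phi> P xy ne(4) ne(1)] kf by simp
  show "VA P3 = - kF \<and> VB P3 = - 1" if P: "P3 \<in> paths k n E c c''"
    using scaled_values(1,2)[OF \<phi> P xy ne(3) ne(2)] kf
      scaled_values(4)[OF \<phi> P xy ne(3), of "mk p2 q2" "mk p1 q1"] scaled_values(4)[OF \<phi> P xy ne(3), of "mk p2 q1" "mk p1 q2"] by simp
  show "VA P4 = - 1 \<and> VB P4 = 0" if P: "P4 \<in> paths k n E c c''"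
    using scaled_values(1,2)[OF \<phi> P xy ne(4) ne(2)] kf
      scaled_values(4)[OF \<phi> P xy ne(4), of "mk p2 q2" "mk p1 q1"] scaled_values(4)[OF \<phi> P xy ne(4), of "mk p2 q1" "mk p1 q2"] by simp
qed

text \<open>With equal rows on the side of U the two tested arrangements are interchanges of each
  other, so the second value is the negative of the first.\<close>

lemma values_eq:
  assumes p: "p1 = p2"
  shows "P1 \<in> paths k n E c c'' \<Longrightarrow> VA P1 = 1 - kF \<and> VB P1 = kF - 1"
    and "P2 \<in> paths k n E c c'' \<Longrightarrow> VA P2 = - 1 \<and> VB P2 = 1"
proof -
  have ne: "q1 \<noteq> q2" "q2 \<noteq> q1" using q12 by auto
  show "VA P1 = 1 - kF \<and> VB P1 = kF - 1" if P: "P1 \<in> paths k n E c c''"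
    using scaled_values(3)[OF \<phi> P xy ne(1) p] scaled_values(4)[OF \<phi> P xy ne(1), of "mk p2 q1" "mk p1 q2"] p by simp
  show "VA P2 = - 1 \<and> VB P2 = 1" if P: "P2 \<in> paths k n E c c''"
    using scaled_values(3)[OF \<phi> P xy ne(2) p] scaled_values(4)[OF \<phi> P xy ne(2), of "mk p2 q2" "mk p1 q1"] p kap_flip(2) by simp
qed

lemma paths_lt:
  assumes p: "p1 < p2"
  shows "cdist k c True p1 p2 \<noteq> 1 \<Longrightarrow> cdist k c False q1 q2 \<noteq> 1 \<Longrightarrow> paths k n E c c'' = {P1, P2, P3, P4}"
    and "cdist k c True p1 p2 = 1 \<Longrightarrow> cdist k c False q1 q2 \<noteq> 1 \<Longrightarrow> paths k n E c c'' = {P1, P2}"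
    and "cdist k c True p1 p2 \<noteq> 1 \<Longrightarrow> cdist k c False q1 q2 = 1 \<Longrightarrow> paths k n E c c'' = {P1, P3}"
    and "cdist k c True p1 p2 = 1 \<Longrightarrow> cdist k c False q1 q2 = 1 \<Longrightarrow> paths k n E c c'' = {P1}"
  unfolding paths_good using good_first' good_second' p by auto

lemma paths_eq:
  assumes p: "p1 = p2"
  shows "cdist k c False q1 q2 \<noteq> 1 \<Longrightarrow> paths k n E c c'' = {P1, P2}"
    and "cdist k c False q1 q2 = 1 \<Longrightarrow> paths k n E c c'' = {P1}"
  unfolding paths_good using good_first' good_second' p by auto

lemma rel_single:
  assumes "paths k n E c c'' = {A}" "VA A = a" "VB A = a'"
  shows "rel \<phi> co \<longleftrightarrow> co A * a = 0 \<and> co A * a' = 0"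
proof -
  have S: "sum h {A} = h A" for h :: "nat \<times> nat \<times> nat \<times> nat \<Rightarrow> complex" by (rule sum_single)
  show ?thesis by (rule rel_sums[unfolded assms(1) S assms(2,3)])
qed

lemma rel_pair:
  assumes "paths k n E c c'' = {A, B}" "A \<noteq> B" "VA A = a" "VB A = a'" "VA B = b" "VB B = b'"
  shows "rel \<phi> co \<longleftrightarrow> co A * a + co B * b = 0 \<and> co A * a' + co B * b' = 0"
  by (rule rel_sums[unfolded assms(1) sum_pair[OF assms(2)] assms(3-6)])

lemma rel_quad:
  assumes "paths k n E c c'' = {A, B, C, D}" "distinct [A, B, C, D]" "VA A = a" "VB A = a'" "VA B = b" "VB B = b'"
    "VA C = d" "VB C = d'" "VA D = e" "VB D = e'"
  shows "rel \<phi> co \<longleftrightarrow> co A * a + co B * b + co C * d + co D * e = 0 \<and> co A * a' + co B * b' + co C * d' + co D * e' = 0"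
  by (rule rel_sums[unfolded assms(1) sum_quad[OF assms(2)] assms(3-10)])

lemma kap_one: "p1 < p2 \<Longrightarrow> cdist k c True p1 p2 = 1 \<Longrightarrow> kT = - 1" "cdist k c False q1 q2 = 1 \<Longrightarrow> kF = - 1"
  using q12 by (simp_all add: kap_def)

lemma mem_quad: "X \<in> {X, Y, Z, W}" "Y \<in> {X, Y, Z, W}" "Z \<in> {X, Y, Z, W}" "W \<in> {X, Y, Z, W}"
  "X \<in> {X, Y}" "Y \<in> {X, Y}" "X \<in> {X}"
  by simp_all

lemma rel_i1:
  assumes p: "p1 < p2" and t: "cdist k c True p1 p2 \<noteq> 1" "cdist k c False q1 q2 \<noteq> 1"
  shows "rel \<phi> co \<longleftrightarrow>
      (- kF + kT) * co P1 - co P2 + co P3 = 0 \<and> (kT * kF - 1) * co P1 + kT * co P2 + kF * co P3 + co P4 = 0"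
proof -
  have ne: "p1 \<noteq> p2" "q1 \<noteq> q2" using p q12 by auto
  have dis: "distinct [P1, P2, P3, P4]" using ne by simp
  note P = paths_lt(1)[OF p t]
  note m = mem_quad(1)[of P1 P2 P3 P4, folded P] mem_quad(2)[of P2 P1 P3 P4, folded P] mem_quad(3)[of P3 P1 P2 P4, folded P] mem_quad(4)[of P4 P1 P2 P3, folded P]
  note V = values_lt(1)[OF p m(1)] values_lt(2)[OF p m(2)] values_lt(3)[OF p m(3)] values_lt(4)[OF p m(4)]
  show ?thesis
    by (rule trans[OF rel_quad[OF P dis conjunct1[OF V(1)] conjunct2[OF V(1)] conjunct1[OF V(2)] conjunct2[OF V(2)]
      conjunct1[OF V(3)] conjunct2[OF V(3)] conjunct1[OF V(4)] conjunct2[OF V(4)]] coefficients_i1])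
qed

lemma rel_i2:
  assumes p: "p1 < p2" and t: "cdist k c True p1 p2 = 1" "cdist k c False q1 q2 \<noteq> 1"
  shows "rel \<phi> co \<longleftrightarrow> (- kF - 1) * co P1 - co P2 = 0"
proof -
  have dis: "P1 \<noteq> P2" using q12 by simp
  note P = paths_lt(2)[OF p t]
  note m = mem_quad(5)[of P1 P2, folded P] mem_quad(6)[of P2 P1, folded P]
  note V = values_lt(1)[OF p m(1), unfolded kap_one(1)[OF p t(1)]] values_lt(2)[OF p m(2), unfolded kap_one(1)[OF p t(1)]]
  show ?thesis
    by (rule trans[OF rel_pair[OF P dis conjunct1[OF V(1)] conjunct2[OF V(1)] conjunct1[OF V(2)] conjunct2[OF V(2)]] coefficients_i2])
qed

lemma rel_i3:
  assumes p: "p1 < p2" and t: "cdist k c True p1 p2 \<noteq> 1" "cdist k c False q1 q2 = 1"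
  shows "rel \<phi> co \<longleftrightarrow> (1 + kT) * co P1 + co P3 = 0"
proof -
  have dis: "P1 \<noteq> P3" using p by simp
  note P = paths_lt(3)[OF p t]
  note m = mem_quad(5)[of P1 P3, folded P] mem_quad(6)[of P3 P1, folded P]
  note V = values_lt(1)[OF p m(1), unfolded kap_one(2)[OF t(2)]] values_lt(3)[OF p m(2), unfolded kap_one(2)[OF t(2)]]
  show ?thesis
    by (rule trans[OF rel_pair[OF P dis conjunct1[OF V(1)] conjunct2[OF V(1)] conjunct1[OF V(2)] conjunct2[OF V(2)]] coefficients_i3])
qed

text \<open>Both exchange factors are -1, so 1 - kF kT and kF - kT vanish: the wedge of the only
  path has no highest weight coefficient left.\<close>

lemma rel_i4:
  assumes p: "p1 < p2" and t: "cdist k c True p1 p2 = 1" "cdist k c False q1 q2 = 1"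
  shows "rel \<phi> co"
proof -
  note P = paths_lt(4)[OF p t]
  note V = values_lt(1)[OF p mem_quad(7)[of P1, folded P], unfolded kap_one(1)[OF p t(1)] kap_one(2)[OF t(2)]]
  show ?thesis
    unfolding rel_single[OF P conjunct1[OF V] conjunct2[OF V]] by simp
qed

lemma rel_ii1:
  assumes p: "p1 = p2" and t: "cdist k c False q1 q2 \<noteq> 1"
  shows "rel \<phi> co \<longleftrightarrow> (1 - kF) * co P1 - co P2 = 0"
proof -
  have dis: "P1 \<noteq> P2" using q12 by simp
  note P = paths_eq(1)[OF p t]
  note m = mem_quad(5)[of P1 P2, folded P] mem_quad(6)[of P2 P1, folded P]
  note V = values_eq(1)[OF p m(1)] values_eq(2)[OF p m(2)]
  show ?thesis
    by (rule trans[OF rel_pair[OF P dis conjunct1[OF V(1)] conjunct2[OF V(1)] conjunct1[OF V(2)] conjunct2[OF V(2)]] coefficients_ii1])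
qed

text \<open>The exchange factor is -1, so the coefficient of the only path is 2, which forces the
  path map itself to vanish.\<close>

lemma rel_ii2:
  assumes p: "p1 = p2" and t: "cdist k c False q1 q2 = 1"
  shows "rel \<phi> co \<longleftrightarrow> co P1 = 0"
proof -
  note P = paths_eq(2)[OF p t]
  note V = values_eq(1)[OF p mem_quad(7)[of P1, folded P], unfolded kap_one(2)[OF t]]
  show ?thesis
    by (rule trans[OF rel_single[OF P conjunct1[OF V] conjunct2[OF V]] coefficients_ii2])
qed

lemmas rel_lt = rel_i1 rel_i2 rel_i3 rel_i4
lemmas rel_eq = rel_ii1 rel_ii2

end

end

lemma mat_zero_iff: "M \<in> carrier_mat a b \<Longrightarrow> M = 0\<^sub>m a b \<longleftrightarrow> (\<forall>i<a. \<forall>j<b. M $$ (i, j) = 0)"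
  by (auto intro!: eq_matI)

text \<open>Here k = 1 and n = 3, so O(1) has weight \<lambda>_2 and the final weight -\<lambda>_2
  is that of O(-1). Both partitions are empty, so their two rows are adjacent and of equal length,
  and both distances are 1.\<close>

lemma hille_counterexample:
  "let O1 = fund_weight 3 2; e = (\<lambda>_. 0) in
        O1 = bundle_weight 1 3 e e 1 \<and>
        shift 1 3 O1 1 1 = bundle_weight 1 3 (add_box 1 e) (add_box 1 e) 1 \<and>
        shift 1 3 (shift 1 3 O1 1 1) 2 2
          = bundle_weight 1 3 (add_box 2 (add_box 1 e)) (add_box 2 (add_box 1 e)) 1 \<and>
        shift 1 3 (shift 1 3 O1 1 1) 2 2 = (\<lambda>j. - fund_weight 3 2 j) \<and>
        ptilde 1 O1 1 2 = 1 \<and> qtilde 1 O1 1 2 = 1"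
proof -
  let ?e = "\<lambda>_. 0 :: nat"
  have r: "(1::nat) \<in> {1..1 + 1}" "(1::nat) \<in> {1..3 - 1}" "(2::nat) \<in> {1..1 + 1}" "(2::nat) \<in> {1..3 - 1}" "(1::nat) < 3" by auto
  have 1: "fund_weight 3 2 = bundle_weight 1 3 ?e ?e 1"
    by (auto simp: bundle_weight_def fun_eq_iff)
  have 2: "shift 1 3 (fund_weight 3 2) 1 1 = bundle_weight 1 3 (add_box 1 ?e) (add_box 1 ?e) 1"
    unfolding 1 by (rule shift_bundle_weight[OF r(1,2,5)])
  have 3: "shift 1 3 (shift 1 3 (fund_weight 3 2) 1 1) 2 2
      = bundle_weight 1 3 (add_box 2 (add_box 1 ?e)) (add_box 2 (add_box 1 ?e)) 1"
    unfolding 2 by (rule shift_bundle_weight[OF r(3,4,5)])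
  have 4: "shift 1 3 (shift 1 3 (fund_weight 3 2) 1 1) 2 2 = (\<lambda>j. - fund_weight 3 2 j)"
    unfolding shift2[OF r(5,1,2,3,4)] by (rule ext) (simp add: eps_def fund_weight_def)
  have u: "{1..<2} = {1::nat}" by auto
  have 5: "ptilde 1 (fund_weight 3 2) 1 2 = 1" "qtilde 1 (fund_weight 3 2) 1 2 = 1"
    unfolding ptilde_def qtilde_def u by (simp_all add: fund_weight_def)
  show ?thesis unfolding Let_def using 1 2 3 4 5 by blast
qed

theorem proposition8p4:
  fixes k n p1 p2 q1 q2 :: nat and \<alpha> \<alpha>'' \<beta> \<beta>'' :: "nat \<Rightarrow> nat" and t :: int
    and lam lam'' :: weight
    and E :: "weight \<Rightarrow> rmod" and v :: "weight \<Rightarrow> complex vec"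
    and nv :: "nat \<Rightarrow> nat \<Rightarrow> complex mat"
    and m :: "weight \<Rightarrow> nat \<Rightarrow> nat \<Rightarrow> complex mat \<Rightarrow> complex mat"
    and pt qt :: complex
  assumes "k < n"
    and "is_irreducible_family k n E v"
    and "is_eigenbasis k n nv"
    and "is_normalized k n E v nv m"
    and "p1 \<in> {1..k + 1}" "p2 \<in> {1..k + 1}" "q1 \<in> {1..n - k}" "q2 \<in> {1..n - k}"
    and "is_partition (k + 1) \<alpha>" "is_partition (n - k) \<beta>"
    and "\<alpha>'' = add_box p2 (add_box p1 \<alpha>)" "\<beta>'' = add_box q2 (add_box q1 \<beta>)"
    and "is_partition (k + 1) \<alpha>''" "is_partition (n - k) \<beta>''"
    and "lam = bundle_weight k n \<alpha> \<beta> t" "lam'' = bundle_weight k n \<alpha>'' \<beta>'' t"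
    and "pt = of_int (ptilde k lam p1 p2)" "qt = of_int (qtilde k lam q1 q2)"
  shows
    "(p1 = p2 \<and> q1 = q2 \<longrightarrow> Ext2_G_zero k n (E lam) (E lam'')) \<and>
     (p1 \<le> p2 \<and> q1 < q2 \<longrightarrow>
       (p1 < p2 \<longrightarrow>
         (pt \<noteq> 1 \<and> qt \<noteq> 1 \<longrightarrow>
            (\<forall>dV g. is_quiver_rep k n E dV g \<longrightarrow>
               (relations_hold k n E m dV g lam lam'' \<longleftrightarrow>
                  (1 / qt - 1 / pt) \<cdot>\<^sub>m path_map k n g lam p1 q1 p2 q2
                    - path_map k n g lam p1 q2 p2 q1
                    + path_map k n g lam p2 q1 p1 q2 = 0\<^sub>m (dV lam'') (dV lam) \<and>
                  (1 / (pt * qt) - 1) \<cdot>\<^sub>m path_map k n g lam p1 q1 p2 q2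
                    - (1 / pt) \<cdot>\<^sub>m path_map k n g lam p1 q2 p2 q1
                    - (1 / qt) \<cdot>\<^sub>m path_map k n g lam p2 q1 p1 q2
                    + path_map k n g lam p2 q2 p1 q1 = 0\<^sub>m (dV lam'') (dV lam)))) \<and>
         (pt = 1 \<and> qt \<noteq> 1 \<longrightarrow>
            shift k n lam p2 q1 \<notin> D1 k n \<and> shift k n lam p2 q2 \<notin> D1 k n \<and>
            (\<forall>dV g. is_quiver_rep k n E dV g \<longrightarrow>
               (relations_hold k n E m dV g lam lam'' \<longleftrightarrow>
                  (1 / qt - 1) \<cdot>\<^sub>m path_map k n g lam p1 q1 p2 q2
                    - path_map k n g lam p1 q2 p2 q1 = 0\<^sub>m (dV lam'') (dV lam)))) \<and>
         (pt \<noteq> 1 \<and> qt = 1 \<longrightarrow>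
            shift k n lam p1 q2 \<notin> D1 k n \<and> shift k n lam p2 q2 \<notin> D1 k n \<and>
            (\<forall>dV g. is_quiver_rep k n E dV g \<longrightarrow>
               (relations_hold k n E m dV g lam lam'' \<longleftrightarrow>
                  (1 - 1 / pt) \<cdot>\<^sub>m path_map k n g lam p1 q1 p2 q2
                    + path_map k n g lam p2 q1 p1 q2 = 0\<^sub>m (dV lam'') (dV lam)))) \<and>
         (pt = 1 \<and> qt = 1 \<longrightarrow>
            shift k n lam p1 q1 \<in> D1 k n \<and> shift k n lam p1 q2 \<notin> D1 k n \<and>
            shift k n lam p2 q1 \<notin> D1 k n \<and> shift k n lam p2 q2 \<notin> D1 k n \<and>
            paths k n E lam lam'' = {(p1, q1, p2, q2)} \<and>
            (\<forall>dV g. is_quiver_rep k n E dV g \<longrightarrow> relations_hold k n E m dV g lam lam''))) \<and>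
       (p1 = p2 \<longrightarrow>
         (qt \<noteq> 1 \<longrightarrow>
            (\<forall>dV g. is_quiver_rep k n E dV g \<longrightarrow>
               (relations_hold k n E m dV g lam lam'' \<longleftrightarrow>
                  ((1 + qt) / qt) \<cdot>\<^sub>m path_map k n g lam p1 q1 p1 q2
                    - path_map k n g lam p1 q2 p1 q1 = 0\<^sub>m (dV lam'') (dV lam)))) \<and>
         (qt = 1 \<longrightarrow>
            (\<forall>dV g. is_quiver_rep k n E dV g \<longrightarrow>
               (relations_hold k n E m dV g lam lam'' \<longleftrightarrow>
                  path_map k n g lam p1 q1 p1 q2 = 0\<^sub>m (dV lam'') (dV lam)))))) \<and>
     (let O1 = fund_weight 3 2; e = (\<lambda>_. 0) in
        O1 = bundle_weight 1 3 e e 1 \<and>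
        shift 1 3 O1 1 1 = bundle_weight 1 3 (add_box 1 e) (add_box 1 e) 1 \<and>
        shift 1 3 (shift 1 3 O1 1 1) 2 2
          = bundle_weight 1 3 (add_box 2 (add_box 1 e)) (add_box 2 (add_box 1 e)) 1 \<and>
        shift 1 3 (shift 1 3 O1 1 1) 2 2 = (\<lambda>j. - fund_weight 3 2 j) \<and>
        ptilde 1 O1 1 2 = 1 \<and> qtilde 1 O1 1 2 = 1)"
proof -
  have lam: "lam \<in> D1 k n" and lam'': "lam'' \<in> D1 k n"
    unfolding assms(15,16) by (rule bundle_weight_D1[OF assms(1,9,10)], rule bundle_weight_D1[OF assms(1,13,14)])
  have eq: "lam'' = shift k n (shift k n lam p1 q1) p2 q2"
    unfolding assms(11,12,15,16) shift_bundle_weight[OF assms(5,7,1)] shift_bundle_weight[OF assms(6,8,1)] ..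
  interpret two_boxes k n E v nv m lam lam'' p1 p2 q1 q2
    by (unfold_locales; (rule assms lam lam'' eq))
  have pt: "pt = of_int (cdist k lam True p1 p2)" and qt: "qt = of_int (cdist k lam False q1 q2)"
    unfolding assms(17,18) ptilde_cdist qtilde_cdist by (rule refl)+
  have pt1: "pt = 1 \<longleftrightarrow> cdist k lam True p1 p2 = 1" and qt1: "qt = 1 \<longleftrightarrow> cdist k lam False q1 q2 = 1"
    unfolding pt qt by simp_all
  obtain \<phi> where \<phi>: "hw_mod (rr k n) (XX k n (E lam'')) (vv lam'') (al k n lam'') \<phi>"
    using family_hw(3)[OF assms(1,2) lam''] by blast
  obtain x y where xy: "\<forall>p\<in>{1..k + 1}. \<forall>q\<in>{1..n - k}. x p * y q \<noteq> 0 \<and> nv p q = (x p * y q) \<cdot>\<^sub>m eu n (ps k (mk p q))"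
    using nv_eu by blast
  note rel = relations_hold_rel[OF \<phi>]
  have pm: "pmap g lam (a, b, a', b') = path_map k n g lam a b a' b'" for g a b a' b' by (simp add: pmap_def)
  have zero: "p1 = p2 \<and> q1 = q2 \<longrightarrow> Ext2_G_zero k n (E lam) (E lam'')" using Ext2_zero by blast
  have kF: "kap k lam False q1 q2 = - (1 / qt)" if "q1 < q2" using that by (simp add: kap_def qt)
  have kT: "kap k lam True p1 p2 = - (1 / pt)" if "p1 < p2" using that by (simp add: kap_def pt)
  have i1: "relations_hold k n E m dV g lam lam'' \<longleftrightarrow>
                  (1 / qt - 1 / pt) \<cdot>\<^sub>m path_map k n g lam p1 q1 p2 q2
                    - path_map k n g lam p1 q2 p2 q1
                    + path_map k n g lam p2 q1 p1 q2 = 0\<^sub>m (dV lam'') (dV lam) \<and>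
                  (1 / (pt * qt) - 1) \<cdot>\<^sub>m path_map k n g lam p1 q1 p2 q2
                    - (1 / pt) \<cdot>\<^sub>m path_map k n g lam p1 q2 p2 q1
                    - (1 / qt) \<cdot>\<^sub>m path_map k n g lam p2 q1 p1 q2
                    + path_map k n g lam p2 q2 p1 q1 = 0\<^sub>m (dV lam'') (dV lam)"
    if p: "p1 < p2" and q: "q1 < q2" and t: "pt \<noteq> 1" "qt \<noteq> 1" and g: "is_quiver_rep k n E dV g" for dV g
  proof -
    note t' = t[unfolded pt1 qt1]
    \<comment> \<open>Membership in \<open>paths\<close> fixes the sizes of the path maps, so the
      matrix equations can be compared with the scalar ones entry by entry.\<close>
    have C: "path_map k n g lam p1 q1 p2 q2 \<in> carrier_mat (dV lam'') (dV lam)" "path_map k n g lam p1 q2 p2 q1 \<in> carrier_mat (dV lam'') (dV lam)"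
      "path_map k n g lam p2 q1 p1 q2 \<in> carrier_mat (dV lam'') (dV lam)" "path_map k n g lam p2 q2 p1 q1 \<in> carrier_mat (dV lam'') (dV lam)"
      using pmap_carrier[OF g] paths_lt(1)[OF \<phi> xy q p t'] by auto
    note D = carrier_matD[OF C(1)] carrier_matD[OF C(2)] carrier_matD[OF C(3)] carrier_matD[OF C(4)]
    have 0: "A = 0\<^sub>m (dV lam'') (dV lam) \<longleftrightarrow> (\<forall>i<dV lam''. \<forall>j<dV lam. A $$ (i, j) = 0)" if "A \<in> carrier_mat (dV lam'') (dV lam)" for A :: "complex mat"
      using that by (rule mat_zero_iff)
    show ?thesis
      unfolding rel rel_lt(1)[OF \<phi> xy q p t'] pm kF[OF q] kT[OF p]
      by (subst (1 2) 0) (use C in \<open>auto simp: D\<close>)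
  qed
  have i2: "relations_hold k n E m dV g lam lam'' \<longleftrightarrow>
                  (1 / qt - 1) \<cdot>\<^sub>m path_map k n g lam p1 q1 p2 q2
                    - path_map k n g lam p1 q2 p2 q1 = 0\<^sub>m (dV lam'') (dV lam)"
    if p: "p1 < p2" and q: "q1 < q2" and t: "pt = 1" "qt \<noteq> 1" and g: "is_quiver_rep k n E dV g" for dV g
  proof -
    note t' = t[unfolded pt1 qt1]
    have C: "path_map k n g lam p1 q1 p2 q2 \<in> carrier_mat (dV lam'') (dV lam)" "path_map k n g lam p1 q2 p2 q1 \<in> carrier_mat (dV lam'') (dV lam)"
      using pmap_carrier[OF g] paths_lt(2)[OF \<phi> xy q p t'] by auto
    note D = carrier_matD[OF C(1)] carrier_matD[OF C(2)]
    show ?thesis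
      unfolding rel rel_lt(2)[OF \<phi> xy q p t'] pm kF[OF q]
      by (subst mat_zero_iff) (use C in \<open>auto simp: D\<close>)
  qed
  have i3: "relations_hold k n E m dV g lam lam'' \<longleftrightarrow>
                  (1 - 1 / pt) \<cdot>\<^sub>m path_map k n g lam p1 q1 p2 q2
                    + path_map k n g lam p2 q1 p1 q2 = 0\<^sub>m (dV lam'') (dV lam)"
    if p: "p1 < p2" and q: "q1 < q2" and t: "pt \<noteq> 1" "qt = 1" and g: "is_quiver_rep k n E dV g" for dV g
  proof -
    note t' = t[unfolded pt1 qt1]
    have C: "path_map k n g lam p1 q1 p2 q2 \<in> carrier_mat (dV lam'') (dV lam)" "path_map k n g lam p2 q1 p1 q2 \<in> carrier_mat (dV lam'') (dV lam)"
      using pmap_carrier[OF g] paths_lt(3)[OF \<phi> xy q p t'] by auto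
    note D = carrier_matD[OF C(1)] carrier_matD[OF C(2)]
    show ?thesis
      unfolding rel rel_lt(3)[OF \<phi> xy q p t'] pm kT[OF p]
      by (subst mat_zero_iff) (use C in \<open>auto simp: D\<close>)
  qed
  have i4: "relations_hold k n E m dV g lam lam''"
    if p: "p1 < p2" and q: "q1 < q2" and t: "pt = 1" "qt = 1" for dV g
    unfolding rel using rel_lt(4)[OF \<phi> xy q p t[unfolded pt1 qt1]] by blast
  have ii1: "relations_hold k n E m dV g lam lam'' \<longleftrightarrow>
                  ((1 + qt) / qt) \<cdot>\<^sub>m path_map k n g lam p1 q1 p1 q2
                    - path_map k n g lam p1 q2 p1 q1 = 0\<^sub>m (dV lam'') (dV lam)"
    if p: "p1 = p2" and q: "q1 < q2" and t: "qt \<noteq> 1" and g: "is_quiver_rep k n E dV g" for dV g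
  proof -
    note t' = t[unfolded qt1]
    have C: "path_map k n g lam p1 q1 p1 q2 \<in> carrier_mat (dV lam'') (dV lam)" "path_map k n g lam p1 q2 p1 q1 \<in> carrier_mat (dV lam'') (dV lam)"
      using pmap_carrier[OF g] paths_eq(1)[OF \<phi> xy q p t'] p by auto
    note D = carrier_matD[OF C(1)] carrier_matD[OF C(2)]
    \<comment> \<open>Positivity of the distance makes \<open>qt\<close> nonzero, as the fraction in
      the coefficient requires.\<close>
    have "1 \<le> cdist k lam False q1 q2"
      using assms q by (intro cdist_pos[OF assms(1) lam]) (auto simp: rr_def)
    then have "qt \<noteq> 0" unfolding qt by auto
    then have k: "1 - kap k lam False q1 q2 = (1 + qt) / qt" unfolding kF[OF q] by (simp add: field_simps)
    show ?thesis
      unfolding rel rel_eq(1)[OF \<phi> xy q p t'] pm k p[symmetric]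
      by (subst mat_zero_iff) (use C in \<open>auto simp: D\<close>)
  qed
  have ii2: "relations_hold k n E m dV g lam lam'' \<longleftrightarrow> path_map k n g lam p1 q1 p1 q2 = 0\<^sub>m (dV lam'') (dV lam)"
    if p: "p1 = p2" and q: "q1 < q2" and t: "qt = 1" and g: "is_quiver_rep k n E dV g" for dV g
  proof -
    note t' = t[unfolded qt1]
    have C: "path_map k n g lam p1 q1 p1 q2 \<in> carrier_mat (dV lam'') (dV lam)"
      using pmap_carrier[OF g] paths_eq(2)[OF \<phi> xy q p t'] p by auto
    show ?thesis
      unfolding rel rel_eq(2)[OF \<phi> xy q p t'] pm p[symmetric] mat_zero_iff[OF C] ..
  qed
  have G: "good True p1" "good False q1" "good True p2 \<longleftrightarrow> pt \<noteq> 1" "good False q2 \<longleftrightarrow> qt \<noteq> 1" if p: "p1 < p2" and q: "q1 < q2"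
    using good_first'(1)[OF \<phi> xy q] good_first'(2)[OF \<phi> xy q] good_second'(1)[OF \<phi> xy q p] good_second'(2)[OF \<phi> xy q] p pt1 qt1 by auto
  note S = shift_good[OF assms(5,7)] shift_good[OF assms(5,8)] shift_good[OF assms(6,7)] shift_good[OF assms(6,8)]
  have P: "paths k n E lam lam'' = {(p1, q1, p2, q2)}" if "p1 < p2" "q1 < q2" "pt = 1" "qt = 1"
    using paths_lt(4)[OF \<phi> xy that(2,1)] that(3,4) pt1 qt1 by blast
  show ?thesis
  proof (intro conjI impI allI)
    show "p1 = p2 \<and> q1 = q2 \<Longrightarrow> Ext2_G_zero k n (E lam) (E lam'')" using zero by blast
    show "let O1 = fund_weight 3 2; e = (\<lambda>_. 0) in
        O1 = bundle_weight 1 3 e e 1 \<and>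
        shift 1 3 O1 1 1 = bundle_weight 1 3 (add_box 1 e) (add_box 1 e) 1 \<and>
        shift 1 3 (shift 1 3 O1 1 1) 2 2
          = bundle_weight 1 3 (add_box 2 (add_box 1 e)) (add_box 2 (add_box 1 e)) 1 \<and>
        shift 1 3 (shift 1 3 O1 1 1) 2 2 = (\<lambda>j. - fund_weight 3 2 j) \<and>
        ptilde 1 O1 1 2 = 1 \<and> qtilde 1 O1 1 2 = 1" by (rule hille_counterexample)
  qed (elim conjE, (rule i1 i2 i3 i4 ii1 ii2 P, assumption+) | (use G S in blast))+
qed

end
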